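(* Let $p\ge 3$ be a prime, let $r\equiv a\bmod (p-1)$ with $1\le a\le p-1$, and let $r\equiv r_0\bmod p$ with $0\le r_0\le p-1$. Let $1\le [a-i]<i<p-1$ and $i(p+1)+p\le r$. Then there is an exact sequence of $\Gamma$-modules $$0\to W\to Q(i)\to Q([a-i]-1)\to 0,$$ where: (i) If $\binom{r-[a-i]+1}{i+1}\not\equiv0\bmod p$, then $W=0$. (ii) If $\binom{r-[a-i]+1}{i+1}\equiv0\bmod p$ and $\binom{r-i-1}{[a-i]}\not\equiv0\bmod p$, then: (a) if $[a-r_0]<r_0+1$, there is an exact sequence $0\to V_r^{([a-r_0]+1)}/V_r^{(i+1)}\to W\to V_{[a-2r_0]}\otimes D^{r_0}\to 0$; (b) if $[a-r_0]=r_0+1$, then $W=V_r^{([a-r_0])}/V_r^{(i+1)}$; (c) if $[a-r_0]>r_0+1$, there is an exact sequence $0\to V_r^{([a-r_0])}/V_r^{(i+1)}\to W\to V_{p-1-[2r_0+2-a]}\otimes D^{r_0+1}\to 0$. (iii) If $\binom{r-i-1}{[a-i]}\equiv0\bmod p$ and $r\not\equiv[a-i]+i\bmod p$, then $W=V_r^{([a-i])}/V_r^{(i+1)}$.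
   Context: Let $\Gamma=\mathrm{GL}_2(\mathbb{F}_p)$ and $D:\Gamma\to\mathbb{F}_p^\ast$ the determinant character. For an integer $n$, $[n]\in\{1,2,\dots,p-1\}$ denotes the element with $[n]\equiv n\bmod (p-1)$. $V_r$ is the $\mathbb{F}_p$-space of homogeneous polynomials $F(X,Y)$ of degree $r$ over $\mathbb{F}_p$, with action $\begin{pmatrix} a&b\\c&d\end{pmatrix}\cdot F(X,Y)=F(aX+cY,\,bX+dY)$. $X_{r-l}=X_{r-l,\,r}\subseteq V_r$ is the $\mathbb{F}_p[\Gamma]$-submodule generated by $X^{r-l}Y^{l}$. Let $\theta=X^pY-XY^p$ and, for $m\ge0$, $V_r^{(m)}=\{F\in V_r:\theta^m\mid F\}$, a $\Gamma$-submodule of $V_r$. For $l\ge0$, $Q(l)=V_r/(X_{r-l}+V_r^{(l+1)})$ (all formed from the same $V_r$). All exact sequences are of $\Gamma$-modules, and equalities of $W$ with a module are up to isomorphism. *)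

theory Defs
  imports
    "HOL-Algebra.Module"
    "HOL-Algebra.AbelCoset"
    "HOL-Algebra.Algebraic_Closure_Type"
    "Jordan_Normal_Form.Determinant"
    "Berlekamp_Zassenhaus.Finite_Field"
begin

section \<open>Modules over a ring with a linear group action\<close>

text \<open>
  A module over the group algebra \<open>R[G]\<close> is represented as an \<open>R\<close>-module together with an
  \<open>R\<close>-linear left action of \<open>G\<close>. The ring multiplication and unit fields that the library's
  record type \<^type>\<open>module_scheme\<close> inherits from rings play no role.
\<close>

record ('k, 'v, 'g) gmodule = "('k, 'v) module" +
  act :: "'g \<Rightarrow> 'v \<Rightarrow> 'v"

locale gmodule = module R M + group G
  for R :: "('k, 'm) ring_scheme" (structure)
    and G :: "('g, 'n) monoid_scheme" (structure)
    and M :: "('k, 'v, 'g) gmodule" (structure) +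
  assumes act_closed: "\<lbrakk>g \<in> carrier G; x \<in> carrier M\<rbrakk> \<Longrightarrow> act M g x \<in> carrier M"
    and act_add: "\<lbrakk>g \<in> carrier G; x \<in> carrier M; y \<in> carrier M\<rbrakk>
      \<Longrightarrow> act M g (x \<oplus>\<^bsub>M\<^esub> y) = act M g x \<oplus>\<^bsub>M\<^esub> act M g y"
    and act_smult: "\<lbrakk>g \<in> carrier G; c \<in> carrier R; x \<in> carrier M\<rbrakk>
      \<Longrightarrow> act M g (c \<odot>\<^bsub>M\<^esub> x) = c \<odot>\<^bsub>M\<^esub> act M g x"
    and act_one: "x \<in> carrier M \<Longrightarrow> act M \<one>\<^bsub>G\<^esub> x = x"
    and act_mult: "\<lbrakk>g \<in> carrier G; h \<in> carrier G; x \<in> carrier M\<rbrakk>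
      \<Longrightarrow> act M (g \<otimes>\<^bsub>G\<^esub> h) x = act M g (act M h x)"

definition gsubmodule ::
  "('k, 'm) ring_scheme \<Rightarrow> ('g, 'n) monoid_scheme \<Rightarrow> ('k, 'v, 'g) gmodule \<Rightarrow> 'v set \<Rightarrow> bool" where
  "gsubmodule R G M N \<longleftrightarrow>
     submodule N R M \<and> (\<forall>g \<in> carrier G. \<forall>x \<in> N. act M g x \<in> N)"

definition gspan ::
  "('k, 'm) ring_scheme \<Rightarrow> ('g, 'n) monoid_scheme \<Rightarrow> ('k, 'v, 'g) gmodule \<Rightarrow> 'v set \<Rightarrow> 'v set" where
  "gspan R G M S = \<Inter>{N. gsubmodule R G M N \<and> S \<subseteq> N}"

definition gmodule_hom ::
  "('k, 'm) ring_scheme \<Rightarrow> ('g, 'n) monoid_scheme \<Rightarrow>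
   ('k, 'v, 'g) gmodule \<Rightarrow> ('k, 'w, 'g) gmodule \<Rightarrow> ('v \<Rightarrow> 'w) set" where
  "gmodule_hom R G M N =
     {f. f \<in> carrier M \<rightarrow> carrier N \<and>
         (\<forall>x \<in> carrier M. \<forall>y \<in> carrier M. f (x \<oplus>\<^bsub>M\<^esub> y) = f x \<oplus>\<^bsub>N\<^esub> f y) \<and>
         (\<forall>c \<in> carrier R. \<forall>x \<in> carrier M. f (c \<odot>\<^bsub>M\<^esub> x) = c \<odot>\<^bsub>N\<^esub> f x) \<and>
         (\<forall>g \<in> carrier G. \<forall>x \<in> carrier M. f (act M g x) = act N g (f x))}"

definition gmodule_iso ::
  "('k, 'm) ring_scheme \<Rightarrow> ('g, 'n) monoid_scheme \<Rightarrow>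
   ('k, 'v, 'g) gmodule \<Rightarrow> ('k, 'w, 'g) gmodule \<Rightarrow> bool" where
  "gmodule_iso R G M N \<longleftrightarrow>
     (\<exists>f \<in> gmodule_hom R G M N. bij_betw f (carrier M) (carrier N))"

text \<open>Existence of a short exact sequence \<open>0 \<rightarrow> A \<rightarrow> B \<rightarrow> C \<rightarrow> 0\<close>.\<close>

definition short_exact ::
  "('k, 'm) ring_scheme \<Rightarrow> ('g, 'n) monoid_scheme \<Rightarrow>
   ('k, 'u, 'g) gmodule \<Rightarrow> ('k, 'v, 'g) gmodule \<Rightarrow> ('k, 'w, 'g) gmodule \<Rightarrow> bool" where
  "short_exact R G A B C \<longleftrightarrow>
     (\<exists>f \<in> gmodule_hom R G A B. \<exists>g \<in> gmodule_hom R G B C.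
        inj_on f (carrier A) \<and> f ` carrier A = a_kernel B C g \<and> g ` carrier B = carrier C)"

text \<open>
  The quotient \<open>M / N\<close>, on the additive cosets of \<open>N\<close>. Scaling by \<open>0\<close> maps a coset onto \<open>{0}\<close>
  rather than onto \<open>N\<close>, hence the union of cosets.
\<close>

definition quot_gmodule :: "('k, 'v, 'g) gmodule \<Rightarrow> 'v set \<Rightarrow> ('k, 'v set, 'g) gmodule" where
  "quot_gmodule M N = \<lparr>
     carrier = a_rcosets\<^bsub>M\<^esub> N,
     monoid.mult = undefined,
     one = undefined,
     zero = N,
     add = set_add M,
     module.smult = (\<lambda>c A. \<Union>x\<in>A. N +>\<^bsub>M\<^esub> (c \<odot>\<^bsub>M\<^esub> x)),
     act = (\<lambda>g A. \<Union>x\<in>A. N +>\<^bsub>M\<^esub> act M g x)\<rparr>"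

text \<open>The subquotient \<open>L / N\<close> of \<open>M\<close>, for \<open>N \<subseteq> L\<close>.\<close>

abbreviation subquot_gmodule ::
  "('k, 'v, 'g) gmodule \<Rightarrow> 'v set \<Rightarrow> 'v set \<Rightarrow> ('k, 'v set, 'g) gmodule" where
  "subquot_gmodule M L N \<equiv> quot_gmodule (M\<lparr>carrier := L\<rparr>) N"


section \<open>The group \<open>GL\<^sub>2(\<bbbF>\<^sub>p)\<close> and its modules \<open>V\<^sub>r\<close>\<close>

text \<open>
  \<open>\<bbbF>\<^sub>p\<close> is the type \<^typ>\<open>'p mod_ring\<close>, where \<open>'p\<close> is a type of prime cardinality \<open>p\<close>.
\<close>

abbreviation Fp :: "'p::prime_card mod_ring ring" where
  "Fp \<equiv> ring_of_type_algebra"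

abbreviation GL2 :: "'p::prime_card mod_ring mat monoid" where
  "GL2 \<equiv> units_of (ring_mat TYPE('p mod_ring) 2 ())"

text \<open>
  \<open>\<bbbF>\<^sub>p[X, Y]\<close> is \<open>\<bbbF>\<^sub>p[X][Y]\<close>: the coefficient of \<open>X\<^sup>i Y\<^sup>j\<close> in \<open>F\<close> is
  \<open>poly.coeff (poly.coeff F j) i\<close>.
\<close>

definition varX :: "'p::prime_card mod_ring poly poly" where
  "varX = [:[:0, 1:]:]"

definition varY :: "'p::prime_card mod_ring poly poly" where
  "varY = [:0, 1:]"

definition const :: "'p::prime_card mod_ring \<Rightarrow> 'p mod_ring poly poly" where
  "const c = [:[:c:]:]"

definition homogeneous :: "nat \<Rightarrow> 'p::prime_card mod_ring poly poly \<Rightarrow> bool" where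
  "homogeneous r F \<longleftrightarrow> (\<forall>i j. poly.coeff (poly.coeff F j) i \<noteq> 0 \<longrightarrow> i + j = r)"

text \<open>The substitution \<open>F(P, Q)\<close>.\<close>

definition subst ::
  "'p::prime_card mod_ring poly poly \<Rightarrow> 'p mod_ring poly poly \<Rightarrow> 'p mod_ring poly poly
   \<Rightarrow> 'p mod_ring poly poly" where
  "subst F P Q =
     (\<Sum>j\<le>Polynomial.degree F. \<Sum>i\<le>Polynomial.degree (poly.coeff F j).
        const (poly.coeff (poly.coeff F j) i) * P ^ i * Q ^ j)"

type_synonym ('p, 'v) Gamma_module = "('p mod_ring, 'v, 'p mod_ring mat) gmodule"

definition V :: "nat \<Rightarrow> ('p::prime_card, 'p mod_ring poly poly) Gamma_module" where
  "V r = \<lparr>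
     carrier = {F. homogeneous r F},
     monoid.mult = undefined,
     one = undefined,
     zero = 0,
     add = (+),
     module.smult = (\<lambda>c F. const c * F),
     act = (\<lambda>g F. subst F (const (g $$ (0,0)) * varX + const (g $$ (1,0)) * varY)
                          (const (g $$ (0,1)) * varX + const (g $$ (1,1)) * varY))\<rparr>"

text \<open>
  \<open>M \<otimes> D\<^sup>k\<close>: tensoring with the one-dimensional module on which \<open>g\<close> acts by \<open>(det g)\<^sup>k\<close>
  keeps the underlying vector space and multiplies the action of \<open>g\<close> by \<open>(det g)\<^sup>k\<close>.
\<close>

definition det_twist :: "('p::prime_card, 'v) Gamma_module \<Rightarrow> nat \<Rightarrow> ('p, 'v) Gamma_module" where
  "det_twist M k = M\<lparr>act := (\<lambda>g x. (det g ^ k) \<odot>\<^bsub>M\<^esub> act M g x)\<rparr>"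

definition theta :: "'p::prime_card mod_ring poly poly" where
  "theta = varX ^ CARD('p) * varY - varX * varY ^ CARD('p)"

text \<open>\<open>V\<^sub>r\<^sup>(\<^sup>m\<^sup>)\<close>\<close>

definition Vfil :: "nat \<Rightarrow> nat \<Rightarrow> 'p::prime_card mod_ring poly poly set" where
  "Vfil r m = {F \<in> carrier (V r). theta ^ m dvd F}"

text \<open>\<open>X\<^bsub>r-l, r\<^esub>\<close>, for \<open>l \<le> r\<close>\<close>

definition Xsub :: "nat \<Rightarrow> nat \<Rightarrow> 'p::prime_card mod_ring poly poly set" where
  "Xsub r l = gspan Fp GL2 (V r) {varX ^ (r - l) * varY ^ l}"

definition Q :: "nat \<Rightarrow> nat \<Rightarrow> ('p::prime_card, 'p mod_ring poly poly set) Gamma_module" where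
  "Q r l = quot_gmodule (V r) (Xsub r l <+>\<^bsub>V r\<^esub> Vfil r (l + 1))"

text \<open>
  \<open>br p n\<close> is the representative of \<open>n\<close> modulo \<open>p - 1\<close> in \<open>{1, \<dots>, p - 1}\<close> (not in
  \<open>{0, \<dots>, p - 2}\<close>). It is total on integers, so that differences are formed in \<^typ>\<open>int\<close>.
\<close>

definition br :: "nat \<Rightarrow> int \<Rightarrow> nat" where
  "br p n = nat ((n - 1) mod (int p - 1) + 1)"

lemma br_unique:
  assumes "p \<ge> 2"
  shows "br p n = m \<longleftrightarrow> m \<in> {1..p - 1} \<and> [int m = n] (mod (int p - 1))"
proof -
  define q where "q = int p - 1"
  have q: "q > 0" using assms by (simp add: q_def)
  have b: "0 \<le> (n - 1) mod q" "(n - 1) mod q < q" using q by simp_all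
  have eq: "int (br p n) = (n - 1) mod q + 1" using b by (simp add: br_def q_def)
  have "[int m = n] (mod q) \<longleftrightarrow> [int m - 1 = n - 1] (mod q)"
    by (metis cong_diff cong_refl cong_add diff_add_cancel)
  moreover have "m \<in> {1..p - 1} \<longleftrightarrow> 0 \<le> int m - 1 \<and> int m - 1 < q"
    using assms by (auto simp: q_def)
  ultimately have "m \<in> {1..p - 1} \<and> [int m = n] (mod q) \<longleftrightarrow> int m - 1 = (n - 1) mod q"
    using b by (metis cong_def mod_mod_trivial mod_pos_pos_trivial)
  thus ?thesis using eq unfolding q_def by linarith
qed

end

theory Submission
  imports Defs
begin

text \<open>
  Put \<open>j = [a - i]\<close>, so that \<open>r \<equiv> i + j\<close> modulo \<open>p - 1\<close>, and write \<open>V\<^sup>(\<^sup>m\<^sup>)\<close> for \<open>V\<^sub>r\<^sup>(\<^sup>m\<^sup>)\<close>. The modules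
  \<open>X\<^bsub>r-i\<^esub> + V\<^sup>(\<^sup>j\<^sup>)\<close> and \<open>X\<^bsub>r-j+1\<^esub> + V\<^sup>(\<^sup>j\<^sup>)\<close> coincide (\<open>XV_lower\<close>). With \<open>A = X\<^bsub>r-i\<^esub> + V\<^sup>(\<^sup>i\<^sup>+\<^sup>1\<^sup>)\<close> and
  \<open>B = X\<^bsub>r-i\<^esub> + V\<^sup>(\<^sup>j\<^sup>)\<close> this gives \<open>Q(j - 1) = V\<^sub>r / B\<close>, hence \<open>W = B / A\<close>, and \<open>W\<close> is the image of \<open>V\<^sup>(\<^sup>j\<^sup>)\<close> in
  \<open>V\<^sub>r / A\<close>. The theorem says which steps of the filtration \<open>V\<^sup>(\<^sup>j\<^sup>) \<supseteq> \<dots> \<supseteq> V\<^sup>(\<^sup>i\<^sup>+\<^sup>1\<^sup>)\<close> survive there.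

  Bounds from below on \<open>A\<close> come from arbitrary linear forms \<open>f\<close> that vanish on it. If \<open>f\<close> vanishes on
  \<open>V\<^sup>(\<^sup>d\<^sup>+\<^sup>1\<^sup>)\<close>, then \<open>f(X\<^bsup>r-t\<^esup> Y\<^sup>t)\<close> is, for \<open>t\<close> in a fixed class modulo \<open>p - 1\<close>, a polynomial of degree at most
  \<open>d\<close> in \<open>t\<close>: vanishing on the multiples of \<open>\<theta>\<^sup>d\<^sup>+\<^sup>1\<close> means that the differences of order \<open>d + 1\<close> are zero
  (\<open>functional_bpoly\<close>). Vanishing on \<open>(X + Y)\<^bsup>r-k\<^esup> X\<^sup>k\<close> for \<open>k \<le> i\<close> is a system of linear equations for
  that polynomial, and the left-hand sides are the values at \<open>k\<close> of another polynomial of small degree (\<open>eqpoly\<close>).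
  Differences in \<open>k\<close> solve the system far enough to show that \<open>f\<close> vanishes on generators of a step
  (\<open>reach_below\<close>, \<open>reach_all\<close>, \<open>top_generator\<close>, \<open>boundary_generator\<close>).

  Bounds from above come from explicit linear forms that do vanish on \<open>A\<close>, in which the polynomial is a suitable
  binomial coefficient (\<open>exclusion\<close>). On \<open>\<theta>\<^sup>m G\<close> their values are the coefficient of \<open>X\<^sup>s\<close> in \<open>G\<close>, or moments
  \<open>\<Sum>\<^bsub>w\<^esub> G(w) w\<^sub>1\<^sup>a w\<^sub>2\<^sup>b\<close> over the plane \<open>\<bbbF>\<^sub>p\<^sup>2\<close>. As the \<open>G\<close> with \<open>\<theta>\<^sup>m G \<in> A\<close> form a submodule, one vanishing
  moment forces the vanishing of all moments of its degree, and a vanishing leading coefficient forces \<open>\<theta> dvd G\<close>.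
  Hence \<open>A\<close> meets \<open>V\<^sup>(\<^sup>l\<^sup>)\<close> exactly in \<open>V\<^sup>(\<^sup>i\<^sup>+\<^sup>1\<^sup>)\<close> for suitable \<open>l\<close> (\<open>intersection_eq\<close>).

  The extra constituents of \<open>W\<close> are the image of a \<open>\<Gamma>\<close>-map. The polynomial \<open>\<Sum>\<^bsub>w\<^esub> G(w) (w\<^sub>1 Y - w\<^sub>2 X)\<^sup>n\<close>
  collects all moments of degree \<open>n\<close>, transforms under \<open>\<Gamma>\<close> up to a power of the determinant, and vanishes on multiples
  of \<open>\<theta>\<close>. If \<open>q = [a - r\<^sub>0]\<close>, then \<open>r\<^sub>0 + q = i + j\<close> in part (ii), and \<open>B = A + V\<^sup>(\<^sup>l\<^sup>)\<close> where \<open>l\<close> is \<open>q\<close>, \<open>q\<close> and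
  \<open>q - 1\<close> in the cases (a), (b) and (c). In (a) and (c) the linear forms above show that \<open>A \<inter> V\<^sup>(\<^sup>l\<^sup>)\<close> lies in the kernel
  of \<open>\<theta>\<^sup>l G \<mapsto> \<Sum>\<^bsub>w\<^esub> G(w) (w\<^sub>1 Y - w\<^sub>2 X)\<^sup>n\<close>, and the generators found before show that this kernel lies in
  \<open>A + V\<^sup>(\<^sup>l\<^sup>+\<^sup>1\<^sup>)\<close> (\<open>kernel_low\<close>, \<open>kernel_high\<close>). In part (i) already \<open>V\<^sup>(\<^sup>j\<^sup>) \<subseteq> A\<close>, and in part (iii) nothing of \<open>V\<^sup>(\<^sup>j\<^sup>)\<close> beyond
  \<open>V\<^sup>(\<^sup>i\<^sup>+\<^sup>1\<^sup>)\<close> lies in \<open>A\<close>.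
\<close>

section \<open>Quotients of modules with a group action\<close>

context gmodule
begin

lemma gsubmoduleD:
  assumes "gsubmodule R G M N"
  shows "N \<subseteq> carrier M" "\<zero>\<^bsub>M\<^esub> \<in> N"
    "\<And>x y. x \<in> N \<Longrightarrow> y \<in> N \<Longrightarrow> x \<oplus>\<^bsub>M\<^esub> y \<in> N"
    "\<And>x. x \<in> N \<Longrightarrow> \<ominus>\<^bsub>M\<^esub> x \<in> N"
    "\<And>x y. x \<in> N \<Longrightarrow> y \<in> N \<Longrightarrow> x \<ominus>\<^bsub>M\<^esub> y \<in> N"
    "\<And>c x. c \<in> carrier R \<Longrightarrow> x \<in> N \<Longrightarrow> c \<odot>\<^bsub>M\<^esub> x \<in> N"
    "\<And>g x. g \<in> carrier G \<Longrightarrow> x \<in> N \<Longrightarrow> act M g x \<in> N"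
proof -
  have s: "submodule N R M" using assms by (simp add: gsubmodule_def)
  note E = submoduleE[OF s]
  show 1: "N \<subseteq> carrier M" by (rule E(1))
  show 2: "\<And>x y. x \<in> N \<Longrightarrow> y \<in> N \<Longrightarrow> x \<oplus>\<^bsub>M\<^esub> y \<in> N" by (rule E(5))
  show 3: "\<And>x. x \<in> N \<Longrightarrow> \<ominus>\<^bsub>M\<^esub> x \<in> N" by (rule E(3))
  show "\<And>x y. x \<in> N \<Longrightarrow> y \<in> N \<Longrightarrow> x \<ominus>\<^bsub>M\<^esub> y \<in> N"
    using 2 3 by (simp add: a_minus_def)
  show "\<And>c x. c \<in> carrier R \<Longrightarrow> x \<in> N \<Longrightarrow> c \<odot>\<^bsub>M\<^esub> x \<in> N" by (rule E(4))
  show "\<And>g x. g \<in> carrier G \<Longrightarrow> x \<in> N \<Longrightarrow> act M g x \<in> N"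
    using assms by (simp add: gsubmodule_def)
  obtain x where x: "x \<in> N" using E(2) by blast
  have "x \<oplus>\<^bsub>M\<^esub> (\<ominus>\<^bsub>M\<^esub> x) \<in> N" using 2 3 x by blast
  thus "\<zero>\<^bsub>M\<^esub> \<in> N" using x 1 by (metis M.r_neg subsetD)
qed

lemma gsubmoduleI:
  assumes "N \<subseteq> carrier M" "\<zero>\<^bsub>M\<^esub> \<in> N"
    "\<And>x y. x \<in> N \<Longrightarrow> y \<in> N \<Longrightarrow> x \<oplus>\<^bsub>M\<^esub> y \<in> N"
    "\<And>c x. c \<in> carrier R \<Longrightarrow> x \<in> N \<Longrightarrow> c \<odot>\<^bsub>M\<^esub> x \<in> N"
    "\<And>g x. g \<in> carrier G \<Longrightarrow> x \<in> N \<Longrightarrow> act M g x \<in> N"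
  shows "gsubmodule R G M N"
proof -
  have "\<ominus>\<^bsub>M\<^esub> x \<in> N" if x: "x \<in> N" for x
  proof -
    have xM: "x \<in> carrier M" using x assms(1) by auto
    have "(\<ominus>\<^bsub>R\<^esub> \<one>\<^bsub>R\<^esub>) \<odot>\<^bsub>M\<^esub> x \<in> N" using x assms(4) by simp
    moreover have "(\<ominus>\<^bsub>R\<^esub> \<one>\<^bsub>R\<^esub>) \<odot>\<^bsub>M\<^esub> x = \<ominus>\<^bsub>M\<^esub> x" using xM by (simp add: smult_l_minus)
    ultimately show ?thesis by simp
  qed
  hence "submodule N R M" using assms by (intro submoduleI) auto
  thus ?thesis using assms(5) by (simp add: gsubmodule_def)
qed

lemma gsubmodule_carrier: "gsubmodule R G M (carrier M)"
  by (rule gsubmoduleI) (auto intro: act_closed)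

lemma gmodule_restrict:
  assumes "gsubmodule R G M L"
  shows "gmodule R G (M\<lparr>carrier := L\<rparr>)"
proof -
  note D = gsubmoduleD[OF assms]
  have "module R (M\<lparr>carrier := L\<rparr>)"
    using assms module_axioms by (auto simp: gsubmodule_def intro: submodule.submodule_is_module)
  thus ?thesis
  proof (intro gmodule.intro gmodule_axioms.intro)
    show "Group.group G" by (rule group_axioms)
  qed (use D in \<open>auto simp: subset_iff intro!: act_add act_smult act_one act_mult\<close>)
qed

lemma gsubmodule_in_restrict:
  assumes "gsubmodule R G M L" "gsubmodule R G M N" "N \<subseteq> L"
  shows "gsubmodule R G (M\<lparr>carrier := L\<rparr>) N"
proof -
  interpret L: gmodule R G "M\<lparr>carrier := L\<rparr>" by (rule gmodule_restrict[OF assms(1)])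
  show ?thesis
    by (rule L.gsubmoduleI) (use gsubmoduleD[OF assms(2)] assms(3) in auto)
qed

lemma abelian_subgroup:
  assumes "gsubmodule R G M N"
  shows "abelian_subgroup N M"
proof (rule abelian_subgroupI3)
  show "additive_subgroup N M"
    using assms by (auto simp: gsubmodule_def submodule_def additive_subgroup_def)
qed (rule M.abelian_group_axioms)

lemma coset_eq_iff:
  assumes "gsubmodule R G M N" "x \<in> carrier M" "y \<in> carrier M"
  shows "N +>\<^bsub>M\<^esub> x = N +>\<^bsub>M\<^esub> y \<longleftrightarrow> x \<ominus>\<^bsub>M\<^esub> y \<in> N"
proof -
  interpret N: abelian_subgroup N M by (rule abelian_subgroup[OF assms(1)])
  have "N +>\<^bsub>M\<^esub> x = N +>\<^bsub>M\<^esub> y \<longleftrightarrow> x \<in> N +>\<^bsub>M\<^esub> y"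
    using N.a_repr_independence' N.a_rcos_self assms by blast
  also have "\<dots> \<longleftrightarrow> x \<ominus>\<^bsub>M\<^esub> y \<in> N"
    using N.a_rcos_module_minus[OF _ assms(3,2)] N.a_rcos_module[OF assms(3,2)]
    by (simp add: a_minus_def)
  finally show ?thesis .
qed

lemma mem_coset_iff:
  assumes "gsubmodule R G M N" "x \<in> carrier M"
  shows "z \<in> N +>\<^bsub>M\<^esub> x \<longleftrightarrow> z \<in> carrier M \<and> z \<ominus>\<^bsub>M\<^esub> x \<in> N"
proof -
  interpret N: abelian_subgroup N M by (rule abelian_subgroup[OF assms(1)])
  show ?thesis
    using N.a_rcos_module[OF assms(2)] N.a_elemrcos_carrier[OF assms(2)]
    by (auto simp: a_minus_def)
qed

lemma quot_carrier: "carrier (quot_gmodule M N) = (\<lambda>x. N +>\<^bsub>M\<^esub> x) ` carrier M"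
  by (auto simp: quot_gmodule_def A_RCOSETS_def' a_r_coset_def')

lemma quot_zero: "\<zero>\<^bsub>quot_gmodule M N\<^esub> = N"
  by (simp add: quot_gmodule_def)

lemma quot_zero_coset:
  assumes "gsubmodule R G M N" shows "N +>\<^bsub>M\<^esub> \<zero>\<^bsub>M\<^esub> = N"
  using gsubmoduleD(1)[OF assms] by (rule a_coset_add_zero)

lemma quot_add:
  assumes "gsubmodule R G M N" "x \<in> carrier M" "y \<in> carrier M"
  shows "(N +>\<^bsub>M\<^esub> x) \<oplus>\<^bsub>quot_gmodule M N\<^esub> (N +>\<^bsub>M\<^esub> y) = N +>\<^bsub>M\<^esub> (x \<oplus>\<^bsub>M\<^esub> y)"
proof -
  interpret N: abelian_subgroup N M by (rule abelian_subgroup[OF assms(1)])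
  show ?thesis using N.a_rcos_sum[OF assms(2,3)] by (simp add: quot_gmodule_def)
qed

text \<open>A map that respects cosets is well defined on the quotient: the union over the coset
  that represents it has only one distinct member.\<close>

lemma coset_Union_eq:
  assumes N: "gsubmodule R G M N" and x: "x \<in> carrier M"
    and f: "\<And>z. z \<in> carrier M \<Longrightarrow> z \<ominus>\<^bsub>M\<^esub> x \<in> N \<Longrightarrow> F z = F x"
  shows "(\<Union>z\<in>N +>\<^bsub>M\<^esub> x. F z) = F x"
proof -
  have "x \<in> N +>\<^bsub>M\<^esub> x"
    using x gsubmoduleD(2)[OF N] by (simp add: mem_coset_iff[OF N x] a_minus_def M.r_neg)
  moreover have "F z = F x" if "z \<in> N +>\<^bsub>M\<^esub> x" for z
    using that by (intro f) (auto simp: mem_coset_iff[OF N x])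
  ultimately show ?thesis by blast
qed

lemma act_diff:
  assumes "g \<in> carrier G" "x \<in> carrier M" "y \<in> carrier M"
  shows "act M g (x \<ominus>\<^bsub>M\<^esub> y) = act M g x \<ominus>\<^bsub>M\<^esub> act M g y"
proof -
  have "act M g (x \<ominus>\<^bsub>M\<^esub> y) \<oplus>\<^bsub>M\<^esub> act M g y = act M g x"
    using assms act_add[OF assms(1), of "x \<ominus>\<^bsub>M\<^esub> y" y]
    by (simp add: a_minus_def M.a_assoc M.l_neg)
  thus ?thesis using assms act_closed
    by (metis M.add.inv_solve_right' M.minus_closed a_minus_def)
qed

lemma smult_diff:
  assumes "c \<in> carrier R" "x \<in> carrier M" "y \<in> carrier M"
  shows "c \<odot>\<^bsub>M\<^esub> (x \<ominus>\<^bsub>M\<^esub> y) = c \<odot>\<^bsub>M\<^esub> x \<ominus>\<^bsub>M\<^esub> c \<odot>\<^bsub>M\<^esub> y"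
  using assms by (simp add: a_minus_def smult_r_distr smult_r_minus)

lemma quot_smult:
  assumes N: "gsubmodule R G M N" and "c \<in> carrier R" "x \<in> carrier M"
  shows "c \<odot>\<^bsub>quot_gmodule M N\<^esub> (N +>\<^bsub>M\<^esub> x) = N +>\<^bsub>M\<^esub> (c \<odot>\<^bsub>M\<^esub> x)"
proof -
  have "(\<Union>z\<in>N +>\<^bsub>M\<^esub> x. N +>\<^bsub>M\<^esub> (c \<odot>\<^bsub>M\<^esub> z)) = N +>\<^bsub>M\<^esub> (c \<odot>\<^bsub>M\<^esub> x)"
  proof (rule coset_Union_eq[OF N assms(3)])
    fix z assume z: "z \<in> carrier M" "z \<ominus>\<^bsub>M\<^esub> x \<in> N"
    hence "c \<odot>\<^bsub>M\<^esub> z \<ominus>\<^bsub>M\<^esub> c \<odot>\<^bsub>M\<^esub> x \<in> N"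
      using gsubmoduleD(6)[OF N assms(2) z(2)] assms smult_diff by simp
    thus "N +>\<^bsub>M\<^esub> (c \<odot>\<^bsub>M\<^esub> z) = N +>\<^bsub>M\<^esub> (c \<odot>\<^bsub>M\<^esub> x)"
      using z assms by (simp add: coset_eq_iff[OF N])
  qed
  thus ?thesis by (simp add: quot_gmodule_def)
qed

lemma quot_act:
  assumes N: "gsubmodule R G M N" and "g \<in> carrier G" "x \<in> carrier M"
  shows "act (quot_gmodule M N) g (N +>\<^bsub>M\<^esub> x) = N +>\<^bsub>M\<^esub> act M g x"
proof -
  have "(\<Union>z\<in>N +>\<^bsub>M\<^esub> x. N +>\<^bsub>M\<^esub> act M g z) = N +>\<^bsub>M\<^esub> act M g x"
  proof (rule coset_Union_eq[OF N assms(3)])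
    fix z assume z: "z \<in> carrier M" "z \<ominus>\<^bsub>M\<^esub> x \<in> N"
    hence "act M g z \<ominus>\<^bsub>M\<^esub> act M g x \<in> N"
      using gsubmoduleD(7)[OF N assms(2) z(2)] assms act_diff by simp
    thus "N +>\<^bsub>M\<^esub> act M g z = N +>\<^bsub>M\<^esub> act M g x"
      using z assms act_closed by (simp add: coset_eq_iff[OF N])
  qed
  thus ?thesis by (simp add: quot_gmodule_def)
qed

lemma gmodule_quot:
  assumes N: "gsubmodule R G M N"
  shows "gmodule R G (quot_gmodule M N)"
proof -
  interpret N: abelian_subgroup N M by (rule abelian_subgroup[OF N])
  let ?Q = "quot_gmodule M N"
  note simps = quot_add[OF N] quot_smult[OF N] quot_act[OF N] act_closed
  have "module R ?Q"
  proof (rule moduleI)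
    show "cring R" by (rule R.cring_axioms)
    show "abelian_group ?Q"
    proof (rule abelian_groupI)
      show "\<zero>\<^bsub>?Q\<^esub> \<in> carrier ?Q"
        using quot_zero_coset[OF N] by (force simp: quot_zero quot_carrier)
    next
      fix x assume "x \<in> carrier ?Q"
      then obtain u where u: "u \<in> carrier M" "x = N +>\<^bsub>M\<^esub> u" by (auto simp: quot_carrier)
      have z: "\<zero>\<^bsub>?Q\<^esub> = N +>\<^bsub>M\<^esub> \<zero>\<^bsub>M\<^esub>" using quot_zero_coset[OF N] by (simp add: quot_zero)
      show "\<zero>\<^bsub>?Q\<^esub> \<oplus>\<^bsub>?Q\<^esub> x = x" unfolding z u(2) using u(1) by (simp add: simps)
      have "(N +>\<^bsub>M\<^esub> \<ominus>\<^bsub>M\<^esub> u) \<oplus>\<^bsub>?Q\<^esub> x = \<zero>\<^bsub>?Q\<^esub>"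
        unfolding z u(2) using u(1) by (simp add: simps M.l_neg)
      moreover have "(N +>\<^bsub>M\<^esub> \<ominus>\<^bsub>M\<^esub> u) \<in> carrier ?Q" using u(1) by (auto simp: quot_carrier)
      ultimately show "\<exists>y\<in>carrier ?Q. y \<oplus>\<^bsub>?Q\<^esub> x = \<zero>\<^bsub>?Q\<^esub>" by blast
    qed (auto simp: quot_carrier simps M.a_ac intro!: imageI)
  qed (auto simp: quot_carrier simps smult_l_distr smult_r_distr smult_assoc1)
  thus ?thesis
    by (intro gmodule.intro gmodule_axioms.intro group_axioms)
      (auto simp: quot_carrier simps act_add act_smult act_one act_mult)
qed

lemma gmodule_homD:
  assumes "f \<in> gmodule_hom R G M C"
  shows "\<And>x. x \<in> carrier M \<Longrightarrow> f x \<in> carrier C"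
    "\<And>x y. x \<in> carrier M \<Longrightarrow> y \<in> carrier M \<Longrightarrow> f (x \<oplus>\<^bsub>M\<^esub> y) = f x \<oplus>\<^bsub>C\<^esub> f y"
    "\<And>c x. c \<in> carrier R \<Longrightarrow> x \<in> carrier M \<Longrightarrow> f (c \<odot>\<^bsub>M\<^esub> x) = c \<odot>\<^bsub>C\<^esub> f x"
    "\<And>g x. g \<in> carrier G \<Longrightarrow> x \<in> carrier M \<Longrightarrow> f (act M g x) = act C g (f x)"
  using assms by (auto simp: gmodule_hom_def)

lemma minus_self: "x \<in> carrier M \<Longrightarrow> x \<ominus>\<^bsub>M\<^esub> x = \<zero>\<^bsub>M\<^esub>"
  and minus_zero: "x \<in> carrier M \<Longrightarrow> x \<ominus>\<^bsub>M\<^esub> \<zero>\<^bsub>M\<^esub> = x"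
  and minus_add_self: "x \<in> carrier M \<Longrightarrow> u \<in> carrier M \<Longrightarrow> (x \<ominus>\<^bsub>M\<^esub> u) \<oplus>\<^bsub>M\<^esub> u = x"
  by (simp_all add: a_minus_def M.r_neg M.a_assoc M.l_neg)

text \<open>The isomorphism theorems in the form used below: a map out of \<open>M\<close> whose kernel is
  \<open>A + U\<close> makes \<open>M / A\<close> an extension of its image by \<open>U / (U \<inter> A)\<close>.\<close>

lemma short_exact_of_hom:
  assumes A: "gsubmodule R G M A" and U: "gsubmodule R G M U"
    and C: "gmodule R G C" and phi: "\<phi> \<in> gmodule_hom R G M C" and surj: "\<phi> ` carrier M = carrier C"
    and ker: "\<And>x. x \<in> carrier M \<Longrightarrow> \<phi> x = \<zero>\<^bsub>C\<^esub> \<longleftrightarrow> (\<exists>u\<in>U. x \<ominus>\<^bsub>M\<^esub> u \<in> A)"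
    and D: "U \<inter> A = D"
  shows "short_exact R G (quot_gmodule (M\<lparr>carrier := U\<rparr>) D) (quot_gmodule M A) C"
proof -
  interpret C: gmodule R G C by (rule C)
  let ?U = "M\<lparr>carrier := U\<rparr>"
  interpret U: gmodule R G ?U by (rule gmodule_restrict[OF U])
  have Dsub: "gsubmodule R G ?U D"
    by (rule U.gsubmoduleI) (use gsubmoduleD[OF A] gsubmoduleD[OF U] D in auto)
  have UM: "u \<in> carrier M" if "u \<in> U" for u using that gsubmoduleD(1)[OF U] by auto
  have minusU: "x \<ominus>\<^bsub>?U\<^esub> y = x \<ominus>\<^bsub>M\<^esub> y" if "x \<in> U" "y \<in> U" for x y
  proof -
    have "(x \<ominus>\<^bsub>?U\<^esub> y) \<oplus>\<^bsub>?U\<^esub> y = x"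
      by (rule U.minus_add_self) (simp_all add: that)
    hence e: "(x \<ominus>\<^bsub>?U\<^esub> y) \<oplus>\<^bsub>M\<^esub> y = x" by simp
    have "(x \<ominus>\<^bsub>?U\<^esub> y) \<in> U" using U.M.minus_closed[of x y] that by simp
    hence c: "(x \<ominus>\<^bsub>?U\<^esub> y) \<in> carrier M" "y \<in> carrier M" using UM that by auto
    have "x \<ominus>\<^bsub>M\<^esub> y = ((x \<ominus>\<^bsub>?U\<^esub> y) \<oplus>\<^bsub>M\<^esub> y) \<ominus>\<^bsub>M\<^esub> y" by (simp only: e)
    also have "\<dots> = x \<ominus>\<^bsub>?U\<^esub> y" using c by (subst a_minus_def) (simp add: M.a_assoc M.r_neg)
    finally show ?thesis ..
  qed
  define f where "f K = (\<Union>x\<in>K. A +>\<^bsub>M\<^esub> x)" for K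
  define h where "h K = the_elem (\<phi> ` K)" for K
  have f: "f (D +>\<^bsub>?U\<^esub> u) = A +>\<^bsub>M\<^esub> u" if u: "u \<in> U" for u
  proof -
    have "f (D +>\<^bsub>?U\<^esub> u) = (\<Union>z\<in>D +>\<^bsub>?U\<^esub> u. A +>\<^bsub>M\<^esub> z)" by (simp add: f_def)
    also have "\<dots> = A +>\<^bsub>M\<^esub> u"
    proof (rule U.coset_Union_eq[OF Dsub])
      show "u \<in> carrier ?U" using u by simp
      fix z assume z: "z \<in> carrier ?U" "z \<ominus>\<^bsub>?U\<^esub> u \<in> D"
      hence zU: "z \<in> U" by simp
      have "z \<ominus>\<^bsub>M\<^esub> u \<in> A" using z(2) minusU[OF zU u] D by auto
      thus "A +>\<^bsub>M\<^esub> z = A +>\<^bsub>M\<^esub> u" using coset_eq_iff[OF A UM[OF zU] UM[OF u]] by blast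
    qed
    finally show ?thesis .
  qed
  have phi0: "\<phi> \<zero>\<^bsub>M\<^esub> = \<zero>\<^bsub>C\<^esub>"
  proof -
    have "\<phi> \<zero>\<^bsub>M\<^esub> \<oplus>\<^bsub>C\<^esub> \<phi> \<zero>\<^bsub>M\<^esub> = \<phi> \<zero>\<^bsub>M\<^esub>"
      using gmodule_homD(2)[OF phi, of "\<zero>\<^bsub>M\<^esub>" "\<zero>\<^bsub>M\<^esub>"] by simp
    thus ?thesis using gmodule_homD(1)[OF phi M.zero_closed] by (simp add: C.M.add.l_cancel_one)
  qed
  have phiA: "\<phi> x = \<zero>\<^bsub>C\<^esub>" if "x \<in> A" for x
  proof -
    have "x \<ominus>\<^bsub>M\<^esub> \<zero>\<^bsub>M\<^esub> \<in> A" using that gsubmoduleD[OF A] by blast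
    thus ?thesis using ker[of x] gsubmoduleD(1)[OF A] gsubmoduleD(2)[OF U] that by blast
  qed
  have h: "h (A +>\<^bsub>M\<^esub> x) = \<phi> x" if x: "x \<in> carrier M" for x
  proof -
    have "\<phi> z = \<phi> x" if z: "z \<in> A +>\<^bsub>M\<^esub> x" for z
    proof -
      have zc: "z \<in> carrier M" "z \<ominus>\<^bsub>M\<^esub> x \<in> A" using z by (auto simp: mem_coset_iff[OF A x])
      have "\<phi> ((z \<ominus>\<^bsub>M\<^esub> x) \<oplus>\<^bsub>M\<^esub> x) = \<phi> (z \<ominus>\<^bsub>M\<^esub> x) \<oplus>\<^bsub>C\<^esub> \<phi> x"
        using zc x by (intro gmodule_homD(2)[OF phi]) auto
      moreover have "(z \<ominus>\<^bsub>M\<^esub> x) \<oplus>\<^bsub>M\<^esub> x = z" using zc x by (simp add: a_minus_def M.a_assoc M.l_neg)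
      ultimately show ?thesis using phiA[OF zc(2)] gmodule_homD(1)[OF phi x] by simp
    qed
    moreover have "x \<in> A +>\<^bsub>M\<^esub> x"
      using x gsubmoduleD(2)[OF A] by (simp add: mem_coset_iff[OF A x] a_minus_def M.r_neg)
    ultimately have "\<phi> ` (A +>\<^bsub>M\<^esub> x) = {\<phi> x}" by blast
    thus ?thesis by (simp add: h_def)
  qed
  have carrU: "carrier (quot_gmodule ?U D) = (\<lambda>x. D +>\<^bsub>?U\<^esub> x) ` U" by (simp add: U.quot_carrier)
  have fhom: "f \<in> gmodule_hom R G (quot_gmodule ?U D) (quot_gmodule M A)"
  proof -
    have "f ((D +>\<^bsub>?U\<^esub> x) \<oplus>\<^bsub>quot_gmodule ?U D\<^esub> (D +>\<^bsub>?U\<^esub> y)) =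
        f (D +>\<^bsub>?U\<^esub> x) \<oplus>\<^bsub>quot_gmodule M A\<^esub> f (D +>\<^bsub>?U\<^esub> y)" if "x \<in> U" "y \<in> U" for x y
    proof -
      have "(D +>\<^bsub>?U\<^esub> x) \<oplus>\<^bsub>quot_gmodule ?U D\<^esub> (D +>\<^bsub>?U\<^esub> y) = D +>\<^bsub>?U\<^esub> (x \<oplus>\<^bsub>M\<^esub> y)"
        using U.quot_add[OF Dsub, of x y] that by simp
      thus ?thesis using f[OF that(1)] f[OF that(2)] f[OF gsubmoduleD(3)[OF U that]]
        quot_add[OF A UM[OF that(1)] UM[OF that(2)]] by simp
    qed
    moreover have "f (c \<odot>\<^bsub>quot_gmodule ?U D\<^esub> (D +>\<^bsub>?U\<^esub> x)) = c \<odot>\<^bsub>quot_gmodule M A\<^esub> f (D +>\<^bsub>?U\<^esub> x)"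
      if "c \<in> carrier R" "x \<in> U" for c x
    proof -
      have "c \<odot>\<^bsub>quot_gmodule ?U D\<^esub> (D +>\<^bsub>?U\<^esub> x) = D +>\<^bsub>?U\<^esub> (c \<odot>\<^bsub>M\<^esub> x)"
        using U.quot_smult[OF Dsub that(1), of x] that by simp
      thus ?thesis using f[OF that(2)] f[OF gsubmoduleD(6)[OF U that]]
        quot_smult[OF A that(1) UM[OF that(2)]] by simp
    qed
    moreover have "f (act (quot_gmodule ?U D) g (D +>\<^bsub>?U\<^esub> x)) = act (quot_gmodule M A) g (f (D +>\<^bsub>?U\<^esub> x))"
      if "g \<in> carrier G" "x \<in> U" for g x
    proof -
      have "act (quot_gmodule ?U D) g (D +>\<^bsub>?U\<^esub> x) = D +>\<^bsub>?U\<^esub> (act M g x)"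
        using U.quot_act[OF Dsub that(1), of x] that by simp
      thus ?thesis using f[OF that(2)] f[OF gsubmoduleD(7)[OF U that]]
        quot_act[OF A that(1) UM[OF that(2)]] by simp
    qed
    moreover have "f (D +>\<^bsub>?U\<^esub> x) \<in> carrier (quot_gmodule M A)" if "x \<in> U" for x
      using f[OF that] UM[OF that] by (auto simp: quot_carrier)
    ultimately show ?thesis unfolding gmodule_hom_def carrU by blast
  qed
  have inj: "inj_on f (carrier (quot_gmodule ?U D))"
  proof (rule inj_onI)
    fix K K' assume KK: "K \<in> carrier (quot_gmodule ?U D)" "K' \<in> carrier (quot_gmodule ?U D)" "f K = f K'"
    obtain x where x: "x \<in> U" "K = D +>\<^bsub>?U\<^esub> x" using KK(1) unfolding carrU by (rule imageE)
    obtain y where y: "y \<in> U" "K' = D +>\<^bsub>?U\<^esub> y" using KK(2) unfolding carrU by (rule imageE)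
    have "A +>\<^bsub>M\<^esub> x = A +>\<^bsub>M\<^esub> y"
      using KK(3) unfolding x(2) y(2) f[OF x(1)] f[OF y(1)] .
    hence "x \<ominus>\<^bsub>M\<^esub> y \<in> A" unfolding coset_eq_iff[OF A UM[OF x(1)] UM[OF y(1)]] .
    hence "x \<ominus>\<^bsub>M\<^esub> y \<in> D" unfolding D[symmetric] using gsubmoduleD(5)[OF U x(1) y(1)] by (rule IntI[rotated])
    hence "x \<ominus>\<^bsub>?U\<^esub> y \<in> D" unfolding minusU[OF x(1) y(1)] .
    moreover have "x \<in> carrier ?U" "y \<in> carrier ?U" using x y by simp_all
    ultimately have "D +>\<^bsub>?U\<^esub> x = D +>\<^bsub>?U\<^esub> y" by (simp only: U.coset_eq_iff[OF Dsub])
    thus "K = K'" unfolding x(2) y(2) .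
  qed
  have hhom: "h \<in> gmodule_hom R G (quot_gmodule M A) C"
  proof -
    have "h ((A +>\<^bsub>M\<^esub> x) \<oplus>\<^bsub>quot_gmodule M A\<^esub> (A +>\<^bsub>M\<^esub> y)) = h (A +>\<^bsub>M\<^esub> x) \<oplus>\<^bsub>C\<^esub> h (A +>\<^bsub>M\<^esub> y)"
      if "x \<in> carrier M" "y \<in> carrier M" for x y
      using that by (simp add: quot_add[OF A] h gmodule_homD[OF phi])
    moreover have "h (c \<odot>\<^bsub>quot_gmodule M A\<^esub> (A +>\<^bsub>M\<^esub> x)) = c \<odot>\<^bsub>C\<^esub> h (A +>\<^bsub>M\<^esub> x)"
      if "c \<in> carrier R" "x \<in> carrier M" for c x
      using that by (simp add: quot_smult[OF A] h gmodule_homD[OF phi])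
    moreover have "h (act (quot_gmodule M A) g (A +>\<^bsub>M\<^esub> x)) = act C g (h (A +>\<^bsub>M\<^esub> x))"
      if "g \<in> carrier G" "x \<in> carrier M" for g x
      using that act_closed[OF that] by (simp add: quot_act[OF A] h gmodule_homD[OF phi])
    moreover have "h (A +>\<^bsub>M\<^esub> x) \<in> carrier C" if "x \<in> carrier M" for x
      using that by (simp add: h gmodule_homD[OF phi])
    ultimately show ?thesis unfolding gmodule_hom_def quot_carrier by blast
  qed
  have im: "f ` carrier (quot_gmodule ?U D) = a_kernel (quot_gmodule M A) C h"
  proof -
    have "a_kernel (quot_gmodule M A) C h = {A +>\<^bsub>M\<^esub> x | x. x \<in> carrier M \<and> \<phi> x = \<zero>\<^bsub>C\<^esub>}"
      unfolding a_kernel_def' quot_carrier using h by auto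
    also have "\<dots> = {A +>\<^bsub>M\<^esub> x | x. x \<in> U}"
    proof (intro equalityI subsetI; clarify)
      fix x assume x: "x \<in> carrier M" "\<phi> x = \<zero>\<^bsub>C\<^esub>"
      then obtain u where u: "u \<in> U" "x \<ominus>\<^bsub>M\<^esub> u \<in> A" using ker by blast
      hence "A +>\<^bsub>M\<^esub> x = A +>\<^bsub>M\<^esub> u" using coset_eq_iff[OF A x(1) UM[OF u(1)]] by blast
      thus "\<exists>u. A +>\<^bsub>M\<^esub> x = A +>\<^bsub>M\<^esub> u \<and> u \<in> U" using u by blast
    next
      fix u assume u: "u \<in> U"
      have "u \<ominus>\<^bsub>M\<^esub> u \<in> A" using UM[OF u] gsubmoduleD(2)[OF A] by (simp add: a_minus_def M.r_neg)
      thus "\<exists>x. A +>\<^bsub>M\<^esub> u = A +>\<^bsub>M\<^esub> x \<and> x \<in> carrier M \<and> \<phi> x = \<zero>\<^bsub>C\<^esub>"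
        using ker[OF UM[OF u]] u UM[OF u] by blast
    qed
    also have "\<dots> = f ` carrier (quot_gmodule ?U D)" unfolding carrU using f by auto
    finally show ?thesis ..
  qed
  have "h ` carrier (quot_gmodule M A) = \<phi> ` carrier M"
    unfolding quot_carrier image_image using h by (rule image_cong[OF refl])
  hence "h ` carrier (quot_gmodule M A) = carrier C" unfolding surj .
  with inj im have "inj_on f (carrier (quot_gmodule ?U D)) \<and>
      f ` carrier (quot_gmodule ?U D) = a_kernel (quot_gmodule M A) C h \<and>
      h ` carrier (quot_gmodule M A) = carrier C" by (intro conjI)
  thus ?thesis unfolding short_exact_def by (intro bexI[OF _ fhom] bexI[OF _ hhom])
qed

lemma quot_hom:
  assumes A: "gsubmodule R G M A"
  shows "(\<lambda>x. A +>\<^bsub>M\<^esub> x) \<in> gmodule_hom R G M (quot_gmodule M A)"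
  unfolding gmodule_hom_def quot_carrier
  using quot_add[OF A] quot_smult[OF A] quot_act[OF A] by simp

lemma short_exact_subquot:
  assumes A: "gsubmodule R G M A" and B: "gsubmodule R G M B" and "A \<subseteq> B"
  shows "short_exact R G (quot_gmodule (M\<lparr>carrier := B\<rparr>) A) (quot_gmodule M A) (quot_gmodule M B)"
proof (rule short_exact_of_hom[OF A B gmodule_quot[OF B] quot_hom[OF B]])
  show "(\<lambda>x. B +>\<^bsub>M\<^esub> x) ` carrier M = carrier (quot_gmodule M B)" by (simp add: quot_carrier)
  show "B \<inter> A = A" using assms(3) by auto
  fix x assume x: "x \<in> carrier M"
  have "B +>\<^bsub>M\<^esub> x = \<zero>\<^bsub>quot_gmodule M B\<^esub> \<longleftrightarrow> x \<in> B"
    using coset_eq_iff[OF B x M.zero_closed] minus_zero[OF x] quot_zero_coset[OF B]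
    by (simp add: quot_zero)
  also have "\<dots> \<longleftrightarrow> (\<exists>u\<in>B. x \<ominus>\<^bsub>M\<^esub> u \<in> A)"
  proof
    assume "x \<in> B"
    moreover have "x \<ominus>\<^bsub>M\<^esub> x \<in> A" unfolding minus_self[OF x] by (rule gsubmoduleD(2)[OF A])
    ultimately show "\<exists>u\<in>B. x \<ominus>\<^bsub>M\<^esub> u \<in> A" by blast
  next
    assume "\<exists>u\<in>B. x \<ominus>\<^bsub>M\<^esub> u \<in> A"
    then obtain u where u: "u \<in> B" "x \<ominus>\<^bsub>M\<^esub> u \<in> A" by blast
    hence "(x \<ominus>\<^bsub>M\<^esub> u) \<oplus>\<^bsub>M\<^esub> u \<in> B" using assms(3) gsubmoduleD(3)[OF B] by blast
    moreover have "u \<in> carrier M" using u gsubmoduleD(1)[OF B] by auto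
    ultimately show "x \<in> B" using minus_add_self[OF x] by simp
  qed
  finally show "B +>\<^bsub>M\<^esub> x = \<zero>\<^bsub>quot_gmodule M B\<^esub> \<longleftrightarrow> (\<exists>u\<in>B. x \<ominus>\<^bsub>M\<^esub> u \<in> A)" .
qed

text \<open>A degenerate case of the extension: the third term is \<open>M / M = 0\<close>.\<close>

lemma quot_iso_of_sum:
  assumes A: "gsubmodule R G M A" and U: "gsubmodule R G M U"
    and sum: "\<And>x. x \<in> carrier M \<Longrightarrow> \<exists>u\<in>U. x \<ominus>\<^bsub>M\<^esub> u \<in> A" and D: "U \<inter> A = D"
  shows "gmodule_iso R G (quot_gmodule M A) (quot_gmodule (M\<lparr>carrier := U\<rparr>) D)"
proof -
  let ?U = "M\<lparr>carrier := U\<rparr>"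
  let ?Q = "quot_gmodule M (carrier M)"
  have C: "gsubmodule R G M (carrier M)" by (rule gsubmodule_carrier)
  interpret U: gmodule R G ?U by (rule gmodule_restrict[OF U])
  have Dsub: "gsubmodule R G ?U D"
    by (rule U.gsubmoduleI) (use gsubmoduleD[OF A] gsubmoduleD[OF U] D in auto)
  let ?QU = "quot_gmodule ?U D" and ?QA = "quot_gmodule M A"
  interpret QU: gmodule R G ?QU by (rule U.gmodule_quot[OF Dsub])
  interpret QA: gmodule R G ?QA by (rule gmodule_quot[OF A])
  have zero: "carrier M +>\<^bsub>M\<^esub> x = carrier M" if "x \<in> carrier M" for x
    using coset_eq_iff[OF C that M.zero_closed] quot_zero_coset[OF C] that by simp
  have "short_exact R G ?QU ?QA ?Q"
  proof (rule short_exact_of_hom[OF A U gmodule_quot[OF C] quot_hom[OF C] _ _ D])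
    show "(\<lambda>x. carrier M +>\<^bsub>M\<^esub> x) ` carrier M = carrier ?Q" by (simp add: quot_carrier)
    show "carrier M +>\<^bsub>M\<^esub> x = \<zero>\<^bsub>?Q\<^esub> \<longleftrightarrow> (\<exists>u\<in>U. x \<ominus>\<^bsub>M\<^esub> u \<in> A)" if "x \<in> carrier M" for x
      using zero[OF that] sum[OF that] by (simp add: quot_zero)
  qed
  then obtain f g where f: "f \<in> gmodule_hom R G ?QU ?QA" and g: "g \<in> gmodule_hom R G ?QA ?Q"
    and inj: "inj_on f (carrier ?QU)" and im: "f ` carrier ?QU = a_kernel ?QA ?Q g"
    unfolding short_exact_def by (elim bexE conjE)
  have Q0: "carrier ?Q \<subseteq> {\<zero>\<^bsub>?Q\<^esub>}" unfolding quot_carrier quot_zero using zero by blast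
  have "a_kernel ?QA ?Q g = carrier ?QA"
    unfolding a_kernel_def' using QA.gmodule_homD(1)[OF g] Q0 by blast
  hence bij: "bij_betw f (carrier ?QU) (carrier ?QA)" using im inj by (simp add: bij_betw_def)
  let ?h = "inv_into (carrier ?QU) f"
  have hbij: "bij_betw ?h (carrier ?QA) (carrier ?QU)" by (rule bij_betw_inv_into[OF bij])
  have hc: "?h x \<in> carrier ?QU" if "x \<in> carrier ?QA" for x
    using bij_betwE[OF hbij] that by blast
  have fh: "f (?h x) = x" if "x \<in> carrier ?QA" for x
    using bij_betw_inv_into_right[OF bij that] .
  have hf: "?h (f x) = x" if "x \<in> carrier ?QU" for x
    using bij_betw_inv_into_left[OF bij that] .
  note F = QU.gmodule_homD[OF f]
  have "?h (x \<oplus>\<^bsub>?QA\<^esub> y) = ?h x \<oplus>\<^bsub>?QU\<^esub> ?h y" if x: "x \<in> carrier ?QA" and y: "y \<in> carrier ?QA" for x y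
    using F(2)[OF hc[OF x] hc[OF y]] hf[OF QU.M.a_closed[OF hc[OF x] hc[OF y]]]
    unfolding fh[OF x] fh[OF y] by simp
  moreover have "?h (c \<odot>\<^bsub>?QA\<^esub> x) = c \<odot>\<^bsub>?QU\<^esub> ?h x" if c: "c \<in> carrier R" and x: "x \<in> carrier ?QA" for c x
    using F(3)[OF c hc[OF x]] hf[OF QU.smult_closed[OF c hc[OF x]]] unfolding fh[OF x] by simp
  moreover have "?h (act ?QA k x) = act ?QU k (?h x)" if k: "k \<in> carrier G" and x: "x \<in> carrier ?QA" for k x
    using F(4)[OF k hc[OF x]] hf[OF QU.act_closed[OF k hc[OF x]]] unfolding fh[OF x] by simp
  ultimately have "?h \<in> gmodule_hom R G ?QA ?QU"
    unfolding gmodule_hom_def by (intro CollectI conjI ballI funcsetI hc) assumption+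
  with hbij show ?thesis unfolding gmodule_iso_def by (rule bexI)
qed

end

section \<open>Homogeneous polynomials in two variables over \<open>\<bbbF>\<^sub>p\<close>\<close>

abbreviation co :: "'p::prime_card mod_ring poly poly \<Rightarrow> nat \<Rightarrow> nat \<Rightarrow> 'p mod_ring" where
  "co F u t \<equiv> poly.coeff (poly.coeff F t) u"

definition mon :: "nat \<Rightarrow> nat \<Rightarrow> 'p::prime_card mod_ring poly poly" where
  "mon a b = varX ^ a * varY ^ b"

lemma const_add: "const (c + d) = const c + const d" by (simp add: const_def)
lemma const_mult: "const (c * d) = const c * const d" by (simp add: const_def)
lemma const_0 [simp]: "const 0 = 0" by (simp add: const_def)
lemma const_1 [simp]: "const 1 = 1" by (simp add: const_def one_pCons)
lemma const_minus: "const (- c) = - const c" by (simp add: const_def)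
lemma const_diff: "const (c - d) = const c - const d" by (simp add: const_def)
lemma const_power: "const (c ^ n) = const c ^ n" by (induction n) (simp_all add: const_mult)
lemma const_sum: "const (sum f A) = (\<Sum>x\<in>A. const (f x))"
  by (induction A rule: infinite_finite_induct) (simp_all add: const_add)
lemma const_of_nat: "const (of_nat n) = of_nat n"
  by (induction n) (simp_all add: const_add)

lemma co_const_mult [simp]: "co (const c * F) u t = c * co F u t"
  by (simp add: const_def)

lemma co_sum: "co (sum f A) u t = (\<Sum>x\<in>A. co (f x) u t)"
  by (simp add: coeff_sum)

lemma bipoly_eqI: "(\<And>u t. co F u t = co G u t) \<Longrightarrow> F = G"
  by (intro poly_eqI) blast

lemma varX_power: "varX ^ a = [:Polynomial.monom 1 a:]"
  by (induction a) (simp_all add: varX_def one_pCons monom_Suc mult.commute monom_0)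

lemma varY_power: "varY ^ b = Polynomial.monom 1 b"
  unfolding varY_def x_as_monom x_pow_n ..

lemma mon_eq: "mon a b = Polynomial.monom (Polynomial.monom 1 a) b"
  by (simp add: mon_def varX_power varY_power smult_monom)

lemma co_mon [simp]: "co (mon a b) u t = (if u = a \<and> t = b then 1 else 0)"
  by (auto simp: mon_eq)

lemma mon_mult: "mon a b * mon c d = mon (a + c) (b + d)"
  by (simp add: mon_def power_add algebra_simps)

lemma mon_0_0 [simp]: "mon 0 0 = 1" by (simp add: mon_def)

lemma co_mon_mult: "co (mon a b * F) u t = (if a \<le> u \<and> b \<le> t then co F (u - a) (t - b) else 0)"
  by (auto simp: mon_eq coeff_monom_mult)

lemma homogeneous_0 [simp]: "homogeneous r 0" by (simp add: homogeneous_def)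

lemma homogeneous_add: "homogeneous r F \<Longrightarrow> homogeneous r G \<Longrightarrow> homogeneous r (F + G)"
  unfolding homogeneous_def by (metis add.right_neutral coeff_add)

lemma homogeneous_const: "homogeneous r F \<Longrightarrow> homogeneous r (const c * F)"
  by (simp add: homogeneous_def)

lemma homogeneous_diff: "homogeneous r F \<Longrightarrow> homogeneous r G \<Longrightarrow> homogeneous r (F - G)"
  using homogeneous_add[of r F "const (-1) * G"] homogeneous_const[of r G "-1"]
  by (simp add: const_minus)

lemma homogeneous_sum: "(\<And>x. x \<in> A \<Longrightarrow> homogeneous r (f x)) \<Longrightarrow> homogeneous r (sum f A)"
  by (induction A rule: infinite_finite_induct) (simp_all add: homogeneous_add)

lemma homogeneous_mon: "a + b = r \<Longrightarrow> homogeneous r (mon a b)"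
  by (simp add: homogeneous_def)

lemma homogeneous_expand:
  assumes "homogeneous r F"
  shows "F = (\<Sum>t\<le>r. const (co F (r - t) t) * mon (r - t) t)"
proof (rule bipoly_eqI)
  fix u t
  have "co (\<Sum>t\<le>r. const (co F (r - t) t) * mon (r - t) t) u t =
      (\<Sum>s\<le>r. co F (r - s) s * (if u = r - s \<and> t = s then 1 else 0))"
    by (simp add: co_sum)
  also have "\<dots> = (\<Sum>s\<le>r. if s = t then (if u = r - t then co F u t else 0) else 0)"
    by (intro sum.cong) auto
  also have "\<dots> = (if t \<le> r \<and> u = r - t then co F u t else 0)" by (auto simp: sum.delta)
  also have "\<dots> = co F u t"
  proof -
    have "co F u t \<noteq> 0 \<Longrightarrow> u + t = r" using assms by (simp add: homogeneous_def)
    thus ?thesis by (cases "co F u t = 0") auto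
  qed
  finally show "co F u t = co (\<Sum>t\<le>r. const (co F (r - t) t) * mon (r - t) t) u t" ..
qed

lemma homogeneous_mult:
  assumes "homogeneous r F" "homogeneous s G"
  shows "homogeneous (r + s) (F * G)"
proof -
  have "F * G = (\<Sum>t\<le>r. \<Sum>v\<le>s. const (co F (r - t) t * co G (s - v) v) * mon (r - t + (s - v)) (t + v))"
    by (subst homogeneous_expand[OF assms(1)], subst homogeneous_expand[OF assms(2)])
      (simp only: sum_product const_mult mon_mult[symmetric] mult_ac)
  also have "homogeneous (r + s) \<dots>"
    by (intro homogeneous_sum homogeneous_const homogeneous_mon) auto
  finally show ?thesis .
qed

lemma homogeneous_power: "homogeneous r F \<Longrightarrow> homogeneous (r * n) (F ^ n)"
proof (induction n)
  case 0
  show ?case using homogeneous_mon[of 0 0 0] by simp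
next
  case (Suc n)
  show ?case using homogeneous_mult[OF Suc.prems Suc.IH[OF Suc.prems]] by simp
qed

definition lin :: "'p::prime_card mod_ring \<Rightarrow> 'p mod_ring \<Rightarrow> 'p mod_ring poly poly" where
  "lin a b = const a * varX + const b * varY"

lemma lin_1_0 [simp]: "lin 1 0 = varX" and lin_0_1 [simp]: "lin 0 1 = varY"
  by (simp_all add: lin_def)

lemma homogeneous_lin: "homogeneous 1 (lin a b)"
proof -
  have "homogeneous 1 (mon 1 0)" "homogeneous 1 (mon 0 1)" by (simp_all add: homogeneous_mon)
  thus ?thesis unfolding lin_def by (intro homogeneous_add homogeneous_const) (simp_all add: mon_def)
qed

subsection \<open>Substitution\<close>

definition sub1 :: "'p::prime_card mod_ring poly poly \<Rightarrow> 'p mod_ring poly \<Rightarrow> 'p mod_ring poly poly" where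
  "sub1 A c = poly (map_poly const c) A"

lemma comm_ring_hom_const: "comm_ring_hom const"
  by unfold_locales (simp_all add: const_add const_mult)

lemma comm_ring_hom_poly_map:
  assumes "comm_ring_hom (h :: 'a::comm_ring_1 \<Rightarrow> 'b::comm_ring_1)"
  shows "comm_ring_hom (\<lambda>c. poly (map_poly h c) A)"
proof -
  interpret h: comm_ring_hom h by fact
  interpret m: map_poly_comm_ring_hom h by unfold_locales
  show ?thesis by unfold_locales (simp_all add: m.hom_add m.hom_mult)
qed

lemma comm_ring_hom_sub1: "comm_ring_hom (sub1 A)"
  using comm_ring_hom_poly_map[OF comm_ring_hom_const, of A] by (simp add: sub1_def[abs_def])

lemma sub1_expand: "sub1 A c = (\<Sum>i\<le>Polynomial.degree c. const (poly.coeff c i) * A ^ i)"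
proof -
  interpret comm_ring_hom const by (rule comm_ring_hom_const)
  show ?thesis by (simp add: sub1_def poly_map_poly_eval_poly eval_poly_as_sum mult.commute)
qed

lemma subst_eq: "subst F A B = poly (map_poly (sub1 A) F) B"
proof -
  interpret comm_ring_hom "sub1 A" by (rule comm_ring_hom_sub1)
  have "poly (map_poly (sub1 A) F) B = (\<Sum>j\<le>Polynomial.degree F. sub1 A (poly.coeff F j) * B ^ j)"
    by (simp add: poly_map_poly_eval_poly eval_poly_as_sum mult.commute)
  also have "\<dots> = subst F A B"
    by (simp add: subst_def sub1_expand sum_distrib_right)
  finally show ?thesis ..
qed

lemma comm_ring_hom_subst: "comm_ring_hom (\<lambda>F. subst F A B)"
  using comm_ring_hom_poly_map[OF comm_ring_hom_sub1, of A B] by (simp add: subst_eq)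

lemma subst_add: "subst (F + G) A B = subst F A B + subst G A B"
  and subst_mult: "subst (F * G) A B = subst F A B * subst G A B"
  and subst_0 [simp]: "subst 0 A B = 0"
  and subst_1 [simp]: "subst 1 A B = 1"
proof -
  interpret comm_ring_hom "\<lambda>F. subst F A B" by (rule comm_ring_hom_subst)
  show "subst (F + G) A B = subst F A B + subst G A B"
    "subst (F * G) A B = subst F A B * subst G A B" "subst 0 A B = 0" "subst 1 A B = 1"
    by (simp_all add: hom_add hom_mult)
qed

lemma subst_power: "subst (F ^ n) A B = subst F A B ^ n"
  by (induction n) (simp_all add: subst_mult)

lemma subst_sum: "subst (sum f S) A B = (\<Sum>x\<in>S. subst (f x) A B)"
  by (induction S rule: infinite_finite_induct) (simp_all add: subst_add)

lemma subst_const [simp]: "subst (const c) A B = const c"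
  by (simp add: subst_def const_def)

lemma subst_varX [simp]: "subst varX A B = A"
  by (simp add: subst_def varX_def)

lemma subst_varY [simp]: "subst varY A B = B"
  by (simp add: subst_def varY_def)

lemma subst_diff: "subst (F - G) A B = subst F A B - subst G A B"
  by (metis subst_add add_diff_cancel diff_add_cancel)

lemma subst_mon: "subst (mon a b) A B = A ^ a * B ^ b"
  by (simp add: mon_def subst_mult subst_power)

lemma subst_varX_varY: "subst F varX varY = F"
proof (rule bipoly_eqI)
  fix u t
  have "co (subst F varX varY) u t = (\<Sum>j\<le>Polynomial.degree F. \<Sum>i\<le>Polynomial.degree (poly.coeff F j).
      co F i j * (if u = i \<and> t = j then 1 else 0))"
    unfolding subst_def mult.assoc mon_def[symmetric] by (simp add: co_sum)
  also have "\<dots> = (\<Sum>j\<le>Polynomial.degree F. if j = t then co F u t else 0)"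
  proof (intro sum.cong refl)
    fix j
    have "(\<Sum>i\<le>Polynomial.degree (poly.coeff F j). co F i j * (if u = i \<and> t = j then 1 else 0)) =
        (\<Sum>i\<le>Polynomial.degree (poly.coeff F j). if i = u then (if t = j then co F u j else 0) else 0)"
      by (intro sum.cong) auto
    also have "\<dots> = (if j = t then co F u t else 0)"
      by (auto simp: sum.delta coeff_eq_0)
    finally show "(\<Sum>i\<le>Polynomial.degree (poly.coeff F j). co F i j * (if u = i \<and> t = j then 1 else 0)) =
      (if j = t then co F u t else 0)" .
  qed
  also have "\<dots> = co F u t" by (auto simp: sum.delta coeff_eq_0)
  finally show "co (subst F varX varY) u t = co F u t" .
qed

lemma subst_subst: "subst (subst F A B) A' B' = subst F (subst A A' B') (subst B A' B')"
  by (simp add: subst_def[of F] subst_sum subst_mult subst_power)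

lemma subst_lin: "subst (lin a b) A B = const a * A + const b * B"
  by (simp add: lin_def subst_add subst_mult)

lemma homogeneous_subst:
  assumes "homogeneous r F"
  shows "homogeneous r (subst F (lin a c) (lin b d))"
proof -
  have "subst F (lin a c) (lin b d) =
      (\<Sum>t\<le>r. const (co F (r - t) t) * (lin a c ^ (r - t) * lin b d ^ t))"
    by (subst homogeneous_expand[OF assms]) (simp add: subst_sum subst_mult subst_mon)
  also have "homogeneous r \<dots>"
  proof (intro homogeneous_sum homogeneous_const)
    fix t assume "t \<in> {..r}"
    thus "homogeneous r (lin a c ^ (r - t) * lin b d ^ t)"
      using homogeneous_mult[OF homogeneous_power[OF homogeneous_lin, of "r - t" a c]
          homogeneous_power[OF homogeneous_lin, of t b d]] by simp
  qed
  finally show ?thesis .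
qed

subsection \<open>The modules \<open>V\<^sub>r\<close>\<close>

lemma V_simps [simp]:
  "carrier (V r) = {F. homogeneous r F}" "\<zero>\<^bsub>V r\<^esub> = 0" "F \<oplus>\<^bsub>V r\<^esub> G = F + G"
  "c \<odot>\<^bsub>V r\<^esub> F = const c * F"
  "act (V r) g F = subst F (lin (g $$ (0,0)) (g $$ (1,0))) (lin (g $$ (0,1)) (g $$ (1,1)))"
  by (simp_all add: V_def lin_def)

lemma Fp_simps [simp]:
  "carrier Fp = UNIV" "\<zero>\<^bsub>Fp\<^esub> = 0" "\<one>\<^bsub>Fp\<^esub> = 1" "c \<oplus>\<^bsub>Fp\<^esub> d = c + d" "c \<otimes>\<^bsub>Fp\<^esub> d = c * d"
  by (simp_all add: ring_of_type_algebra_def)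

lemma det_2:
  assumes "A \<in> carrier_mat 2 2"
  shows "det A = A $$ (0,0) * A $$ (1,1) - A $$ (0,1) * A $$ (1,0)"
proof -
  have "det A = (\<Sum>j<2. A $$ (0,j) * cofactor A 0 j)"
    using laplace_expansion_row[OF assms, of 0] by simp
  also have "\<dots> = A $$ (0,0) * cofactor A 0 0 + A $$ (0,1) * cofactor A 0 1"
    by (simp add: numeral_2_eq_2)
  finally have "det A = A $$ (0,0) * cofactor A 0 0 + A $$ (0,1) * cofactor A 0 1" .
  moreover have "cofactor A 0 0 = A $$ (1,1)" "cofactor A 0 1 = - A $$ (1,0)"
    using assms by (simp_all add: cofactor_def det_single mat_delete_def)
  ultimately show ?thesis by simp
qed

lemma carrier_GL2: "g \<in> carrier GL2 \<longleftrightarrow> g \<in> carrier_mat 2 2 \<and> det g \<noteq> 0"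
  using unit_imp_det_non_zero[of g 2 "()"] det_non_zero_imp_unit[of g 2 "()"]
  by (auto simp: units_of_def Units_def ring_mat_def)

lemma GL2_group: "Group.group (GL2 :: 'p::prime_card mod_ring mat monoid)"
proof -
  interpret ring "ring_mat TYPE('p mod_ring) 2 ()" by (rule ring_mat)
  show ?thesis by (rule units_group)
qed

lemma GL2_mult: "g \<otimes>\<^bsub>GL2\<^esub> h = g * h" and GL2_one: "\<one>\<^bsub>GL2\<^esub> = 1\<^sub>m 2"
  by (simp_all add: units_of_def ring_mat_def)

lemma mult_2_index:
  assumes "g \<in> carrier_mat 2 2" "h \<in> carrier_mat 2 2" "i < 2" "j < 2"
  shows "(g * h) $$ (i,j) = g $$ (i,0) * h $$ (0,j) + g $$ (i,1) * h $$ (1,j)"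
  using assms by (simp add: scalar_prod_def numeral_2_eq_2)

definition mk2 :: "'a \<Rightarrow> 'a \<Rightarrow> 'a \<Rightarrow> 'a \<Rightarrow> 'a mat" where
  "mk2 a b c d = mat 2 2 (\<lambda>(i,j). if i = 0 then (if j = 0 then a else b) else (if j = 0 then c else d))"

lemma mk2_simps [simp]:
  "mk2 a b c d $$ (0,0) = a" "mk2 a b c d $$ (0,1) = b"
  "mk2 a b c d $$ (1,0) = c" "mk2 a b c d $$ (1,1) = d"
  "mk2 a b c d $$ (0,Suc 0) = b" "mk2 a b c d $$ (Suc 0,0) = c" "mk2 a b c d $$ (Suc 0,Suc 0) = d"
  "mk2 a b c d \<in> carrier_mat 2 2"
  by (simp_all add: mk2_def)

lemma mk2_GL2: "mk2 a b c d \<in> carrier GL2 \<longleftrightarrow> a * d - b * c \<noteq> (0 :: 'p::prime_card mod_ring)"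
  by (simp add: carrier_GL2 det_2)

lemma gmodule_V: "gmodule Fp GL2 (V r :: ('p::prime_card, 'p mod_ring poly poly) Gamma_module)"
proof (intro gmodule.intro gmodule_axioms.intro GL2_group moduleI)
  show "cring (Fp :: 'p mod_ring ring)" by (rule cring_from_type_algebra)
  show "abelian_group (V r :: ('p, 'p mod_ring poly poly) Gamma_module)"
  proof (rule abelian_groupI)
    fix F :: "'p mod_ring poly poly" assume "F \<in> carrier (V r)"
    thus "\<exists>G\<in>carrier (V r). G \<oplus>\<^bsub>V r\<^esub> F = \<zero>\<^bsub>V r\<^esub>"
      using homogeneous_const[of r F "-1"] by (intro bexI[of _ "const (-1) * F"]) (simp_all add: const_minus)
  qed (auto simp: homogeneous_add add_ac)
next
  fix g h :: "'p mod_ring mat" and F assume *: "g \<in> carrier GL2" "h \<in> carrier GL2"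
    "F \<in> carrier (V r :: ('p, 'p mod_ring poly poly) Gamma_module)"
  hence c: "g \<in> carrier_mat 2 2" "h \<in> carrier_mat 2 2" by (simp_all add: carrier_GL2)
  show "act (V r) (g \<otimes>\<^bsub>GL2\<^esub> h) F = act (V r) g (act (V r) h F)"
    by (simp add: GL2_mult subst_subst subst_lin mult_2_index[OF c])
      (simp add: lin_def const_add const_mult algebra_simps)
qed (auto simp: homogeneous_const homogeneous_add homogeneous_subst const_add const_mult
    subst_add subst_mult distrib_left distrib_right mult.assoc GL2_one subst_varX_varY)

text \<open>The form in which submodules of \<open>V\<^sub>r\<close> are used below: matrices enter only through their entries.\<close>

lemma gsubmodule_V_iff:
  fixes N :: "'p::prime_card mod_ring poly poly set"
  shows "gsubmodule Fp GL2 (V r) N \<longleftrightarrow> (\<forall>F\<in>N. homogeneous r F) \<and> 0 \<in> N \<and>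
     (\<forall>F\<in>N. \<forall>H\<in>N. F + H \<in> N) \<and> (\<forall>c. \<forall>F\<in>N. const c * F \<in> N) \<and>
     (\<forall>a b c d. \<forall>F\<in>N. a * d - b * c \<noteq> 0 \<longrightarrow> subst F (lin a c) (lin b d) \<in> N)"
  (is "?L \<longleftrightarrow> ?R")
proof
  interpret gmodule Fp GL2 "V r" by (rule gmodule_V)
  {
    assume L: ?L
    note D = gsubmoduleD[OF L]
    have "subst F (lin a c) (lin b d) \<in> N" if "F \<in> N" "a * d - b * c \<noteq> 0" for a b c d F
      using D(7)[of "mk2 a b c d" F] that by (simp add: mk2_GL2)
    thus ?R using D(1-3,6) by auto
  next
    assume R: ?R
    show ?L
    proof (rule gsubmoduleI)
      fix g :: "'p mod_ring mat" and F assume g: "g \<in> carrier GL2" and F: "F \<in> N"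
      have "g $$ (0,0) * g $$ (1,1) - g $$ (0,1) * g $$ (1,0) \<noteq> 0"
        using g by (auto simp: carrier_GL2 det_2)
      thus "act (V r) g F \<in> N" using R F by simp
    qed (use R in auto)
  }
qed

section \<open>The field \<open>\<bbbF>\<^sub>p\<close>\<close>

locale prime_field =
  fixes p :: nat and tp :: "'p::prime_card itself"
  assumes p: "p = CARD('p)" and p3: "p \<ge> 3"
begin

lemma prime_p: "prime p" using prime_card[where 'a = 'p] p by simp

lemma CHAR_p: "CHAR('p mod_ring) = p" by (simp add: p)

lemma CARD_p: "card (UNIV :: 'p mod_ring set) = p" by (simp add: p)

lemma of_nat_eq_0: "of_nat n = (0 :: 'p mod_ring) \<longleftrightarrow> p dvd n"
  using of_nat_eq_0_iff_char_dvd[of n, where 'a = "'p mod_ring"] by (simp add: p)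

lemma of_nat_eq: "of_nat m = (of_nat n :: 'p mod_ring) \<longleftrightarrow> [m = n] (mod p)"
proof (induction m n rule: linorder_wlog)
  case (le m n)
  have "of_nat m = (of_nat n :: 'p mod_ring) \<longleftrightarrow> of_nat (n - m) = (0 :: 'p mod_ring)"
    using le by (auto simp: of_nat_diff)
  also have "\<dots> \<longleftrightarrow> [n = m] (mod p)" unfolding of_nat_eq_0 using le by (simp add: cong_altdef_nat)
  finally show ?case by (simp add: cong_sym_eq)
next
  case (sym m n)
  thus ?case by (auto simp: cong_sym_eq)
qed

lemma of_nat_p: "of_nat p = (0 :: 'p mod_ring)"
  by (simp add: of_nat_eq_0)

lemma of_nat_p_minus_1: "of_nat (p - 1) = (- 1 :: 'p mod_ring)"
  using p3 of_nat_p by (simp add: of_nat_diff)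

lemma obtain_of_nat:
  obtains n where "n < p" "x = (of_nat n :: 'p mod_ring)"
  using surj_of_nat_mod_ring[of x] p by blast

lemma fact_nonzero: "n < p \<Longrightarrow> of_nat (fact n) \<noteq> (0 :: 'p mod_ring)"
  using prime_p by (simp add: of_nat_eq_0 prime_dvd_fact_iff)

lemma choose_nonzero:
  assumes "k \<le> n" "n < p" shows "of_nat (n choose k) \<noteq> (0 :: 'p mod_ring)"
proof
  assume "of_nat (n choose k) = (0 :: 'p mod_ring)"
  hence "p dvd (n choose k)" by (simp add: of_nat_eq_0)
  also have "(n choose k) dvd fact n"
    using binomial_fact_lemma[OF assms(1)] by (metis dvd_triv_right)
  finally have "of_nat (fact n) = (0 :: 'p mod_ring)" by (simp add: of_nat_eq_0)
  with fact_nonzero[OF assms(2)] show False by simp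
qed

lemma power_p: "x ^ p = (x :: 'p mod_ring)"
  using finite_field_power_card_eq_same[of x] by (simp only: CARD_p)

lemma power_p_minus_1: "x \<noteq> 0 \<Longrightarrow> x ^ (p - 1) = (1 :: 'p mod_ring)"
proof -
  assume x: "x \<noteq> 0"
  have "x * x ^ (p - 1) = x * 1" using p3 power_p[of x] by (simp add: power_eq_if)
  thus ?thesis using x by simp
qed

lemma power_cong:
  assumes "x \<noteq> (0 :: 'p mod_ring)" "[m = n] (mod (p - 1))"
  shows "x ^ m = x ^ n"
proof -
  have "x ^ k = x ^ (k mod (p - 1))" for k
  proof -
    have "x ^ k = x ^ ((p - 1) * (k div (p - 1)) + k mod (p - 1))" by simp
    also have "\<dots> = x ^ (k mod (p - 1))"
      by (simp only: power_add power_mult power_p_minus_1[OF assms(1)] power_one mult_1_left)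
    finally show ?thesis .
  qed
  thus ?thesis using assms(2) by (metis cong_def)
qed

lemma power_cong_pos:
  assumes "[m = n] (mod (p - 1))" "m > 0" "n > 0"
  shows "(x :: 'p mod_ring) ^ m = x ^ n"
  using power_cong[OF _ assms(1), of x] assms(2,3) by (cases "x = 0") (auto simp: power_0_left)

lemma exists_power_neq_1:
  assumes "\<not> (p - 1) dvd n"
  shows "\<exists>x :: 'p mod_ring. x \<noteq> 0 \<and> x ^ n \<noteq> 1"
proof (rule ccontr)
  assume "\<not> ?thesis"
  hence all: "x ^ n = 1" if "x \<noteq> 0" for x :: "'p mod_ring" using that by blast
  define m where "m = n mod (p - 1)"
  have m: "0 < m" "m < p - 1" using assms p3 by (auto simp: m_def dvd_eq_mod_eq_0)
  define f where "f = Polynomial.monom (1 :: 'p mod_ring) m - 1"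
  have "poly.coeff f m = 1" using m by (simp add: f_def)
  hence f0: "f \<noteq> 0" by auto
  have "Polynomial.degree f \<le> m" unfolding f_def
    by (intro degree_diff_le) (simp_all add: degree_monom_le)
  moreover have "UNIV - {0} \<subseteq> {x. poly f x = 0}"
  proof
    fix x :: "'p mod_ring" assume "x \<in> UNIV - {0}"
    hence "x ^ m = 1" using all[of x] power_cong[of x m n] by (simp add: m_def)
    thus "x \<in> {x. poly f x = 0}" by (simp add: f_def poly_monom)
  qed
  hence "card (UNIV - {0 :: 'p mod_ring}) \<le> card {x. poly f x = 0}"
    by (intro card_mono poly_roots_finite f0)
  moreover have "card (UNIV - {0 :: 'p mod_ring}) = p - 1" by (simp add: card_Diff_singleton p)
  ultimately show False using card_poly_roots_bound[OF f0] m by linarith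
qed

lemma sum_power_nonzero:
  "(\<Sum>x\<in>UNIV - {0 :: 'p mod_ring}. x ^ n) = (if (p - 1) dvd n then - 1 else 0)"
proof (cases "(p - 1) dvd n")
  case True
  hence "(\<Sum>x\<in>UNIV - {0 :: 'p mod_ring}. x ^ n) = (\<Sum>x\<in>UNIV - {0 :: 'p mod_ring}. 1)"
    by (intro sum.cong refl) (auto simp: power_mult power_p_minus_1[simplified] elim!: dvdE)
  also have "\<dots> = of_nat (p - 1)" by (simp add: card_Diff_singleton p)
  finally show ?thesis using True of_nat_p_minus_1 by simp
next
  case False
  then obtain y :: "'p mod_ring" where y: "y \<noteq> 0" "y ^ n \<noteq> 1" using exists_power_neq_1 by blast
  let ?S = "\<Sum>x\<in>UNIV - {0 :: 'p mod_ring}. x ^ n"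
  have "?S = (\<Sum>x\<in>UNIV - {0 :: 'p mod_ring}. (y * x) ^ n)"
    by (rule sum.reindex_bij_witness[of _ "\<lambda>x. y * x" "\<lambda>x. inverse y * x"])
      (use y in \<open>auto simp flip: mult.assoc\<close>)
  also have "\<dots> = y ^ n * ?S" by (simp add: power_mult_distrib sum_distrib_left)
  finally have "(y ^ n - 1) * ?S = 0" by (simp add: algebra_simps)
  thus ?thesis using y False by simp
qed

lemma sum_power:
  "(\<Sum>x\<in>(UNIV :: 'p mod_ring set). x ^ n) = (if n > 0 \<and> (p - 1) dvd n then - 1 else 0)"
proof (cases "n = 0")
  case True
  thus ?thesis using of_nat_p by (simp add: p)
next
  case False
  have "(\<Sum>x\<in>(UNIV :: 'p mod_ring set). x ^ n) = 0 ^ n + (\<Sum>x\<in>UNIV - {0}. x ^ n)"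
    by (rule sum.remove) auto
  thus ?thesis using False sum_power_nonzero by (simp add: power_0_left)
qed

text \<open>Extraction of a weight: \<open>x\<^sup>-\<^sup>e\<close> is \<open>x\<close> to the power \<open>e (p - 2)\<close>.\<close>

lemma weight_dvd_iff: "(p - 1) dvd (t + e * (p - 2)) \<longleftrightarrow> [t = e] (mod (p - 1))"
proof -
  obtain q where q: "p = q + 2" using p3 by (metis add.commute le_Suc_ex numeral_3_eq_3 numeral_2_eq_2 Suc_leD)
  have "[t + e * (p - 2) + e = t + e * (p - 1)] (mod (p - 1))"
    unfolding q by (simp add: add_ac)
  hence "[t + e * (p - 2) + e = t] (mod (p - 1))"
    by (simp add: cong_def)
  hence "[t = e] (mod (p - 1)) \<longleftrightarrow> [t + e * (p - 2) + e = 0 + e] (mod (p - 1))"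
    by (metis add_0 cong_sym cong_trans)
  also have "\<dots> \<longleftrightarrow> [t + e * (p - 2) = 0] (mod (p - 1))" by (rule cong_add_rcancel_nat)
  finally show ?thesis by (simp add: cong_0_iff)
qed

section \<open>The polynomial \<open>\<theta>\<close> and the filtration\<close>

lemma theta_eq: "(theta :: 'p mod_ring poly poly) = mon p 1 - mon 1 p"
  by (simp add: theta_def mon_def p)

lemma theta_nonzero: "(theta :: 'p mod_ring poly poly) \<noteq> 0"
proof
  assume "(theta :: 'p mod_ring poly poly) = 0"
  hence "co (theta :: 'p mod_ring poly poly) p 1 = 0" by simp
  thus False using p3 by (simp add: theta_eq)
qed

lemma homogeneous_theta: "homogeneous (p + 1) (theta :: 'p mod_ring poly poly)"
  unfolding theta_eq by (intro homogeneous_diff homogeneous_mon) auto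

lemma homogeneous_theta_power: "homogeneous (m * (p + 1)) (theta ^ m :: 'p mod_ring poly poly)"
  using homogeneous_power[OF homogeneous_theta, of m] by (simp add: mult.commute)

lemma lin_power_p: "lin a c ^ p = const (a :: 'p mod_ring) * varX ^ p + const c * varY ^ p"
proof -
  have "prime CHAR('p mod_ring poly poly)" "p = CHAR('p mod_ring poly poly)"
    using prime_p CHAR_p by simp_all
  hence "(x + y) ^ p = x ^ p + y ^ p" for x y :: "'p mod_ring poly poly"
    by (rule freshmans_dream)
  moreover have "const a ^ p = const a" for a :: "'p mod_ring"
    using power_p by (simp flip: const_power)
  ultimately show ?thesis by (simp add: lin_def power_mult_distrib)
qed

lemma subst_theta:
  "subst (theta :: 'p mod_ring poly poly) (lin a c) (lin b d) = const (a * d - b * c) * theta"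
  by (simp add: theta_eq subst_diff subst_mon lin_power_p)
    (simp add: lin_def mon_def const_diff const_mult algebra_simps)

lemma subst_theta_power:
  "subst (theta ^ m * G :: 'p mod_ring poly poly) (lin a c) (lin b d) =
    const ((a * d - b * c) ^ m) * (theta ^ m * subst G (lin a c) (lin b d))"
  by (simp add: subst_mult subst_power subst_theta power_mult_distrib const_power mult_ac)

lemma mon_power: "mon a b ^ n = mon (a * n) (b * n)"
  by (simp add: mon_def power_mult_distrib power_mult)

lemma theta_power_mon:
  "(theta ^ D * mon a b :: 'p mod_ring poly poly) =
    (\<Sum>l\<le>D. const ((- 1) ^ l * of_nat (D choose l)) *
      mon (a + p * (D - l) + l) (b + (D - l) + p * l))"
proof -
  have "(theta ^ D :: 'p mod_ring poly poly) = (- mon 1 p + mon p 1) ^ D" by (simp add: theta_eq)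
  also have "\<dots> = (\<Sum>l\<le>D. of_nat (D choose l) * (- mon 1 p) ^ l * mon p 1 ^ (D - l))"
    by (rule binomial_ring)
  also have "\<dots> = (\<Sum>l\<le>D. const ((- 1) ^ l * of_nat (D choose l)) * mon (p * (D - l) + l) ((D - l) + p * l))"
  proof (intro sum.cong refl)
    fix l
    have 1: "(- mon 1 p) ^ l = const ((- 1) ^ l :: 'p mod_ring) * mon (1 * l) (p * l)"
      by (simp only: power_minus[of "mon 1 p"] const_power const_minus const_1 mon_power)
    have "of_nat (D choose l) * (- mon 1 p) ^ l * (mon p 1 :: 'p mod_ring poly poly) ^ (D - l) =
        const ((- 1) ^ l * of_nat (D choose l)) * (mon (p * (D - l)) (1 * (D - l)) * mon (1 * l) (p * l))"
      unfolding 1 mon_power by (simp only: const_of_nat[symmetric] const_mult mult_ac)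
    thus "of_nat (D choose l) * (- mon 1 p) ^ l * (mon p 1 :: 'p mod_ring poly poly) ^ (D - l) =
        const ((- 1) ^ l * of_nat (D choose l)) * mon (p * (D - l) + l) ((D - l) + p * l)"
      by (simp add: mon_mult)
  qed
  finally show ?thesis
    by (simp add: sum_distrib_right mult.assoc mon_mult add_ac)
qed

definition homogeneous_part :: "nat \<Rightarrow> 'p mod_ring poly poly \<Rightarrow> 'p mod_ring poly poly" where
  "homogeneous_part r F = (\<Sum>t\<le>r. const (co F (r - t) t) * mon (r - t) t)"

lemma co_homogeneous_part: "co (homogeneous_part r F) u t = (if u + t = r then co F u t else 0)"
proof -
  have "co (homogeneous_part r F) u t = (\<Sum>s\<le>r. co F (r - s) s * (if u = r - s \<and> t = s then 1 else 0))"
    by (simp add: homogeneous_part_def co_sum)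
  also have "\<dots> = (\<Sum>s\<le>r. if s = t then (if u = r - t then co F u t else 0) else 0)"
    by (intro sum.cong) auto
  also have "\<dots> = (if u + t = r then co F u t else 0)" by (auto simp: sum.delta)
  finally show ?thesis .
qed

lemma homogeneous_homogeneous_part: "homogeneous r (homogeneous_part r F)"
  by (simp add: homogeneous_def co_homogeneous_part)

lemma homogeneous_part_id: "homogeneous r F \<Longrightarrow> homogeneous_part r F = F"
  unfolding homogeneous_part_def by (rule homogeneous_expand[symmetric])

lemma homogeneous_part_mult:
  assumes H: "homogeneous h H" and "h \<le> r"
  shows "homogeneous_part r (H * G) = H * homogeneous_part (r - h) G"
proof (rule bipoly_eqI)
  fix u t
  have E: "co (H * K) u t = (\<Sum>s\<le>h. co H (h - s) s * (if h - s \<le> u \<and> s \<le> t then co K (u - (h - s)) (t - s) else 0))" for K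
    by (subst homogeneous_expand[OF H]) (simp add: sum_distrib_right mult.assoc co_sum co_mon_mult)
  show "co (homogeneous_part r (H * G)) u t = co (H * homogeneous_part (r - h) G) u t"
  proof (cases "u + t = r")
    case True
    thus ?thesis unfolding co_homogeneous_part E using assms(2)
      by (auto intro!: sum.cong simp: co_homogeneous_part)
  next
    case False
    have "(\<Sum>s\<le>h. co H (h - s) s * (if h - s \<le> u \<and> s \<le> t
        then co (homogeneous_part (r - h) G) (u - (h - s)) (t - s) else 0)) = 0"
      using False assms(2) by (intro sum.neutral) (auto simp: co_homogeneous_part)
    thus ?thesis using False by (simp add: co_homogeneous_part E)
  qed
qed

text \<open>Any cofactor may be replaced by its homogeneous part of the right degree.\<close>

lemma theta_power_dvdE:
  assumes "homogeneous r (F :: 'p mod_ring poly poly)" "theta ^ m dvd F" "m * (p + 1) \<le> r"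
  obtains G where "homogeneous (r - m * (p + 1)) G" "F = theta ^ m * G"
proof -
  from assms(2) obtain G where G: "F = theta ^ m * G" by (elim dvdE)
  have "F = homogeneous_part r F" using homogeneous_part_id[OF assms(1)] by simp
  also have "\<dots> = theta ^ m * homogeneous_part (r - m * (p + 1)) G"
    unfolding G by (rule homogeneous_part_mult[OF homogeneous_theta_power assms(3)])
  finally show ?thesis using that homogeneous_homogeneous_part by blast
qed

lemma Vfil_iff: "(F :: 'p mod_ring poly poly) \<in> Vfil r m \<longleftrightarrow> homogeneous r F \<and> theta ^ m dvd F"
  by (simp add: Vfil_def)

lemma Vfil_mult:
  "homogeneous s (G :: 'p mod_ring poly poly) \<Longrightarrow> s + m * (p + 1) = r \<Longrightarrow> theta ^ m * G \<in> Vfil r m"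
  using homogeneous_mult[OF homogeneous_theta_power, of s G m] by (simp add: Vfil_iff add.commute)

lemma Vfil_mono: "m \<le> n \<Longrightarrow> Vfil r n \<subseteq> (Vfil r m :: 'p mod_ring poly poly set)"
  using le_imp_power_dvd[of m n "theta :: 'p mod_ring poly poly"] by (auto simp: Vfil_iff intro: dvd_trans)

lemma gsubmodule_Vfil: "gsubmodule Fp GL2 (V r) (Vfil r m :: 'p mod_ring poly poly set)"
  unfolding gsubmodule_V_iff
proof (intro conjI ballI allI impI)
  fix a b c d and F :: "'p mod_ring poly poly" assume F: "F \<in> Vfil r m"
  hence "theta ^ m dvd F" by (simp add: Vfil_iff)
  then obtain G where G: "F = theta ^ m * G" by (rule dvdE)
  have "homogeneous r (subst F (lin a c) (lin b d))" using F by (simp add: Vfil_iff homogeneous_subst)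
  thus "subst F (lin a c) (lin b d) \<in> Vfil r m"
    unfolding Vfil_iff G subst_theta_power by simp
qed (auto simp: Vfil_iff homogeneous_add homogeneous_const)

section \<open>Submodules of \<open>V\<^sub>r\<close>\<close>

definition subm :: "nat \<Rightarrow> 'p mod_ring poly poly set \<Rightarrow> bool" where
  "subm r N \<longleftrightarrow> gsubmodule Fp GL2 (V r) N"

lemma submD:
  assumes "subm r N"
  shows "F \<in> N \<Longrightarrow> homogeneous r F" "0 \<in> N" "F \<in> N \<Longrightarrow> H \<in> N \<Longrightarrow> F + H \<in> N"
    "F \<in> N \<Longrightarrow> const c * F \<in> N"
    "F \<in> N \<Longrightarrow> a * d - b * c' \<noteq> 0 \<Longrightarrow> subst F (lin a c') (lin b d) \<in> N"
  using assms unfolding subm_def gsubmodule_V_iff by blast+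

lemma subm_diff: "subm r N \<Longrightarrow> F \<in> N \<Longrightarrow> H \<in> N \<Longrightarrow> F - H \<in> N"
  using submD(3)[of r N F "const (-1) * H"] submD(4)[of r N H "-1"] by (simp add: const_minus)

lemma subm_sum: "subm r N \<Longrightarrow> (\<And>x. x \<in> S \<Longrightarrow> f x \<in> N) \<Longrightarrow> sum f S \<in> N"
  by (induction S rule: infinite_finite_induct) (simp_all add: submD)

lemma subm_const_cancel: "subm r N \<Longrightarrow> const c * F \<in> N \<Longrightarrow> c \<noteq> 0 \<Longrightarrow> F \<in> N"
  using submD(4)[of r N "const c * F" "inverse c"]
  by (simp add: mult.assoc[symmetric] const_mult[symmetric])

lemma subm_Vfil: "subm r (Vfil r m)" by (simp add: subm_def gsubmodule_Vfil)

text \<open>The matrices \<open>diag(1, c)\<close> multiply \<open>X\<^bsup>r-t\<^esup> Y\<^sup>t\<close> by \<open>c\<^sup>t\<close>. A weighted sum over \<open>c \<noteq> 0\<close> therefore isolates the exponents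
  \<open>t\<close> of one class modulo \<open>p - 1\<close>.\<close>

lemma subm_weight:
  assumes N: "subm r N" and F: "(\<Sum>t\<le>r. const (f t) * mon (r - t) t) \<in> N"
  shows "(\<Sum>t\<le>r. if [t = e] (mod (p - 1)) then const (f t) * mon (r - t) t else 0) \<in> N"
proof -
  let ?F = "\<Sum>t\<le>r. const (f t) * mon (r - t) t"
  let ?U = "UNIV - {0 :: 'p mod_ring}"
  have "(\<Sum>c\<in>?U. const (- (c ^ (e * (p - 2)))) * subst ?F (lin 1 0) (lin 0 c)) \<in> N"
    by (intro subm_sum[OF N] submD(4)[OF N] submD(5)[OF N F]) auto
  also have "(\<Sum>c\<in>?U. const (- (c ^ (e * (p - 2)))) * subst ?F (lin 1 0) (lin 0 c)) =
    (\<Sum>c\<in>?U. \<Sum>t\<le>r. const (- (c ^ (t + e * (p - 2)))) * (const (f t) * mon (r - t) t))"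
    by (simp add: subst_sum subst_mult subst_mon sum_distrib_left)
      (simp add: lin_def mon_def power_mult_distrib power_add const_mult const_minus mult_ac flip: const_power)
  also have "\<dots> = (\<Sum>t\<le>r. const (- (\<Sum>c\<in>?U. c ^ (t + e * (p - 2)))) * (const (f t) * mon (r - t) t))"
    by (subst sum.swap) (simp add: const_sum sum_distrib_right sum_negf const_minus)
  also have "\<dots> = (\<Sum>t\<le>r. if [t = e] (mod (p - 1)) then const (f t) * mon (r - t) t else 0)"
    by (intro sum.cong refl) (simp add: sum_power_nonzero weight_dvd_iff del: One_nat_def)
  finally show ?thesis .
qed

definition functional :: "('p mod_ring poly poly \<Rightarrow> 'p mod_ring) \<Rightarrow> bool" where
  "functional f \<longleftrightarrow> (\<forall>F G. f (F + G) = f F + f G) \<and> (\<forall>c F. f (const c * F) = c * f F)"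

lemma functional_sum: "functional f \<Longrightarrow> f (\<Sum>x\<in>S. g x) = (\<Sum>x\<in>S. f (g x))"
proof -
  assume f: "functional f"
  hence "f (const 0 * 0) = 0 * f 0" unfolding functional_def by blast
  hence "f 0 = 0" by simp
  thus ?thesis using f by (induction S rule: infinite_finite_induct) (simp_all add: functional_def)
qed

lemma functional_const: "functional f \<Longrightarrow> f (const c * F) = c * f F"
  by (simp add: functional_def)

definition kills :: "('p mod_ring poly poly \<Rightarrow> 'p mod_ring) \<Rightarrow> 'p mod_ring poly poly set \<Rightarrow> bool" where
  "kills f N \<longleftrightarrow> (\<forall>H\<in>N. f H = 0)"

lemma killsD: "kills f N \<Longrightarrow> F \<in> N \<Longrightarrow> f F = 0"
  by (simp add: kills_def)

text \<open>A subspace is the intersection of the kernels of the linear forms that vanish on it. Membership becomes a computation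
  with an unknown form.\<close>

lemma mem_subm_if_functional:
  assumes N: "subm r N" and "\<And>f. functional f \<Longrightarrow> kills f N \<Longrightarrow> f F = 0"
  shows "F \<in> N"
proof (rule ccontr)
  assume F: "F \<notin> N"
  interpret vs: vector_space "\<lambda>c (F :: 'p mod_ring poly poly). const c * F"
    by unfold_locales (simp_all add: const_add const_mult algebra_simps)
  interpret vf: vector_space "\<lambda>c (d :: 'p mod_ring). c * d"
    by unfold_locales (simp_all add: algebra_simps)
  interpret pair: vector_space_pair "\<lambda>c (F :: 'p mod_ring poly poly). const c * F" "\<lambda>c (d :: 'p mod_ring). c * d" ..
  obtain B where B: "B \<subseteq> N" "vs.independent B" "N \<subseteq> vs.span B"
    using vs.maximal_independent_subset by blast
  have "vs.subspace N" unfolding vs.subspace_def using submD[OF N] by blast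
  hence spanN: "vs.span B \<subseteq> N" using vs.span_minimal[OF B(1)] by blast
  hence "F \<notin> vs.span B" using F by blast
  hence ind: "vs.independent (insert F B)" by (rule vs.independent_insertI[OF _ B(2)])
  obtain g where g: "Vector_Spaces.linear (\<lambda>c F. const c * F) (\<lambda>c d. c * d) g"
    "\<forall>x\<in>insert F B. g x = (if x = F then 1 else 0)"
    using pair.linear_independent_extend[OF ind, of "\<lambda>x. if x = F then 1 else 0"] by blast
  interpret g: Vector_Spaces.linear "\<lambda>c (F :: 'p mod_ring poly poly). const c * F" "\<lambda>c (d :: 'p mod_ring). c * d" g
    by (rule g(1))
  have "functional g" unfolding functional_def using g.add g.scale by blast
  moreover have "g H = 0" if "H \<in> N" for H
  proof -
    have "H \<in> vs.span B" using that B(3) by blast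
    moreover have "g x = 0" if "x \<in> B" for x using g(2) that F B(1) by auto
    ultimately show ?thesis using g.eq_0_on_span by blast
  qed
  ultimately have "g F = 0" by (intro assms(2)) (simp_all add: kills_def)
  thus False using g(2) by simp
qed

section \<open>The submodules generated by monomials\<close>

lemma subm_Xsub:
  assumes "l \<le> r" shows "subm r (Xsub r l)"
proof -
  interpret gmodule Fp GL2 "V r :: ('p, 'p mod_ring poly poly) Gamma_module" by (rule gmodule_V)
  have ex: "\<exists>N. gsubmodule Fp GL2 (V r) N \<and> {mon (r - l) l :: 'p mod_ring poly poly} \<subseteq> N"
    using gsubmodule_carrier assms by (intro exI[of _ "carrier (V r)"]) (auto simp: homogeneous_mon)
  let ?S = "{N. gsubmodule Fp GL2 (V r) N \<and> {mon (r - l) l :: 'p mod_ring poly poly} \<subseteq> N}"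
  have X: "Xsub r l = \<Inter>?S" by (simp add: Xsub_def gspan_def mon_def)
  have el: "F \<in> \<Inter>?S \<Longrightarrow> N \<in> ?S \<Longrightarrow> F \<in> N" for F N by blast
  have "homogeneous r F" if "F \<in> \<Inter>?S" for F
    using ex el[OF that] unfolding gsubmodule_V_iff by blast
  thus ?thesis unfolding subm_def X unfolding gsubmodule_V_iff by blast
qed

lemma mon_in_Xsub: "mon (r - l) l \<in> (Xsub r l :: 'p mod_ring poly poly set)"
  by (auto simp: Xsub_def gspan_def mon_def)

lemma Xsub_least: "subm r N \<Longrightarrow> mon (r - l) l \<in> N \<Longrightarrow> Xsub r l \<subseteq> N"
  unfolding subm_def by (auto simp: Xsub_def gspan_def mon_def)

definition XV :: "nat \<Rightarrow> nat \<Rightarrow> nat \<Rightarrow> 'p mod_ring poly poly set" where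
  "XV r l m = {F + G | F G. F \<in> Xsub r l \<and> G \<in> Vfil r m}"

lemma XV_eq: "Xsub r l <+>\<^bsub>V r\<^esub> Vfil r m = XV r l m"
  by (auto simp: XV_def set_add_def')

lemma Xsub_XV: "Xsub r l \<subseteq> XV r l m"
  unfolding XV_def using submD(2)[OF subm_Vfil[of r m]] by force

lemma Vfil_XV: "l \<le> r \<Longrightarrow> Vfil r m \<subseteq> XV r l m"
  unfolding XV_def using submD(2)[OF subm_Xsub, of l r] by force

lemma XV_least: "subm r N \<Longrightarrow> Xsub r l \<subseteq> N \<Longrightarrow> Vfil r m \<subseteq> N \<Longrightarrow> XV r l m \<subseteq> N"
  unfolding XV_def using submD(3) by blast

lemma subm_XV:
  assumes "l \<le> r" shows "subm r (XV r l m)"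
proof -
  note D1 = submD[OF subm_Xsub[OF assms]] and D2 = submD[OF subm_Vfil[of r m]]
  show ?thesis unfolding subm_def gsubmodule_V_iff
  proof (intro conjI ballI allI impI)
    fix F :: "'p mod_ring poly poly" assume "F \<in> XV r l m"
    then obtain A B where AB: "F = A + B" "A \<in> Xsub r l" "B \<in> Vfil r m" by (auto simp: XV_def)
    show "homogeneous r F" using AB D1(1) D2(1) by (simp add: homogeneous_add)
    show "const c * F \<in> XV r l m" for c
      unfolding XV_def using AB D1(4)[of A c] D2(4)[of B c] by (auto simp: distrib_left)
    show "subst F (lin a c) (lin b d) \<in> XV r l m" if "a * d - b * c \<noteq> 0" for a b c d
      unfolding XV_def using AB D1(5)[of A, OF _ that] D2(5)[of B, OF _ that] by (auto simp: subst_add)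
    fix H :: "'p mod_ring poly poly" assume "H \<in> XV r l m"
    then obtain A' B' where AB': "H = A' + B'" "A' \<in> Xsub r l" "B' \<in> Vfil r m" by (auto simp: XV_def)
    have "F + H = (A + A') + (B + B')" using AB AB' by simp
    moreover have "A + A' \<in> Xsub r l" "B + B' \<in> Vfil r m" using AB AB' D1(3) D2(3) by blast+
    ultimately show "F + H \<in> XV r l m" unfolding XV_def by blast
  next
    show "0 \<in> XV r l m" using Xsub_XV D1(2) by blast
  qed
qed

end

section \<open>Binomial coefficients modulo \<open>p\<close>\<close>

lemma alternating_Suc:
  fixes g :: "nat \<Rightarrow> 'a::comm_ring_1"
  shows "(\<Sum>l\<le>Suc D. (- 1) ^ l * of_nat (Suc D choose l) * g l) =
    (\<Sum>l\<le>D. (- 1) ^ l * of_nat (D choose l) * (g l - g (Suc l)))"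
proof -
  have "(\<Sum>l\<le>Suc D. (- 1) ^ l * of_nat (Suc D choose l) * g l) =
      g 0 + (\<Sum>l\<le>D. (- 1) ^ Suc l * of_nat (Suc D choose Suc l) * g (Suc l))"
    by (subst sum.atMost_Suc_shift) simp
  also have "(\<Sum>l\<le>D. (- 1) ^ Suc l * of_nat (Suc D choose Suc l) * g (Suc l)) =
      (\<Sum>l\<le>D. (- 1) ^ Suc l * of_nat (D choose Suc l) * g (Suc l)) -
      (\<Sum>l\<le>D. (- 1) ^ l * of_nat (D choose l) * g (Suc l))"
    unfolding sum_subtractf[symmetric] by (intro sum.cong refl) (simp add: algebra_simps)
  finally have "(\<Sum>l\<le>Suc D. (- 1) ^ l * of_nat (Suc D choose l) * g l) =
      g 0 + ((\<Sum>l\<le>D. (- 1) ^ Suc l * of_nat (D choose Suc l) * g (Suc l)) -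
      (\<Sum>l\<le>D. (- 1) ^ l * of_nat (D choose l) * g (Suc l)))" .
  also have "(\<Sum>l\<le>Suc D. (- 1) ^ l * of_nat (D choose l) * g l) =
      g 0 + (\<Sum>l\<le>D. (- 1) ^ Suc l * of_nat (D choose Suc l) * g (Suc l))"
    by (subst sum.atMost_Suc_shift) simp
  hence "g 0 + ((\<Sum>l\<le>D. (- 1) ^ Suc l * of_nat (D choose Suc l) * g (Suc l)) -
      (\<Sum>l\<le>D. (- 1) ^ l * of_nat (D choose l) * g (Suc l))) =
      (\<Sum>l\<le>Suc D. (- 1) ^ l * of_nat (D choose l) * g l) -
      (\<Sum>l\<le>D. (- 1) ^ l * of_nat (D choose l) * g (Suc l))"
    by (simp only: add_diff_eq)
  also have "\<dots> = (\<Sum>l\<le>D. (- 1) ^ l * of_nat (D choose l) * (g l - g (Suc l)))"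
    by (simp add: algebra_simps sum_subtractf binomial_eq_0)
  finally show ?thesis .
qed

text \<open>By Pascal's rule, each difference in the upper argument of a binomial coefficient lowers both arguments by one.\<close>

lemma alternating_choose:
  assumes "D \<le> N"
  shows "(\<Sum>l\<le>D. (- 1) ^ l * of_nat (D choose l) * of_nat (N - l choose n)) =
    (if D \<le> n then of_nat (N - D choose (n - D)) else (0 :: 'a::comm_ring_1))"
  using assms
proof (induction D arbitrary: N)
  case 0
  show ?case by simp
next
  case (Suc D)
  have "(\<Sum>l\<le>Suc D. (- 1) ^ l * of_nat (Suc D choose l) * of_nat (N - l choose n)) =
      (\<Sum>l\<le>D. (- 1) ^ l * of_nat (D choose l) * of_nat (N - l choose n)) -
      (\<Sum>l\<le>D. (- 1) ^ l * of_nat (D choose l) * (of_nat (N - 1 - l choose n) :: 'a))"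
    by (subst alternating_Suc) (simp add: algebra_simps sum_subtractf)
  also have "\<dots> = (if D \<le> n then of_nat (N - D choose (n - D)) else 0) -
      (if D \<le> n then of_nat (N - 1 - D choose (n - D)) else 0)"
    using Suc.IH[of N] Suc.IH[of "N - 1"] Suc.prems by simp
  also have "\<dots> = (if Suc D \<le> n then of_nat (N - Suc D choose (n - Suc D)) else 0)"
  proof (cases "Suc D \<le> n")
    case True
    then obtain k where k: "n = Suc D + k" using le_Suc_ex by blast
    obtain M where M: "N = Suc D + M" using Suc.prems le_Suc_ex by blast
    show ?thesis by (simp add: k M)
  qed (cases "D \<le> n"; auto)
  finally show ?case .
qed

context prime_field
begin

text \<open>The polynomial \<open>x (x - 1) \<dots> (x - n + 1) / n!\<close>.\<close>

definition fbp :: "nat \<Rightarrow> 'p mod_ring poly" where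
  "fbp n = Polynomial.smult (inverse (of_nat (fact n))) (\<Prod>a<n. [:- of_nat a, 1:])"

lemma poly_fbp: "n < p \<Longrightarrow> poly (fbp n) (of_nat N) = of_nat (N choose n)"
proof -
  assume n: "n < p"
  have "(\<Prod>a<n. of_nat N - of_nat a) = (of_nat (fact n * (N choose n)) :: 'p mod_ring)" for n
  proof (induction n)
    case (Suc n)
    have "(of_nat (N choose n) :: 'p mod_ring) * (of_nat N - of_nat n) = of_nat ((N choose n) * (N - n))"
      by (cases "n \<le> N") (simp_all add: of_nat_diff binomial_eq_0)
    also have "(N choose n) * (N - n) = Suc n * (N choose Suc n)"
      using binomial_absorption[of n N] binomial_absorb_comp[of N n] by (simp add: mult.commute)
    finally have e: "(of_nat (N choose n) :: 'p mod_ring) * (of_nat N - of_nat n) = of_nat (Suc n * (N choose Suc n))" .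
    have "(\<Prod>a<Suc n. of_nat N - of_nat a) = of_nat (fact n) * ((of_nat (N choose n) :: 'p mod_ring) * (of_nat N - of_nat n))"
      by (simp add: Suc.IH mult_ac)
    also have "\<dots> = of_nat (fact (Suc n) * (N choose Suc n))" unfolding e by (simp add: algebra_simps)
    finally show ?case .
  qed simp
  thus ?thesis using fact_nonzero[OF n] by (simp add: fbp_def poly_prod)
qed

lemma degree_fbp: "Polynomial.degree (fbp n) \<le> n"
proof -
  have "Polynomial.degree (\<Prod>a<n. [:- of_nat a, 1 :: 'p mod_ring:]) \<le> (\<Sum>a<n. Polynomial.degree [:- of_nat a, 1 :: 'p mod_ring:])"
    using degree_prod_sum_le[of "{..<n}" "\<lambda>a. [:- of_nat a, 1 :: 'p mod_ring:]"] by (simp add: o_def)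
  also have "\<dots> = n" by simp
  finally show ?thesis unfolding fbp_def using degree_smult_le order_trans by blast
qed

lemma coeff_fbp: "poly.coeff (fbp n) n = inverse (of_nat (fact n))"
proof -
  have "poly.coeff (\<Prod>a<n. [:- of_nat a, 1 :: 'p mod_ring:]) n = 1"
  proof (induction n)
    case (Suc n)
    have "Polynomial.degree (\<Prod>a<n. [:- of_nat a, 1 :: 'p mod_ring:]) \<le> (\<Sum>a<n. Polynomial.degree [:- of_nat a, 1 :: 'p mod_ring:])"
      using degree_prod_sum_le[of "{..<n}" "\<lambda>a. [:- of_nat a, 1 :: 'p mod_ring:]"] by (simp add: o_def)
    hence "poly.coeff (\<Prod>a<n. [:- of_nat a, 1 :: 'p mod_ring:]) (Suc n) = 0" by (intro coeff_eq_0) simp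
    thus ?case using Suc by (simp add: mult.commute)
  qed simp
  thus ?thesis by (simp add: fbp_def)
qed

lemma choose_cong: "[s = t] (mod p) \<Longrightarrow> n < p \<Longrightarrow> of_nat (s choose n) = (of_nat (t choose n) :: 'p mod_ring)"
  using poly_fbp[of n s] poly_fbp[of n t] of_nat_eq[of s t] by simp

lemma choose_zero_iff: "n < p \<Longrightarrow> of_nat (N choose n) = (0 :: 'p mod_ring) \<longleftrightarrow> N mod p < n"
proof -
  assume n: "n < p"
  have e: "of_nat (N choose n) = (of_nat (N mod p choose n) :: 'p mod_ring)"
    using n by (intro choose_cong) (simp_all add: cong_def)
  have "N mod p < p" using p3 by simp
  thus ?thesis unfolding e using choose_nonzero[of n "N mod p"] by (cases "n \<le> N mod p") (auto simp: binomial_eq_0)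
qed

lemma choose_p_minus_1: "n < p \<Longrightarrow> of_nat (p - 1 choose n) = ((- 1) ^ n :: 'p mod_ring)"
proof (induction n)
  case (Suc n)
  have "p dvd (p choose Suc n)" using Suc.prems prime_p by (intro dvd_choose_prime) auto
  hence "of_nat (p - 1 choose n) + of_nat (p - 1 choose Suc n) = (0 :: 'p mod_ring)"
    using p3 of_nat_eq_0[of "p choose Suc n"] by (cases p) simp_all
  thus ?case using Suc by (simp add: add_eq_0_iff)
qed simp

lemma binomial_basis:
  fixes h :: "'p mod_ring poly"
  assumes "Polynomial.degree h \<le> d" "d < p"
  shows "\<exists>q. h = (\<Sum>n\<le>d. Polynomial.smult (q n) (fbp n)) \<and> q d = of_nat (fact d) * poly.coeff h d"
  using assms
proof (induction d arbitrary: h)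
  case 0
  have "fbp 0 = 1" by (simp add: fbp_def)
  moreover obtain c where "h = [:c:]" using 0 by (auto elim: degree_eq_zeroE)
  ultimately show ?case by (intro exI[of _ "\<lambda>_. c"]) simp
next
  case (Suc d)
  let ?c = "of_nat (fact (Suc d)) * poly.coeff h (Suc d)"
  let ?h = "h - Polynomial.smult ?c (fbp (Suc d))"
  have c0: "poly.coeff ?h (Suc d) = 0"
    using fact_nonzero[OF Suc.prems(2)] by (simp add: coeff_fbp del: fact_Suc)
  have dQ: "Polynomial.degree ?h \<le> Suc d"
    using Suc.prems(1) degree_fbp[of "Suc d"] degree_smult_le[of ?c "fbp (Suc d)"]
    by (intro degree_diff_le) auto
  have "poly.coeff ?h i = 0" if "i > d" for i
  proof (cases "i = Suc d")
    case False
    thus ?thesis using that dQ by (intro coeff_eq_0) auto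
  qed (simp only: c0)
  hence "Polynomial.degree ?h \<le> d" by (intro degree_le) blast
  then obtain q where q: "?h = (\<Sum>n\<le>d. Polynomial.smult (q n) (fbp n))"
    using Suc.IH[of ?h] Suc.prems by auto
  let ?q = "q(Suc d := ?c)"
  have "(\<Sum>n\<le>d. Polynomial.smult (?q n) (fbp n)) = (\<Sum>n\<le>d. Polynomial.smult (q n) (fbp n))"
    by (intro sum.cong) auto
  hence "h = (\<Sum>n\<le>Suc d. Polynomial.smult (?q n) (fbp n))"
    using q by (simp add: diff_eq_eq del: fact_Suc)
  thus ?case by (intro exI[of _ ?q]) simp
qed

lemma sum_alternating_poly:
  fixes h :: "'p mod_ring poly"
  assumes h: "Polynomial.degree h \<le> D" and D: "D < p"
  shows "(\<Sum>l\<le>D. (- 1) ^ l * of_nat (D choose l) * poly h (x - of_nat l)) = of_nat (fact D) * poly.coeff h D"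
proof -
  obtain q where q: "h = (\<Sum>n\<le>D. Polynomial.smult (q n) (fbp n))" "q D = of_nat (fact D) * poly.coeff h D"
    using binomial_basis[OF h D] by blast
  obtain N0 where N0: "x = of_nat N0" using obtain_of_nat[of x] by blast
  define N where "N = N0 + p"
  have N: "x = of_nat N" "D \<le> N" using D by (simp_all add: N_def N0 of_nat_p)
  have "poly h (x - of_nat l) = (\<Sum>n\<le>D. q n * of_nat (N - l choose n))" if "l \<le> D" for l
  proof -
    have "x - of_nat l = of_nat (N - l)" using that N by (simp add: of_nat_diff)
    thus ?thesis using D by (simp add: q(1) poly_sum poly_fbp)
  qed
  hence "(\<Sum>l\<le>D. (- 1) ^ l * of_nat (D choose l) * poly h (x - of_nat l)) =
      (\<Sum>l\<le>D. \<Sum>n\<le>D. q n * ((- 1) ^ l * of_nat (D choose l) * of_nat (N - l choose n)))"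
    by (intro sum.cong refl) (simp add: sum_distrib_left mult_ac)
  also have "\<dots> = (\<Sum>n\<le>D. q n * (\<Sum>l\<le>D. (- 1) ^ l * of_nat (D choose l) * of_nat (N - l choose n)))"
    by (subst sum.swap) (simp add: sum_distrib_left)
  also have "\<dots> = (\<Sum>n\<le>D. if n = D then q n else 0)"
    unfolding alternating_choose[OF N(2)] by (intro sum.cong refl) auto
  also have "\<dots> = q D" by simp
  finally show ?thesis using q(2) by simp
qed

lemma sum_alternating_poly_plus:
  fixes h :: "'p mod_ring poly"
  assumes "Polynomial.degree h \<le> D" and "D < p"
  shows "(\<Sum>l\<le>D. (- 1) ^ l * of_nat (D choose l) * poly h (x + of_nat l)) =
    (- 1) ^ D * (of_nat (fact D) * poly.coeff h D)"
proof -
  have "(\<Sum>l\<le>D. (- 1) ^ l * of_nat (D choose l) * poly h (x + of_nat l)) =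
      (\<Sum>l\<le>D. (- 1) ^ (D - l) * of_nat (D choose (D - l)) * poly h (x + of_nat (D - l)))"
    by (rule sum.reindex_bij_witness[of _ "\<lambda>l. D - l" "\<lambda>l. D - l"]) auto
  also have "\<dots> = (- 1) ^ D * (\<Sum>l\<le>D. (- 1) ^ l * of_nat (D choose l) * poly h (x + of_nat D - of_nat l))"
    unfolding sum_distrib_left
  proof (intro sum.cong refl)
    fix l assume l: "l \<in> {..D}"
    have "(- 1 :: 'p mod_ring) ^ (D - l) = (- 1) ^ D * (- 1) ^ l"
      using l by (auto simp: minus_one_power_iff)
    moreover have "D choose (D - l) = D choose l" using l binomial_symmetric by (metis atMost_iff)
    ultimately show "(- 1) ^ (D - l) * of_nat (D choose (D - l)) * poly h (x + of_nat (D - l)) =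
        (- 1) ^ D * ((- 1) ^ l * of_nat (D choose l) * poly h (x + of_nat D - of_nat l))"
      using l by (simp add: of_nat_diff add_diff_eq mult_ac)
  qed
  finally show ?thesis unfolding sum_alternating_poly[OF assms] .
qed

definition class_sum :: "nat \<Rightarrow> nat \<Rightarrow> 'p mod_ring" where
  "class_sum N a = (\<Sum>s\<le>N. if [s = a] (mod (p - 1)) then of_nat (N choose s) else 0)"

lemma class_sum_eq: "class_sum N a = - (\<Sum>c\<in>UNIV - {0}. c ^ (a * (p - 2)) * (1 + c) ^ N)"
proof -
  have "(\<Sum>c\<in>UNIV - {0 :: 'p mod_ring}. c ^ (a * (p - 2)) * (1 + c) ^ N) =
      (\<Sum>c\<in>UNIV - {0}. \<Sum>s\<le>N. of_nat (N choose s) * c ^ (s + a * (p - 2)))"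
  proof (intro sum.cong refl)
    fix c :: "'p mod_ring"
    have "(1 + c) ^ N = (\<Sum>s\<le>N. of_nat (N choose s) * c ^ s)"
      using binomial_ring[of c 1 N] by (simp add: add.commute)
    thus "c ^ (a * (p - 2)) * (1 + c) ^ N = (\<Sum>s\<le>N. of_nat (N choose s) * c ^ (s + a * (p - 2)))"
      by (simp add: sum_distrib_left power_add mult_ac)
  qed
  also have "\<dots> = (\<Sum>s\<le>N. of_nat (N choose s) * (\<Sum>c\<in>UNIV - {0}. c ^ (s + a * (p - 2))))"
    by (subst sum.swap) (simp add: sum_distrib_left)
  also have "\<dots> = - class_sum N a"
    unfolding class_sum_def sum_negf[symmetric]
    by (intro sum.cong refl) (simp add: sum_power_nonzero weight_dvd_iff del: One_nat_def)
  finally show ?thesis by simp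
qed

lemma class_sum_cong: "[N = M] (mod (p - 1)) \<Longrightarrow> N > 0 \<Longrightarrow> M > 0 \<Longrightarrow> class_sum N a = class_sum M a"
  unfolding class_sum_eq using power_cong_pos[of N M] by simp

lemma cong_small:
  assumes "[s = t] (mod (p - 1))" "s < p - 1" "t < p - 1" shows "s = t"
  using assms by (simp add: cong_def)

lemma class_sum_small:
  assumes y: "1 \<le> y" "y \<le> p - 1" and a: "a < p - 1"
  shows "class_sum y a = of_nat (y choose a) + (if a = 0 \<and> y = p - 1 then 1 else 0)"
proof -
  let ?S = "{s\<in>{..y}. [s = a] (mod (p - 1))}"
  have C: "class_sum y a = (\<Sum>s\<in>?S. of_nat (y choose s))"
    unfolding class_sum_def by (rule sum.inter_filter[symmetric]) simp
  have cases: "s = a \<or> s = p - 1 \<and> a = 0 \<and> y = p - 1" if s: "s \<in> ?S" for s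
  proof (cases "s = p - 1")
    case True
    hence "[0 = a] (mod (p - 1))" using s by (simp add: cong_def)
    moreover have "0 < p - 1" using p3 by simp
    ultimately have "0 = a" using cong_small[of 0 a] a by blast
    thus ?thesis using True s y by simp
  next
    case False
    hence "s < p - 1" using s y by simp
    thus ?thesis using cong_small[of s a] a s by simp
  qed
  show ?thesis
  proof (cases "a = 0 \<and> y = p - 1")
    case True
    have "?S \<subseteq> {0, p - 1}" using cases True by blast
    moreover have "{0, p - 1} \<subseteq> ?S" using True by (simp add: cong_def)
    ultimately have "?S = {0, p - 1}" by blast
    thus ?thesis unfolding C using True p3 by simp
  next
    case False
    show ?thesis
    proof (cases "a \<le> y")
      case True
      have "?S \<subseteq> {a}" using cases False by blast
      moreover have "{a} \<subseteq> ?S" using True by simp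
      ultimately have "?S = {a}" by blast
      thus ?thesis unfolding C using False by auto
    next
      case False
      have "?S = {}" using cases \<open>\<not> (a = 0 \<and> y = p - 1)\<close> False by force
      hence "class_sum y a = 0" unfolding C by (simp only: sum.empty)
      thus ?thesis using False by (auto simp: binomial_eq_0)
    qed
  qed
qed

text \<open>The sum is a power sum over \<open>\<bbbF>\<^sub>p\<^sup>*\<close>, so it depends only on \<open>N\<close> modulo \<open>p - 1\<close>. For the representative \<open>y\<close> it has at most
  two nonzero terms, and it has two only if both ends \<open>0\<close> and \<open>p - 1\<close> are in the class.\<close>

lemma class_sum_value:
  assumes "[N = y] (mod (p - 1))" "N > 0" "1 \<le> y" "y \<le> p - 1" "a < p - 1"
  shows "class_sum N a = of_nat (y choose a) + (if a = 0 \<and> y = p - 1 then 1 else 0)"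
  using class_sum_cong[OF assms(1,2)] class_sum_small[OF assms(3-5)] assms(3) by simp

text \<open>The binomial basis is used because \<open>q d\<close> is then the difference of order \<open>d\<close>, and because sums of
  \<open>(Z choose t) (t choose n)\<close> over a class are again binomial sums.\<close>

definition bpoly :: "(nat \<Rightarrow> 'p mod_ring) \<Rightarrow> nat \<Rightarrow> nat \<Rightarrow> 'p mod_ring" where
  "bpoly q d t = (\<Sum>n\<le>d. q n * of_nat (t choose n))"

lemma bpoly_poly:
  assumes "d < p"
  shows "bpoly q d t = poly (\<Sum>n\<le>d. Polynomial.smult (q n) (fbp n)) (of_nat t)"
  using assms by (simp add: bpoly_def poly_sum poly_fbp)

lemma degree_bpoly: "Polynomial.degree (\<Sum>n\<le>d. Polynomial.smult (q n) (fbp n)) \<le> d"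
proof (rule degree_sum_le)
  fix n assume "n \<in> {..d}"
  thus "Polynomial.degree (Polynomial.smult (q n) (fbp n)) \<le> d"
    using degree_fbp[of n] degree_smult_le[of "q n" "fbp n"] by (meson atMost_iff le_trans)
qed simp

lemma coeff_bpoly:
  assumes "d < p"
  shows "of_nat (fact d) * poly.coeff (\<Sum>n\<le>d. Polynomial.smult (q n) (fbp n)) d = q d"
proof -
  have "poly.coeff (\<Sum>n\<le>d. Polynomial.smult (q n) (fbp n)) d = (\<Sum>n\<le>d. if n = d then q d * inverse (of_nat (fact d)) else 0)"
    unfolding coeff_sum
  proof (intro sum.cong refl)
    fix n assume "n \<in> {..d}"
    thus "poly.coeff (Polynomial.smult (q n) (fbp n)) d = (if n = d then q d * inverse (of_nat (fact d)) else 0)"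
      using degree_fbp[of n] by (auto simp: coeff_fbp coeff_eq_0)
  qed
  thus ?thesis using fact_nonzero[OF assms] by simp
qed

lemma bpoly_difference:
  assumes "d < p"
  shows "(\<Sum>l\<le>d. (- 1) ^ l * of_nat (d choose l) * bpoly q d (t + l * (p - 1))) = q d"
proof -
  have "of_nat (t + l * (p - 1)) = (of_nat t - of_nat l :: 'p mod_ring)" for l
    by (simp add: of_nat_p_minus_1[simplified])
  hence "(\<Sum>l\<le>d. (- 1) ^ l * of_nat (d choose l) * bpoly q d (t + l * (p - 1))) =
      of_nat (fact d) * poly.coeff (\<Sum>n\<le>d. Polynomial.smult (q n) (fbp n)) d"
    using sum_alternating_poly[OF degree_bpoly[of q d] assms, of "of_nat t"]
    by (simp only: bpoly_poly[OF assms])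
  thus ?thesis by (simp only: coeff_bpoly[OF assms])
qed

lemma poly_bpoly:
  fixes h :: "'p mod_ring poly"
  assumes "Polynomial.degree h \<le> d" "d < p"
  obtains q where "\<And>t. poly h (of_nat t) = bpoly q d t"
proof -
  obtain q where "h = (\<Sum>n\<le>d. Polynomial.smult (q n) (fbp n))"
    using binomial_basis[OF assms] by blast
  hence "\<And>t. poly h (of_nat t) = bpoly q d t" using bpoly_poly[OF assms(2), of q] by simp
  thus ?thesis by (rule that)
qed

lemma interpolate:
  "d < p \<Longrightarrow> \<exists>h. Polynomial.degree h \<le> d \<and> (\<forall>u\<le>d. poly h (of_nat u) = (f u :: 'p mod_ring))"
proof (induction d)
  case 0
  show ?case by (intro exI[of _ "[:f 0:]"]) simp
next
  case (Suc d)
  then obtain h where h: "Polynomial.degree h \<le> d" "\<And>u. u \<le> d \<Longrightarrow> poly h (of_nat u) = f u" by auto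
  let ?c = "f (Suc d) - poly h (of_nat (Suc d))"
  let ?h = "h + Polynomial.smult ?c (fbp (Suc d))"
  have "Polynomial.degree ?h \<le> Suc d"
    using h(1) degree_fbp[of "Suc d"] degree_smult_le[of ?c "fbp (Suc d)"] by (intro degree_add_le) auto
  moreover have "poly ?h (of_nat u) = f u" if "u \<le> Suc d" for u
  proof (cases "u = Suc d")
    case True
    have "poly (fbp (Suc d)) (of_nat (Suc d)) = 1"
      by (simp only: poly_fbp[OF Suc.prems] binomial_n_n of_nat_1)
    thus ?thesis by (simp add: True del: of_nat_Suc)
  next
    case False
    hence "poly (fbp (Suc d)) (of_nat u) = 0"
      using that by (simp only: poly_fbp[OF Suc.prems]) (simp add: binomial_eq_0)
    thus ?thesis using that False h(2)[of u] by simp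
  qed
  ultimately show ?case by blast
qed

lemma class_sum_bpoly:
  assumes "d \<le> e"
  shows "(\<Sum>t\<le>Z. if [t = e] (mod (p - 1)) then of_nat (Z choose t) * bpoly q d t else 0) =
    (\<Sum>n\<le>d. q n * of_nat (Z choose n) * class_sum (Z - n) (e - n))"
proof -
  have "(\<Sum>t\<le>Z. if [t = e] (mod (p - 1)) then of_nat (Z choose t) * of_nat (t choose n) else 0) =
      of_nat (Z choose n) * class_sum (Z - n) (e - n)" if n: "n \<le> e" for n
  proof (cases "n \<le> Z")
    case True
    have "(\<Sum>t\<le>Z. if [t = e] (mod (p - 1)) then of_nat (Z choose t) * of_nat (t choose n) else 0) =
        (\<Sum>t\<in>{n..Z}. if [t = e] (mod (p - 1)) then of_nat (Z choose t) * of_nat (t choose n) else (0 :: 'p mod_ring))"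
      by (rule sum.mono_neutral_right) (auto simp: binomial_eq_0)
    also have "\<dots> = (\<Sum>s\<le>Z - n. of_nat (Z choose n) * (if [s = e - n] (mod (p - 1)) then of_nat (Z - n choose s) else 0))"
    proof (rule sum.reindex_bij_witness[of _ "\<lambda>s. s + n" "\<lambda>t. t - n"])
      fix t assume t: "t \<in> {n..Z}"
      have "[t = e] (mod (p - 1)) \<longleftrightarrow> [t - n + n = e - n + n] (mod (p - 1))" using t n by simp
      also have "\<dots> \<longleftrightarrow> [t - n = e - n] (mod (p - 1))" by (rule cong_add_rcancel_nat)
      finally have c: "[t = e] (mod (p - 1)) \<longleftrightarrow> [t - n = e - n] (mod (p - 1))" .
      have "(of_nat (Z choose n) * of_nat (Z - n choose (t - n)) :: 'p mod_ring) = of_nat (Z choose t) * of_nat (t choose n)"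
        using choose_mult[of n t Z] t by (simp flip: of_nat_mult)
      thus "of_nat (Z choose n) * (if [t - n = e - n] (mod (p - 1)) then of_nat (Z - n choose (t - n)) else 0) =
          (if [t = e] (mod (p - 1)) then of_nat (Z choose t) * of_nat (t choose n) else (0 :: 'p mod_ring))"
        by (simp add: c del: One_nat_def)
    qed (use True in auto)
    finally show ?thesis by (simp add: class_sum_def sum_distrib_left)
  next
    case False
    hence "(\<Sum>t\<le>Z. if [t = e] (mod (p - 1)) then of_nat (Z choose t) * of_nat (t choose n) else (0 :: 'p mod_ring)) = 0"
      by (intro sum.neutral) (auto simp: binomial_eq_0)
    thus ?thesis using False by (simp add: binomial_eq_0 del: One_nat_def)
  qed
  note E = this
  have "(\<Sum>t\<le>Z. if [t = e] (mod (p - 1)) then of_nat (Z choose t) * bpoly q d t else 0) =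
      (\<Sum>t\<le>Z. \<Sum>n\<le>d. q n * (if [t = e] (mod (p - 1)) then of_nat (Z choose t) * of_nat (t choose n) else 0))"
    by (intro sum.cong refl) (auto simp: bpoly_def sum_distrib_left mult_ac)
  also have "\<dots> = (\<Sum>n\<le>d. q n * (\<Sum>t\<le>Z. if [t = e] (mod (p - 1)) then of_nat (Z choose t) * of_nat (t choose n) else 0))"
    by (subst sum.swap) (simp add: sum_distrib_left)
  also have "\<dots> = (\<Sum>n\<le>d. q n * of_nat (Z choose n) * class_sum (Z - n) (e - n))"
    using assms by (intro sum.cong refl) (simp add: E mult.assoc del: One_nat_def)
  finally show ?thesis .
qed

section \<open>Linear forms on \<open>V\<^sub>r\<close> that vanish on a step of the filtration\<close>

lemma theta_mon_expand:
  assumes "a + b + D * (p + 1) = r"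
  shows "(theta ^ D * mon a b :: 'p mod_ring poly poly) =
    (\<Sum>l\<le>D. const ((- 1) ^ l * of_nat (D choose l)) * mon (r - (D + b + l * (p - 1))) (D + b + l * (p - 1)))"
  unfolding theta_power_mon
proof (intro sum.cong refl)
  fix l assume "l \<in> {..D}"
  then obtain m where D: "D = l + m" using le_Suc_ex by auto
  obtain P where P: "p = Suc P" using p3 by (cases p) auto
  have "a + p * (D - l) + l = r - (D + b + l * (p - 1))"
    unfolding assms[symmetric] D P by (simp add: algebra_simps)
  moreover have "b + (D - l) + p * l = D + b + l * (p - 1)"
    unfolding D P by (simp add: algebra_simps)
  ultimately show "const ((- 1) ^ l * of_nat (D choose l)) * mon (a + p * (D - l) + l) (b + (D - l) + p * l) =
      const ((- 1) ^ l * of_nat (D choose l)) * (mon (r - (D + b + l * (p - 1))) (D + b + l * (p - 1)) :: 'p mod_ring poly poly)"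
    by (simp only:)
qed

lemma functional_theta_mon:
  assumes "functional f" "a + b + D * (p + 1) = r"
  shows "f (theta ^ D * mon a b) = (\<Sum>l\<le>D. (- 1) ^ l * of_nat (D choose l) *
    f (mon (r - (D + b + l * (p - 1))) (D + b + l * (p - 1))))"
  unfolding theta_mon_expand[OF assms(2)]
  by (simp add: functional_sum[OF assms(1)] functional_const[OF assms(1)])

lemma functional_recurrence:
  assumes f: "functional f" and K: "kills f (Vfil r D)"
    and "D \<le> t" "t + D * (p - 1) + D \<le> r"
  shows "(\<Sum>l\<le>D. (- 1) ^ l * of_nat (D choose l) * f (mon (r - (t + l * (p - 1))) (t + l * (p - 1)))) = 0"
proof -
  obtain b where b: "t = D + b" using assms(3) le_Suc_ex by blast
  obtain a where "r = t + D * (p - 1) + D + a" using assms(4) le_Suc_ex by blast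
  moreover obtain P where "p = Suc P" using p3 by (cases p) auto
  ultimately have r: "a + b + D * (p + 1) = r" by (simp add: b algebra_simps)
  have "homogeneous (a + b) (mon a b :: 'p mod_ring poly poly)" by (rule homogeneous_mon) simp
  hence "theta ^ D * mon a b \<in> (Vfil r D :: 'p mod_ring poly poly set)" by (rule Vfil_mult[OF _ r])
  from killsD[OF K this] show ?thesis unfolding functional_theta_mon[OF f r] b .
qed

text \<open>The strict bounds leave out the boundary monomials \<open>X\<^bsup>r-t\<^esup> Y\<^sup>t\<close> and \<open>X\<^sup>t Y\<^bsup>r-t\<^esup>\<close> with \<open>t \<le> d\<close>. They do not occur in
  multiples of \<open>\<theta>\<^sup>d\<^sup>+\<^sup>1\<close>, and the form is arbitrary on them.\<close>

definition fits :: "('p mod_ring poly poly \<Rightarrow> 'p mod_ring) \<Rightarrow> nat \<Rightarrow> nat \<Rightarrow> nat \<Rightarrow> (nat \<Rightarrow> 'p mod_ring) \<Rightarrow> bool" where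
  "fits f r d e q \<longleftrightarrow> (\<forall>t. d < t \<and> t < r - d \<and> [t = e] (mod (p - 1)) \<longrightarrow> f (mon (r - t) t) = bpoly q d t)"

lemma fitsD: "fits f r d e q \<Longrightarrow> d < t \<Longrightarrow> t < r - d \<Longrightarrow> [t = e] (mod (p - 1)) \<Longrightarrow> f (mon (r - t) t) = bpoly q d t"
  by (simp add: fits_def)

text \<open>The exponents of \<open>Y\<close> in \<open>\<theta>\<^sup>d\<^sup>+\<^sup>1 X\<^sup>a Y\<^sup>b\<close> form an arithmetic progression with step \<open>p - 1\<close>, with alternating binomial
  coefficients. Vanishing there is the vanishing of a difference of order \<open>d + 1\<close>, which characterises polynomials of
  degree at most \<open>d\<close>.\<close>

lemma functional_bpoly:
  assumes f: "functional f" and K: "kills f (Vfil r (d + 1))" and d: "d + 1 < p"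
  obtains q where "fits f r d e q"
proof -
  define D where "D = d + 1"
  define g where "g t = f (mon (r - t) t)" for t
  define x where "x = (e + D * (p - 2)) mod (p - 1)"
  define t1 where "t1 = D + x"
  have xl: "x < p - 1" using p3 by (simp add: x_def)
  have t1: "[t1 = e] (mod (p - 1))"
  proof -
    obtain P where P: "p = P + 2" using p3 by (metis add.commute le_Suc_ex numeral_3_eq_3 numeral_2_eq_2 Suc_leD)
    have "[t1 = D + (e + D * (p - 2))] (mod (p - 1))"
      unfolding t1_def x_def by (intro cong_add) (simp_all add: cong_def)
    also have "D + (e + D * (p - 2)) = e + D * (p - 1)" by (simp add: P algebra_simps)
    also have "[e + D * (p - 1) = e] (mod (p - 1))" by (simp add: cong_def)
    finally show ?thesis .
  qed
  have rec: "(\<Sum>l\<le>D. (- 1) ^ l * of_nat (D choose l) * g (t + l * (p - 1))) = 0"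
    if "D \<le> t" "t + D * (p - 1) + D \<le> r" for t
    unfolding g_def using functional_recurrence[OF f, of r D t] K that by (simp add: D_def)
  obtain h where h: "Polynomial.degree h \<le> d" "\<And>u. u \<le> d \<Longrightarrow> poly h (of_nat u) = g (t1 + u * (p - 1))"
    using interpolate[of d "\<lambda>u. g (t1 + u * (p - 1))"] d by auto
  \<comment> \<open>For \<open>u > d\<close> the recurrence determines the value from the \<open>d + 1\<close> preceding ones.\<close>
  have main: "t1 + u * (p - 1) + D \<le> r \<Longrightarrow> g (t1 + u * (p - 1)) = poly h (of_nat u)" for u
  proof (induction u rule: less_induct)
    case (less u)
    show ?case
    proof (cases "u \<le> d")
      case False
      define v where "v = u - D"
      have u: "u = v + D" using False by (simp add: v_def D_def)
      have "t1 + v * (p - 1) + D * (p - 1) + D \<le> r" using less.prems by (simp only: u add_mult_distrib add.assoc)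
      hence 1: "(\<Sum>l\<le>D. (- 1) ^ l * of_nat (D choose l) * g (t1 + v * (p - 1) + l * (p - 1))) = 0"
        by (intro rec) (simp_all add: t1_def)
      have "poly.coeff h D = 0" using h(1) by (intro coeff_eq_0) (simp add: D_def)
      hence 2: "(\<Sum>l\<le>D. (- 1) ^ l * of_nat (D choose l) * poly h (of_nat v + of_nat l)) = 0"
        using sum_alternating_poly_plus[of h D "of_nat v"] h(1) d by (simp add: D_def)
      have "0 = (\<Sum>l\<le>D. (- 1) ^ l * of_nat (D choose l) *
          (g (t1 + (v + l) * (p - 1)) - poly h (of_nat (v + l))))"
        using 1 2 by (simp only: right_diff_distrib sum_subtractf add_mult_distrib of_nat_add add.assoc diff_zero)
      also have "\<dots> = (\<Sum>l\<le>D. if l = D then (- 1) ^ D * (g (t1 + u * (p - 1)) - poly h (of_nat u)) else 0)"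
      proof (intro sum.cong refl)
        fix l assume l: "l \<in> {..D}"
        have "g (t1 + (v + l) * (p - 1)) = poly h (of_nat (v + l))" if "l \<noteq> D"
        proof (rule less.IH)
          show "v + l < u" using that l by (simp add: u)
          have "(v + l) * (p - 1) \<le> u * (p - 1)" using l by (intro mult_le_mono1) (simp add: u)
          thus "t1 + (v + l) * (p - 1) + D \<le> r" using less.prems by linarith
        qed
        thus "(- 1) ^ l * of_nat (D choose l) * (g (t1 + (v + l) * (p - 1)) - poly h (of_nat (v + l))) =
            (if l = D then (- 1) ^ D * (g (t1 + u * (p - 1)) - poly h (of_nat u)) else 0)"
          by (auto simp: u)
      qed
      also have "\<dots> = (- 1) ^ D * (g (t1 + u * (p - 1)) - poly h (of_nat u))" by simp
      finally show ?thesis by simp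
    qed (use h(2) in simp)
  qed
  \<comment> \<open>Since \<open>p - 1 = - 1\<close> in \<open>\<bbbF>\<^sub>p\<close>, the index of \<open>t = t\<^sub>1 + u (p - 1)\<close> is \<open>u = t\<^sub>1 - t\<close>.\<close>
  let ?h = "pcompose h [:of_nat t1, - 1:]"
  have "Polynomial.degree ?h \<le> d"
    using h(1) degree_pcompose_le[of h "[:of_nat t1, - 1:]"] by simp
  then obtain q where q: "\<And>t. poly ?h (of_nat t) = bpoly q d t" using poly_bpoly[of ?h d] d by auto
  show thesis
  proof (rule that, unfold fits_def, intro allI impI, elim conjE)
    fix t assume t: "d < t" "t < r - d" "[t = e] (mod (p - 1))"
    have tt1: "[t = t1] (mod (p - 1))" using t(3) t1 by (metis cong_sym cong_trans)
    have "t1 \<le> t"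
    proof (rule ccontr)
      assume n: "\<not> t1 \<le> t"
      have "[t1 - t = 0] (mod (p - 1))" using cong_sym[OF tt1] n by (simp add: cong_altdef_nat cong_0_iff)
      moreover have "t1 - t < p - 1" "0 < p - 1" using xl t(1) p3 by (auto simp: t1_def D_def)
      ultimately show False using cong_small[of "t1 - t" 0] n by simp
    qed
    then obtain u where u: "t = u * (p - 1) + t1" using tt1 by (auto simp: cong_le_nat)
    have "t + D \<le> r" using t(2) by (simp add: D_def)
    hence "g t = poly h (of_nat u)" using main[of u] by (simp add: u add.commute)
    also have "of_nat u = (of_nat t1 - of_nat t :: 'p mod_ring)"
      by (simp add: u of_nat_p_minus_1[simplified])
    also have "poly h (of_nat t1 - of_nat t) = poly ?h (of_nat t)" by (simp add: poly_pcompose)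
    finally show "f (mon (r - t) t) = bpoly q d t" by (simp add: g_def q)
  qed
qed

text \<open>If the progression of exponents stays inside the range of the polynomial, the value is its difference of order \<open>d\<close>. For
  \<open>b = 0\<close> and for \<open>a = 0\<close> the first or last exponent is a boundary exponent, which is corrected for.\<close>

lemma functional_theta_mon_value:
  assumes f: "functional f" and d: "0 < d" "d < p" and r: "a + b + d * (p + 1) = r"
    and q: "fits f r d e q" and e: "[d + b = e] (mod (p - 1))"
  shows "f (theta ^ d * mon a b) = q d + (if b = 0 then f (mon (r - d) d) - bpoly q d d else 0) +
    (if a = 0 then (- 1) ^ d * (f (mon d (r - d)) - bpoly q d (r - d)) else 0)"
proof -
  let ?t = "\<lambda>l. d + b + l * (p - 1)"
  let ?A = "if b = 0 then f (mon (r - d) d) - bpoly q d d else 0"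
  let ?B = "if a = 0 then f (mon d (r - d)) - bpoly q d (r - d) else 0"
  obtain P where P: "p = Suc P" using p3 by (cases p) auto
  have P0: "P > 0" using p3 P by simp
  have "f (mon (r - ?t l) (?t l)) = bpoly q d (?t l) + (if l = 0 then ?A else 0) + (if l = d then ?B else 0)"
    if l: "l \<le> d" for l
  proof -
    obtain m where m: "d = l + m" using l le_Suc_ex by blast
    have rt: "r - ?t l = a + d + m * P" by (simp add: r[symmetric] P m algebra_simps)
    have c: "[?t l = e] (mod (p - 1))" using e by (simp add: cong_def)
    consider "l = 0" "b = 0" | "l = d" "a = 0" | "0 < ?t l - d" "0 < r - ?t l - d"
      using P0 m d unfolding rt by (cases "l = 0"; cases "m = 0"; auto simp: P)
    thus ?thesis
    proof cases
      case 1
      thus ?thesis using d by simp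
    next
      case 2
      have "?t d = r - d" using r 2 by (simp add: P algebra_simps)
      moreover have "r - (r - d) = d" using r by auto
      ultimately show ?thesis using 2 d by simp
    next
      case 3
      have "f (mon (r - ?t l) (?t l)) = bpoly q d (?t l)" using 3 by (intro fitsD[OF q] c) auto
      moreover have "l = 0 \<Longrightarrow> b \<noteq> 0" "l = d \<Longrightarrow> a \<noteq> 0" using 3 m unfolding rt by auto
      ultimately show ?thesis by auto
    qed
  qed
  hence "f (theta ^ d * mon a b) = (\<Sum>l\<le>d. (- 1) ^ l * of_nat (d choose l) *
      (bpoly q d (?t l) + (if l = 0 then ?A else 0) + (if l = d then ?B else 0)))"
    unfolding functional_theta_mon[OF f r] by (intro sum.cong refl) simp
  also have "\<dots> = (\<Sum>l\<le>d. (- 1) ^ l * of_nat (d choose l) * bpoly q d (?t l)) +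
      (\<Sum>l\<le>d. if l = 0 then ?A else 0) + (\<Sum>l\<le>d. if l = d then (- 1) ^ d * ?B else 0)"
    unfolding sum.distrib[symmetric] by (intro sum.cong refl) (auto simp: distrib_left)
  also have "(\<Sum>l\<le>d. (- 1) ^ l * of_nat (d choose l) * bpoly q d (?t l)) = q d"
    by (rule bpoly_difference[OF d(2)])
  finally show ?thesis by simp
qed

section \<open>The linear equations imposed by the monomial submodules\<close>

lemma lin_power_expand:
  assumes "k \<le> r"
  shows "lin a c ^ (r - k) * varX ^ k =
    (\<Sum>t\<le>r. const (of_nat (r - k choose t) * (a ^ (r - k - t) * c ^ t)) * (mon (r - t) t :: 'p mod_ring poly poly))"
proof -
  have "lin a c = const c * varY + const a * (varX :: 'p mod_ring poly poly)" by (simp add: lin_def add.commute)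
  hence "lin a c ^ (r - k) * varX ^ k =
      (\<Sum>t\<le>r - k. of_nat (r - k choose t) * (const c * varY) ^ t * (const a * (varX :: 'p mod_ring poly poly)) ^ (r - k - t) * varX ^ k)"
    by (simp only: binomial_ring sum_distrib_right)
  also have "\<dots> = (\<Sum>t\<le>r - k. const (of_nat (r - k choose t) * (a ^ (r - k - t) * c ^ t)) * mon (r - t) t)"
  proof (intro sum.cong refl)
    fix t assume "t \<in> {..r - k}"
    hence "r - k - t + k = r - t" using assms by auto
    hence "mon (r - t) t = (varX ^ (r - k - t) * varX ^ k * varY ^ t :: 'p mod_ring poly poly)"
      by (simp only: mon_def power_add[symmetric])
    thus "of_nat (r - k choose t) * (const c * varY) ^ t * (const a * varX) ^ (r - k - t) * varX ^ k =
        const (of_nat (r - k choose t) * (a ^ (r - k - t) * c ^ t)) * (mon (r - t) t :: 'p mod_ring poly poly)"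
      by (simp only: const_mult const_power const_of_nat power_mult_distrib mult_ac)
  qed
  also have "\<dots> = (\<Sum>t\<le>r. const (of_nat (r - k choose t) * (a ^ (r - k - t) * c ^ t)) * mon (r - t) t)"
    by (rule sum.mono_neutral_left) (auto simp: binomial_eq_0)
  finally show ?thesis .
qed

lemma lin_power_mon:
  assumes "k \<le> r"
  shows "lin 1 1 ^ (r - k) * varX ^ k = (\<Sum>t\<le>r. const (of_nat (r - k choose t)) * (mon (r - t) t :: 'p mod_ring poly poly))"
  using lin_power_expand[OF assms, of 1 1] by simp

lemma Xsub_equation:
  assumes f: "functional f" and K: "kills f (Xsub r k)" and k: "k \<le> r"
  shows "(\<Sum>t\<le>r. if [t = e] (mod (p - 1)) then of_nat (r - k choose t) * f (mon (r - t) t) else 0) = 0"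
proof -
  note N = subm_Xsub[OF k]
  have "subst (mon (r - k) k) (lin 1 1) (lin 1 0) \<in> (Xsub r k :: 'p mod_ring poly poly set)"
    by (rule submD(5)[OF N mon_in_Xsub]) simp
  hence "(\<Sum>t\<le>r. const (of_nat (r - k choose t)) * (mon (r - t) t :: 'p mod_ring poly poly)) \<in> Xsub r k"
    using lin_power_mon[OF k] by (simp add: subst_mon)
  from killsD[OF K subm_weight[OF N this, of e]]
  have A: "(\<Sum>t\<le>r. f (if [t = e] (mod (p - 1)) then const (of_nat (r - k choose t)) * mon (r - t) t else 0)) = 0"
    by (simp only: functional_sum[OF f])
  have "f 0 = 0" using functional_sum[OF f, of "\<lambda>_. 0" "{}"] by simp
  hence X: "f (if [t = e] (mod (p - 1)) then const (of_nat (r - k choose t)) * mon (r - t) t else 0) =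
      (if [t = e] (mod (p - 1)) then of_nat (r - k choose t) * f (mon (r - t) t) else 0)" for t
    by (simp add: functional_const[OF f])
  show ?thesis using A unfolding X .
qed

text \<open>The form is applied to the part of \<open>(X + Y)\<^bsup>r-k\<^esup> X\<^sup>k\<close> in one class of exponents. Only \<open>e\<close> and \<open>r - u\<close> can be boundary
  exponents; they account for the right-hand side.\<close>

lemma Xsub_bpoly_equation:
  assumes f: "functional f" and K: "kills f (Xsub r k)" and k: "k \<le> r"
    and q: "fits f r d e q"
    and de: "d \<le> e" and e: "e < p - 1" and u: "u < p - 1" and eu: "[e + u = r] (mod (p - 1))" and r: "e + u < r" and r2: "e + d < r"
  shows "(\<Sum>n\<le>d. q n * of_nat (r - k choose n) * class_sum (r - k - n) (e - n)) =
    (if e \<le> d then of_nat (r - k choose e) * (bpoly q d e - f (mon (r - e) e)) else 0) +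
    (if u \<le> d then of_nat (r - k choose (r - u)) * (bpoly q d (r - u) - f (mon u (r - u))) else 0)"
proof -
  let ?c = "\<lambda>t. [t = e] (mod (p - 1))"
  let ?g = "\<lambda>t. of_nat (r - k choose t) * (bpoly q d t - f (mon (r - t) t))"
  have "(\<Sum>n\<le>d. q n * of_nat (r - k choose n) * class_sum (r - k - n) (e - n)) =
      (\<Sum>t\<le>r - k. if ?c t then of_nat (r - k choose t) * bpoly q d t else 0)"
    by (rule class_sum_bpoly[OF de, symmetric])
  also have "\<dots> = (\<Sum>t\<le>r. if ?c t then of_nat (r - k choose t) * bpoly q d t else 0)"
    by (rule sum.mono_neutral_left) (auto simp: binomial_eq_0)
  also have "\<dots> = (\<Sum>t\<le>r. if ?c t then ?g t else 0) + (\<Sum>t\<le>r. if ?c t then of_nat (r - k choose t) * f (mon (r - t) t) else 0)"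
    unfolding sum.distrib[symmetric] by (intro sum.cong refl) (simp add: algebra_simps)
  also have "\<dots> = (\<Sum>t\<le>r. if ?c t then ?g t else 0)"
  proof -
    have "(\<Sum>t\<le>r. if ?c t then of_nat (r - k choose t) * f (mon (r - t) t) else 0) = 0"
      by (rule Xsub_equation[OF f K k])
    thus ?thesis by (simp only: add_0_right)
  qed
  also have "\<dots> = (\<Sum>t\<le>r. (if t = e then (if e \<le> d then ?g e else 0) else 0) +
      (if t = r - u then (if u \<le> d then ?g (r - u) else 0) else 0))"
  proof (intro sum.cong refl)
    fix t assume "t \<in> {..r}"
    hence tr: "t \<le> r" by simp
    have ru: "[r - u = e] (mod (p - 1))"
    proof -
      have "[r - u + u = e + u] (mod (p - 1))" using eu r by (simp add: cong_sym_eq)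
      thus ?thesis by (rule cong_add_rcancel_nat[THEN iffD1])
    qed
    consider "t = e" | "t = r - u" "t \<noteq> e" | "t \<noteq> e" "t \<noteq> r - u" by blast
    thus "(if ?c t then ?g t else 0) = (if t = e then (if e \<le> d then ?g e else 0) else 0) +
      (if t = r - u then (if u \<le> d then ?g (r - u) else 0) else 0)"
    proof cases
      case 1
      have "e \<noteq> r - u" using r by simp
      moreover have "?g e = 0" if "\<not> e \<le> d"
        using fitsD[OF q, of e] that de r e r2 by (cases "e < r - d") auto
      ultimately show ?thesis using 1 by auto
    next
      case 2
      have "?g (r - u) = 0" if "\<not> u \<le> d" using fitsD[OF q, of "r - u"] that ru de e u r r2 by auto
      thus ?thesis using 2 ru by auto
    next
      case 3
      have "?g t = 0" if c: "?c t"
      proof -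
        have "d < t"
        proof (rule ccontr)
          assume "\<not> d < t"
          hence "t < p - 1" using de e by simp
          thus False using cong_small[OF c _ e] 3 by simp
        qed
        moreover have "t < r - d"
        proof (rule ccontr)
          assume n: "\<not> t < r - d"
          hence "r - t < p - 1" using de e tr by simp
          moreover have "[r - t = u] (mod (p - 1))"
          proof -
            have "[r - t + t = u + t] (mod (p - 1))"
              using eu c tr by (metis add.commute cong_add_lcancel_nat cong_sym cong_trans le_add_diff_inverse2)
            thus ?thesis by (rule cong_add_rcancel_nat[THEN iffD1])
          qed
          ultimately have "r - t = u" using u by (intro cong_small)
          thus False using 3 tr by auto
        qed
        ultimately show ?thesis using fitsD[OF q] c by simp
      qed
      thus ?thesis using 3 by auto
    qed
  qed
  also have "\<dots> = (if e \<le> d then ?g e else 0) + (if u \<le> d then ?g (r - u) else 0)"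
    using r by (simp add: sum.distrib)
  finally show ?thesis using r by simp
qed

text \<open>The representative \<open>y\<close> may exceed \<open>p - 1\<close>: then both sides vanish.\<close>

lemma class_sum_choose:
  assumes "[N = y] (mod (p - 1))" "N > 0" "1 \<le> y" "a \<le> y" "y < a + (p - 1)" "a < p - 1"
  shows "class_sum N a = of_nat (y choose a)"
proof (cases "y \<le> p - 1")
  case True
  thus ?thesis using class_sum_value[OF assms(1,2,3) True assms(6)] assms(5) by auto
next
  case False
  define y' where "y' = y - (p - 1)"
  have "[N = y'] (mod (p - 1))"
  proof -
    have "[y' + (p - 1) = y'] (mod (p - 1))" by (simp add: cong_def)
    hence "[y = y'] (mod (p - 1))" using False by (simp add: y'_def)
    thus ?thesis using assms(1) by (metis cong_trans)
  qed
  moreover have y': "1 \<le> y'" "y' \<le> p - 1" "y' < a" using False assms by (auto simp: y'_def)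
  ultimately have "class_sum N a = of_nat (y' choose a)"
    using class_sum_value[OF _ assms(2) _ _ assms(6)] by auto
  moreover have "of_nat (y choose a) = (0 :: 'p mod_ring)"
  proof -
    have "p \<le> y" "y < 2 * p" using False assms by auto
    hence "y mod p = y - p" by (simp add: le_mod_geq)
    thus ?thesis using choose_zero_iff[of a y] assms y' False by (auto simp: y'_def)
  qed
  ultimately show ?thesis using y' by (simp add: binomial_eq_0)
qed

text \<open>For fixed \<open>q\<close> the left-hand sides of the equations are the values of a polynomial in \<open>k\<close>
  of degree at most \<open>e\<close>, whose leading coefficient is a value of the function \<open>q\<close>.\<close>

definition eqpoly :: "(nat \<Rightarrow> 'p mod_ring) \<Rightarrow> nat \<Rightarrow> nat \<Rightarrow> nat \<Rightarrow> nat \<Rightarrow> 'p mod_ring poly" where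
  "eqpoly q d e u r = (\<Sum>n\<le>d. Polynomial.smult (q n)
     (pcompose (fbp n) [:of_nat r, - 1:] * pcompose (fbp (e - n)) [:of_nat (e + u) - of_nat n, - 1:]))"

lemma poly_eqpoly:
  "poly (eqpoly q d e u r) x =
    (\<Sum>n\<le>d. q n * (poly (fbp n) (of_nat r - x) * poly (fbp (e - n)) (of_nat (e + u) - of_nat n - x)))"
  by (simp add: eqpoly_def poly_sum poly_pcompose)

lemma poly_eqpoly_nat:
  assumes "e < p" "d \<le> e" "k \<le> r" "k + d \<le> e + u"
  shows "poly (eqpoly q d e u r) (of_nat k) =
    (\<Sum>n\<le>d. q n * of_nat (r - k choose n) * of_nat (e + u - n - k choose (e - n)))"
  unfolding poly_eqpoly
proof (intro sum.cong refl)
  fix n assume "n \<in> {..d}"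
  hence n: "n \<le> d" by simp
  have "(of_nat r - of_nat k :: 'p mod_ring) = of_nat (r - k)" using assms by (simp add: of_nat_diff)
  moreover have "(of_nat (e + u) - of_nat n - of_nat k :: 'p mod_ring) = of_nat (e + u - n - k)"
    using assms n by (simp add: of_nat_diff)
  moreover have "n < p" "e - n < p" using n assms by auto
  ultimately show "q n * (poly (fbp n) (of_nat r - of_nat k) * poly (fbp (e - n)) (of_nat (e + u) - of_nat n - of_nat k)) =
      q n * of_nat (r - k choose n) * of_nat (e + u - n - k choose (e - n))"
    by (simp add: poly_fbp mult.assoc)
qed

lemma coeff_mult_top:
  fixes g h :: "'p mod_ring poly"
  assumes "Polynomial.degree g \<le> n" "Polynomial.degree h \<le> m"
  shows "poly.coeff (g * h) (n + m) = poly.coeff g n * poly.coeff h m"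
proof -
  have "poly.coeff (g * h) (n + m) = (\<Sum>i\<le>n + m. if i = n then poly.coeff g n * poly.coeff h m else 0)"
    unfolding coeff_mult
  proof (intro sum.cong refl)
    fix i assume "i \<in> {..n + m}"
    thus "poly.coeff g i * poly.coeff h (n + m - i) = (if i = n then poly.coeff g n * poly.coeff h m else 0)"
      using assms coeff_eq_0[of g i] coeff_eq_0[of h "n + m - i"]
      by (cases i n rule: linorder_cases) auto
  qed
  thus ?thesis by simp
qed

lemma fbp_reflect:
  assumes "n < p"
  shows "Polynomial.degree (pcompose (fbp n) [:c, - 1:]) \<le> n"
    "poly.coeff (pcompose (fbp n) [:c, - 1:]) n = (- 1) ^ n * inverse (of_nat (fact n))"
proof -
  show "Polynomial.degree (pcompose (fbp n) [:c, - 1:]) \<le> n"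
    using degree_pcompose_le[of "fbp n" "[:c, - 1:]"] degree_fbp[of n] by simp
  have "poly.coeff (fbp n) n \<noteq> 0" using fact_nonzero[OF assms] by (simp add: coeff_fbp)
  hence dn: "Polynomial.degree (fbp n) = n" using degree_fbp[of n] le_degree le_antisym by blast
  have "Polynomial.degree (pcompose (fbp n) [:c, - 1:]) = n" by (simp add: dn)
  moreover have "lead_coeff (pcompose (fbp n) [:c, - 1:]) = (- 1) ^ n * inverse (of_nat (fact n))"
    using lead_coeff_comp[of "[:c, - 1 :: 'p mod_ring:]" "fbp n"] by (simp add: dn coeff_fbp)
  ultimately show "poly.coeff (pcompose (fbp n) [:c, - 1:]) n = (- 1) ^ n * inverse (of_nat (fact n))" by simp
qed

lemma degree_eqpoly: "d \<le> e \<Longrightarrow> e < p \<Longrightarrow> Polynomial.degree (eqpoly q d e u r) \<le> e"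
  unfolding eqpoly_def
proof (rule degree_sum_le)
  fix n assume *: "d \<le> e" "e < p" "n \<in> {..d}"
  let ?g = "pcompose (fbp n) [:of_nat r, - 1:]" and ?h = "pcompose (fbp (e - n)) [:of_nat (e + u) - of_nat n, - 1:]"
  have "Polynomial.degree ?g \<le> n" "Polynomial.degree ?h \<le> e - n" using * by (intro fbp_reflect; simp)+
  hence "Polynomial.degree (?g * ?h) \<le> e" using degree_mult_le[of ?g ?h] * by simp
  thus "Polynomial.degree (Polynomial.smult (q n) (?g * ?h)) \<le> e"
    using degree_smult_le order_trans by blast
qed simp

lemma coeff_eqpoly:
  assumes "d \<le> e" "e < p"
  shows "of_nat (fact e) * poly.coeff (eqpoly q d e u r) e = (- 1) ^ e * bpoly q d e"
proof -
  have "of_nat (fact e) * poly.coeff (eqpoly q d e u r) e =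
      (\<Sum>n\<le>d. (- 1) ^ e * (q n * of_nat (e choose n)))"
    unfolding eqpoly_def coeff_sum sum_distrib_left
  proof (intro sum.cong refl)
    fix n assume "n \<in> {..d}"
    hence n: "n \<le> e" "n < p" "e - n < p" using assms by auto
    let ?g = "pcompose (fbp n) [:of_nat r, - 1:]" and ?h = "pcompose (fbp (e - n)) [:of_nat (e + u) - of_nat n, - 1:]"
    have "poly.coeff (?g * ?h) e = poly.coeff ?g n * poly.coeff ?h (e - n)"
      using coeff_mult_top[OF fbp_reflect(1)[OF n(2)] fbp_reflect(1)[OF n(3)]] n(1) by simp
    also have "\<dots> = (- 1) ^ e * (inverse (of_nat (fact n)) * inverse (of_nat (fact (e - n))))"
      using n(1) by (simp add: fbp_reflect(2)[OF n(2)] fbp_reflect(2)[OF n(3)] mult_ac flip: power_add)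
    finally have 1: "poly.coeff (?g * ?h) e = (- 1) ^ e * (inverse (of_nat (fact n)) * inverse (of_nat (fact (e - n))))" .
    have "(of_nat (fact e) :: 'p mod_ring) = of_nat (fact n) * of_nat (fact (e - n)) * of_nat (e choose n)"
      using binomial_fact_lemma[OF n(1)] by (metis of_nat_mult)
    hence "of_nat (fact e) * (inverse (of_nat (fact n)) * inverse (of_nat (fact (e - n)))) = (of_nat (e choose n) :: 'p mod_ring)"
      using fact_nonzero[OF n(2)] fact_nonzero[OF n(3)] by (simp add: field_simps)
    hence H: "of_nat (e choose n) = of_nat (fact e) * (inverse (of_nat (fact n)) * inverse (of_nat (fact (e - n))) :: 'p mod_ring)" ..
    show "of_nat (fact e) * poly.coeff (Polynomial.smult (q n) (?g * ?h)) e = (- 1) ^ e * (q n * of_nat (e choose n))"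
      unfolding coeff_smult 1 H by (simp only: mult_ac)
  qed
  thus ?thesis by (simp add: bpoly_def sum_distrib_left)
qed

text \<open>The difference of order \<open>e\<close> of a polynomial of degree at most \<open>e\<close> is its leading coefficient, up to sign and \<open>e!\<close>.\<close>

lemma eqpoly_difference:
  assumes "d \<le> e" "e < p"
  shows "(\<Sum>a\<le>e. (- 1) ^ a * of_nat (e choose a) * poly (eqpoly q d e u r) (x + of_nat a)) = bpoly q d e"
  unfolding sum_alternating_poly_plus[OF degree_eqpoly[OF assms] assms(2)] coeff_eqpoly[OF assms]
  by (simp flip: mult.assoc power_add power_mult_distrib)

section \<open>Generators modulo \<open>\<theta>\<close>\<close>

lemma subst_swap: "subst (mon a b) varY varX = (mon b a :: 'p mod_ring poly poly)"
  by (simp add: subst_mon) (simp add: mon_def mult.commute)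

lemma subm_swap: "subm r N \<Longrightarrow> F \<in> N \<Longrightarrow> subst F varY varX \<in> N"
  using submD(5)[of r N F 0 0 1 1] by simp

lemma theta_swap: "subst (theta ^ m * mon a b :: 'p mod_ring poly poly) varY varX = const ((- 1) ^ m) * (theta ^ m * mon b a)"
  using subst_theta_power[of m "mon a b" 0 1 1 0] by (simp add: subst_swap)

lemma subm_theta_swap:
  assumes "subm r N" "theta ^ m * mon a b \<in> N"
  shows "theta ^ m * mon b a \<in> N"
  using subm_const_cancel[OF assms(1), of "(- 1) ^ m" "theta ^ m * mon b a"] subm_swap[OF assms]
  by (simp add: theta_swap)

lemma subm_shear:
  assumes N: "subm r N" and F: "mon (r - i) i \<in> N" and i: "i \<le> r"
  shows "(\<Sum>t\<le>r. if [t = e] (mod (p - 1)) then const (of_nat (i choose t)) * mon (r - t) t else 0) \<in> N"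
proof -
  have "subst (mon (r - i) i) (lin 1 0) (lin 1 1) \<in> N" by (rule submD(5)[OF N F]) simp
  moreover have "subst (mon (r - i) i) (lin 1 0) (lin 1 1) = (lin 1 1 ^ (r - (r - i)) * varX ^ (r - i) :: 'p mod_ring poly poly)"
    using i by (simp add: subst_mon mult.commute)
  ultimately have "(\<Sum>t\<le>r. const (of_nat (r - (r - i) choose t)) * mon (r - t) t) \<in> N"
    using lin_power_mon[of "r - i" r] by simp
  hence "(\<Sum>t\<le>r. const (of_nat (i choose t)) * mon (r - t) t) \<in> N" using i by simp
  thus ?thesis by (rule subm_weight[OF N])
qed

text \<open>The monomial is a nonzero multiple of a weight component of \<open>X\<^bsup>r-i\<^esup> (X + Y)\<^sup>i\<close>: for \<open>i < p - 1\<close> different exponents lie in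
  different classes.\<close>

lemma mon_mem_mono:
  assumes N: "subm r N" and F: "mon (r - i) i \<in> N" and i: "i \<le> r" "i < p - 1" and k: "k \<le> i"
  shows "mon (r - k) k \<in> N"
proof -
  have "(\<Sum>t\<le>r. if [t = k] (mod (p - 1)) then const (of_nat (i choose t)) * mon (r - t) t else 0) =
      (\<Sum>t\<le>r. if t = k then const (of_nat (i choose k)) * (mon (r - k) k :: 'p mod_ring poly poly) else 0)"
  proof (intro sum.cong refl)
    fix t
    have "t = k" if "[t = k] (mod (p - 1))" "t \<le> i" using cong_small[OF that(1)] that(2) i k by simp
    thus "(if [t = k] (mod (p - 1)) then const (of_nat (i choose t)) * mon (r - t) t else 0) =
        (if t = k then const (of_nat (i choose k)) * (mon (r - k) k :: 'p mod_ring poly poly) else 0)"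
      by (cases "t \<le> i") (auto simp: binomial_eq_0)
  qed
  also have "\<dots> = const (of_nat (i choose k)) * mon (r - k) k" using i k by simp
  finally have "const (of_nat (i choose k)) * mon (r - k) k \<in> N"
    using subm_shear[OF N F i(1), of k] by simp
  thus ?thesis by (rule subm_const_cancel[OF N]) (use choose_nonzero[OF k] i in simp)
qed

lemma Xsub_mono: "k \<le> i \<Longrightarrow> i \<le> r \<Longrightarrow> i < p - 1 \<Longrightarrow> Xsub r k \<subseteq> (Xsub r i :: 'p mod_ring poly poly set)"
  using mon_mem_mono[OF subm_Xsub mon_in_Xsub] by (intro Xsub_least subm_Xsub) auto

lemma theta_mon_1: "(theta * mon a b :: 'p mod_ring poly poly) = mon (a + p) (b + 1) - mon (a + 1) (b + p)"
  by (simp add: theta_eq left_diff_distrib mon_mult add_ac)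

text \<open>Modulo \<open>\<theta>\<close>, the monomials \<open>X\<^sup>s\<^sup>-\<^sup>c Y\<^sup>c\<close> with \<open>0 < c < s\<close> depend only on \<open>c\<close> modulo \<open>p - 1\<close>.\<close>

lemma normal_form:
  assumes "homogeneous s (G :: 'p mod_ring poly poly)" "p \<le> s"
  shows "\<exists>\<alpha> \<beta> \<gamma> H. theta * H \<in> Vfil s 1 \<and>
    G = const \<alpha> * mon s 0 + const \<beta> * mon 0 s + (\<Sum>c\<in>{1..p - 1}. const (\<gamma> c) * mon (s - c) c) + theta * H"
proof -
  define S where "S = {G :: 'p mod_ring poly poly. \<exists>\<alpha> \<beta> \<gamma> H. theta * H \<in> Vfil s 1 \<and>
    G = const \<alpha> * mon s 0 + const \<beta> * mon 0 s + (\<Sum>c\<in>{1..p - 1}. const (\<gamma> c) * mon (s - c) c) + theta * H}"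
  have I: "const \<alpha> * mon s 0 + const \<beta> * mon 0 s + (\<Sum>c\<in>{1..p - 1}. const (\<gamma> c) * mon (s - c) c) + theta * H \<in> S"
    if "theta * H \<in> Vfil s 1" for \<alpha> \<beta> \<gamma> H unfolding S_def using that by blast
  note V1 = submD[OF subm_Vfil[of s 1]]
  have V0: "theta * 0 \<in> (Vfil s 1 :: 'p mod_ring poly poly set)" using V1(2) by simp
  have add: "F + G \<in> S" if "F \<in> S" "G \<in> S" for F G
  proof -
    from that obtain \<alpha> \<beta> \<gamma> H \<alpha>' \<beta>' \<gamma>' H' where
      F: "theta * H \<in> Vfil s 1" "F = const \<alpha> * mon s 0 + const \<beta> * mon 0 s + (\<Sum>c\<in>{1..p - 1}. const (\<gamma> c) * mon (s - c) c) + theta * H"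
      and G: "theta * H' \<in> Vfil s 1" "G = const \<alpha>' * mon s 0 + const \<beta>' * mon 0 s + (\<Sum>c\<in>{1..p - 1}. const (\<gamma>' c) * mon (s - c) c) + theta * H'"
      unfolding S_def by blast
    have "F + G = const (\<alpha> + \<alpha>') * mon s 0 + const (\<beta> + \<beta>') * mon 0 s + (\<Sum>c\<in>{1..p - 1}. const (\<gamma> c + \<gamma>' c) * mon (s - c) c) + theta * (H + H')"
      unfolding F(2) G(2) by (simp add: const_add distrib_right distrib_left sum.distrib)
    moreover have "theta * (H + H') \<in> Vfil s 1" using V1(3)[OF F(1) G(1)] by (simp add: distrib_left)
    ultimately show ?thesis using I by simp
  qed
  have scale: "const c * F \<in> S" if "F \<in> S" for c F
  proof -
    from that obtain \<alpha> \<beta> \<gamma> H where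
      F: "theta * H \<in> Vfil s 1" "F = const \<alpha> * mon s 0 + const \<beta> * mon 0 s + (\<Sum>c\<in>{1..p - 1}. const (\<gamma> c) * mon (s - c) c) + theta * H"
      unfolding S_def by blast
    have "const c * F = const (c * \<alpha>) * mon s 0 + const (c * \<beta>) * mon 0 s + (\<Sum>d\<in>{1..p - 1}. const (c * \<gamma> d) * mon (s - d) d) + theta * (const c * H)"
      unfolding F(2) by (simp add: const_mult distrib_left sum_distrib_left mult_ac)
    moreover have "theta * (const c * H) \<in> Vfil s 1" using V1(4)[OF F(1), of c] by (simp add: mult_ac)
    ultimately show ?thesis using I by simp
  qed
  have sum: "sum g T \<in> S" if "\<And>x. x \<in> T \<Longrightarrow> g x \<in> S" for g and T :: "nat set"
    using that
  proof (induction T rule: infinite_finite_induct)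
    case (insert x T)
    thus ?case using add by simp
  qed (use I[OF V0, of 0 0 "\<lambda>_. 0"] in simp_all)
  have mid: "mon (s - t) t \<in> S" if "0 < t" "t < s" for t using that
  proof (induction t rule: less_induct)
    case (less t)
    show ?case
    proof (cases "t < p")
      case True
      have "(\<Sum>c\<in>{1..p - 1}. const (if c = t then 1 else 0) * mon (s - c) c) =
          (\<Sum>c\<in>{1..p - 1}. if c = t then mon (s - t) t else (0 :: 'p mod_ring poly poly))"
        by (intro sum.cong) auto
      also have "\<dots> = mon (s - t) t" using True less.prems by simp
      finally show ?thesis using I[OF V0, of 0 0 "\<lambda>c. if c = t then 1 else 0"] by simp
    next
      case False
      define b where "b = t - p"
      obtain a where a: "s = t + a + 1" using less.prems less_imp_Suc_add by fastforce
      have t: "t = b + p" using False by (simp add: b_def)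
      have m: "mon (s - (b + 1)) (b + 1) \<in> S" using less.prems p3 by (intro less.IH) (simp_all add: t)
      have "homogeneous (a + b) (mon a b :: 'p mod_ring poly poly)" by (rule homogeneous_mon) simp
      hence "homogeneous (a + b) (const (- 1) * mon a b :: 'p mod_ring poly poly)" by (rule homogeneous_const)
      from Vfil_mult[OF this, of 1 s] have "theta ^ 1 * (const (- 1) * mon a b) \<in> (Vfil s 1 :: 'p mod_ring poly poly set)"
        by (simp add: a t)
      hence "theta * (const (- 1) * mon a b) \<in> S" using I[of "const (- 1) * mon a b" 0 0 "\<lambda>_. 0"] by simp
      from add[OF m this] have "mon (s - (b + 1)) (b + 1) - theta * mon a b \<in> S" by (simp add: const_minus)
      moreover have "mon (s - (b + 1)) (b + 1) - theta * mon a b = (mon (s - t) t :: 'p mod_ring poly poly)"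
        unfolding theta_mon_1 by (simp add: a t add_ac)
      ultimately show ?thesis by simp
    qed
  qed
  have mons: "mon (s - t) t \<in> S" if ts: "t \<le> s" for t
  proof -
    consider "t = 0" | "t = s" | "0 < t" "t < s" using ts by linarith
    thus ?thesis
      by cases (use I[OF V0, of 1 0 "\<lambda>_. 0"] I[OF V0, of 0 1 "\<lambda>_. 0"] mid in simp_all)
  qed
  have "G \<in> S" by (subst homogeneous_expand[OF assms(1)]) (intro sum scale mons, simp)
  thus ?thesis unfolding S_def by blast
qed

text \<open>The polynomials \<open>G\<close> with \<open>\<theta>\<^sup>m G \<in> N\<close> form a submodule, because \<open>\<theta>\<close> is semi-invariant.\<close>

lemma subm_theta_quotient:
  assumes N: "subm r N" and r: "s + m * (p + 1) = r"
  shows "subm s {G. homogeneous s G \<and> theta ^ m * G \<in> N}"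
  unfolding subm_def gsubmodule_V_iff
proof (intro conjI ballI allI impI)
  fix a b c d and G assume G: "G \<in> {G. homogeneous s G \<and> theta ^ m * G \<in> N}"
    and det: "a * d - b * c \<noteq> (0 :: 'p mod_ring)"
  have "const ((a * d - b * c) ^ m) * (theta ^ m * subst G (lin a c) (lin b d)) \<in> N"
    using submD(5)[OF N _ det, of "theta ^ m * G"] G by (simp only: subst_theta_power mem_Collect_eq)
  hence "theta ^ m * subst G (lin a c) (lin b d) \<in> N"
    by (rule subm_const_cancel[OF N]) (use det in simp)
  thus "subst G (lin a c) (lin b d) \<in> {G. homogeneous s G \<and> theta ^ m * G \<in> N}"
    using G by (simp add: homogeneous_subst)
next
  fix c G assume "G \<in> {G. homogeneous s G \<and> theta ^ m * G \<in> N}"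
  thus "const c * G \<in> {G. homogeneous s G \<and> theta ^ m * G \<in> N}"
    using submD(4)[OF N, of "theta ^ m * G" c] by (simp add: homogeneous_const mult.left_commute)
next
  fix G H assume "G \<in> {G. homogeneous s G \<and> theta ^ m * G \<in> N}" "H \<in> {G. homogeneous s G \<and> theta ^ m * G \<in> N}"
  thus "G + H \<in> {G. homogeneous s G \<and> theta ^ m * G \<in> N}"
    using submD(3)[OF N] by (simp add: homogeneous_add distrib_left)
qed (use submD(2)[OF N] in auto)

text \<open>Unipotent translates of \<open>X\<^bsup>s-(p-1)\<^esup> Y\<^bsup>p-1\<^esup>\<close> and weights give all monomials that occur in \<open>normal_form\<close>. So one element
  generates \<open>V\<^sup>(\<^sup>m\<^sup>)\<close> modulo \<open>V\<^sup>(\<^sup>m\<^sup>+\<^sup>1\<^sup>)\<close>.\<close>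

lemma Vfil_subset_if_generator:
  assumes N: "subm r N" and r: "s + m * (p + 1) = r" and s: "p \<le> s" and V: "Vfil r (m + 1) \<subseteq> N"
    and g: "theta ^ m * mon (s - (p - 1)) (p - 1) \<in> N"
  shows "Vfil r m \<subseteq> N"
proof
  let ?N = "{G. homogeneous s G \<and> theta ^ m * G \<in> N}"
  note S = subm_theta_quotient[OF N r]
  have E: "mon (s - (p - 1)) (p - 1) \<in> ?N" using g s by (simp add: homogeneous_mon)
  have ps: "p - 1 \<le> s" using s by simp
  have mid: "mon (s - c) c \<in> ?N" if c: "0 < c" "c < p - 1" for c
  proof -
    have "(\<Sum>t\<le>s. if [t = c] (mod (p - 1)) then const (of_nat (p - 1 choose t)) * mon (s - t) t else 0) =
        (\<Sum>t\<le>s. if t = c then const (of_nat (p - 1 choose c)) * (mon (s - c) c :: 'p mod_ring poly poly) else 0)"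
    proof (intro sum.cong refl)
      fix t
      have "t = c" if t: "[t = c] (mod (p - 1))" "t \<le> p - 1"
      proof -
        have "t \<noteq> p - 1" using t(1) c by (auto simp: cong_def)
        thus ?thesis using cong_small[OF t(1)] t(2) c by simp
      qed
      thus "(if [t = c] (mod (p - 1)) then const (of_nat (p - 1 choose t)) * mon (s - t) t else 0) =
          (if t = c then const (of_nat (p - 1 choose c)) * (mon (s - c) c :: 'p mod_ring poly poly) else 0)"
        by (cases "t \<le> p - 1") (auto simp: binomial_eq_0 simp del: One_nat_def)
    qed
    also have "\<dots> = const (of_nat (p - 1 choose c)) * mon (s - c) c" using c s by simp
    finally have "const (of_nat (p - 1 choose c)) * mon (s - c) c \<in> ?N"
      using subm_shear[OF S E ps, of c] by (simp only:)
    thus ?thesis by (rule subm_const_cancel[OF S]) (use choose_nonzero[of c "p - 1"] c p3 in simp)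
  qed
  have X: "mon s 0 \<in> ?N"
  proof -
    have "(\<Sum>t\<le>s. if [t = 0] (mod (p - 1)) then const (of_nat (p - 1 choose t)) * mon (s - t) t else 0) =
        (\<Sum>t\<le>s. (if t = 0 then mon s 0 else 0) + (if t = p - 1 then (mon (s - (p - 1)) (p - 1) :: 'p mod_ring poly poly) else 0))"
    proof (intro sum.cong refl)
      fix t
      have "t = 0 \<or> t = p - 1" if t: "[t = 0] (mod (p - 1))" "t \<le> p - 1"
        using cong_small[OF t(1)] t(2) p3 by (cases "t = p - 1") auto
      moreover have "[p - 1 = 0] (mod (p - 1))" by (simp add: cong_def)
      ultimately show "(if [t = 0] (mod (p - 1)) then const (of_nat (p - 1 choose t)) * mon (s - t) t else 0) =
          (if t = 0 then mon s 0 else 0) + (if t = p - 1 then (mon (s - (p - 1)) (p - 1) :: 'p mod_ring poly poly) else 0)"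
        using p3 by (cases "t \<le> p - 1") (auto simp: binomial_eq_0 simp del: One_nat_def)
    qed
    also have "\<dots> = mon s 0 + mon (s - (p - 1)) (p - 1)" using s by (simp add: sum.distrib)
    finally have "mon s 0 + mon (s - (p - 1)) (p - 1) \<in> ?N"
      using subm_shear[OF S E ps, of 0] by (simp only:)
    from subm_diff[OF S this E] show ?thesis by simp
  qed
  have Y: "mon 0 s \<in> ?N" using subm_swap[OF S X] by (simp only: subst_swap)
  fix F :: "'p mod_ring poly poly" assume F: "F \<in> Vfil r m"
  have "m * (p + 1) \<le> r" using r by simp
  moreover have "r - m * (p + 1) = s" using r by simp
  moreover have "homogeneous r F" "theta ^ m dvd F" using F by (simp_all add: Vfil_iff)
  ultimately obtain G where G: "homogeneous s G" "F = theta ^ m * G"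
    using theta_power_dvdE[of r F m] by metis
  from normal_form[OF G(1) s] obtain \<alpha> \<beta> \<gamma> and H :: "'p mod_ring poly poly" where H: "theta * H \<in> Vfil s 1"
    "G = const \<alpha> * mon s 0 + const \<beta> * mon 0 s + (\<Sum>c\<in>{1..p - 1}. const (\<gamma> c) * mon (s - c) c) + theta * H" by blast
  have "theta ^ m * (theta * H) \<in> Vfil r (m + 1)"
    using H(1) Vfil_mult[of s "theta * H" m r] r by (simp add: Vfil_iff mult_ac)
  hence "theta * H \<in> ?N" using V H(1) by (auto simp: Vfil_iff)
  moreover have "(\<Sum>c\<in>{1..p - 1}. const (\<gamma> c) * mon (s - c) c) \<in> ?N"
  proof (intro subm_sum[OF S] submD(4)[OF S])
    fix c assume "c \<in> {1..p - 1}"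
    thus "mon (s - c) c \<in> ?N" using mid[of c] E by (cases "c = p - 1") auto
  qed
  ultimately have "G \<in> ?N" unfolding H(2) by (intro submD(3)[OF S] submD(4)[OF S] X Y)
  thus "F \<in> N" by (simp add: G(2))
qed

section \<open>Steps of the filtration that are reached by the monomial submodules\<close>

text \<open>The number \<open>j\<close> is \<open>[a - i]\<close> in the theorem. It is a separate argument since the proofs pass between pairs \<open>(i, j)\<close> with
  the same sum.\<close>

definition admissible :: "nat \<Rightarrow> nat \<Rightarrow> nat \<Rightarrow> bool" where
  "admissible i j r \<longleftrightarrow> 1 \<le> j \<and> j \<le> i \<and> i < p - 1 \<and> [i + j = r] (mod (p - 1)) \<and> i * (p + 1) + p \<le> r"

lemma admissibleD:
  assumes "admissible i j r"
  shows "1 \<le> j" "j \<le> i" "i < p - 1" "[i + j = r] (mod (p - 1))" "i * (p + 1) + p \<le> r" "2 * p \<le> r" "i \<le> r" "i + j < r"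
proof -
  show 1: "1 \<le> j" "j \<le> i" "i < p - 1" "[i + j = r] (mod (p - 1))" "i * (p + 1) + p \<le> r"
    using assms by (auto simp: admissible_def)
  have "1 * (p + 1) \<le> i * (p + 1)" using 1 by (intro mult_le_mono1) simp
  hence "1 * (p + 1) + p \<le> i * (p + 1) + p" by (rule add_right_mono)
  hence "1 * (p + 1) + p \<le> r" using 1(5) by (rule le_trans)
  thus "2 * p \<le> r" by simp
  thus "i \<le> r" "i + j < r" using 1(2,3) by simp_all
qed

lemma XV_functional:
  assumes K: "kills f (XV r i m)" and i: "i \<le> r" "i < p - 1"
  shows "k \<le> i \<Longrightarrow> kills f (Xsub r k)" "kills f (Vfil r m)"
    "k \<le> i \<Longrightarrow> f (mon (r - k) k) = 0" "k \<le> i \<Longrightarrow> f (mon k (r - k)) = 0"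
proof -
  show X: "k \<le> i \<Longrightarrow> kills f (Xsub r k)" for k
    using K Xsub_XV[of r i m] Xsub_mono[of k i r] i unfolding kills_def by blast
  show "kills f (Vfil r m)" using K Vfil_XV[OF i(1), of m] unfolding kills_def by blast
  show "k \<le> i \<Longrightarrow> f (mon (r - k) k) = 0" using killsD[OF X mon_in_Xsub] .
  show "k \<le> i \<Longrightarrow> f (mon k (r - k)) = 0"
    using killsD[OF X subm_swap[OF subm_Xsub mon_in_Xsub], of k] i by (simp add: subst_swap)
qed

lemma theta_class:
  assumes "s + d * (p + 1) = r" "x = 0 \<or> x = p - 1" "x \<le> s"
  shows "[d + (s - x) + d = r] (mod (p - 1))"
proof -
  obtain P where P: "p = Suc P" using p3 by (cases p) auto
  have "[r = d + s + d] (mod (p - 1))"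
  proof -
    have "r = d + s + d + d * (p - 1)" using assms(1) by (simp add: P)
    thus ?thesis by (simp add: cong_def)
  qed
  moreover have "[d + s + d = d + (s - x) + d] (mod (p - 1))"
  proof -
    have "d + s + d = d + (s - x) + d + x" using assms(3) by simp
    moreover have "[x = 0] (mod (p - 1))" using assms(2) by (auto simp: cong_def)
    ultimately show ?thesis by (metis add.right_neutral cong_add_lcancel_nat)
  qed
  ultimately show ?thesis by (metis cong_sym cong_trans)
qed

lemma class_shift:
  assumes "[i + j = r] (mod (p - 1))" "i + j \<le> r" "k + n \<le> i + j"
  shows "[r - k - n = i + j - k - n] (mod (p - 1))"
proof -
  have "[r - k - n + (k + n) = i + j - k - n + (k + n)] (mod (p - 1))"
    using cong_sym[OF assms(1)] assms(2,3) by simp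
  thus ?thesis by (rule cong_add_rcancel_nat[THEN iffD1])
qed

text \<open>In the equation for \<open>k = i\<close> every term except the one of \<open>q j\<close> has a vanishing class sum.\<close>

lemma reach_below_coeff:
  assumes st: "admissible i j r" and ji: "j < i" and nz: "of_nat (r - i choose j) \<noteq> (0 :: 'p mod_ring)"
    and f: "functional f" and k: "kills f (XV r i (j + 1))" and q: "fits f r j i q"
  shows "q j = 0"
proof -
  note st' = admissibleD[OF st]
  note K = XV_functional[OF k st'(7,3)]
  have "(\<Sum>n\<le>j. q n * of_nat (r - i choose n) * class_sum (r - i - n) (i - n)) =
      (if i \<le> j then of_nat (r - i choose i) * (bpoly q j i - f (mon (r - i) i)) else 0) +
      (if j \<le> j then of_nat (r - i choose (r - j)) * (bpoly q j (r - j) - f (mon j (r - j))) else 0)"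
    by (rule Xsub_bpoly_equation[OF f K(1)[OF order_refl] st'(7) q st'(2,3) _ st'(4)]) (use st'(2,3,6) in simp_all)
  also have "r - i choose (r - j) = 0" using ji st'(8) by (intro binomial_eq_0) simp
  finally have 0: "(\<Sum>n\<le>j. q n * of_nat (r - i choose n) * class_sum (r - i - n) (i - n)) = 0"
    using ji by simp
  have "class_sum (r - i - n) (i - n) = (if n = j then of_nat (p - 1 choose (i - j)) else 0)" if n: "n \<le> j" for n
  proof -
    have c: "[r - i - n = j - n] (mod (p - 1))"
      using class_shift[OF st'(4), of i n] st'(8) n by simp
    have pos: "0 < r - i - n" "i - n < p - 1" "i - n \<noteq> 0" using n ji st'(3,8) by simp_all
    show ?thesis
    proof (cases "n = j")
      case True
      have "[r - i - n = p - 1] (mod (p - 1))" using c True by (simp add: cong_def)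
      thus ?thesis using class_sum_value[OF _ pos(1) _ order_refl pos(2)] pos(3) p3 True by simp
    next
      case False
      have 1: "1 \<le> j - n" "j - n \<le> p - 1" using n False ji st'(3) by simp_all
      have "j - n choose (i - n) = 0" using ji n by (intro binomial_eq_0) simp
      thus ?thesis using class_sum_value[OF c pos(1) 1 pos(2)] pos(3) False by (simp add: binomial_eq_0)
    qed
  qed
  hence "(\<Sum>n\<le>j. q n * of_nat (r - i choose n) * class_sum (r - i - n) (i - n)) =
      (\<Sum>n\<le>j. if n = j then q j * of_nat (r - i choose j) * of_nat (p - 1 choose (i - j)) else 0)"
    by (intro sum.cong refl) simp
  also have "\<dots> = q j * of_nat (r - i choose j) * of_nat (p - 1 choose (i - j))" by simp
  finally have "q j * of_nat (r - i choose j) * of_nat (p - 1 choose (i - j)) = 0" using 0 by simp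
  moreover have "of_nat (p - 1 choose (i - j)) \<noteq> (0 :: 'p mod_ring)"
    using st'(3) by (intro choose_nonzero) simp_all
  ultimately show "q j = 0" using nz by simp
qed

lemma admissible_quotient:
  assumes "admissible i j r" "m \<le> i"
  shows "r - m * (p + 1) + m * (p + 1) = r" "p \<le> r - m * (p + 1)"
proof -
  have "m * (p + 1) \<le> i * (p + 1)" using assms(2) by (rule mult_le_mono1)
  hence "m * (p + 1) + p \<le> r" using admissibleD(5)[OF assms(1)] by linarith
  thus "r - m * (p + 1) + m * (p + 1) = r" "p \<le> r - m * (p + 1)" by simp_all
qed

lemma reach_below:
  assumes st: "admissible i j r" and ji: "j < i" and nz: "of_nat (r - i choose j) \<noteq> (0 :: 'p mod_ring)"
  shows "Vfil r j \<subseteq> (XV r i (j + 1) :: 'p mod_ring poly poly set)"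
proof -
  note st' = admissibleD[OF st]
  define s where "s = r - j * (p + 1)"
  have s: "s + j * (p + 1) = r" "p \<le> s" using admissible_quotient[OF st st'(2)] by (simp_all only: s_def)
  note N = subm_XV[OF st'(7), of "j + 1"]
  have jp: "0 < j" "j < p" "j + 1 < p" using st'(1) ji st'(3) by simp_all
  have "theta ^ j * mon (p - 1) (s - (p - 1)) \<in> (XV r i (j + 1) :: 'p mod_ring poly poly set)"
  proof (rule mem_subm_if_functional[OF N])
    fix f :: "'p mod_ring poly poly \<Rightarrow> 'p mod_ring"
    assume f: "functional f" and k: "kills f (XV r i (j + 1))"
    obtain q where q: "fits f r j i q"
      using functional_bpoly[OF f XV_functional(2)[OF k st'(7,3)] jp(3)] .
    have "[j + (s - (p - 1)) + j = i + j] (mod (p - 1))"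
      using cong_trans[OF theta_class[OF s(1), of "p - 1"] cong_sym[OF st'(4)]] s(2) by simp
    hence c: "[j + (s - (p - 1)) = i] (mod (p - 1))" by (simp only: cong_add_rcancel_nat)
    have "p - 1 + (s - (p - 1)) + j * (p + 1) = r" using s by simp
    from functional_theta_mon_value[OF f jp(1,2) this q c] s(2) p3
    show "f (theta ^ j * mon (p - 1) (s - (p - 1))) = 0"
      by (simp add: reach_below_coeff[OF st ji nz f k q])
  qed
  from subm_theta_swap[OF N this] show ?thesis
    using Vfil_subset_if_generator[OF N s] Vfil_XV[OF st'(7), of "j + 1"] by blast
qed

lemma top_equation:
  assumes st: "admissible i j r" and f: "functional f" and k: "kills f (XV r i (i + 1))" and q: "fits f r i i q" and ki: "k \<le> i"
  shows "(\<Sum>n\<le>i. q n * of_nat (r - k choose n) * class_sum (r - k - n) (i - n)) =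
    of_nat (r - k choose i) * bpoly q i i + of_nat (r - k choose (r - j)) * bpoly q i (r - j)"
proof -
  note st' = admissibleD[OF st]
  note K = XV_functional[OF k st'(7,3)]
  have "(\<Sum>n\<le>i. q n * of_nat (r - k choose n) * class_sum (r - k - n) (i - n)) =
      (if i \<le> i then of_nat (r - k choose i) * (bpoly q i i - f (mon (r - i) i)) else 0) +
      (if j \<le> i then of_nat (r - k choose (r - j)) * (bpoly q i (r - j) - f (mon j (r - j))) else 0)"
    by (rule Xsub_bpoly_equation[OF f K(1)[OF ki] _ q order_refl st'(3) _ st'(4)]) (use st'(2,3,6,7) ki in simp_all)
  thus ?thesis using K(3)[OF order_refl] K(4)[OF st'(2)] st'(2) by simp
qed

lemma class_sum_top:
  assumes st: "admissible i j r" and n: "n \<le> i" and e: "n \<le> e" "j \<le> e" "e \<le> i" and k: "k \<le> i + j - e" "k + n < i + j"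
  shows "class_sum (r - k - n) (e - n) = of_nat (i + j - k - n choose (e - n))"
proof -
  note st' = admissibleD[OF st]
  show ?thesis
    by (rule class_sum_choose[OF class_shift[OF st'(4)]]) (use st'(2,3,8) n e k in simp_all)
qed

text \<open>This is the equation for \<open>k = j\<close>, where each class sum is \<open>1\<close>, except for \<open>2\<close> at \<open>n = i\<close>.\<close>

lemma top_coeff:
  assumes st: "admissible i j r" and f: "functional f" and k: "kills f (XV r i (i + 1))" and q: "fits f r i i q"
    and nz: "of_nat (r - j choose i) \<noteq> (0 :: 'p mod_ring)"
  shows "q i = bpoly q i i"
proof -
  note st' = admissibleD[OF st]
  have "class_sum (r - j - n) (i - n) = 1 + (if n = i then 1 else 0)" if n: "n \<le> i" for n
  proof (cases "n = i")
    case True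
    have "[r - j - i = p - 1] (mod (p - 1))"
      using class_shift[OF st'(4), of j i] st'(8) by (simp add: cong_def add.commute)
    thus ?thesis using class_sum_value[of "r - j - i" "p - 1" 0] st'(8) p3 True by (simp add: add.commute)
  next
    case False
    thus ?thesis using class_sum_top[OF st n n st'(2) order_refl, of j] st'(2) n by simp
  qed
  hence "(\<Sum>n\<le>i. q n * of_nat (r - j choose n) * class_sum (r - j - n) (i - n)) =
      (\<Sum>n\<le>i. q n * of_nat (r - j choose n) + (if n = i then q i * of_nat (r - j choose i) else 0))"
    by (intro sum.cong refl) (auto simp: distrib_left)
  also have "\<dots> = bpoly q i (r - j) + q i * of_nat (r - j choose i)"
    by (simp add: sum.distrib bpoly_def)
  finally have "of_nat (r - j choose i) * (q i - bpoly q i i) = 0"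
    using top_equation[OF st f k q st'(2)] by (simp add: algebra_simps)
  thus ?thesis using nz by simp
qed

text \<open>In the equation for \<open>k = j + s\<close> the contributions of \<open>q i\<close> cancel by \<open>top_coeff\<close>. What remains involves \<open>q (i - s)\<close> and the
  coefficients \<open>q (i - s')\<close> with \<open>0 < s' < s\<close>, which vanish by induction.\<close>

lemma middle_coeffs:
  assumes st: "admissible i j r" and f: "functional f" and k: "kills f (XV r i (i + 1))" and q: "fits f r i i q"
    and nz: "\<And>s. s \<le> i - j \<Longrightarrow> of_nat (r - (j + s) choose (i - s)) \<noteq> (0 :: 'p mod_ring)"
    and s: "1 \<le> s" "s \<le> i - j"
  shows "q (i - s) = 0"
  using s
proof (induction s rule: less_induct)
  case (less s)
  note st' = admissibleD[OF st]
  have qi: "q i = bpoly q i i" using top_coeff[OF st f k q] nz[of 0] by simp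
  let ?k = "j + s"
  have ki: "?k \<le> i" using less.prems(2) st'(2) by simp
  have z: "r - ?k choose (r - j) = 0" using less.prems st'(2,8) by (intro binomial_eq_0) simp
  have pos: "0 < r - ?k - n" if "n \<le> i" for n using that st'(8) less.prems st'(5,6,3) by simp
  have "q n * of_nat (r - ?k choose n) * class_sum (r - ?k - n) (i - n) =
      (if n = i - s then q (i - s) * of_nat (r - ?k choose (i - s)) * of_nat (p - 1 choose s) else 0) +
      (if n = i then q i * of_nat (r - ?k choose i) else 0)" if n: "n \<le> i" for n
  proof -
    consider "n < i - s" | "n = i - s" | "i - s < n" "n < i" | "n = i" using n by linarith
    thus ?thesis
    proof cases
      case 1
      have c: "[r - ?k - n = i - n - s] (mod (p - 1))"
        using class_shift[OF st'(4), of ?k n] st'(8) 1 by (simp add: diff_diff_add add.commute add.left_commute)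
      have "class_sum (r - ?k - n) (i - n) = of_nat (i - n - s choose (i - n)) + (if i - n = 0 \<and> i - n - s = p - 1 then 1 else 0)"
        using 1 st'(3) by (intro class_sum_value[OF c pos[OF n]]) simp_all
      moreover have "i - n \<noteq> 0" using 1 by simp
      moreover have "i - n - s choose (i - n) = 0" using 1 less.prems(1) by (intro binomial_eq_0) simp
      ultimately show ?thesis using 1 by (simp add: binomial_eq_0)
    next
      case 2
      have sn: "i - n = s" using 2 less.prems(2) by simp
      have "[r - ?k - n = p - 1] (mod (p - 1))"
        using class_shift[OF st'(4), of ?k n] st'(8) 2 less.prems(2) by (simp add: cong_def add.commute add.left_commute)
      hence "class_sum (r - ?k - n) (i - n) = of_nat (p - 1 choose s) + (if s = 0 \<and> p - 1 = p - 1 then 1 else 0)"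
        unfolding sn using p3 st'(3) less.prems(2) by (intro class_sum_value pos[OF n]) simp_all
      thus ?thesis using 2 less.prems by simp
    next
      case 3
      have "q (i - (i - n)) = 0" using 3 less.prems by (intro less.IH) simp_all
      hence "q n = 0" using n by simp
      thus ?thesis using 3 by simp
    next
      case 4
      have "[r - ?k - n + s = p - 1 - s + s] (mod (p - 1))"
        using class_shift[OF st'(4), of j n] st'(8) 4 less.prems st'(3) pos[OF n]
        by (simp add: cong_def add.commute add.left_commute)
      hence "[r - ?k - n = p - 1 - s] (mod (p - 1))" by (simp only: cong_add_rcancel_nat)
      hence "class_sum (r - ?k - n) (i - n) = of_nat (p - 1 - s choose (i - n)) + (if i - n = 0 \<and> p - 1 - s = p - 1 then 1 else 0)"
        using p3 st'(3) less.prems 4 by (intro class_sum_value pos[OF n]) simp_all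
      thus ?thesis using 4 less.prems p3 by auto
    qed
  qed
  hence "(\<Sum>n\<le>i. q n * of_nat (r - ?k choose n) * class_sum (r - ?k - n) (i - n)) =
      (\<Sum>n\<le>i. (if n = i - s then q (i - s) * of_nat (r - ?k choose (i - s)) * of_nat (p - 1 choose s) else 0) +
      (if n = i then q i * of_nat (r - ?k choose i) else 0))"
    by (intro sum.cong refl) simp
  also have "\<dots> = q (i - s) * of_nat (r - ?k choose (i - s)) * of_nat (p - 1 choose s) + q i * of_nat (r - ?k choose i)"
    by (simp add: sum.distrib)
  finally have "q (i - s) * of_nat (r - ?k choose (i - s)) * of_nat (p - 1 choose s) = 0"
    unfolding top_equation[OF st f k q ki] z using qi by simp
  moreover have "of_nat (p - 1 choose s) \<noteq> (0 :: 'p mod_ring)"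
    using st'(3) less.prems by (intro choose_nonzero) simp_all
  ultimately show ?case using nz[OF less.prems(2)] by simp
qed

lemma choose_Suc_times: "Suc n * (N choose Suc n) = (N - n) * (N choose n)"
  using binomial_absorption[of n N] binomial_absorb_comp[of N n] by simp

text \<open>With \<open>q n = 0\<close> for \<open>j \<le> n < i\<close>, the left-hand sides are, up to the term of \<open>q i\<close>, the values of a polynomial of degree
  less than \<open>i\<close> at \<open>0, \<dots>, i + 1\<close>. Its differences of order \<open>i\<close> at \<open>0\<close> and at \<open>1\<close> vanish. These are two linear equations in
  \<open>q i\<close> and the boundary value, and eliminating the latter leaves \<open>(r - j + 1) q i = 0\<close> up to a unit.\<close>

lemma reach_top_coeff:
  assumes st: "admissible i j r" and f: "functional f" and k: "kills f (XV r i (i + 1))" and q: "fits f r i i q"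
    and nz: "of_nat (r - j + 1 choose (i + 1)) \<noteq> (0 :: 'p mod_ring)"
  shows "q i = 0"
proof -
  note st' = admissibleD[OF st]
  obtain j' where j': "j = Suc j'" using st'(1) by (cases j) auto
  have ip: "i + 1 < p" using st'(3) by simp
  have x: "i + 1 \<le> (r - j + 1) mod p" using nz unfolding choose_zero_iff[OF ip] by (simp only: not_less)
  define x0 where "x0 = (r - j + 1) mod p"
  have x0: "i + 1 \<le> x0" "x0 < p" using x p3 by (simp_all add: x0_def)
  have modx: "[r - (j + s) = x0 - 1 - s] (mod p)" if "s \<le> i - j" for s
  proof -
    have "[r - (j + s) + (s + 1) = x0 - 1 - s + (s + 1)] (mod p)"
      using that x0 st'(2,8) by (simp add: x0_def cong_def)
    thus ?thesis by (rule cong_add_rcancel_nat[THEN iffD1])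
  qed
  have nzs: "of_nat (r - (j + s) choose (i - s)) \<noteq> (0 :: 'p mod_ring)" if "s \<le> i - j" for s
    using choose_cong[OF modx[OF that], of "i - s"] choose_nonzero[of "i - s" "x0 - 1 - s"] x0 ip that by simp
  have nzr: "of_nat (r - j + 1) \<noteq> (0 :: 'p mod_ring)"
    using x0 by (simp only: of_nat_eq_0) (auto simp: x0_def dvd_eq_mod_eq_0 simp del: One_nat_def)
  have qi: "q i = bpoly q i i" using top_coeff[OF st f k q] nzs[of 0] by simp
  have mid: "q n = 0" if "j \<le> n" "n < i" for n
    using middle_coeffs[OF st f k q nzs, of "i - n"] that by simp
  have split: "(\<Sum>n\<le>i. q n * g n) = (\<Sum>n\<le>j'. q n * g n) + q i * g i" for g
  proof -
    have "(\<Sum>n\<le>i. q n * g n) = (\<Sum>n\<in>insert i {..j'}. q n * g n)"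
      using st'(2) mid by (intro sum.mono_neutral_right) (auto simp: j')
    thus ?thesis using st'(2) by (simp add: j' add.commute)
  qed
  define R where "R = r - j"
  define \<kappa> where "\<kappa> = q i * of_nat (R choose i)"
  have bi: "bpoly q j' i = 0"
    using split[of "\<lambda>n. of_nat (i choose n)"] qi by (simp add: bpoly_def)
  let ?A = "eqpoly q j' i j r"
  have A: "poly ?A (of_nat k) = of_nat (r - k choose R) * bpoly q i R - (if k = j then \<kappa> else 0)" if ki: "k \<le> i + 1" for k
  proof -
    have P: "poly ?A (of_nat k) = (\<Sum>n\<le>j'. q n * of_nat (r - k choose n) * of_nat (i + j - n - k choose (i - n)))"
      using ki st'(2,3,8) by (intro poly_eqpoly_nat) (simp_all add: j')
    consider "k < j" | "k = j" | "j < k" by linarith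
    thus ?thesis
    proof cases
      case 1
      have "of_nat (r - k choose i) * bpoly q i i + of_nat (r - k choose R) * bpoly q i R =
          (\<Sum>n\<le>i. q n * of_nat (r - k choose n) * class_sum (r - k - n) (i - n))"
        unfolding R_def using 1 st'(2) by (intro top_equation[OF st f assms(3) q, symmetric]) simp
      also have "\<dots> = (\<Sum>n\<le>i. q n * (of_nat (r - k choose n) * of_nat (i + j - k - n choose (i - n))))"
      proof (intro sum.cong refl)
        fix n assume "n \<in> {..i}"
        thus "q n * of_nat (r - k choose n) * class_sum (r - k - n) (i - n) =
            q n * (of_nat (r - k choose n) * of_nat (i + j - k - n choose (i - n)))"
          using class_sum_top[OF st, of n i k] 1 st'(2) by (simp add: mult.assoc)
      qed
      also have "\<dots> = poly ?A (of_nat k) + q i * of_nat (r - k choose i)"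
        unfolding split P using 1 by (simp add: add.commute mult.assoc)
      finally show ?thesis using 1 qi by (simp add: algebra_simps)
    next
      case 2
      have "poly ?A (of_nat k) = bpoly q j' R"
        unfolding P bpoly_def R_def
      proof (intro sum.cong refl)
        fix n assume "n \<in> {..j'}"
        have "i + j - n - k = i - n" using 2 st'(2) by simp
        thus "q n * of_nat (r - k choose n) * of_nat (i + j - n - k choose (i - n)) = q n * of_nat (r - j choose n)"
          using 2 by simp
      qed
      also have "\<dots> = bpoly q i R - \<kappa>"
        using split[of "\<lambda>n. of_nat (R choose n)"] by (simp add: bpoly_def \<kappa>_def)
      finally show ?thesis using 2 by (simp add: R_def)
    next
      case 3
      have "r - k choose R = 0" using 3 st'(8) by (intro binomial_eq_0) (simp add: R_def)
      moreover have "poly ?A (of_nat k) = 0"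
        unfolding P
      proof (intro sum.neutral ballI)
        fix n assume "n \<in> {..j'}"
        hence "i + j - n - k choose (i - n) = 0" using 3 st'(2) by (intro binomial_eq_0) (simp add: j')
        thus "q n * of_nat (r - k choose n) * of_nat (i + j - n - k choose (i - n)) = 0" by (simp add: binomial_eq_0)
      qed
      ultimately show ?thesis using 3 by (simp add: binomial_eq_0)
    qed
  qed
  have D: "(\<Sum>a\<le>i. (- 1) ^ a * of_nat (i choose a) * poly ?A (of_nat (x + a))) = 0" for x
    using eqpoly_difference[of j' i q j r "of_nat x"] bi st'(2,3) by (simp add: j')
  have R: "i \<le> R" "R - i = r - i - j" using st'(8) by (simp_all add: R_def)
  have E: "bpoly q i R * of_nat (r - x - i choose (R - i)) = (- 1) ^ (j - x) * of_nat (i choose (j - x)) * \<kappa>" if x: "x \<le> 1" for x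
  proof -
    have "0 = (\<Sum>a\<le>i. (- 1) ^ a * of_nat (i choose a) *
        (of_nat (r - (x + a) choose R) * bpoly q i R - (if x + a = j then \<kappa> else 0)))"
    proof -
      have "poly ?A (of_nat (x + a)) = of_nat (r - (x + a) choose R) * bpoly q i R - (if x + a = j then \<kappa> else 0)"
        if "a \<in> {..i}" for a using A[of "x + a"] that x by simp
      thus ?thesis using D[of x] by (simp del: of_nat_add)
    qed
    also have "\<dots> = (\<Sum>a\<le>i. bpoly q i R * ((- 1) ^ a * of_nat (i choose a) * of_nat (r - x - a choose R)) -
        (if a = j - x then (- 1) ^ (j - x) * of_nat (i choose (j - x)) * \<kappa> else 0))"
      using x st'(1) by (intro sum.cong refl) (auto simp: algebra_simps)
    also have "\<dots> = bpoly q i R * (\<Sum>a\<le>i. (- 1) ^ a * of_nat (i choose a) * of_nat (r - x - a choose R)) -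
        (- 1) ^ (j - x) * of_nat (i choose (j - x)) * \<kappa>"
      unfolding sum_subtractf sum_distrib_left using st'(2) by simp
    also have "(\<Sum>a\<le>i. (- 1) ^ a * of_nat (i choose a) * of_nat (r - x - a choose R)) = (of_nat (r - x - i choose (R - i)) :: 'p mod_ring)"
      using x st'(1,8) R(1) by (subst alternating_choose) simp_all
    finally show ?thesis by simp
  qed
  have c0: "r - i choose (R - i) = r - i choose Suc j'"
    using binomial_symmetric[of "Suc j'" "r - i"] st'(8) R(2) by (simp add: j')
  have c1: "r - 1 - i choose (R - i) = r - 1 - i choose j'"
    using binomial_symmetric[of j' "r - 1 - i"] st'(8) R(2) by (simp add: j')
  have E0: "bpoly q i R * of_nat (r - i choose Suc j') = - ((- 1) ^ j' * of_nat (i choose Suc j') * \<kappa>)"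
    using E[of 0] c0 by (simp add: j')
  have E1: "bpoly q i R * of_nat (r - 1 - i choose j') = (- 1) ^ j' * of_nat (i choose j') * \<kappa>"
    using E[of 1] c1 by (simp add: j')
  \<comment> \<open>The left-hand side of \<open>E\<close> for \<open>x = 0\<close> and \<open>x = 1\<close> differs by a known factor, which eliminates the boundary value.\<close>
  have N0: "Suc j' * (r - i choose Suc j') = (r - i) * (r - 1 - i choose j')"
    using binomial_absorption[of j' "r - i"] by (simp add: diff_right_commute)
  have N1: "Suc j' * (i choose Suc j') = (i - j') * (i choose j')" by (rule choose_Suc_times)
  have "- ((- 1) ^ j' * \<kappa> * of_nat (Suc j' * (i choose Suc j'))) = bpoly q i R * of_nat (Suc j' * (r - i choose Suc j'))"
    using arg_cong[OF E0, of "\<lambda>z. of_nat (Suc j') * z"] by (simp only: of_nat_mult mult_ac mult_minus_right)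
  also have "\<dots> = (- 1) ^ j' * \<kappa> * (of_nat (r - i) * of_nat (i choose j'))"
    unfolding N0 using arg_cong[OF E1, of "\<lambda>z. of_nat (r - i) * z"] by (simp only: of_nat_mult mult_ac)
  finally have "(- 1) ^ j' * \<kappa> * of_nat (i choose j') * (of_nat (r - i) + of_nat (i - j')) = 0"
    unfolding N1 of_nat_mult neg_eq_iff_add_eq_0 by (simp add: algebra_simps)
  moreover have "of_nat (r - i) + of_nat (i - j') = (of_nat (r - j + 1) :: 'p mod_ring)"
  proof -
    have "r - i + (i - j') = r - j + 1" using st'(2,8) by (simp add: j')
    thus ?thesis by (simp only: of_nat_add[symmetric])
  qed
  moreover have "of_nat (i choose j') \<noteq> (0 :: 'p mod_ring)" using st'(2,3) by (intro choose_nonzero) (simp_all add: j')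
  ultimately have "\<kappa> = 0" using nzr by simp
  thus ?thesis using nzs[of 0] by (simp add: \<kappa>_def R_def)
qed

section \<open>Generators that lie in the monomial submodules\<close>

lemma choose_nonzero_diff:
  assumes nz: "of_nat (N choose n) \<noteq> (0 :: 'p mod_ring)" and s: "s \<le> n" "n < p"
  shows "of_nat (N - s choose (n - s)) \<noteq> (0 :: 'p mod_ring)"
proof -
  have x: "n \<le> N mod p" using nz unfolding choose_zero_iff[OF s(2)] by (simp only: not_less)
  have "N mod p \<le> N" by simp
  hence N: "s \<le> N" using x s by linarith
  have "[N - s + s = N mod p - s + s] (mod p)" using x s N by (simp add: cong_def)
  hence "[N - s = N mod p - s] (mod p)" by (simp only: cong_add_rcancel_nat)
  moreover have "n - s < p" using s by simp
  ultimately have "of_nat (N - s choose (n - s)) = (of_nat (N mod p - s choose (n - s)) :: 'p mod_ring)"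
    by (rule choose_cong)
  moreover have "N mod p < p" using p3 by simp
  ultimately show ?thesis using choose_nonzero[of "n - s" "N mod p - s"] x by simp
qed

lemma reach_top:
  assumes st: "admissible i j r" and nz: "of_nat (r - j + 1 choose (i + 1)) \<noteq> (0 :: 'p mod_ring)"
  shows "Vfil r i \<subseteq> (XV r i (i + 1) :: 'p mod_ring poly poly set)"
proof -
  note st' = admissibleD[OF st]
  define s where "s = r - i * (p + 1)"
  have s: "s + i * (p + 1) = r" "p \<le> s" using admissible_quotient[OF st order_refl] by (simp_all only: s_def)
  note N = subm_XV[OF st'(7), of "i + 1"]
  have ip: "0 < i" "i < p" "i + 1 < p" using st'(1,2,3) by simp_all
  have "theta ^ i * mon (s - (p - 1)) (p - 1) \<in> (XV r i (i + 1) :: 'p mod_ring poly poly set)"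
  proof (rule mem_subm_if_functional[OF N])
    fix f :: "'p mod_ring poly poly \<Rightarrow> 'p mod_ring"
    assume f: "functional f" and k: "kills f (XV r i (i + 1))"
    obtain q where q: "fits f r i i q"
      using functional_bpoly[OF f XV_functional(2)[OF k st'(7,3)] ip(3)] .
    have c: "[i + (p - 1) = i] (mod (p - 1))" by (simp add: cong_def)
    have "s - (p - 1) + (p - 1) + i * (p + 1) = r" using s by simp
    from functional_theta_mon_value[OF f ip(1,2) this q c] s(2) p3
    show "f (theta ^ i * mon (s - (p - 1)) (p - 1)) = 0"
      by (simp add: reach_top_coeff[OF st f k q nz])
  qed
  thus ?thesis
    using Vfil_subset_if_generator[OF N s] Vfil_XV[OF st'(7), of "i + 1"] by blast
qed

text \<open>The step at \<open>j\<close> comes from \<open>reach_below\<close> and the step at \<open>i\<close> from \<open>reach_top\<close>. The steps in between come from the pair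
  \<open>(i - 1, j + 1)\<close>, which has the same sum.\<close>

lemma reach_all:
  assumes "admissible i j r" "of_nat (r - j + 1 choose (i + 1)) \<noteq> (0 :: 'p mod_ring)"
  shows "Vfil r j \<subseteq> (XV r i (i + 1) :: 'p mod_ring poly poly set)"
  using assms
proof (induction "i - j" arbitrary: i j rule: less_induct)
  case less
  note st = less.prems(1) and nz = less.prems(2)
  note st' = admissibleD[OF st]
  note top = reach_top[OF st nz] and N = subm_XV[OF st'(7), of "i + 1"]
  show ?case
  proof (cases "i = j")
    case False
    hence ji: "j < i" using st'(2) by simp
    have sub: "XV r (i - 1) i \<subseteq> (XV r i (i + 1) :: 'p mod_ring poly poly set)"
      using Xsub_mono[of "i - 1" i r] st'(3,7) Xsub_XV[of r i "i + 1"] top by (intro XV_least[OF N]) auto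
    have next_step: "Vfil r (j + 1) \<subseteq> (XV r i (i + 1) :: 'p mod_ring poly poly set)"
    proof (cases "i = j + 1")
      case True
      thus ?thesis using top by simp
    next
      case False
      have "admissible (i - 1) (j + 1) r"
      proof -
        have "(i - 1) * (p + 1) \<le> i * (p + 1)" by (intro mult_le_mono1) simp
        hence "(i - 1) * (p + 1) + p \<le> r" using st'(5) by linarith
        thus ?thesis unfolding admissible_def using st' ji False by auto
      qed
      moreover have "of_nat (r - (j + 1) + 1 choose (i - 1 + 1)) \<noteq> (0 :: 'p mod_ring)"
      proof -
        have "r - (j + 1) + 1 = r - j + 1 - 1" "i - 1 + 1 = i + 1 - 1" using st'(8) ji by simp_all
        moreover have "1 \<le> i + 1" "i + 1 < p" using st'(3) by simp_all
        ultimately show ?thesis using choose_nonzero_diff[OF nz] by (simp only:) blast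
      qed
      moreover have "i - 1 - (j + 1) < i - j" using ji by simp
      ultimately have "Vfil r (j + 1) \<subseteq> (XV r (i - 1) (i - 1 + 1) :: 'p mod_ring poly poly set)"
        using less.hyps by blast
      thus ?thesis using sub ji by (simp add: subset_trans)
    qed
    have "r - j + 1 - (i + 1 - j) = r - i" "i + 1 - (i + 1 - j) = j" using st'(2,8) by simp_all
    hence "of_nat (r - i choose j) \<noteq> (0 :: 'p mod_ring)"
      using choose_nonzero_diff[OF nz, of "i + 1 - j"] st'(3) by simp
    from reach_below[OF st ji this] show ?thesis
      using XV_least[OF N Xsub_XV next_step] by (rule subset_trans)
  qed (use top in simp)
qed

text \<open>The value of a form on \<open>\<theta>\<^sup>i X\<^sup>s\<close> is the difference of the two sides in \<open>top_coeff\<close>.\<close>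

lemma top_generator:
  assumes st: "admissible i j r" and nz: "of_nat (r - j choose i) \<noteq> (0 :: 'p mod_ring)" and s: "s + i * (p + 1) = r"
  shows "theta ^ i * mon s 0 \<in> (XV r i (i + 1) :: 'p mod_ring poly poly set)"
proof (rule mem_subm_if_functional[OF subm_XV])
  note st' = admissibleD[OF st]
  show "i \<le> r" using st' by simp
  fix f :: "'p mod_ring poly poly \<Rightarrow> 'p mod_ring"
  assume f: "functional f" and k: "kills f (XV r i (i + 1))"
  have ip: "0 < i" "i < p" "i + 1 < p" using st'(1,2,3) by simp_all
  obtain q where q: "fits f r i i q"
    using functional_bpoly[OF f XV_functional(2)[OF k st'(7,3)] ip(3)] .
  have "s + 0 + i * (p + 1) = r" "[i + 0 = i] (mod (p - 1))" using s by simp_all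
  from functional_theta_mon_value[OF f ip(1,2) this(1) q this(2)]
  show "f (theta ^ i * mon s 0) = 0"
    using XV_functional(3)[OF k st'(7,3) order_refl] top_coeff[OF st f k q nz] s st'(5) p3 by auto
qed

text \<open>For \<open>r \<equiv> i\<close> modulo \<open>p\<close> the values of the polynomial \<open>eqpoly\<close> are known at \<open>1, \<dots>, i + 1\<close>: at \<open>k \<le> i\<close> from the equations and
  at \<open>i + 1\<close> because only the term of \<open>q j\<close> is nonzero there. The identity is the difference of order \<open>i\<close> at \<open>1\<close>.\<close>

lemma boundary_coeff:
  assumes st: "admissible i j r" and ri: "[r = i] (mod p)" and f: "functional f" and k: "kills f (XV r i (j + 1))"
    and q: "fits f r j i q"
  shows "q j = bpoly q j i + (- 1) ^ j * bpoly q j (r - j)"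
proof -
  note st' = admissibleD[OF st]
  note K = XV_functional[OF k st'(7,3)]
  let ?A = "eqpoly q j i j r" and ?P = "bpoly q j (r - j)"
  have ip: "i < p" using st'(3) by simp
  have rk: "of_nat (r - k choose n) = (of_nat (i - k choose n) :: 'p mod_ring)" if "k \<le> i" "n < p" for k n
  proof (rule choose_cong[OF _ that(2)])
    have "[r - k + k = i - k + k] (mod p)" using ri that(1) st'(7) by simp
    thus "[r - k = i - k] (mod p)" by (simp only: cong_add_rcancel_nat)
  qed
  have rp: "of_nat (r - 1 - i choose n) = ((- 1) ^ n :: 'p mod_ring)" if "n < p" for n
  proof -
    have "[r - 1 - i + (i + 1) = p - 1 + (i + 1)] (mod p)" 
    proof -
      have "r - 1 - i + (i + 1) = r" "p - 1 + (i + 1) = i + p" using st'(1,8) p3 by simp_all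
      thus ?thesis using ri by (simp only: cong_def mod_add_self2)
    qed
    hence "[r - 1 - i = p - 1] (mod p)" by (simp only: cong_add_rcancel_nat)
    from choose_cong[OF this that] show ?thesis using choose_p_minus_1[OF that] by simp
  qed
  have A: "poly ?A (of_nat k) = of_nat (r - k choose (r - j)) * ?P" if ki: "1 \<le> k" "k \<le> i" for k
  proof -
    have cl: "of_nat (r - k choose n) * class_sum (r - k - n) (i - n) = of_nat (r - k choose n) * of_nat (i + j - n - k choose (i - n))"
      if n: "n \<le> j" for n
    proof (cases "k + n = i + j")
      case True
      have "of_nat (r - k choose n) = (0 :: 'p mod_ring)"
        using rk[OF ki(2), of n] True ki n st'(1,2) ip by (simp add: binomial_eq_0)
      thus ?thesis by simp
    next
      case False
      have kn: "k + n < i + j" using False ki(2) n by simp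
      have c: "[r - k - n = i + j - k - n] (mod (p - 1))"
        using class_shift[OF st'(4), of k n] st'(8) kn by simp
      have pos: "0 < r - k - n" using st'(8) kn by simp
      have "class_sum (r - k - n) (i - n) = of_nat (i + j - k - n choose (i - n))"
      proof (cases "k \<le> j")
        case True
        thus ?thesis using kn st'(2,3) n by (intro class_sum_choose[OF c pos]) simp_all
      next
        case False
        have "class_sum (r - k - n) (i - n) = of_nat (i + j - k - n choose (i - n)) + (if i - n = 0 \<and> i + j - k - n = p - 1 then 1 else 0)"
          using kn False st'(3) by (intro class_sum_value[OF c pos]) simp_all
        moreover have "i + j - k - n \<noteq> p - 1" using False st'(3) by simp
        ultimately show ?thesis by simp
      qed
      moreover have "i + j - k - n = i + j - n - k" by simp
      ultimately show ?thesis by (simp only:)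
    qed
    have "poly ?A (of_nat k) = (\<Sum>n\<le>j. q n * of_nat (r - k choose n) * of_nat (i + j - n - k choose (i - n)))"
      using ki st'(2,7) ip by (intro poly_eqpoly_nat) simp_all
    also have "\<dots> = (\<Sum>n\<le>j. q n * of_nat (r - k choose n) * class_sum (r - k - n) (i - n))"
      using cl by (intro sum.cong refl) (simp only: mult.assoc atMost_iff)
    also have "\<dots> = (if i \<le> j then of_nat (r - k choose i) * (bpoly q j i - f (mon (r - i) i)) else 0) +
        (if j \<le> j then of_nat (r - k choose (r - j)) * (bpoly q j (r - j) - f (mon j (r - j))) else 0)"
      by (rule Xsub_bpoly_equation[OF f K(1)[OF ki(2)] _ q st'(2,3) _ st'(4)]) (use st'(2,3,6,7) ki in simp_all)
    also have "of_nat (r - k choose i) = (0 :: 'p mod_ring)"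
      using rk[OF ki(2) ip] ki by (simp add: binomial_eq_0)
    finally show ?thesis using K(4)[OF st'(2)] by simp
  qed
  have Ai: "poly ?A (of_nat (i + 1)) = (- 1) ^ i * q j"
  proof -
    have "q n * (poly (fbp n) (of_nat r - of_nat (i + 1)) * poly (fbp (i - n)) (of_nat (i + j) - of_nat n - of_nat (i + 1))) =
        (if n = j then (- 1) ^ i * q j else 0)" if n: "n \<le> j" for n
    proof -
      have r1: "of_nat r - of_nat (i + 1) = (of_nat (r - 1 - i) :: 'p mod_ring)" 
        using st'(1,8) by (simp add: of_nat_diff)
      show ?thesis
      proof (cases "n = j")
        case True
        have "poly (fbp j) (of_nat r - of_nat (i + 1)) = (- 1) ^ j"
          unfolding r1 using poly_fbp[of j "r - 1 - i"] rp[of j] ip st'(2) by simp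
        moreover have "of_nat (i + j) - of_nat j - of_nat (i + 1) = (of_nat (p - 1) :: 'p mod_ring)"
          unfolding of_nat_p_minus_1 by simp
        moreover have "poly (fbp (i - j)) (of_nat (p - 1)) = (- 1) ^ (i - j)"
          using poly_fbp[of "i - j" "p - 1"] choose_p_minus_1[of "i - j"] ip by simp
        ultimately have "poly (fbp n) (of_nat r - of_nat (i + 1)) * poly (fbp (i - n)) (of_nat (i + j) - of_nat n - of_nat (i + 1)) =
            (- 1) ^ j * (- 1) ^ (i - j)"
          using True by (simp only:)
        also have "\<dots> = (- 1) ^ i" using st'(2) by (simp flip: power_add)
        finally show ?thesis using True by simp
      next
        case False
        have "of_nat (i + j) - of_nat n - of_nat (i + 1) = (of_nat (j - n - 1) :: 'p mod_ring)"
          using n False by (simp add: of_nat_diff)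
        moreover have "poly (fbp (i - n)) (of_nat (j - n - 1)) = 0"
          using poly_fbp[of "i - n" "j - n - 1"] n False st'(2) ip by (simp add: binomial_eq_0)
        ultimately show ?thesis using False by simp
      qed
    qed
    hence "poly ?A (of_nat (i + 1)) = (\<Sum>n\<le>j. if n = j then (- 1) ^ i * q j else 0)"
      unfolding poly_eqpoly by (intro sum.cong refl) (simp only: atMost_iff)
    thus ?thesis by simp
  qed
  have "bpoly q j i = (\<Sum>a\<le>i. (- 1) ^ a * of_nat (i choose a) * poly ?A (of_nat (1 + a)))"
    using eqpoly_difference[OF st'(2) ip, of q j r 1] by simp
  also have "\<dots> = (\<Sum>a\<le>i. ?P * ((- 1) ^ a * of_nat (i choose a) * of_nat (r - 1 - a choose (r - j))) + (if a = i then q j else 0))"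
  proof (intro sum.cong refl)
    fix a assume "a \<in> {..i}"
    hence a: "a \<le> i" by simp
    show "(- 1) ^ a * of_nat (i choose a) * poly ?A (of_nat (1 + a)) =
        ?P * ((- 1) ^ a * of_nat (i choose a) * of_nat (r - 1 - a choose (r - j))) + (if a = i then q j else 0)"
    proof (cases "a = i")
      case True
      have z: "r - 1 - i choose (r - j) = 0" using st'(2,8) by (intro binomial_eq_0) simp
      have "poly ?A (of_nat (1 + a)) = (- 1) ^ i * q j" using Ai True by (simp only: add.commute)
      hence "(- 1) ^ a * of_nat (i choose a) * poly ?A (of_nat (1 + a)) = (- 1) ^ i * (- 1) ^ i * q j"
        using True by (simp only: binomial_n_n of_nat_1 mult_1_right mult.assoc)
      also have "\<dots> = q j" by (simp flip: power_add power_mult_distrib)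
      finally show ?thesis using True z by (simp add: binomial_eq_0)
    next
      case False
      hence "poly ?A (of_nat (1 + a)) = of_nat (r - (1 + a) choose (r - j)) * ?P" using a by (intro A) simp_all
      moreover have "r - (1 + a) = r - 1 - a" by simp
      ultimately show ?thesis using False by (simp only: mult_ac if_False add_0_right)
    qed
  qed
  also have "\<dots> = ?P * (\<Sum>a\<le>i. (- 1) ^ a * of_nat (i choose a) * of_nat (r - 1 - a choose (r - j))) + q j"
    by (simp add: sum.distrib sum_distrib_left)
  also have "(\<Sum>a\<le>i. (- 1) ^ a * of_nat (i choose a) * of_nat (r - 1 - a choose (r - j))) = (of_nat (r - 1 - i choose (r - j - i)) :: 'p mod_ring)"
    using st'(1,8) by (subst alternating_choose) simp_all
  also have "r - 1 - i choose (r - j - i) = r - 1 - i choose (j - 1)"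
  proof -
    have "r - 1 - i - (j - 1) = r - j - i" "j - 1 \<le> r - 1 - i" using st'(1,8) by simp_all
    thus ?thesis using binomial_symmetric[of "j - 1" "r - 1 - i"] by simp
  qed
  also have "of_nat (r - 1 - i choose (j - 1)) = (- ((- 1) ^ j) :: 'p mod_ring)"
  proof -
    obtain j' where "j = Suc j'" using st'(1) by (cases j) auto
    thus ?thesis using rp[of "j - 1"] ip st'(2) by simp
  qed
  finally show ?thesis by (simp add: algebra_simps)
qed

lemma boundary_generator:
  assumes st: "admissible i j r" and ri: "[r = i] (mod p)" and s: "s + j * (p + 1) = r"
  shows "j < i \<Longrightarrow> theta ^ j * mon 0 s \<in> (XV r i (j + 1) :: 'p mod_ring poly poly set)"
    and "i = j \<Longrightarrow> theta ^ j * (mon s 0 + mon 0 s - mon (s - (p - 1)) (p - 1)) \<in> (XV r i (j + 1) :: 'p mod_ring poly poly set)"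
proof -
  note st' = admissibleD[OF st]
  note N = subm_XV[OF st'(7), of "j + 1"]
  have jp: "0 < j" "j < p" "j + 1 < p" using st'(1,2,3) by simp_all
  have sp: "p \<le> s"
    using admissible_quotient(2)[OF st st'(2)] s by simp
  have "[j + (s - 0) + j = i + j] (mod (p - 1))"
    using cong_trans[OF theta_class[OF s, of 0] cong_sym[OF st'(4)]] by simp
  hence c: "[j + s = i] (mod (p - 1))" by (simp only: cong_add_rcancel_nat diff_zero)
  have rs: "0 + s + j * (p + 1) = r" "s + 0 + j * (p + 1) = r" "s - (p - 1) + (p - 1) + j * (p + 1) = r"
    using s sp by simp_all
  show "theta ^ j * mon 0 s \<in> (XV r i (j + 1) :: 'p mod_ring poly poly set)" if ji: "j < i"
  proof (rule mem_subm_if_functional[OF N])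
    fix f :: "'p mod_ring poly poly \<Rightarrow> 'p mod_ring"
    assume f: "functional f" and k: "kills f (XV r i (j + 1))"
    obtain q where q: "fits f r j i q"
      using functional_bpoly[OF f XV_functional(2)[OF k st'(7,3)] jp(3)] .
    have "bpoly q j i = 0"
      using fitsD[OF q, of i] XV_functional(3)[OF k st'(7,3) order_refl] ji st'(8) by simp
    hence "q j = (- 1) ^ j * bpoly q j (r - j)" using boundary_coeff[OF st ri f k q] by simp
    thus "f (theta ^ j * mon 0 s) = 0"
      using functional_theta_mon_value[OF f jp(1,2) rs(1) q c] XV_functional(4)[OF k st'(7,3) st'(2)] sp p3 by simp
  qed
  show "theta ^ j * (mon s 0 + mon 0 s - mon (s - (p - 1)) (p - 1)) \<in> (XV r i (j + 1) :: 'p mod_ring poly poly set)" if ij: "i = j"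
  proof (rule mem_subm_if_functional[OF N])
    fix f :: "'p mod_ring poly poly \<Rightarrow> 'p mod_ring"
    assume f: "functional f" and k: "kills f (XV r i (j + 1))"
    obtain q where q: "fits f r j i q"
      using functional_bpoly[OF f XV_functional(2)[OF k st'(7,3)] jp(3)] .
    have c0: "[j + 0 = i] (mod (p - 1))" "[j + (p - 1) = i] (mod (p - 1))" using ij by (simp_all add: cong_def)
    have z: "f (mon (r - j) j) = 0" "f (mon j (r - j)) = 0"
      using XV_functional(3,4)[OF k st'(7,3) st'(2)] by simp_all
    have v: "f (theta ^ j * mon 0 s) = q j - (- 1) ^ j * bpoly q j (r - j)"
      "f (theta ^ j * mon s 0) = q j - bpoly q j j"
      "f (theta ^ j * mon (s - (p - 1)) (p - 1)) = q j"
      using functional_theta_mon_value[OF f jp(1,2) rs(1) q c] functional_theta_mon_value[OF f jp(1,2) rs(2) q c0(1)]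
        functional_theta_mon_value[OF f jp(1,2) rs(3) q c0(2)] z sp p3 by simp_all
    have "theta ^ j * (mon s 0 + mon 0 s - mon (s - (p - 1)) (p - 1)) =
        theta ^ j * mon s 0 + theta ^ j * mon 0 s + const (- 1) * (theta ^ j * mon (s - (p - 1)) (p - 1) :: 'p mod_ring poly poly)"
      by (simp add: algebra_simps const_minus)
    thus "f (theta ^ j * (mon s 0 + mon 0 s - mon (s - (p - 1)) (p - 1))) = 0"
      using f boundary_coeff[OF st ri f k q] ij
      by (simp add: functional_def v functional_const[OF f] del: One_nat_def)
  qed
qed

section \<open>Enlarging the monomial submodule\<close>

lemma poly_eq_0_if_zeros:
  fixes g :: "'p mod_ring poly"
  assumes "Polynomial.degree g < card S" "S \<subseteq> {..<p}" "\<And>k. k \<in> S \<Longrightarrow> poly g (of_nat k) = 0"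
  shows "g = 0"
proof (rule ccontr)
  assume g: "g \<noteq> 0"
  have "inj_on (of_nat :: nat \<Rightarrow> 'p mod_ring) S"
    using subsetD[OF assms(2)] by (intro inj_onI) (auto simp: of_nat_eq cong_def)
  hence "card S = card ((of_nat :: nat \<Rightarrow> 'p mod_ring) ` S)" by (simp add: card_image)
  also have "\<dots> \<le> card {x. poly g x = 0}"
    using assms(3) by (intro card_mono poly_roots_finite[OF g]) auto
  also have "\<dots> \<le> Polynomial.degree g" by (rule card_poly_roots_bound[OF g])
  finally show False using assms(1) by simp
qed

text \<open>The polynomial \<open>eqpoly\<close> has degree at most \<open>e\<close> and \<open>e + 1\<close> zeros: the equations give \<open>0, \<dots>, j - 1\<close>, and vanishing binomial
  coefficients give \<open>i + j - e + 1, \<dots>, i + 1\<close>. So its leading coefficient is zero, which is the value of the form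
  at the monomial.\<close>

lemma mon_in_lower_XV:
  assumes st: "admissible i j r" and e: "j \<le> e" "e \<le> i"
  shows "mon (r - e) e \<in> (XV r (j - 1) j :: 'p mod_ring poly poly set)"
proof -
  note st' = admissibleD[OF st]
  define d where "d = j - 1"
  define u where "u = i + j - e"
  have d: "j = d + 1" "d \<le> r" "d < p - 1" "d + 1 < p" "d < e" "d < u" using st' e by (simp_all add: d_def u_def)
  have u: "u < p - 1" "e + u = i + j" "e < p - 1" "e < p" using st' e by (simp_all add: u_def)
  have "mon (r - e) e \<in> (XV r d (d + 1) :: 'p mod_ring poly poly set)"
  proof (rule mem_subm_if_functional[OF subm_XV[OF d(2)]])
    fix f :: "'p mod_ring poly poly \<Rightarrow> 'p mod_ring"
    assume f: "functional f" and k: "kills f (XV r d (d + 1))"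
    obtain q where q: "fits f r d e q"
      using functional_bpoly[OF f XV_functional(2)[OF k d(2,3)] d(4)] .
    let ?A = "eqpoly q d e u r"
    have eu: "[e + u = r] (mod (p - 1))" using st'(4) u(2) by simp
    have P: "poly ?A (of_nat k) = (\<Sum>n\<le>d. q n * of_nat (r - k choose n) * of_nat (e + u - n - k choose (e - n)))"
      if "k \<le> i + 1" for k
      using that st'(8) d(1,5) u st'(1) by (intro poly_eqpoly_nat) simp_all
    have "?A = 0"
    proof (rule poly_eq_0_if_zeros[where S = "{..<j} \<union> {u + 1..i + 1}"])
      have "{..<j} \<inter> {u + 1..i + 1} = {}" using d(1,6) by auto
      hence "card ({..<j} \<union> {u + 1..i + 1}) = e + 1" using e u(2) by (simp add: card_Un_disjoint)
      thus "Polynomial.degree ?A < card ({..<j} \<union> {u + 1..i + 1})"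
        using degree_eqpoly[of d e q u r] d(5) u(4) by simp
      show "{..<j} \<union> {u + 1..i + 1} \<subseteq> {..<p}" using st'(2,3) by auto
      fix k assume "k \<in> {..<j} \<union> {u + 1..i + 1}"
      then consider "k \<le> d" | "u < k" "k \<le> i + 1" using d(1) by fastforce
      thus "poly ?A (of_nat k) = 0"
      proof cases
        case 1
        have kr: "k \<le> r" using 1 d(2) by simp
        have "poly ?A (of_nat k) = (\<Sum>n\<le>d. q n * of_nat (r - k choose n) * of_nat (e + u - n - k choose (e - n)))"
          using 1 d(1) st'(2) by (intro P) simp
        also have "\<dots> = (\<Sum>n\<le>d. q n * of_nat (r - k choose n) * class_sum (r - k - n) (e - n))"
        proof (intro sum.cong refl)
          fix n assume "n \<in> {..d}"
          hence n: "n \<le> d" by simp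
          have "class_sum (r - k - n) (e - n) = of_nat (e + u - k - n choose (e - n))"
            using class_shift[OF eu, of k n] n 1 d u(1,3) u(2) st'(8) by (intro class_sum_choose) simp_all
          moreover have "e + u - k - n = e + u - n - k" by simp
          ultimately show "q n * of_nat (r - k choose n) * of_nat (e + u - n - k choose (e - n)) =
              q n * of_nat (r - k choose n) * class_sum (r - k - n) (e - n)" by (simp only:)
        qed
        also have "\<dots> = 0"
          using Xsub_bpoly_equation[OF f XV_functional(1)[OF k d(2,3) 1] kr q less_imp_le[OF d(5)] u(3,1) eu] d(1,5,6) u st'(8) e by simp
        finally show ?thesis .
      next
        case 2
        have "of_nat (e + u - n - k choose (e - n)) = (0 :: 'p mod_ring)" if "n \<le> d" for n
          using 2 that d(5) by (subst binomial_eq_0) simp_all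
        thus ?thesis unfolding P[OF 2(2)] by (intro sum.neutral) simp
      qed
    qed
    hence "bpoly q d e = 0" using eqpoly_difference[of d e q u r 0] d(5) u(4) by simp
    thus "f (mon (r - e) e) = 0" using fitsD[OF q d(5)] d u st'(8) e by simp
  qed
  thus ?thesis using d(1) by simp
qed

lemma XV_lower:
  assumes st: "admissible i j r"
  shows "XV r i j = (XV r (j - 1) j :: 'p mod_ring poly poly set)"
proof
  note st' = admissibleD[OF st]
  have j: "j - 1 \<le> r" using st' by simp
  show "XV r i j \<subseteq> (XV r (j - 1) j :: 'p mod_ring poly poly set)"
    using Xsub_least[OF subm_XV[OF j] mon_in_lower_XV[OF st st'(2) order_refl]] Vfil_XV[OF j]
    by (intro XV_least[OF subm_XV[OF j]])
  have "Xsub r (j - 1) \<subseteq> (Xsub r i :: 'p mod_ring poly poly set)" using st' by (intro Xsub_mono) simp_all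
  thus "XV r (j - 1) j \<subseteq> (XV r i j :: 'p mod_ring poly poly set)"
    using Xsub_XV[of r i j] Vfil_XV[OF st'(7), of j] by (intro XV_least[OF subm_XV[OF st'(7)]]) auto
qed

section \<open>Sums over the plane\<close>

definition ev :: "'p mod_ring poly poly \<Rightarrow> 'p mod_ring \<Rightarrow> 'p mod_ring \<Rightarrow> 'p mod_ring" where
  "ev F x y = poly (poly F [:y:]) x"

lemma ev_simps [simp]:
  "ev (F + G) x y = ev F x y + ev G x y" "ev (F - G) x y = ev F x y - ev G x y"
  "ev (F * G) x y = ev F x y * ev G x y" "ev (F ^ n) x y = ev F x y ^ n"
  "ev (const c) x y = c" "ev varX x y = x" "ev varY x y = y" "ev (lin a b) x y = a * x + b * y"
  "ev (mon u t) x y = x ^ u * y ^ t"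
  by (simp_all add: ev_def const_def varX_def varY_def lin_def mon_def poly_power)

lemma ev_sum: "ev (sum f S) x y = (\<Sum>i\<in>S. ev (f i) x y)"
  by (simp add: ev_def poly_sum)

lemma ev_expand: "homogeneous s F \<Longrightarrow> ev F x y = (\<Sum>t\<le>s. co F (s - t) t * (x ^ (s - t) * y ^ t))"
  by (subst homogeneous_expand[of s F]) (simp_all add: ev_sum)

lemma ev_subst:
  assumes "homogeneous s F"
  shows "ev (subst F A B) x y = ev F (ev A x y) (ev B x y)"
  by (subst (1 2) homogeneous_expand[OF assms])
    (simp add: subst_sum subst_mult subst_mon ev_sum)

definition total :: "'p mod_ring poly poly \<Rightarrow> 'p mod_ring" where
  "total F = (\<Sum>x\<in>UNIV. \<Sum>y\<in>UNIV. ev F x y)"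

lemma functional_total: "functional total"
  by (simp add: functional_def total_def sum.distrib sum_distrib_left)

lemma total_simps: "total 0 = 0" "total (F + G) = total F + total G" "total (const c * F) = c * total F"
  using functional_total functional_sum[OF functional_total, of "\<lambda>_. 0" "{}"] by (simp_all add: functional_def)

lemma total_mon: "total (mon a b) = (if 0 < a \<and> (p - 1) dvd a \<and> 0 < b \<and> (p - 1) dvd b then 1 else 0)"
proof -
  have "total (mon a b) = (\<Sum>x\<in>UNIV. x ^ a) * (\<Sum>y\<in>UNIV. y ^ b)"
    unfolding total_def ev_simps by (simp only: sum_product)
  thus ?thesis unfolding sum_power by simp
qed

lemma ev_theta [simp]: "ev theta x y = 0"
  by (simp add: theta_eq power_p)

lemma total_theta: "total (theta * G) = 0"
  by (simp add: total_def)

lemma bij_linear: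
  assumes "a * d - b * c \<noteq> (0 :: 'p mod_ring)"
  shows "bij (\<lambda>(x, y). (a * x + c * y, b * x + d * y))"
proof (rule o_bij)
  define e where "e = inverse (a * d - b * c)"
  have e: "e * (a * d - b * c) = 1" using assms by (simp add: e_def)
  let ?g = "\<lambda>(x, y). (e * (d * x - c * y), e * (a * y - b * x))"
  have "e * (d * (a * x + c * y) - c * (b * x + d * y)) = e * (a * d - b * c) * x"
    "e * (a * (b * x + d * y) - b * (a * x + c * y)) = e * (a * d - b * c) * y"
    "a * (e * (d * x - c * y)) + c * (e * (a * y - b * x)) = e * (a * d - b * c) * x"
    "b * (e * (d * x - c * y)) + d * (e * (a * y - b * x)) = e * (a * d - b * c) * y" for x y
    by (simp_all add: algebra_simps)
  thus "?g \<circ> (\<lambda>(x, y). (a * x + c * y, b * x + d * y)) = id" "(\<lambda>(x, y). (a * x + c * y, b * x + d * y)) \<circ> ?g = id"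
    unfolding e by auto
qed

lemma sum_linear:
  assumes "a * d - b * c \<noteq> (0 :: 'p mod_ring)"
  shows "(\<Sum>x\<in>UNIV. \<Sum>y\<in>UNIV. h (a * x + c * y) (b * x + d * y)) = (\<Sum>x\<in>UNIV. \<Sum>y\<in>UNIV. h x y)"
  unfolding sum.cartesian_product UNIV_Times_UNIV
  using sum.reindex_bij_betw[OF bij_linear[OF assms], of "\<lambda>(x, y). h x y"] by (simp add: case_prod_unfold)

lemma total_subst:
  assumes "homogeneous s F" "a * d - b * c \<noteq> 0"
  shows "total (subst F (lin a c) (lin b d)) = total F"
  unfolding total_def ev_subst[OF assms(1)] using sum_linear[OF assms(2), of "ev F"] by simp

lemma subst_inverse:
  assumes N: "subm s N" and G: "G \<in> N" and det: "a * d - b * c \<noteq> 0"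
  obtains H where "H \<in> N" "G = subst H (lin a c) (lin b d)"
proof -
  define e where "e = inverse (a * d - b * c)"
  have e: "e * (a * d - b * c) = 1" using det by (simp add: e_def)
  have "e * d * (e * a) - - (e * b) * - (e * c) = e * (e * (a * d - b * c))" by (simp add: algebra_simps)
  also have "\<dots> \<noteq> 0" using e by auto
  finally have "subst G (lin (e * d) (- (e * c))) (lin (- (e * b)) (e * a)) \<in> N" by (rule submD(5)[OF N G])
  moreover have "subst (subst G (lin (e * d) (- (e * c))) (lin (- (e * b)) (e * a))) (lin a c) (lin b d) = G"
  proof -
    have "const (e * d) * lin a c + const (- (e * c)) * lin b d = lin (e * (a * d - b * c)) 0"
      "const (- (e * b)) * lin a c + const (e * a) * lin b d = lin 0 (e * (a * d - b * c))"
      by (simp_all add: lin_def const_mult const_minus const_diff algebra_simps)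
    thus ?thesis unfolding subst_subst subst_lin e by (simp add: subst_varX_varY)
  qed
  ultimately show thesis using that by metis
qed

text \<open>The pairing \<open>(G, \<phi>) \<mapsto> \<Sum>\<^bsub>w\<^esub> G(w) \<phi>(w)\<close> over the points \<open>w\<close> of \<open>\<bbbF>\<^sub>p\<^sup>2\<close> is \<open>\<Gamma>\<close>-invariant.\<close>

lemma subm_orthogonal:
  assumes N: "subm s N"
  shows "subm n {\<phi>. homogeneous n \<phi> \<and> (\<forall>G\<in>N. total (G * \<phi>) = 0)}"
  unfolding subm_def gsubmodule_V_iff
proof (intro conjI ballI allI impI)
  fix a b c d \<phi> assume \<phi>: "\<phi> \<in> {\<phi>. homogeneous n \<phi> \<and> (\<forall>G\<in>N. total (G * \<phi>) = 0)}"
    and det: "a * d - b * c \<noteq> (0 :: 'p mod_ring)"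
  have "total (G * subst \<phi> (lin a c) (lin b d)) = 0" if G: "G \<in> N" for G
  proof -
    obtain H where H: "H \<in> N" "G = subst H (lin a c) (lin b d)" using subst_inverse[OF N G det] .
    have "homogeneous (s + n) (H * \<phi>)" using \<phi> submD(1)[OF N H(1)] by (simp add: homogeneous_mult)
    from total_subst[OF this det] show ?thesis using \<phi> H(1) by (simp add: H(2) subst_mult)
  qed
  thus "subst \<phi> (lin a c) (lin b d) \<in> {\<phi>. homogeneous n \<phi> \<and> (\<forall>G\<in>N. total (G * \<phi>) = 0)}"
    using \<phi> by (simp add: homogeneous_subst)
qed (auto simp: total_simps homogeneous_add homogeneous_const distrib_left mult.left_commute[of _ "const _"])

text \<open>The inequalities make \<open>mon_mem_mono\<close> applicable to \<open>X\<^sup>a Y\<^sup>b\<close> and, after exchanging the variables, to \<open>X\<^sup>b Y\<^sup>a\<close>. Together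
  the two reach every exponent, even for \<open>n \<ge> p - 1\<close>.\<close>

lemma all_monomials:
  assumes N: "subm n N" and m: "mon a b \<in> N" and ab: "a + b = n" "a < p - 1" "b < p - 1" and t: "t \<le> n"
  shows "mon (n - t) t \<in> N"
proof -
  have m': "mon b a \<in> N" using subm_swap[OF N m] by (simp only: subst_swap)
  show ?thesis
  proof (cases "t \<le> b")
    case True
    thus ?thesis using mon_mem_mono[OF N, of b t] m ab by auto
  next
    case False
    have "mon (n - (n - t)) (n - t) \<in> N" using mon_mem_mono[OF N, of a "n - t"] m' ab t False by auto
    from subm_swap[OF N this] show ?thesis using t by (simp add: subst_swap)
  qed
qed

text \<open>The forms of degree \<open>a + b\<close> that are orthogonal to \<open>N\<close> are a submodule, to which \<open>all_monomials\<close> applies.\<close>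

lemma moments_vanish:
  assumes N: "subm s N" and z: "\<And>G. G \<in> N \<Longrightarrow> total (G * mon a b) = 0" and ab: "a < p - 1" "b < p - 1"
    and "G \<in> N" "t \<le> a + b"
  shows "total (G * mon (a + b - t) t) = 0"
  using all_monomials[OF subm_orthogonal[OF N], of a b "a + b" t] z ab assms(5,6) by (simp add: homogeneous_mon)

lemma total_mult_mon:
  assumes "homogeneous s G"
  shows "total (G * mon a b) = (\<Sum>t\<le>s. co G (s - t) t * total (mon (s - t + a) (t + b)))"
proof -
  have "G * mon a b = (\<Sum>t\<le>s. const (co G (s - t) t) * mon (s - t + a) (t + b))"
    by (subst homogeneous_expand[OF assms]) (simp add: sum_distrib_right mult.assoc mon_mult)
  thus ?thesis by (simp add: functional_sum[OF functional_total] functional_const[OF functional_total])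
qed

lemma poly_zero_if_vanishes:
  fixes g :: "nat \<Rightarrow> 'p mod_ring"
  assumes z: "\<And>y. y \<noteq> 0 \<Longrightarrow> (\<Sum>c\<in>{1..p - 1}. g c * y ^ c) = 0" and c: "c \<in> {1..p - 1}"
  shows "g c = 0"
proof -
  define h where "h = (\<Sum>c\<in>{1..p - 1}. Polynomial.monom (g c) c)"
  have "poly h y = 0" for y
    using z[of y] by (cases "y = 0") (auto simp: h_def poly_sum poly_monom power_0_left)
  moreover have "Polynomial.degree h \<le> p - 1"
    unfolding h_def by (rule degree_sum_le) (auto intro: order_trans[OF degree_monom_le])
  ultimately have "h = 0" using p3 by (intro poly_eq_0_if_zeros[of h "{..<p}"]) auto
  hence "poly.coeff h c = 0" by simp
  moreover have "poly.coeff h c = (\<Sum>d\<in>{1..p - 1}. if d = c then g c else 0)"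
    unfolding h_def coeff_sum by (intro sum.cong) auto
  ultimately show ?thesis using c by simp
qed

text \<open>The coefficient of \<open>X\<^sup>s\<close> is the value at \<open>(1, 0)\<close>, and \<open>\<Gamma>\<close> is transitive on the nonzero vectors of \<open>\<bbbF>\<^sub>p\<^sup>2\<close>. So all members of
  \<open>N\<close> vanish on the plane, and by \<open>normal_form\<close> such polynomials are multiples of \<open>\<theta>\<close>.\<close>

lemma Vfil_if_leading_coeff_0:
  assumes N: "subm s N" and s: "p \<le> s" and z: "\<And>G. G \<in> N \<Longrightarrow> co G s 0 = 0"
  shows "N \<subseteq> Vfil s 1"
proof
  fix G assume G: "G \<in> N"
  obtain \<alpha> \<beta> \<gamma> and H :: "'p mod_ring poly poly" where H: "theta * H \<in> Vfil s 1"
    "G = const \<alpha> * mon s 0 + const \<beta> * mon 0 s + (\<Sum>c\<in>{1..p - 1}. const (\<gamma> c) * mon (s - c) c) + theta * H"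
    using normal_form[OF submD(1)[OF N G] s] by blast
  have E: "ev G' 1 0 = 0" if "G' \<in> N" for G'
  proof -
    have "ev G' 1 0 = (\<Sum>t\<le>s. if t = 0 then co G' s 0 else 0)"
      unfolding ev_expand[OF submD(1)[OF N that]] by (intro sum.cong) (auto simp: power_0_left)
    thus ?thesis using z[OF that] by simp
  qed
  have th: "ev (theta * H) x y = 0" for x y by simp
  have EG: "ev G x y = \<alpha> * x ^ s + \<beta> * y ^ s + (\<Sum>c\<in>{1..p - 1}. \<gamma> c * (x ^ (s - c) * y ^ c))" for x y
    unfolding H(2) ev_simps(1) th using s p3 by (simp add: ev_sum power_0_left)
  have EN: "ev G x y = 0" if xy: "x \<noteq> 0 \<or> y \<noteq> 0" for x y
  proof -
    obtain c d where det: "x * d - y * c \<noteq> 0"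
    proof (cases "x = 0")
      case True
      thus thesis using that[of 1 0] that[of 0 1] that xy by (cases "y = 0") (auto intro: that[of 0 1])
    next
      case False
      thus thesis using that[of 1 0] by simp
    qed
    have "ev (subst G (lin x c) (lin y d)) 1 0 = 0" by (rule E[OF submD(5)[OF N G det]])
    thus ?thesis by (simp add: ev_subst[OF submD(1)[OF N G]])
  qed
  have "\<alpha> = 0" using EN[of 1 0] EG[of 1 0] s p3 by (simp add: power_0_left)
  moreover have b: "\<beta> = 0"
  proof -
    have "(\<Sum>c\<in>{1..p - 1}. \<gamma> c * ((0 :: 'p mod_ring) ^ (s - c) * 1 ^ c)) = 0"
      using s p3 by (intro sum.neutral) (auto simp: power_0_left)
    thus ?thesis using EN[of 0 1] EG[of 0 1] s p3 by (simp add: power_0_left del: One_nat_def)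
  qed
  moreover have "\<gamma> c = 0" if "c \<in> {1..p - 1}" for c
    using that
  proof (rule poly_zero_if_vanishes[rotated])
    fix y :: "'p mod_ring" assume "y \<noteq> 0"
    thus "(\<Sum>c\<in>{1..p - 1}. \<gamma> c * y ^ c) = 0" using EN[of 1 y] EG[of 1 y] \<open>\<alpha> = 0\<close> \<open>\<beta> = 0\<close> by simp
  qed
  ultimately show "G \<in> Vfil s 1" using H by simp
qed

section \<open>The homomorphism \<open>V\<^sub>s \<rightarrow> V\<^sub>n\<close> given by the moments of degree \<open>n\<close>\<close>

text \<open>The linear form \<open>w\<^sub>1 Y - w\<^sub>2 X\<close> is the one that vanishes at \<open>w\<close>. It is preserved by \<open>\<Gamma>\<close> up to the determinant, so the sum is
  equivariant up to a power of it, and its coefficients are the moments of degree \<open>n\<close>.\<close>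

definition moment_map :: "nat \<Rightarrow> 'p mod_ring poly poly \<Rightarrow> 'p mod_ring poly poly" where
  "moment_map n G = (\<Sum>x\<in>UNIV. \<Sum>y\<in>UNIV. const (ev G x y) * lin (- y) x ^ n)"

lemma homogeneous_moment_map: "homogeneous n (moment_map n G)"
proof -
  have "homogeneous n (lin a b ^ n :: 'p mod_ring poly poly)" for a b
    using homogeneous_power[OF homogeneous_lin[of a b], of n] by simp
  thus ?thesis unfolding moment_map_def by (intro homogeneous_sum homogeneous_const)
qed

lemma moment_map_add: "moment_map n (F + G) = moment_map n F + moment_map n G"
  and moment_map_const: "moment_map n (const c * G) = const c * moment_map n G"
  by (simp_all add: moment_map_def const_add const_mult distrib_right sum.distrib sum_distrib_left mult.assoc)

lemma moment_map_theta: "moment_map n (theta * G) = 0"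
  by (simp add: moment_map_def)

lemma moment_map_expand:
  "moment_map n G = (\<Sum>t\<le>n. const (of_nat (n choose t) * (- 1) ^ (n - t) * total (G * mon t (n - t))) * mon (n - t) t)"
proof -
  have L: "lin (- y) x ^ n = (\<Sum>t\<le>n. const (of_nat (n choose t) * ((- y) ^ (n - t) * x ^ t)) * (mon (n - t) t :: 'p mod_ring poly poly))" for x y
    using lin_power_expand[of 0 n "- y" x] by simp
  have "moment_map n G = (\<Sum>x\<in>UNIV. \<Sum>y\<in>UNIV. \<Sum>t\<le>n. const (of_nat (n choose t) * (- 1) ^ (n - t) * ev (G * mon t (n - t)) x y) * mon (n - t) t)"
    unfolding moment_map_def L sum_distrib_left
  proof (intro sum.cong refl)
    fix x y :: "'p mod_ring" and t
    show "const (ev G x y) * (const (of_nat (n choose t) * ((- y) ^ (n - t) * x ^ t)) * mon (n - t) t) =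
        const (of_nat (n choose t) * (- 1) ^ (n - t) * ev (G * mon t (n - t)) x y) * mon (n - t) t"
      by (simp add: power_minus[of y] const_mult mult_ac)
  qed
  also have "\<dots> = (\<Sum>x\<in>UNIV. \<Sum>t\<le>n. \<Sum>y\<in>UNIV. const (of_nat (n choose t) * (- 1) ^ (n - t) * ev (G * mon t (n - t)) x y) * mon (n - t) t)"
    by (intro sum.cong refl sum.swap)
  also have "\<dots> = (\<Sum>t\<le>n. \<Sum>x\<in>UNIV. \<Sum>y\<in>UNIV. const (of_nat (n choose t) * (- 1) ^ (n - t) * ev (G * mon t (n - t)) x y) * mon (n - t) t)"
    by (rule sum.swap)
  finally show ?thesis by (simp add: total_def const_sum sum_distrib_left sum_distrib_right del: ev_simps)
qed

lemma co_moment_map: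
  assumes "t \<le> n"
  shows "co (moment_map n G) (n - t) t = of_nat (n choose t) * (- 1) ^ (n - t) * total (G * mon t (n - t))"
proof -
  have "co (moment_map n G) (n - t) t = (\<Sum>u\<le>n. if u = t then of_nat (n choose t) * (- 1) ^ (n - t) * total (G * mon t (n - t)) else 0)"
    unfolding moment_map_expand co_sum by (intro sum.cong refl) auto
  thus ?thesis using assms by simp
qed

lemma moment_map_eq_0_iff:
  assumes "n < p"
  shows "moment_map n G = 0 \<longleftrightarrow> (\<forall>t\<le>n. total (G * mon (n - t) t) = 0)"
proof
  assume "moment_map n G = 0"
  hence "total (G * mon t (n - t)) = 0" if "t \<le> n" for t
    using co_moment_map[OF that, of G] choose_nonzero[OF that assms] by simp
  hence "total (G * mon (n - t) (n - (n - t))) = 0" for t by simp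
  thus "\<forall>t\<le>n. total (G * mon (n - t) t) = 0" by (metis diff_diff_cancel)
next
  assume *: "\<forall>t\<le>n. total (G * mon (n - t) t) = 0"
  have "total (G * mon t (n - t)) = 0" if "t \<le> n" for t using *[rule_format, of "n - t"] that by simp
  thus "moment_map n G = 0" unfolding moment_map_expand by simp
qed

lemma moment_map_subst:
  assumes G: "homogeneous s G" and det: "a * d - b * c \<noteq> 0"
  shows "subst (moment_map n G) (lin a c) (lin b d) = const ((a * d - b * c) ^ n) * moment_map n (subst G (lin a c) (lin b d))"
proof -
  let ?D = "a * d - b * c"
  have L: "subst (lin (- (b * x + d * y)) (a * x + c * y)) (lin a c) (lin b d) = const ?D * lin (- y) x" for x y
    unfolding subst_lin by (simp add: lin_def const_add const_mult const_minus const_diff algebra_simps)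
  have "subst (moment_map n G) (lin a c) (lin b d) =
      (\<Sum>x\<in>UNIV. \<Sum>y\<in>UNIV. const (ev G x y) * subst (lin (- y) x) (lin a c) (lin b d) ^ n)"
    by (simp add: moment_map_def subst_sum subst_mult subst_power)
  also have "\<dots> = (\<Sum>x\<in>UNIV. \<Sum>y\<in>UNIV. const (ev G (a * x + c * y) (b * x + d * y)) *
      subst (lin (- (b * x + d * y)) (a * x + c * y)) (lin a c) (lin b d) ^ n)"
    by (rule sum_linear[OF det, symmetric, of "\<lambda>x y. const (ev G x y) * subst (lin (- y) x) (lin a c) (lin b d) ^ n"])
  also have "\<dots> = const (?D ^ n) * moment_map n (subst G (lin a c) (lin b d))"
    unfolding L moment_map_def sum_distrib_left
    by (intro sum.cong refl) (simp add: ev_subst[OF G] power_mult_distrib const_power mult_ac)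
  finally show ?thesis .
qed

lemma subm_range_moment_map: "subm n (moment_map n ` {G. homogeneous s G})"
  unfolding subm_def gsubmodule_V_iff
proof (intro conjI ballI allI impI)
  fix F H assume "F \<in> moment_map n ` {G. homogeneous s G}" "H \<in> moment_map n ` {G. homogeneous s G}"
  thus "F + H \<in> moment_map n ` {G. homogeneous s G}" by (auto simp flip: moment_map_add simp: homogeneous_add)
next
  fix c F assume "F \<in> moment_map n ` {G. homogeneous s G}"
  thus "const c * F \<in> moment_map n ` {G. homogeneous s G}" by (auto simp flip: moment_map_const simp: homogeneous_const)
next
  fix a b c d F assume F: "F \<in> moment_map n ` {G. homogeneous s G}" and det: "a * d - b * c \<noteq> (0 :: 'p mod_ring)"
  from F obtain G where G: "homogeneous s G" "F = moment_map n G" by auto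
  have "subst F (lin a c) (lin b d) = moment_map n (const ((a * d - b * c) ^ n) * subst G (lin a c) (lin b d))"
    unfolding G(2) moment_map_subst[OF G(1) det] moment_map_const ..
  thus "subst F (lin a c) (lin b d) \<in> moment_map n ` {G. homogeneous s G}"
    using G(1) by (simp add: homogeneous_const homogeneous_subst)
qed (use homogeneous_moment_map moment_map_theta[of n 0] in \<open>auto intro: image_eqI[of _ _ 0]\<close>)

lemma dvd_small: "(p - 1) dvd t \<longleftrightarrow> t = 0 \<or> t = p - 1" if "t \<le> p - 1"
proof
  assume "(p - 1) dvd t"
  thus "t = 0 \<or> t = p - 1" using that by (cases "t = 0") (auto dest: dvd_imp_le)
qed auto

text \<open>The image is a submodule of \<open>V\<^sub>n\<close>. It is everything by \<open>all_monomials\<close>, once it contains a single monomial with both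
  exponents below \<open>p - 1\<close>.\<close>

lemma range_moment_map:
  assumes s: "p \<le> s" and n: "n \<le> p - 1" "(p - 1) dvd (n + s)" and H: "homogeneous n H"
  shows "\<exists>G. homogeneous s G \<and> moment_map n G = H"
proof -
  \<comment> \<open>For \<open>n = p - 1\<close> the exponents \<open>0\<close> and \<open>p - 1\<close> lie in one class, so that a monomial with an inner exponent is used.\<close>
  define l where "l = (if n = p - 1 then 1 else 0 :: nat)"
  define c where "c = p - 1 - l"
  have l: "l \<le> n" "l < p - 1" "n - l < p - 1" "n < p" using n p3 by (auto simp: l_def)
  have c: "c + l = p - 1" "0 < c" "c \<le> s" "c < s" using l s by (auto simp: c_def)
  have "total (mon (s - c) c * mon t (n - t)) = (if t = n - l then 1 else 0)" if t: "t \<le> n" for t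
  proof -
    have 1: "(p - 1) dvd (c + (n - t)) \<longleftrightarrow> t = n - l"
    proof
      assume "(p - 1) dvd (c + (n - t))"
      hence "[c + (n - t) = c + l] (mod (p - 1))" unfolding c(1) by (simp add: cong_def mod_eq_0_iff_dvd del: One_nat_def)
      hence cg: "[n - t = l] (mod (p - 1))" by (simp only: cong_add_lcancel_nat)
      have "n - t = l"
      proof (cases "n - t = p - 1")
        case True
        hence "n = p - 1" using n(1) by simp
        moreover have "[0 = l] (mod (p - 1))" using cg True by (simp add: cong_def)
        hence "0 = l" using l(2) p3 by (intro cong_small) simp_all
        ultimately show ?thesis by (simp add: l_def)
      next
        case False
        hence "n - t < p - 1" using n(1) by linarith
        thus ?thesis using cong_small[OF cg] l(2) by blast
      qed
      thus "t = n - l" using t by simp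
    next
      assume "t = n - l"
      hence "c + (n - t) = p - 1" using c l by simp
      thus "(p - 1) dvd (c + (n - t))" by simp
    qed
    have 2: "(p - 1) dvd (s - c + t)" if "t = n - l"
    proof -
      have "s - c + t + (p - 1) = n + s" using that c l by simp
      thus ?thesis using n(2) by (metis dvd_add_left_iff dvd_refl)
    qed
    show ?thesis using 1 2 c by (simp add: mon_mult total_mon del: One_nat_def)
  qed
  hence "moment_map n (mon (s - c) c) = (\<Sum>t\<le>n. if t = n - l then const (of_nat (n choose (n - l)) * (- 1) ^ l) * mon l (n - l) else 0)"
    unfolding moment_map_expand using l(1) by (intro sum.cong refl) auto
  hence T: "moment_map n (mon (s - c) c) = const (of_nat (n choose (n - l)) * (- 1) ^ l) * mon l (n - l)" by simp
  let ?R = "moment_map n ` {G. homogeneous s G}"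
  note R = subm_range_moment_map[of n s]
  have "moment_map n (mon (s - c) c) \<in> ?R" using c by (intro imageI) (simp add: homogeneous_mon)
  hence "mon l (n - l) \<in> ?R" unfolding T
    by (rule subm_const_cancel[OF R]) (use choose_nonzero[of "n - l" n] l in simp)
  hence "mon (n - t) t \<in> ?R" if "t \<le> n" for t using all_monomials[OF R _ _ l(2,3) that] l by simp
  hence "H \<in> ?R" by (subst homogeneous_expand[OF H]) (intro subm_sum[OF R] submD(4)[OF R], simp)
  thus ?thesis by auto
qed

lemma total_normal_form:
  assumes "G = const \<alpha> * mon s 0 + const \<beta> * mon 0 s + (\<Sum>c\<in>{1..p - 1}. const (\<gamma> c) * mon (s - c) c) + theta * H"
    and s: "p \<le> s" and n: "n \<le> p - 1" "(p - 1) dvd (n + s)" and t: "t \<le> n"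
  shows "total (G * mon (n - t) t) =
    (if t = p - 1 then \<alpha> else 0) + (if n - t = p - 1 then \<beta> else 0) + (if t < p - 1 then \<gamma> (p - 1 - t) else \<gamma> (p - 1))"
proof -
  have d: "(p - 1) dvd (s - c + (n - t))" if "(p - 1) dvd (c + t)" "c \<le> s" for c
  proof -
    have "s - c + (n - t) + (c + t) = n + s" using that t by simp
    thus ?thesis using n(2) that(1) by (metis dvd_add_left_iff)
  qed
  define c0 where "c0 = (if t < p - 1 then p - 1 - t else p - 1)"
  have c0: "c0 \<in> {1..p - 1}" using p3 by (auto simp: c0_def)
  have c0_dvd: "(p - 1) dvd (c0 + t)"
  proof (cases "t < p - 1")
    case False
    hence "c0 + t = (p - 1) + (p - 1)" using t n by (simp add: c0_def)
    thus ?thesis by simp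
  qed (simp add: c0_def)
  have c: "total (mon (s - c) c * mon (n - t) t) = (if c = c0 then 1 else 0)" if c: "c \<in> {1..p - 1}" for c
  proof -
    have "c = c0" if "(p - 1) dvd (c + t)"
    proof -
      have "[c + t = c0 + t] (mod (p - 1))" using that c0_dvd by (metis cong_0_iff cong_sym cong_trans)
      hence "[c = c0] (mod (p - 1))" by (simp only: cong_add_rcancel_nat)
      hence cg: "[c - 1 + 1 = c0 - 1 + 1] (mod (p - 1))" using c c0 by simp
      have "c - 1 < p - 1" "c0 - 1 < p - 1" using c c0 by auto
      with cg have "c - 1 = c0 - 1" by (intro cong_small) (simp_all only: cong_add_rcancel_nat)
      thus ?thesis using c c0 by auto
    qed
    hence iff: "(p - 1) dvd (c + t) \<longleftrightarrow> c = c0" using c0_dvd by blast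
    have cs: "c \<le> s" "0 < s - c" "0 < c" using c s by auto
    show ?thesis
    proof (cases "c = c0")
      case True
      thus ?thesis using d[OF c0_dvd] c0_dvd cs by (simp add: mon_mult total_mon del: One_nat_def)
    next
      case False
      thus ?thesis using iff by (simp add: mon_mult total_mon del: One_nat_def)
    qed
  qed
  have 0: "(p - 1) dvd t \<Longrightarrow> 0 < t \<Longrightarrow> t = p - 1" "(p - 1) dvd (n - t) \<Longrightarrow> 0 < n - t \<Longrightarrow> n - t = p - 1"
    using dvd_small[of t] dvd_small[of "n - t"] t n by auto
  have a: "total (mon s 0 * mon (n - t) t) = (if t = p - 1 then 1 else 0)"
    using d[of 0] 0(1) s p3 by (auto simp: mon_mult total_mon simp del: One_nat_def)
  have b: "total (mon 0 s * mon (n - t) t) = (if n - t = p - 1 then 1 else 0)"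
  proof -
    have "(p - 1) dvd (s + t)" if "n - t = p - 1"
    proof -
      have "s + t + (p - 1) = n + s" using that t by simp
      thus ?thesis using n(2) by (metis dvd_add_left_iff dvd_refl)
    qed
    thus ?thesis using 0(2) s p3 by (auto simp: mon_mult total_mon simp del: One_nat_def)
  qed
  have "G * mon (n - t) t = const \<alpha> * (mon s 0 * mon (n - t) t) + const \<beta> * (mon 0 s * mon (n - t) t) +
      (\<Sum>c\<in>{1..p - 1}. const (\<gamma> c) * (mon (s - c) c * mon (n - t) t)) + theta * (H * mon (n - t) t)"
    unfolding assms(1) by (simp add: algebra_simps sum_distrib_left)
  hence "total (G * mon (n - t) t) = \<alpha> * total (mon s 0 * mon (n - t) t) + \<beta> * total (mon 0 s * mon (n - t) t) +
      (\<Sum>c\<in>{1..p - 1}. \<gamma> c * total (mon (s - c) c * mon (n - t) t)) + total (theta * (H * mon (n - t) t))"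
    by (simp only: functional_sum[OF functional_total] total_simps)
  also have "(\<Sum>c\<in>{1..p - 1}. \<gamma> c * total (mon (s - c) c * mon (n - t) t)) =
      (\<Sum>c\<in>{1..p - 1}. if c = c0 then \<gamma> c0 else 0)"
    by (intro sum.cong refl) (simp add: c)
  also have "\<dots> = (if t < p - 1 then \<gamma> (p - 1 - t) else \<gamma> (p - 1))"
    unfolding sum.delta[OF finite_atLeastAtMost] using c0 by (simp add: c0_def)
  finally show ?thesis unfolding a b total_theta by simp
qed

text \<open>A linear form that vanishes on \<open>V\<^sub>s\<^sup>(\<^sup>1\<^sup>)\<close> is constant on the inner monomials of a class. Applied to the translate \<open>(X + Y)\<^sup>s\<close>
  of \<open>X\<^sup>s\<close>, it gives that constant times a nonzero binomial coefficient.\<close>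

lemma mon_mem_if_power_mem:
  assumes N: "subm s N" and V: "Vfil s 1 \<subseteq> N" and X: "mon s 0 \<in> N"
    and sd: "[s = d] (mod (p - 1))" "d \<le> p - 1" "p \<le> s" and c: "0 < c" "c < d"
  shows "mon (s - c) c \<in> N"
proof (rule mem_subm_if_functional[OF N])
  fix f :: "'p mod_ring poly poly \<Rightarrow> 'p mod_ring"
  assume f: "functional f" and k: "kills f N"
  have k1: "kills f (Vfil s 1)" "kills f (Xsub s 0)"
    using k V Xsub_least[OF N, of 0] X unfolding kills_def by auto
  obtain q where q: "fits f s 0 c q" using functional_bpoly[OF f, of s 0] k1(1) p3 by auto
  have "[c + (d - c) = s] (mod (p - 1))" using c sd(1) by (simp add: cong_sym_eq)
  hence "(\<Sum>n\<le>0. q n * of_nat (s - 0 choose n) * class_sum (s - 0 - n) (c - n)) =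
    (if c \<le> 0 then of_nat (s - 0 choose c) * (bpoly q 0 c - f (mon (s - c) c)) else 0) +
    (if d - c \<le> 0 then of_nat (s - 0 choose (s - (d - c))) * (bpoly q 0 (s - (d - c)) - f (mon (d - c) (s - (d - c)))) else 0)"
    using c sd by (intro Xsub_bpoly_equation[OF f k1(2) _ q]) simp_all
  hence "q 0 * class_sum s c = 0" using c by simp
  moreover have "class_sum s c = of_nat (d choose c)" using class_sum_value[OF sd(1)] c sd by simp
  moreover have "of_nat (d choose c) \<noteq> (0 :: 'p mod_ring)" using c sd p3 by (intro choose_nonzero) simp_all
  ultimately have "q 0 = 0" by simp
  thus "f (mon (s - c) c) = 0" using fitsD[OF q, of c] c sd by (simp add: bpoly_def)
qed

text \<open>In \<open>normal_form\<close> the moments of degree \<open>n\<close> are the coefficients \<open>\<gamma> c\<close> with \<open>c \<ge> p - 1 - n\<close>. The monomials for smaller \<open>c\<close>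
  lie in the submodule generated by \<open>X\<^sup>s\<close>, modulo \<open>\<theta>\<close>.\<close>

lemma ker_moment_map:
  assumes N: "subm s N" and V: "Vfil s 1 \<subseteq> N" and X: "mon s 0 \<in> N" and s: "p \<le> s"
    and n: "n < p - 1" "(p - 1) dvd (n + s)" and G: "homogeneous s G" "moment_map n G = 0"
  shows "G \<in> N"
proof -
  obtain \<alpha> \<beta> \<gamma> and H :: "'p mod_ring poly poly" where H: "theta * H \<in> Vfil s 1"
    "G = const \<alpha> * mon s 0 + const \<beta> * mon 0 s + (\<Sum>c\<in>{1..p - 1}. const (\<gamma> c) * mon (s - c) c) + theta * H"
    using normal_form[OF G(1) s] by blast
  have g: "\<gamma> (p - 1 - t) = 0" if "t \<le> n" for t
  proof -
    have "total (G * mon (n - t) t) = 0" using G(2) moment_map_eq_0_iff[of n G] n that by simp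
    thus ?thesis using total_normal_form[OF H(2) s _ n(2) that] n that by (simp split: if_splits)
  qed
  have sd: "[s = p - 1 - n] (mod (p - 1))"
  proof -
    have "[n + s = n + (p - 1 - n)] (mod (p - 1))" using n by (simp add: cong_def mod_eq_0_iff_dvd)
    thus ?thesis by (simp only: cong_add_lcancel_nat)
  qed
  have m: "const (\<gamma> c) * mon (s - c) c \<in> N" if c: "c \<in> {1..p - 1}" for c
  proof (cases "c < p - 1 - n")
    case True
    thus ?thesis using c s by (intro submD(4)[OF N] mon_mem_if_power_mem[OF N V X sd]) simp_all
  next
    case False
    hence "\<gamma> (p - 1 - (p - 1 - c)) = 0" using c by (intro g) auto
    moreover have "p - 1 - (p - 1 - c) = c" using c by auto
    ultimately have "\<gamma> c = 0" by (simp only:)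
    thus ?thesis using submD(2)[OF N] by simp
  qed
  have Y: "mon 0 s \<in> N" using subm_swap[OF N X] by (simp only: subst_swap)
  have "theta * H \<in> N" using H(1) V by blast
  thus ?thesis unfolding H(2)
    by (intro submD(3)[OF N] submD(4)[OF N X] submD(4)[OF N Y] subm_sum[OF N m])
qed

text \<open>For \<open>n = p - 1\<close> the two extreme moments are \<open>\<alpha> + \<gamma> (p - 1)\<close> and \<open>\<beta> + \<gamma> (p - 1)\<close>, so the kernel modulo \<open>\<theta>\<close> is spanned by one
  polynomial.\<close>

lemma ker_moment_map_top:
  assumes N: "subm s N" and V: "Vfil s 1 \<subseteq> N" and X: "mon s 0 + mon 0 s - mon (s - (p - 1)) (p - 1) \<in> N" and s: "p \<le> s"
    and n: "(p - 1) dvd s" and G: "homogeneous s G" "moment_map (p - 1) G = 0"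
  shows "G \<in> N"
proof -
  obtain \<alpha> \<beta> \<gamma> and H :: "'p mod_ring poly poly" where H: "theta * H \<in> Vfil s 1"
    "G = const \<alpha> * mon s 0 + const \<beta> * mon 0 s + (\<Sum>c\<in>{1..p - 1}. const (\<gamma> c) * mon (s - c) c) + theta * H"
    using normal_form[OF G(1) s] by blast
  have n': "(p - 1) dvd (p - 1 + s)" using n by (simp add: dvd_add)
  have z: "(if t = p - 1 then \<alpha> else 0) + (if p - 1 - t = p - 1 then \<beta> else 0) + (if t < p - 1 then \<gamma> (p - 1 - t) else \<gamma> (p - 1)) = 0"
    if "t \<le> p - 1" for t
  proof -
    have "total (G * mon (p - 1 - t) t) = 0" using G(2) moment_map_eq_0_iff[of "p - 1" G] p3 that by simp
    thus ?thesis using total_normal_form[OF H(2) s order_refl n' that] by (simp only:)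
  qed
  have 1: "\<alpha> = - \<gamma> (p - 1)" using z[of "p - 1"] p3 by (simp add: eq_neg_iff_add_eq_0)
  have 2: "\<beta> = - \<gamma> (p - 1)" using z[of 0] p3 by (simp add: eq_neg_iff_add_eq_0)
  have 3: "\<gamma> c = 0" if c: "c \<in> {1..p - 1}" "c \<noteq> p - 1" for c
  proof -
    have "p - 1 - c \<le> p - 1" "p - 1 - c \<noteq> p - 1" "p - 1 - c < p - 1" "p - 1 - (p - 1 - c) = c" "c \<noteq> p - 1"
      using c p3 by auto
    thus ?thesis using z[of "p - 1 - c"] by (simp only: if_True if_False add_0_left simp_thms)
  qed
  have "(\<Sum>c\<in>{1..p - 1}. const (\<gamma> c) * mon (s - c) c) = (\<Sum>c\<in>{1..p - 1}. if c = p - 1 then const (\<gamma> (p - 1)) * mon (s - (p - 1)) (p - 1) else 0)"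
    by (intro sum.cong refl) (use 3 in auto)
  also have "\<dots> = const (\<gamma> (p - 1)) * mon (s - (p - 1)) (p - 1)" using p3 by simp
  finally have "G = const (- \<gamma> (p - 1)) * (mon s 0 + mon 0 s - mon (s - (p - 1)) (p - 1)) + theta * H"
    unfolding H(2) 1 2 by (simp add: algebra_simps const_minus)
  thus ?thesis using submD(3)[OF N submD(4)[OF N X]] H(1) V by auto
qed

section \<open>Linear forms that bound the intersections from above\<close>

text \<open>The cut-off makes the form vanish on \<open>X\<^bsup>r-k\<^esup> Y\<^sup>k\<close> and \<open>X\<^sup>k Y\<^bsup>r-k\<^esup>\<close> for \<open>k \<le> i\<close>, as every form that kills \<open>X\<^bsub>r-i\<^esub>\<close> does.\<close>

definition band :: "nat \<Rightarrow> nat \<Rightarrow> nat \<Rightarrow> (nat \<Rightarrow> 'p mod_ring) \<Rightarrow> 'p mod_ring poly poly \<Rightarrow> 'p mod_ring" where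
  "band r i e P F = (\<Sum>t\<le>r. if i < t \<and> t < r - i \<and> [t = e] (mod (p - 1)) then P t * co F (r - t) t else 0)"

lemma functional_band: "functional (band r i e P)"
  unfolding functional_def band_def sum_distrib_left sum.distrib[symmetric]
  by (intro conjI allI sum.cong refl) (auto simp: distrib_left)

lemma band_mon:
  assumes "t \<le> r"
  shows "band r i e P (mon (r - t) t) = (if i < t \<and> t < r - i \<and> [t = e] (mod (p - 1)) then P t else 0)"
proof -
  have "band r i e P (mon (r - t) t) = (\<Sum>u\<le>r. if u = t then (if i < t \<and> t < r - i \<and> [t = e] (mod (p - 1)) then P t else 0) else 0)"
    unfolding band_def by (intro sum.cong refl) auto
  thus ?thesis using assms by simp
qed

text \<open>The largest submodule inside the kernel of \<open>f\<close> consists of the \<open>F\<close> all of whose translates are killed.\<close>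

lemma kills_Xsub_if_translates:
  assumes f: "functional f" and l: "l \<le> r"
    and z: "\<And>a b c d. a * d - b * c \<noteq> 0 \<Longrightarrow> f (lin a c ^ (r - l) * lin b d ^ l) = 0"
  shows "kills f (Xsub r l)"
proof -
  let ?N = "{F. homogeneous r F \<and> (\<forall>a b c d. a * d - b * c \<noteq> 0 \<longrightarrow> f (subst F (lin a c) (lin b d)) = 0)}"
  have f': "f 0 = 0" "\<And>F G. f (F + G) = f F + f G" "\<And>c F. f (const c * F) = c * f F"
    using f functional_sum[OF f, of "\<lambda>_. 0" "{}"] by (simp_all add: functional_def)
  have FD: "f (subst F (lin a c) (lin b d)) = 0" if "F \<in> ?N" "a * d - b * c \<noteq> 0" for F a b c d
    using that by blast
  have s0: "subst 0 A B = (0 :: 'p mod_ring poly poly)" for A B using subst_const[of 0 A B] by simp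
  have N: "subm r ?N"
    unfolding subm_def gsubmodule_V_iff
  proof (intro conjI ballI allI impI)
    fix a b c d F assume F: "F \<in> ?N" and det: "a * d - b * c \<noteq> (0 :: 'p mod_ring)"
    have "f (subst (subst F (lin a c) (lin b d)) (lin a' c') (lin b' d')) = 0" if det': "a' * d' - b' * c' \<noteq> 0" for a' b' c' d'
    proof -
      have "(a * a' + c * b') * (b * c' + d * d') - (b * a' + d * b') * (a * c' + c * d') = (a * d - b * c) * (a' * d' - b' * c')"
        by (simp add: algebra_simps)
      hence det'': "(a * a' + c * b') * (b * c' + d * d') - (b * a' + d * b') * (a * c' + c * d') \<noteq> 0" using det det' by simp
      have "subst (subst F (lin a c) (lin b d)) (lin a' c') (lin b' d') =
          subst F (lin (a * a' + c * b') (a * c' + c * d')) (lin (b * a' + d * b') (b * c' + d * d'))"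
        unfolding subst_subst subst_lin by (simp add: lin_def const_add const_mult algebra_simps)
      moreover have "f (subst F (lin (a * a' + c * b') (a * c' + c * d')) (lin (b * a' + d * b') (b * c' + d * d'))) = 0"
        by (rule FD[OF F det''])
      ultimately show ?thesis by (simp only:)
    qed
    thus "subst F (lin a c) (lin b d) \<in> ?N" using F by (simp add: homogeneous_subst)
  qed (auto simp: f' s0 subst_add subst_mult homogeneous_add homogeneous_const)
  have "mon (r - l) l \<in> ?N" using z l by (simp add: subst_mon homogeneous_mon)
  hence "Xsub r l \<subseteq> ?N" by (rule Xsub_least[OF N])
  moreover have "f F = 0" if "F \<in> ?N" for F
  proof -
    have "f (subst F (lin 1 0) (lin 0 1)) = 0" by (rule FD[OF that]) simp
    thus ?thesis by (simp add: subst_varX_varY)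
  qed
  ultimately show ?thesis unfolding kills_def by blast
qed

lemma band_power:
  assumes S: "(\<Sum>t\<le>r. if i < t \<and> t < r - i \<and> [t = e] (mod (p - 1)) then of_nat (r - k choose t) * P t else 0) = 0"
    and k: "k \<le> i" "i \<le> r"
  shows "band r i e P (lin a c ^ (r - k) * varX ^ k) = 0"
proof -
  let ?s = "\<lambda>t. i < t \<and> t < r - i \<and> [t = e] (mod (p - 1))"
  let ?g = "\<lambda>t. of_nat (r - k choose t) * P t"
  have kr: "k \<le> r" using k by simp
  have B: "band r i e P (lin a c ^ (r - k) * varX ^ k) = (\<Sum>t\<le>r. if ?s t then ?g t * (a ^ (r - k - t) * c ^ t) else 0)"
    unfolding lin_power_expand[OF kr] functional_sum[OF functional_band] functional_const[OF functional_band]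
    by (intro sum.cong refl) (simp add: band_mon)
  show ?thesis
  proof (cases "\<exists>u. ?s u")
    case True
    then obtain u where u: "?s u" by blast
    have "a ^ (r - k - t) * c ^ t = a ^ (r - k - u) * c ^ u" if t: "?s t" for t
    proof -
      have cg: "[t = u] (mod (p - 1))" using t u by (metis cong_sym cong_trans)
      have "[r - k - t + t = r - k - u + t] (mod (p - 1))"
      proof -
        have "r - k - t + t = r - k - u + u" 
        proof -
          have "t \<le> r - k" "u \<le> r - k" using t u k by linarith+
          thus ?thesis by simp
        qed
        thus ?thesis using cong_add[OF cong_refl[of "r - k - u"] cong_sym[OF cg]] by (simp only:)
      qed
      hence "[r - k - t = r - k - u] (mod (p - 1))" by (simp only: cong_add_rcancel_nat)
      moreover have "0 < r - k - t" "0 < r - k - u" "0 < t" "0 < u" using t u k by auto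
      ultimately show ?thesis using power_cong_pos[of "r - k - t" "r - k - u" a] power_cong_pos[OF cg, of c] by simp
    qed
    hence "band r i e P (lin a c ^ (r - k) * varX ^ k) = (\<Sum>t\<le>r. (if ?s t then ?g t else 0) * (a ^ (r - k - u) * c ^ u))"
      unfolding B by (intro sum.cong refl) auto
    also have "\<dots> = 0" unfolding sum_distrib_right[symmetric] S by simp
    finally show ?thesis .
  next
    case False
    thus ?thesis unfolding B by (intro sum.neutral) auto
  qed
qed

text \<open>Writing \<open>bX + dY\<close> as a combination of \<open>aX + cY\<close> and \<open>X\<close> expands a translate of \<open>X\<^bsup>r-i\<^esup> Y\<^sup>i\<close> into the products
  \<open>(aX + cY)\<^bsup>r-k\<^esup> X\<^sup>k\<close> with \<open>k \<le> i\<close>. On these the form is a multiple of the sum in the hypothesis, because exponents in one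
  class give equal powers of \<open>a\<close> and \<open>c\<close>.\<close>

lemma band_kills_Xsub:
  assumes S: "\<And>k. k \<le> i \<Longrightarrow>
      (\<Sum>t\<le>r. if i < t \<and> t < r - i \<and> [t = e] (mod (p - 1)) then of_nat (r - k choose t) * P t else 0) = 0"
    and i: "i \<le> r"
  shows "kills (band r i e P) (Xsub r i)"
proof (rule kills_Xsub_if_translates[OF functional_band i])
  fix a b c d assume det: "a * d - b * c \<noteq> (0 :: 'p mod_ring)"
  let ?f = "band r i e P"
  note f = functional_sum[OF functional_band] functional_const[OF functional_band]
  show "?f (lin a c ^ (r - i) * lin b d ^ i) = 0"
  proof (cases "c = 0")
    case True
    have "lin a c ^ (r - i) * lin b d ^ i =
        (\<Sum>t\<le>i. const (a ^ (r - i) * (of_nat (i choose t) * (b ^ (i - t) * d ^ t))) * (mon (r - t) t :: 'p mod_ring poly poly))"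
    proof -
      have "lin b d ^ i = (\<Sum>t\<le>i. const (of_nat (i choose t) * (b ^ (i - t) * d ^ t)) * (mon (i - t) t :: 'p mod_ring poly poly))"
        using lin_power_expand[of 0 i b d] by simp
      moreover have "lin a c ^ (r - i) = const (a ^ (r - i)) * (mon (r - i) 0 :: 'p mod_ring poly poly)"
        unfolding True by (simp add: lin_def power_mult_distrib const_power mon_def)
      ultimately have "lin a c ^ (r - i) * lin b d ^ i = (\<Sum>t\<le>i. const (a ^ (r - i)) * mon (r - i) 0 *
          (const (of_nat (i choose t) * (b ^ (i - t) * d ^ t)) * (mon (i - t) t :: 'p mod_ring poly poly)))"
        by (simp only: sum_distrib_left)
      also have "\<dots> = (\<Sum>t\<le>i. const (a ^ (r - i) * (of_nat (i choose t) * (b ^ (i - t) * d ^ t))) * (mon (r - t) t :: 'p mod_ring poly poly))"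
      proof (intro sum.cong refl)
        fix t assume "t \<in> {..i}"
        hence "r - i + (i - t) = r - t" using i by simp
        hence "mon (r - i) 0 * mon (i - t) t = (mon (r - t) t :: 'p mod_ring poly poly)" unfolding mon_mult by (simp only: add_0)
        note M = this
        have "const (a ^ (r - i)) * mon (r - i) 0 * (const (of_nat (i choose t) * (b ^ (i - t) * d ^ t)) * mon (i - t) t) =
            const (a ^ (r - i)) * const (of_nat (i choose t) * (b ^ (i - t) * d ^ t)) * (mon (r - i) 0 * (mon (i - t) t :: 'p mod_ring poly poly))"
          by (simp only: mult_ac)
        thus "const (a ^ (r - i)) * mon (r - i) 0 * (const (of_nat (i choose t) * (b ^ (i - t) * d ^ t)) * mon (i - t) t) =
            const (a ^ (r - i) * (of_nat (i choose t) * (b ^ (i - t) * d ^ t))) * (mon (r - t) t :: 'p mod_ring poly poly)"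
          by (simp only: M const_mult)
      qed
      finally show ?thesis .
    qed
    thus ?thesis unfolding f using i by (simp add: f band_mon)
  next
    case False
    define x where "x = d / c"
    define y where "y = b - x * a"
    have "lin b d = const y * varX + const x * (lin a c :: 'p mod_ring poly poly)"
    proof -
      have "b = y + x * a" "d = x * c" using False by (simp_all add: x_def y_def)
      thus ?thesis by (simp add: lin_def const_add const_mult algebra_simps)
    qed
    hence "lin b d ^ i = (\<Sum>k\<le>i. of_nat (i choose k) * (const y * varX) ^ k * (const x * (lin a c :: 'p mod_ring poly poly)) ^ (i - k))"
      by (simp only: binomial_ring)
    hence "lin a c ^ (r - i) * lin b d ^ i = (\<Sum>k\<le>i. lin a c ^ (r - i) * (of_nat (i choose k) * (const y * varX) ^ k * (const x * (lin a c :: 'p mod_ring poly poly)) ^ (i - k)))"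
      by (simp only: sum_distrib_left)
    also have "\<dots> = (\<Sum>k\<le>i. const (of_nat (i choose k) * y ^ k * x ^ (i - k)) * (lin a c ^ (r - k) * varX ^ k))"
    proof (intro sum.cong refl)
      fix k assume "k \<in> {..i}"
      hence "r - k = r - i + (i - k)" using i by simp
      hence "lin a c ^ (r - k) = lin a c ^ (r - i) * (lin a c ^ (i - k) :: 'p mod_ring poly poly)"
        by (simp only: power_add)
      thus "lin a c ^ (r - i) * (of_nat (i choose k) * (const y * varX) ^ k * (const x * (lin a c :: 'p mod_ring poly poly)) ^ (i - k)) =
          const (of_nat (i choose k) * y ^ k * x ^ (i - k)) * (lin a c ^ (r - k) * varX ^ k)"
        by (simp only: const_mult const_power const_of_nat power_mult_distrib mult_ac)
    qed
    finally show ?thesis by (simp add: f band_power[OF S _ i])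
  qed
qed

lemma bpoly_extend:
  assumes "\<And>n. m < n \<Longrightarrow> q n = 0" "m \<le> D"
  shows "bpoly q D t = bpoly q m t"
  unfolding bpoly_def using assms by (intro sum.mono_neutral_right) auto

text \<open>The values are a polynomial of degree less than \<open>i + 1\<close>, so its differences of order \<open>i + 1\<close> vanish.\<close>

lemma band_kills_Vfil:
  assumes q: "\<And>n. m < n \<Longrightarrow> q n = 0" and m: "m \<le> i" "i + 1 < p"
  shows "kills (band r i e (bpoly q m)) (Vfil r (i + 1))"
  unfolding kills_def
proof
  let ?f = "band r i e (bpoly q m)" and ?D = "i + 1"
  note f = functional_sum[OF functional_band] functional_const[OF functional_band]
  have mon0: "?f (theta ^ ?D * mon a b) = 0" for a b
  proof (cases "a + b + ?D * (p + 1) = r")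
    case True
    let ?t = "\<lambda>l. ?D + b + l * (p - 1)"
    have v: "?f (mon (r - ?t l) (?t l)) = (if [?D + b = e] (mod (p - 1)) then bpoly q ?D (?t l) else 0)" if l: "l \<le> ?D" for l
    proof -
      obtain P where P: "p = Suc P" using p3 by (cases p) auto
      obtain l' where l': "?D = l + l'" using l le_Suc_ex by blast
      have "r = a + b + ?D + ?D + (l + l') * P" using True unfolding l'[symmetric] P by (simp add: algebra_simps)
      hence r: "r = ?t l + (a + ?D + l' * P)" unfolding P by (simp add: algebra_simps)
      have "[?t l = ?D + b] (mod (p - 1))" by (simp add: cong_def)
      hence "[?t l = e] (mod (p - 1)) \<longleftrightarrow> [?D + b = e] (mod (p - 1))" by (metis cong_sym cong_trans)
      moreover have "i < ?t l" "?t l < r - i" "?t l \<le> r" using r by simp_all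
      moreover have "bpoly q ?D (?t l) = bpoly q m (?t l)" using bpoly_extend[of m q ?D] q m by simp
      ultimately show ?thesis by (simp add: band_mon del: One_nat_def)
    qed
    have "?f (theta ^ ?D * mon a b) = (\<Sum>l\<le>?D. (- 1) ^ l * of_nat (?D choose l) * (if [?D + b = e] (mod (p - 1)) then bpoly q ?D (?t l) else 0))"
      unfolding functional_theta_mon[OF functional_band True] by (intro sum.cong refl) (simp only: v atMost_iff)
    also have "\<dots> = 0"
      using bpoly_difference[OF m(2), of q "?D + b"] q[of ?D] m(1) by (cases "[?D + b = e] (mod (p - 1))") simp_all
    finally show ?thesis .
  next
    case False
    have "homogeneous (?D * (p + 1) + (a + b)) (theta ^ ?D * mon a b :: 'p mod_ring poly poly)"
      by (intro homogeneous_mult homogeneous_theta_power homogeneous_mon refl)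
    hence "co (theta ^ ?D * mon a b :: 'p mod_ring poly poly) (r - t) t = 0" if "t \<le> r" for t
      using False that unfolding homogeneous_def by fastforce
    thus ?thesis unfolding band_def by (intro sum.neutral) auto
  qed
  fix F :: "'p mod_ring poly poly" assume "F \<in> Vfil r (i + 1)"
  then obtain G where G: "F = theta ^ ?D * G" unfolding Vfil_iff by (elim conjE dvdE)
  have "G = subst G varX varY" by (simp add: subst_varX_varY)
  hence GE: "G = (\<Sum>j\<le>Polynomial.degree G. \<Sum>l\<le>Polynomial.degree (poly.coeff G j). const (poly.coeff (poly.coeff G j) l) * mon l j)"
    unfolding subst_def mon_def mult.assoc .
  have "F = (\<Sum>j\<le>Polynomial.degree G. \<Sum>l\<le>Polynomial.degree (poly.coeff G j). const (poly.coeff (poly.coeff G j) l) * (theta ^ ?D * mon l j))"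
    unfolding G using arg_cong[OF GE, of "\<lambda>G. theta ^ ?D * G"] by (simp only: sum_distrib_left mult.left_commute)
  thus "?f F = 0" by (simp only: f mon0 mult_zero_right sum.neutral_const)
qed

text \<open>The form \<open>band\<close> kills \<open>X\<^bsub>r-i\<^esub> + V\<^sub>r\<^sup>(\<^sup>i\<^sup>+\<^sup>1\<^sup>)\<close>, so it kills \<open>\<theta>\<^sup>m G\<close>. The sum is its value there, computed monomial by monomial.\<close>

lemma exclusion:
  assumes st: "admissible i j r" and m: "0 < m" "m \<le> i"
    and q: "\<And>n. m < n \<Longrightarrow> q n = 0"
    and low: "\<And>t. m < t \<Longrightarrow> t \<le> i \<Longrightarrow> [t = e] (mod (p - 1)) \<Longrightarrow> bpoly q m t = 0"
    and high: "\<And>t. r - i \<le> t \<Longrightarrow> t < r - m \<Longrightarrow> [t = e] (mod (p - 1)) \<Longrightarrow> bpoly q m t = 0"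
    and S: "\<And>k. k \<le> i \<Longrightarrow>
      (\<Sum>t\<le>r. if i < t \<and> t < r - i \<and> [t = e] (mod (p - 1)) then of_nat (r - k choose t) * bpoly q m t else 0) = 0"
    and G: "homogeneous s G" "s + m * (p + 1) = r" "theta ^ m * G \<in> XV r i (i + 1)"
  shows "(\<Sum>t\<le>s. co G (s - t) t * (if [m + t = e] (mod (p - 1)) then q m - (if t = 0 then bpoly q m m else 0) -
    (if t = s then (- 1) ^ m * bpoly q m (r - m) else 0) else 0)) = 0"
proof -
  note st' = admissibleD[OF st]
  let ?f = "band r i e (bpoly q m)"
  note f = functional_sum[OF functional_band] functional_const[OF functional_band]
  have ip: "i + 1 < p" "m < p" using st'(3) m by simp_all
  have kX: "kills ?f (Xsub r i)" by (rule band_kills_Xsub[OF S st'(7)])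
  have kV: "kills ?f (Vfil r (i + 1))" by (rule band_kills_Vfil[OF q m(2) ip(1)])
  have "?f H = 0" if "H \<in> XV r i (i + 1)" for H
  proof -
    from that obtain A B where AB: "H = A + B" "A \<in> Xsub r i" "B \<in> Vfil r (i + 1)" by (auto simp: XV_def)
    hence "?f A = 0" "?f B = 0" using kX kV by (auto simp: kills_def)
    thus ?thesis using functional_band[of r i e "bpoly q m"] by (simp add: functional_def AB(1))
  qed
  hence f0: "?f (theta ^ m * G) = 0" using G(3) by blast
  have fit: "fits ?f r m e q"
    unfolding fits_def
  proof (intro allI impI, elim conjE)
    fix t assume t: "m < t" "t < r - m" "[t = e] (mod (p - 1))"
    thus "?f (mon (r - t) t) = bpoly q m t"
      using low[of t] high[of t] by (cases "i < t"; cases "t < r - i") (simp_all add: band_mon)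
  qed
  have zm: "?f (mon (r - m) m) = 0" using m st'(7) by (simp add: band_mon)
  have zr: "?f (mon m (r - m)) = 0"
  proof -
    have "r - i \<le> r - m" "r - (r - m) = m" using m st'(7) by simp_all
    thus ?thesis using band_mon[of "r - m" r i e "bpoly q m"] by simp
  qed
  have v: "?f (theta ^ m * mon (s - t) t) = (if [m + t = e] (mod (p - 1)) then q m - (if t = 0 then bpoly q m m else 0) -
    (if t = s then (- 1) ^ m * bpoly q m (r - m) else 0) else 0)" if t: "t \<le> s" for t
  proof -
    have r: "s - t + t + m * (p + 1) = r" using G(2) t by simp
    show ?thesis
    proof (cases "[m + t = e] (mod (p - 1))")
      case True
      from functional_theta_mon_value[OF functional_band m(1) ip(2) r fit True] show ?thesis
        using True zm zr t by simp
    next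
      case False
      have "?f (mon (r - (m + t + l * (p - 1))) (m + t + l * (p - 1))) = 0" if l: "l \<le> m" for l
      proof -
        have "\<not> [m + t + l * (p - 1) = e] (mod (p - 1))" using False by (simp add: cong_def)
        moreover have "m + t + l * (p - 1) \<le> r"
        proof -
          have "l * (p - 1) \<le> m * (p - 1)" using l by (rule mult_le_mono1)
          moreover have "m * (p - 1) + m + m = m * (p + 1)" using p3 by (simp add: algebra_simps)
          ultimately show ?thesis using r by linarith
        qed
        ultimately show ?thesis by (simp add: band_mon)
      qed
      hence "?f (theta ^ m * mon (s - t) t) = 0"
        unfolding functional_theta_mon[OF functional_band r] by (intro sum.neutral) simp
      thus ?thesis using False by simp
    qed
  qed
  have "theta ^ m * G = (\<Sum>t\<le>s. const (co G (s - t) t) * (theta ^ m * mon (s - t) t))"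
    by (subst homogeneous_expand[OF G(1)]) (simp add: sum_distrib_left mult.left_commute)
  hence "?f (theta ^ m * G) = (\<Sum>t\<le>s. co G (s - t) t * ?f (theta ^ m * mon (s - t) t))"
    by (simp only: f)
  thus ?thesis using f0 v by simp
qed

text \<open>The cut-off removes at most two exponents of a class, the smallest and the largest.\<close>

lemma band_sum:
  assumes e: "e < p - 1" and u: "u < p - 1" and eu: "[e + u = r] (mod (p - 1))" and i: "i < p - 1" and r: "2 * p \<le> r"
  shows "(\<Sum>t\<le>r. if i < t \<and> t < r - i \<and> [t = e] (mod (p - 1)) then g t else 0) =
    (\<Sum>t\<le>r. if [t = e] (mod (p - 1)) then g t else (0 :: 'p mod_ring)) -
    (if e \<le> i then g e else 0) - (if u \<le> i then g (r - u) else 0)"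
proof -
  have ru: "[r - u = e] (mod (p - 1))"
  proof -
    have "[r - u + u = e + u] (mod (p - 1))" using eu u r by (simp add: cong_sym_eq)
    thus ?thesis by (rule cong_add_rcancel_nat[THEN iffD1])
  qed
  have lo: "t = e" if "[t = e] (mod (p - 1))" "t \<le> i" for t
    using cong_small[OF that(1)] that(2) i e by simp
  have hi: "t = r - u" if c: "[t = e] (mod (p - 1))" "r - i \<le> t" "t \<le> r" for t
  proof -
    have "[r - t + t = u + t] (mod (p - 1))"
      using eu c by (metis add.commute cong_add_lcancel_nat cong_sym cong_trans le_add_diff_inverse2)
    hence "[r - t = u] (mod (p - 1))" by (rule cong_add_rcancel_nat[THEN iffD1])
    moreover have "r - t < p - 1" using c i by linarith
    ultimately have "r - t = u" using u by (intro cong_small)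
    thus ?thesis using c(3) by simp
  qed
  have "(\<Sum>t\<le>r. if i < t \<and> t < r - i \<and> [t = e] (mod (p - 1)) then g t else 0) =
      (\<Sum>t\<le>r. (if [t = e] (mod (p - 1)) then g t else 0) - (if t = e then (if e \<le> i then g e else 0) else 0) -
        (if t = r - u then (if u \<le> i then g (r - u) else 0) else 0))"
  proof (intro sum.cong refl)
    fix t assume "t \<in> {..r}"
    hence tr: "t \<le> r" by simp
    have ne: "e \<noteq> r - u" using e u r by simp
    consider "t = e" | "t = r - u" "t \<noteq> e" | "t \<noteq> e" "t \<noteq> r - u" by blast
    thus "(if i < t \<and> t < r - i \<and> [t = e] (mod (p - 1)) then g t else 0) =
        (if [t = e] (mod (p - 1)) then g t else 0) - (if t = e then (if e \<le> i then g e else 0) else 0) -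
        (if t = r - u then (if u \<le> i then g (r - u) else 0) else 0)"
    proof cases
      case 1
      have "e < r - i" using e i r by simp
      thus ?thesis using 1 ne by simp
    next
      case 2
      have "i < r - u" using u i r by simp
      moreover have "r - u < r - i \<longleftrightarrow> \<not> u \<le> i" using u i r by auto
      ultimately show ?thesis using 2 ru by simp
    next
      case 3
      thus ?thesis using lo[of t] hi[of t] tr by (cases "[t = e] (mod (p - 1))"; cases "i < t"; cases "t < r - i") simp_all
    qed
  qed
  also have "\<dots> = (\<Sum>t\<le>r. if [t = e] (mod (p - 1)) then g t else 0) -
    (if e \<le> i then g e else 0) - (if u \<le> i then g (r - u) else 0)"
  proof -
    have "e \<le> r" "r - u \<le> r" using e r by simp_all
    thus ?thesis by (simp add: sum_subtractf)
  qed
  finally show ?thesis .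
qed

lemma full_sum_bpoly:
  assumes "d \<le> e" "k \<le> r"
  shows "(\<Sum>t\<le>r. if [t = e] (mod (p - 1)) then of_nat (r - k choose t) * bpoly q d t else 0) =
    (\<Sum>n\<le>d. q n * of_nat (r - k choose n) * class_sum (r - k - n) (e - n))"
  unfolding class_sum_bpoly[OF assms(1), symmetric]
  by (rule sum.mono_neutral_right) (auto simp: binomial_eq_0)

lemma class_sum_0: "0 < N \<Longrightarrow> class_sum N 0 = (if (p - 1) dvd N then 2 else 1)"
proof -
  assume N: "0 < N"
  define y where "y = (if (p - 1) dvd N then p - 1 else N mod (p - 1))"
  have "[N = y] (mod (p - 1))" by (simp add: y_def cong_def mod_eq_0_iff_dvd)
  moreover have "1 \<le> y" using p3 by (simp add: y_def mod_greater_zero_iff_not_dvd Suc_le_eq)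
  moreover have "y \<le> p - 1" using p3 by (simp add: y_def less_imp_le)
  moreover have "y = p - 1 \<longleftrightarrow> (p - 1) dvd N" 
  proof -
    have "N mod (p - 1) < p - 1" using p3 by (intro mod_less_divisor) simp
    thus ?thesis by (simp add: y_def)
  qed
  ultimately show ?thesis using class_sum_value[of N y 0] N p3 by simp
qed

section \<open>Three exclusion arguments\<close>

lemma admissible_class:
  assumes st: "admissible i j r" and m: "m \<le> i" "m \<le> i + j" and s: "s + m * (p + 1) = r"
  shows "[s + m = i + j - m] (mod (p - 1))"
proof -
  have "[m + (s - 0) + m = i + j] (mod (p - 1))"
    using cong_trans[OF theta_class[OF s, of 0] cong_sym[OF admissibleD(4)[OF st]]] by simp
  moreover have "m + (s - 0) + m = s + m + m" "i + j = i + j - m + m" using m by simp_all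
  ultimately have "[s + m + m = i + j - m + m] (mod (p - 1))" by (simp only:)
  thus ?thesis by (simp only: cong_add_rcancel_nat)
qed

lemma choose_reflect_expand:
  assumes "t \<le> M" "m \<le> M"
  shows "bpoly (\<lambda>n. if n \<le> m then (- 1) ^ n * of_nat (M - n choose (m - n)) else 0) m t = of_nat (M - t choose m)"
proof -
  have "bpoly (\<lambda>n. if n \<le> m then (- 1) ^ n * of_nat (M - n choose (m - n)) else 0) m t =
      (\<Sum>n\<le>m. (- 1) ^ n * of_nat (t choose n) * (of_nat (M - n choose (M - m)) :: 'p mod_ring))"
    unfolding bpoly_def
  proof (intro sum.cong refl)
    fix n assume "n \<in> {..m}"
    moreover from this have "M - n choose (m - n) = M - n choose (M - m)"
      using binomial_symmetric[of "m - n" "M - n"] assms(2) by simp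
    ultimately show "(if n \<le> m then (- 1) ^ n * of_nat (M - n choose (m - n)) else 0) * of_nat (t choose n) =
        (- 1) ^ n * of_nat (t choose n) * (of_nat (M - n choose (M - m)) :: 'p mod_ring)" by simp
  qed
  also have "\<dots> = (\<Sum>n\<le>max m t. (- 1) ^ n * of_nat (t choose n) * of_nat (M - n choose (M - m)))"
    using assms by (intro sum.mono_neutral_left) (auto simp: binomial_eq_0)
  also have "\<dots> = (\<Sum>n\<le>t. (- 1) ^ n * of_nat (t choose n) * of_nat (M - n choose (M - m)))"
    by (intro sum.mono_neutral_right) (auto simp: binomial_eq_0)
  also have "\<dots> = (if t \<le> M - m then of_nat (M - t choose (M - m - t)) else 0)"
    by (rule alternating_choose[OF assms(1)])
  also have "\<dots> = of_nat (M - t choose m)"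
  proof (cases "t \<le> M - m")
    case True
    have "M - t - m = M - m - t" "m \<le> M - t" using True assms by simp_all
    thus ?thesis using True binomial_symmetric[of m "M - t"] by simp
  next
    case False
    thus ?thesis using assms by (simp add: binomial_eq_0)
  qed
  finally show ?thesis .
qed

text \<open>The polynomial is \<open>P(t) = (M - t choose m)\<close> with \<open>M = r + p - k - 1\<close>. By Vandermonde, its sum over the class of \<open>0\<close> against
  \<open>(N choose t)\<close>, where \<open>N = r - l\<close>, is \<open>P(0)\<close> plus the contributions of those \<open>n\<close> with \<open>n \<equiv> N\<close>. The former is the boundary term at \<open>t = 0\<close>. The
  latter is the other boundary term or is zero, in one case by the hypothesis on \<open>(r - k choose m)\<close>.\<close>

lemma moment_zero_low:
  assumes st: "admissible i j r" and m: "j \<le> m" "m \<le> i" and k: "k = i + j - m"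
    and z: "of_nat (r - k choose m) = (0 :: 'p mod_ring)"
    and G: "homogeneous s G" "s + m * (p + 1) = r" "theta ^ m * G \<in> XV r i (i + 1)"
  shows "total (G * mon (p - 1 - k) m) = 0"
proof -
  note st' = admissibleD[OF st]
  define M where "M = r + p - k - 1"
  define q where "q = (\<lambda>n. if n \<le> m then (- 1) ^ n * (of_nat (M - n choose (m - n)) :: 'p mod_ring) else 0)"
  \<comment> \<open>The exponent \<open>0\<close> is always in the class; \<open>r - u\<close> with \<open>u \<equiv> i + j\<close> is the only other one that the cut-off can remove.\<close>
  define u where "u = (if i + j < p - 1 then i + j else i + j - (p - 1))"
  have k': "j \<le> k" "k \<le> i" "k + m = i + j" "k < p - 1" using m k st'(3) by simp_all
  have mp: "0 < m" "m < p - 1" "m < p" using m st'(1,3) by simp_all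
  have rM: "r \<le> M" "m \<le> M" using k'(4) st'(7) m by (simp_all add: M_def)
  have P: "bpoly q m t = of_nat (M - t choose m)" if "t \<le> r" for t
    unfolding q_def using that rM by (intro choose_reflect_expand) simp_all
  have u: "u < p - 1" "[0 + u = r] (mod (p - 1))" "u \<noteq> i + j \<Longrightarrow> u + (p - 1) = i + j" "u \<noteq> i + j \<Longrightarrow> u < j"
    "u = i + j \<longleftrightarrow> i + j < p - 1"
  proof -
    show "u < p - 1" "u \<noteq> i + j \<Longrightarrow> u + (p - 1) = i + j" "u \<noteq> i + j \<Longrightarrow> u < j" "u = i + j \<longleftrightarrow> i + j < p - 1"
      using st'(1,2,3) by (auto simp: u_def)
    have "[u = i + j] (mod (p - 1))"
    proof (cases "i + j < p - 1")
      case False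
      hence "i + j = u + (p - 1)" by (simp add: u_def)
      thus ?thesis by (simp add: cong_def)
    qed (simp add: u_def)
    thus "[0 + u = r] (mod (p - 1))" using st'(4) by (simp add: cong_trans)
  qed
  have S: "(\<Sum>t\<le>r. if i < t \<and> t < r - i \<and> [t = 0] (mod (p - 1)) then of_nat (r - l choose t) * bpoly q m t else 0) = 0"
    if l: "l \<le> i" for l
  proof -
    define N where "N = r - l"
    define c where "c = l + p - k - 1"
    have lr: "l \<le> r" using l st'(7) by simp
    have Mt: "M - t = (N - t) + c" if "t \<le> N" for t
      using that k'(4) lr by (simp add: M_def N_def c_def)
    have NM: "M = N + c" using Mt[of 0] by simp
    have E: "(\<Sum>n\<le>m. of_nat (c choose (m - n)) * of_nat (N choose n) * (if (p - 1) dvd (N - n) then 1 else (0 :: 'p mod_ring))) =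
        (if u \<le> i then of_nat (N choose (r - u)) * of_nat (M - (r - u) choose m) else 0)"
    proof -
      have cl: "(p - 1) dvd (N - n) \<longleftrightarrow> n + l = i + j \<or> n + l = u" if n: "n \<le> m" for n
      proof -
        have nN: "n \<le> N" using n m l st'(3,6) by (simp add: N_def)
        have "(p - 1) dvd (N - n) \<longleftrightarrow> [n = N] (mod (p - 1))"
          unfolding cong_sym_eq[of n N] cong_altdef_nat[OF nN] ..
        also have "\<dots> \<longleftrightarrow> [n + l = N + l] (mod (p - 1))" by (simp only: cong_add_rcancel_nat)
        also have "N + l = r" using lr by (simp add: N_def)
        also have "[n + l = r] (mod (p - 1)) \<longleftrightarrow> [n + l = u] (mod (p - 1))"
          using u(2) by (metis add_0 cong_sym cong_trans)
        also have "\<dots> \<longleftrightarrow> n + l = i + j \<or> n + l = u"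
        proof
          assume c: "[n + l = u] (mod (p - 1))"
          show "n + l = i + j \<or> n + l = u"
          proof (cases "n + l < p - 1")
            case True
            thus ?thesis using cong_small[OF c _ u(1)] by simp
          next
            case False
            hence "[n + l - (p - 1) + (p - 1) = u] (mod (p - 1))" using c by simp
            hence "[n + l - (p - 1) = u] (mod (p - 1))" by (simp add: cong_def)
            moreover have "n + l - (p - 1) < p - 1" using n l m st'(3) by simp
            ultimately have "n + l - (p - 1) = u" using cong_small u(1) by blast
            hence "n + l = u + (p - 1)" using False by simp
            moreover have "u + (p - 1) \<noteq> i + j \<Longrightarrow> False"
              using u(3,5) calculation n l m st'(1,2,3) by linarith
            ultimately show ?thesis by auto
          qed
        next
          assume "n + l = i + j \<or> n + l = u"
          thus "[n + l = u] (mod (p - 1))" using u(2) st'(4) by (auto intro: cong_trans cong_sym)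
        qed
        finally show ?thesis .
      qed
      have zero: "of_nat (c choose (m - n)) * of_nat (N choose n) = (0 :: 'p mod_ring)" if n: "n \<le> m" "n + l = i + j" for n
      proof (cases "l = k")
        case True
        hence "n = m" using n k'(3) by simp
        thus ?thesis using z True by (simp add: N_def)
      next
        case False
        have kl: "k < l" using False n k'(3) by simp
        have "m - n = l - k" using n k'(3) by simp
        moreover have "c mod p = l - k - 1"
        proof -
          have "c = l - k - 1 + p" using kl by (simp add: c_def)
          moreover have "l - k - 1 < p" using l st'(3) by simp
          ultimately show ?thesis by simp
        qed
        moreover have "l - k < p" using l st'(3) by simp
        ultimately have "of_nat (c choose (m - n)) = (0 :: 'p mod_ring)"
          using choose_zero_iff[of "l - k" c] kl by simp
        thus ?thesis by simp
      qed
      have one: "c choose (m - n) = 1" "N choose n = N choose (r - u)" "M - (r - u) choose m = 1" "n \<le> m"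
        if n: "n + l = u" "u \<le> i" for n
      proof -
        have ui: "u + (p - 1) = i + j" using u(3) n(2) st'(1) by linarith
        have "m + l = n + l + (l + p - k - 1)" using ui n k'(3,4) by simp
        hence nc: "m = n + c" using k'(4) by (simp add: c_def)
        thus "c choose (m - n) = 1" "n \<le> m" by simp_all
        have "N - n = r - u" "n \<le> N" using n lr st'(7) by (simp_all add: N_def)
        thus "N choose n = N choose (r - u)" using binomial_symmetric[of n N] by simp
        have "M - (r - u) = m" using ui k'(3,4) n(2) st'(7) by (simp add: M_def)
        thus "M - (r - u) choose m = 1" by simp
      qed
      show ?thesis
      proof (cases "u \<le> i \<and> l \<le> u")
        case True
        have "(\<Sum>n\<le>m. of_nat (c choose (m - n)) * of_nat (N choose n) * (if (p - 1) dvd (N - n) then 1 else (0 :: 'p mod_ring))) =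
            (\<Sum>n\<le>m. if n = u - l then of_nat (N choose (r - u)) else 0)"
        proof (intro sum.cong refl)
          fix n assume "n \<in> {..m}"
          hence n: "n \<le> m" by simp
          consider "n = u - l" | "n \<noteq> u - l" "n + l = i + j" | "n \<noteq> u - l" "n + l \<noteq> i + j" by blast
          thus "of_nat (c choose (m - n)) * of_nat (N choose n) * (if (p - 1) dvd (N - n) then 1 else (0 :: 'p mod_ring)) =
              (if n = u - l then of_nat (N choose (r - u)) else 0)"
          proof cases
            case 1
            thus ?thesis using one[of n] cl[OF n] True by simp
          next
            case 2
            thus ?thesis using zero[OF n] by simp
          next
            case 3
            hence "n + l \<noteq> u" by auto
            thus ?thesis using 3 cl[OF n] by simp
          qed
        qed
        also have "\<dots> = of_nat (N choose (r - u))" using one(4)[of "u - l"] True by simp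
        finally show ?thesis using one(3)[of "u - l"] True by simp
      next
        case False
        have "of_nat (N choose (r - u)) = (0 :: 'p mod_ring)" if "u \<le> i"
        proof -
          have "N < r - u" using False that l lr st'(7) by (auto simp: N_def)
          thus ?thesis by (simp add: binomial_eq_0)
        qed
        moreover
        have "of_nat (c choose (m - n)) * of_nat (N choose n) * (if (p - 1) dvd (N - n) then 1 else (0 :: 'p mod_ring)) = 0"
          if n: "n \<le> m" for n
        proof (cases "n + l = i + j")
          case True
          thus ?thesis using zero[OF n] by simp
        next
          case False
          have "n + l \<noteq> u"
          proof
            assume "n + l = u"
            hence "u = i + j" using \<open>\<not> (u \<le> i \<and> l \<le> u)\<close> u(4) st'(2) by force
            thus False using False \<open>n + l = u\<close> by simp
          qed
          thus ?thesis using cl[OF n] False by simp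
        qed
        hence "(\<Sum>n\<le>m. of_nat (c choose (m - n)) * of_nat (N choose n) * (if (p - 1) dvd (N - n) then 1 else (0 :: 'p mod_ring))) = 0"
          by (intro sum.neutral ballI) (simp only: atMost_iff)
        ultimately show ?thesis by simp
      qed
    qed
    have full: "(\<Sum>t\<le>r. if [t = 0] (mod (p - 1)) then of_nat (N choose t) * bpoly q m t else 0) =
        of_nat (M choose m) + (\<Sum>n\<le>m. of_nat (c choose (m - n)) * of_nat (N choose n) * (if (p - 1) dvd (N - n) then 1 else (0 :: 'p mod_ring)))"
    proof -
      have "(\<Sum>t\<le>r. if [t = 0] (mod (p - 1)) then of_nat (N choose t) * bpoly q m t else 0) =
          (\<Sum>t\<le>N. if [t = 0] (mod (p - 1)) then of_nat (N choose t) * bpoly q m t else 0)"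
        by (rule sum.mono_neutral_right) (auto simp: binomial_eq_0 N_def)
      also have "\<dots> = (\<Sum>t\<le>N. \<Sum>n\<le>m. of_nat (c choose (m - n)) * of_nat (N choose n) * (if [t = 0] (mod (p - 1)) then of_nat (N - n choose t) else 0))"
      proof (intro sum.cong refl)
        fix t assume "t \<in> {..N}"
        hence t: "t \<le> N" "t \<le> r" by (simp_all add: N_def)
        have "(N choose t) * ((N - t) choose n) = (N choose n) * (N - n choose t)" for n
        proof (cases "n \<le> N - t")
          case True
          have "(N choose t) * (N - t choose n) = (N choose (t + n)) * (t + n choose t)"
            using choose_mult[of t "t + n" N] True t by simp
          moreover have "(N choose n) * (N - n choose t) = (N choose (n + t)) * (n + t choose n)"
            using choose_mult[of n "n + t" N] True t by simp
          moreover have "t + n choose t = n + t choose n" using binomial_symmetric[of t "t + n"] by (simp add: add.commute)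
          ultimately show ?thesis by (simp only: add.commute)
        next
          case False
          thus ?thesis using t by (cases "n \<le> N") (simp_all add: binomial_eq_0)
        qed
        hence X: "(N choose t) * ((N - t + c) choose m) = (\<Sum>n\<le>m. (c choose (m - n)) * (N choose n) * (N - n choose t))"
          unfolding vandermonde[of "N - t" c m, symmetric] sum_distrib_left
          by (intro sum.cong refl) (metis mult.assoc mult.commute)
        have "of_nat (N choose t) * bpoly q m t = of_nat ((N choose t) * ((N - t + c) choose m))"
          unfolding P[OF t(2)] Mt[OF t(1)] by simp
        also have "\<dots> = (\<Sum>n\<le>m. of_nat (c choose (m - n)) * of_nat (N choose n) * of_nat (N - n choose t))"
          unfolding X by simp
        finally show "(if [t = 0] (mod (p - 1)) then of_nat (N choose t) * bpoly q m t else 0) =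
            (\<Sum>n\<le>m. of_nat (c choose (m - n)) * of_nat (N choose n) * (if [t = 0] (mod (p - 1)) then of_nat (N - n choose t) else 0))"
          by simp
      qed
      also have "\<dots> = (\<Sum>n\<le>m. of_nat (c choose (m - n)) * of_nat (N choose n) * (\<Sum>t\<le>N. if [t = 0] (mod (p - 1)) then of_nat (N - n choose t) else 0))"
        by (subst sum.swap) (simp only: sum_distrib_left)
      also have "\<dots> = (\<Sum>n\<le>m. of_nat (c choose (m - n)) * of_nat (N choose n) +
          of_nat (c choose (m - n)) * of_nat (N choose n) * (if (p - 1) dvd (N - n) then 1 else (0 :: 'p mod_ring)))"
      proof (intro sum.cong refl)
        fix n assume "n \<in> {..m}"
        hence n: "0 < N - n" using m l st'(3,6) by (simp add: N_def)
        have "(\<Sum>t\<le>N. if [t = 0] (mod (p - 1)) then of_nat (N - n choose t) else 0) = (class_sum (N - n) 0 :: 'p mod_ring)"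
          unfolding class_sum_def by (rule sum.mono_neutral_right) (auto simp: binomial_eq_0)
        thus "of_nat (c choose (m - n)) * of_nat (N choose n) * (\<Sum>t\<le>N. if [t = 0] (mod (p - 1)) then of_nat (N - n choose t) else 0) =
            of_nat (c choose (m - n)) * of_nat (N choose n) +
            of_nat (c choose (m - n)) * of_nat (N choose n) * (if (p - 1) dvd (N - n) then 1 else (0 :: 'p mod_ring))"
          unfolding class_sum_0[OF n] by simp
      qed
      also have "(\<Sum>n\<le>m. of_nat (c choose (m - n)) * of_nat (N choose n) + of_nat (c choose (m - n)) * of_nat (N choose n) * (if (p - 1) dvd (N - n) then 1 else (0 :: 'p mod_ring))) =
          of_nat (\<Sum>n\<le>m. (N choose n) * (c choose (m - n))) +
          (\<Sum>n\<le>m. of_nat (c choose (m - n)) * of_nat (N choose n) * (if (p - 1) dvd (N - n) then 1 else (0 :: 'p mod_ring)))"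
        by (simp add: sum.distrib mult.commute)
      finally show ?thesis unfolding vandermonde NM .
    qed
    have "(\<Sum>t\<le>r. if i < t \<and> t < r - i \<and> [t = 0] (mod (p - 1)) then of_nat (N choose t) * bpoly q m t else 0) =
        (\<Sum>t\<le>r. if [t = 0] (mod (p - 1)) then of_nat (N choose t) * bpoly q m t else 0) -
        (if 0 \<le> i then of_nat (N choose 0) * bpoly q m 0 else 0) -
        (if u \<le> i then of_nat (N choose (r - u)) * bpoly q m (r - u) else 0)"
      using p3 by (intro band_sum u(1,2) st'(3,6)) simp
    also have "\<dots> = 0"
      unfolding full E using P[of 0] P[of "r - u"] by simp
    finally show ?thesis unfolding N_def .
  qed
  have no_class: "\<not> [t = 0] (mod (p - 1))" if t: "0 < t" "t < p - 1" for t
    using cong_small[of t 0] t p3 by auto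
  have "(\<Sum>t\<le>s. co G (s - t) t * (if [m + t = 0] (mod (p - 1)) then q m - (if t = 0 then bpoly q m m else 0) -
    (if t = s then (- 1) ^ m * bpoly q m (r - m) else 0) else 0)) = 0"
  proof (rule exclusion[OF st mp(1) m(2) _ _ _ S G])
    show "q n = 0" if "m < n" for n using that by (simp add: q_def)
    show "bpoly q m t = 0" if "m < t" "t \<le> i" "[t = 0] (mod (p - 1))" for t
      using that no_class[of t] st'(3) by simp
    show "bpoly q m t = 0" if t: "r - i \<le> t" "t < r - m" "[t = 0] (mod (p - 1))" for t
    proof -
      have "[r - t + t = u + t] (mod (p - 1))"
      proof -
        have "[0 + u = t + u] (mod (p - 1))" using cong_add[OF cong_sym[OF t(3)] cong_refl[of u]] .
        moreover have "r - t + t = r" using t by simp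
        ultimately show ?thesis using u(2) by (metis add.commute cong_sym cong_trans)
      qed
      hence "[r - t = u] (mod (p - 1))" by (simp only: cong_add_rcancel_nat)
      moreover have "r - t < p - 1" using t(1) st'(3) by linarith
      ultimately have "r - t = u" using u(1) by (intro cong_small)
      moreover have "m < r - t" "r - t \<le> i" using t by linarith+
      ultimately have False using u(4) m(1) st'(1) by linarith
      thus ?thesis ..
    qed
  qed
  also have "(\<Sum>t\<le>s. co G (s - t) t * (if [m + t = 0] (mod (p - 1)) then q m - (if t = 0 then bpoly q m m else 0) -
      (if t = s then (- 1) ^ m * bpoly q m (r - m) else 0) else 0)) =
      (\<Sum>t\<le>s. (- 1) ^ m * (co G (s - t) t * total (mon (s - t + (p - 1 - k)) (t + m))))"
  proof (intro sum.cong refl)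
    fix t assume "t \<in> {..s}"
    hence t: "t \<le> s" by simp
    note sc = admissible_class[OF st m(2) _ G(2), folded k]
    have sk: "[s + m = k] (mod (p - 1))" using sc m by simp
    have d: "[m + t = 0] (mod (p - 1)) \<longleftrightarrow> (p - 1) dvd (t + m)" by (simp add: cong_0_iff add.commute)
    have d': "(p - 1) dvd (s - t + (p - 1 - k))" if "(p - 1) dvd (t + m)"
    proof -
      have "s - t + (p - 1 - k) + (t + m) + k = s + m + (p - 1)" using t k'(4) by simp
      moreover have "[s + m + (p - 1) = k] (mod (p - 1))" using sk by (simp add: cong_def)
      ultimately have "[s - t + (p - 1 - k) + (t + m) + k = 0 + k] (mod (p - 1))" by (simp only: add_0)
      hence "[s - t + (p - 1 - k) + (t + m) = 0] (mod (p - 1))" by (simp only: cong_add_rcancel_nat)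
      hence "(p - 1) dvd (s - t + (p - 1 - k) + (t + m))" by (simp add: cong_0_iff)
      thus ?thesis using that by (metis dvd_add_left_iff)
    qed
    have t0: "t \<noteq> 0" "t \<noteq> s" if c: "[m + t = 0] (mod (p - 1))"
    proof -
      show "t \<noteq> 0"
      proof
        assume "t = 0"
        thus False using c no_class[OF mp(1,2)] by simp
      qed
      show "t \<noteq> s"
      proof
        assume "t = s"
        hence "[k = 0] (mod (p - 1))" using c sk by (metis add.commute cong_sym cong_trans)
        thus False using no_class[of k] k' st'(1) by simp
      qed
    qed
    show "co G (s - t) t * (if [m + t = 0] (mod (p - 1)) then q m - (if t = 0 then bpoly q m m else 0) -
        (if t = s then (- 1) ^ m * bpoly q m (r - m) else 0) else 0) =
        (- 1) ^ m * (co G (s - t) t * total (mon (s - t + (p - 1 - k)) (t + m)))"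
    proof (cases "[m + t = 0] (mod (p - 1))")
      case True
      hence D: "(p - 1) dvd (t + m)" using d by blast
      have "total (mon (s - t + (p - 1 - k)) (t + m)) = 1"
        unfolding total_mon using D d'[OF D] mp(1) k'(4) by auto
      moreover have "q m = (- 1) ^ m" by (simp add: q_def)
      ultimately show ?thesis using True t0[OF True] by simp
    next
      case False
      hence "total (mon (s - t + (p - 1 - k)) (t + m)) = 0" using d unfolding total_mon by auto
      thus ?thesis using False by simp
    qed
  qed
  also have "\<dots> = (- 1) ^ m * total (G * mon (p - 1 - k) m)"
    unfolding total_mult_mon[OF G(1)] sum_distrib_left ..
  finally show ?thesis by simp
qed

text \<open>Expanding \<open>(Z - n + Y choose m - n)\<close> by Vandermonde and exchanging the sums leaves \<open>(h + p - l choose h)\<close>, which modulo \<open>p\<close>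
  is zero for \<open>0 < l \<le> h\<close>.\<close>

lemma vandermonde_twisted:
  assumes h: "h < m" "m \<le> Z" "h < p" and Y: "Y \<le> h" and c: "c + m = h + p"
  shows "(\<Sum>n\<le>h. of_nat (c choose (h - n)) * of_nat (Z choose n) * of_nat (Z - n + Y choose (m - n))) =
    (of_nat (Z choose m) :: 'p mod_ring)"
proof -
  have X: "(Z choose n) * (Z - n + Y choose (m - n)) = (\<Sum>l\<le>m. (Y choose l) * (Z choose (m - l)) * (m - l choose n))"
    if n: "n \<le> h" for n
  proof -
    have "(Z choose n) * (Z - n + Y choose (m - n)) = (\<Sum>l\<le>m - n. (Z choose n) * ((Y choose l) * (Z - n choose (m - n - l))))"
      unfolding sum_distrib_left[symmetric] vandermonde by (simp only: add.commute)
    also have "\<dots> = (\<Sum>l\<le>m - n. (Y choose l) * (Z choose (m - l)) * (m - l choose n))"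
    proof (intro sum.cong refl)
      fix l assume "l \<in> {..m - n}"
      hence "n \<le> m - l" "m - l \<le> Z" "m - l - n = m - n - l" using n h by auto
      hence "(Z choose (m - l)) * (m - l choose n) = (Z choose n) * (Z - n choose (m - n - l))"
        using choose_mult[of n "m - l" Z] by (simp only:)
      thus "(Z choose n) * ((Y choose l) * (Z - n choose (m - n - l))) = (Y choose l) * (Z choose (m - l)) * (m - l choose n)"
        by (simp only: mult.assoc mult.left_commute)
    qed
    also have "\<dots> = (\<Sum>l\<le>m. (Y choose l) * (Z choose (m - l)) * (m - l choose n))"
      using n h by (intro sum.mono_neutral_left) (auto simp: binomial_eq_0)
    finally show ?thesis .
  qed
  have "(\<Sum>n\<le>h. (c choose (h - n)) * (Z choose n) * (Z - n + Y choose (m - n))) =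
      (\<Sum>n\<le>h. \<Sum>l\<le>m. (Y choose l) * (Z choose (m - l)) * ((m - l choose n) * (c choose (h - n))))"
  proof (rule sum.cong[OF refl])
    fix n assume "n \<in> {..h}"
    hence n: "n \<le> h" by simp
    have "(c choose (h - n)) * (Z choose n) * (Z - n + Y choose (m - n)) =
        (c choose (h - n)) * ((Z choose n) * (Z - n + Y choose (m - n)))" by (rule mult.assoc)
    also have "\<dots> = (\<Sum>l\<le>m. (c choose (h - n)) * ((Y choose l) * (Z choose (m - l)) * (m - l choose n)))"
      unfolding X[OF n] by (rule sum_distrib_left)
    also have "\<dots> = (\<Sum>l\<le>m. (Y choose l) * (Z choose (m - l)) * ((m - l choose n) * (c choose (h - n))))"
    proof (rule sum.cong[OF refl])
      fix l
      show "(c choose (h - n)) * ((Y choose l) * (Z choose (m - l)) * (m - l choose n)) =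
          (Y choose l) * (Z choose (m - l)) * ((m - l choose n) * (c choose (h - n)))"
        by (simp only: mult_ac)
    qed
    finally show "(c choose (h - n)) * (Z choose n) * (Z - n + Y choose (m - n)) =
        (\<Sum>l\<le>m. (Y choose l) * (Z choose (m - l)) * ((m - l choose n) * (c choose (h - n))))" .
  qed
  also have "\<dots> = (\<Sum>l\<le>m. (Y choose l) * (Z choose (m - l)) * (m - l + c choose h))"
    by (subst sum.swap) (simp only: sum_distrib_left[symmetric] vandermonde)
  finally have "(\<Sum>n\<le>h. of_nat (c choose (h - n)) * of_nat (Z choose n) * of_nat (Z - n + Y choose (m - n))) =
      (\<Sum>l\<le>m. of_nat (Y choose l) * of_nat (Z choose (m - l)) * (of_nat (m - l + c choose h) :: 'p mod_ring))"
    by (simp only: of_nat_sum[symmetric] of_nat_mult[symmetric])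
  also have "\<dots> = (\<Sum>l\<le>m. if l = 0 then of_nat (Z choose m) else 0)"
  proof (intro sum.cong refl)
    fix l assume "l \<in> {..m}"
    hence l: "l \<le> m" by simp
    have mlc: "m - l + c = h + p - l" using l c by simp
    consider "l = 0" | "0 < l" "l \<le> Y" | "Y < l" by linarith
    thus "of_nat (Y choose l) * of_nat (Z choose (m - l)) * (of_nat (m - l + c choose h) :: 'p mod_ring) = (if l = 0 then of_nat (Z choose m) else 0)"
    proof cases
      case 1
      have "[h + p = h] (mod p)" by (simp add: cong_def)
      hence "of_nat (h + p choose h) = (1 :: 'p mod_ring)"
        using choose_cong[OF _ h(3)] by (metis binomial_n_n of_nat_1)
      hence W: "of_nat (m - l + c choose h) = (1 :: 'p mod_ring)" unfolding mlc by (simp only: 1 diff_zero)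
      show ?thesis unfolding W using 1 by simp
    next
      case 2
      have "(h + p - l) mod p = h - l"
      proof -
        have "h + p - l = h - l + p" "h - l < p" using 2 Y h by simp_all
        thus ?thesis by (simp only: mod_add_self2 mod_less)
      qed
      hence "(h + p - l) mod p < h" using 2 Y by linarith
      hence W: "of_nat (m - l + c choose h) = (0 :: 'p mod_ring)"
        unfolding mlc using choose_zero_iff[OF h(3)] by blast
      show ?thesis unfolding W using 2 by simp
    next
      case 3
      thus ?thesis by (simp add: binomial_eq_0)
    qed
  qed
  finally show ?thesis by simp
qed

text \<open>This rewrites the class sums for all \<open>l \<le> i\<close> as binomial coefficients with an upper argument \<open>r - l - n + Y\<close>, as needed
  for \<open>vandermonde_twisted\<close>. For \<open>l > k\<close> the representative of the class may be nonpositive and is then raised by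
  \<open>p - 1\<close>, which modulo \<open>p\<close> shifts the argument by one.\<close>

lemma class_sum_twisted:
  assumes st: "admissible i j r" and m: "j \<le> m" "m \<le> i" and k: "k = i + j - m" and mk: "m \<le> k"
    and h: "1 \<le> h" "h < m" "[r + h = i + j] (mod p)" and n: "n \<le> h" and l: "l \<le> i"
  shows "class_sum (r - l - n) (m - n) = of_nat (r - l - n + (if l \<le> k then h else h - 1) choose (m - n))"
proof -
  note st' = admissibleD[OF st]
  have k': "k \<le> i" "k + m = i + j" using m k by simp_all
  have lnr: "l + n < r" using l n h m st'(3,6) by simp
  have pos: "0 < r - l - n" using lnr by simp
  have mp: "m - n < p" "m - n < p - 1" "0 < m - n" using h n m st'(3) by simp_all
  show ?thesis
  proof (cases "l \<le> k")
    case True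
    have ln: "l + n \<le> i + j" using True n h k' by simp
    have "class_sum (r - l - n) (m - n) = of_nat (i + j - l - n choose (m - n))"
      by (rule class_sum_choose[OF class_shift[OF st'(4)] pos]) (use True k' st'(3,8) n h m ln mp in simp_all)
    moreover have "[r - l - n + h + (l + n) = i + j - l - n + (l + n)] (mod p)"
      using h(3) lnr ln by (simp add: add.commute)
    hence "[r - l - n + h = i + j - l - n] (mod p)" by (simp only: cong_add_rcancel_nat)
    ultimately show ?thesis using choose_cong[OF _ mp(1)] True by simp
  next
    case False
    have kl: "k < l" using False by simp
    define y where "y = (if l + n < i + j then i + j - l - n else i + j + (p - 1) - l - n)"
    have y: "[r - l - n = y] (mod (p - 1))" "1 \<le> y" "y \<le> p - 1"
    proof -
      have "[r - l - n + (l + n) = y + (l + n)] (mod (p - 1))"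
      proof (cases "l + n < i + j")
        case True
        thus ?thesis using cong_sym[OF st'(4)] lnr by (simp add: y_def)
      next
        case False
        have "y + (l + n) = i + j + (p - 1)" using False l n h m st'(1,3) by (simp add: y_def)
        moreover have "[r = i + j + (p - 1)] (mod (p - 1))" using cong_sym[OF st'(4)] by (simp add: cong_def)
        ultimately show ?thesis using lnr by simp
      qed
      thus "[r - l - n = y] (mod (p - 1))" by (simp only: cong_add_rcancel_nat)
      have "y + (l + n) = i + j \<and> l + n < i + j \<or> y + (l + n) = i + j + (p - 1) \<and> i + j \<le> l + n"
        using l n h m st'(1,3) by (auto simp: y_def)
      thus "1 \<le> y" "y \<le> p - 1" using kl l n h m k' st'(1,3) by linarith+
    qed
    have "class_sum (r - l - n) (m - n) = of_nat (y choose (m - n))"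
      using class_sum_value[OF y(1) pos y(2,3) mp(2)] mp(3) by simp
    also have "\<dots> = of_nat (r - l - n + (h - 1) choose (m - n))"
    proof (cases "l + n < i + j")
      case True
      have yn: "y < m - n" using True kl k' by (simp add: y_def)
      have "[r - l - n + (h - 1) + (l + n + 1) = y - 1 + (l + n + 1)] (mod p)"
      proof -
        have "r - l - n + (h - 1) + (l + n + 1) = r + h" "y - 1 + (l + n + 1) = i + j"
          using lnr h True by (simp_all add: y_def)
        thus ?thesis using h(3) by (simp only:)
      qed
      hence "[r - l - n + (h - 1) = y - 1] (mod p)" by (simp only: cong_add_rcancel_nat)
      from choose_cong[OF this mp(1)] show ?thesis using yn by (simp add: binomial_eq_0)
    next
      case False
      have "[r - l - n + (h - 1) + (l + n + 1) = y + (l + n + 1)] (mod p)"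
      proof -
        have "r - l - n + (h - 1) + (l + n + 1) = r + h" "y + (l + n + 1) = i + j + p"
          using lnr h False l n m st'(1,3) by (simp_all add: y_def)
        thus ?thesis using h(3) by (simp only: cong_def mod_add_self2)
      qed
      hence "[r - l - n + (h - 1) = y] (mod p)" by (simp only: cong_add_rcancel_nat)
      from choose_cong[OF this mp(1)] show ?thesis by simp
    qed
    finally show ?thesis using False by simp
  qed
qed

lemma class_boundary:
  assumes st: "admissible i j r" and k: "k + m = i + j" "k < p - 1" and t: "r - i \<le> t" "t \<le> r" "[t = m] (mod (p - 1))"
  shows "t = r - k"
proof -
  note st' = admissibleD[OF st]
  have "[r - t + t = k + t] (mod (p - 1))"
  proof -
    have "[k + t = k + m] (mod (p - 1))" using cong_add[OF cong_refl t(3)] .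
    hence "[r = k + t] (mod (p - 1))" using st'(4) k(1) by (metis cong_sym cong_trans)
    thus ?thesis using t(2) by simp
  qed
  hence "[r - t = k] (mod (p - 1))" by (simp only: cong_add_rcancel_nat)
  moreover have "r - t < p - 1" using t st'(3) by linarith
  ultimately have "r - t = k" using k(2) by (intro cong_small)
  thus ?thesis using t(2) by simp
qed

text \<open>The polynomial is \<open>P(t) = (t + c choose h)\<close> with \<open>c \<equiv> h - m\<close> modulo \<open>p\<close>, for which \<open>P(m) = 1\<close> and \<open>P(r - k) = 0\<close>. Its class sums
  are \<open>(r - l choose m)\<close> by \<open>vandermonde_twisted\<close> and equal the boundary term at \<open>t = m\<close>. As the degree is less than \<open>m\<close>,
  the value on \<open>\<theta>\<^sup>m G\<close> consists of a boundary contribution only.\<close>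

lemma leading_coeff_zero:
  assumes st: "admissible i j r" and m: "j \<le> m" "m \<le> i" and k: "k = i + j - m" and mk: "m \<le> k"
    and h: "1 \<le> h" "h < m" "[r + h = i + j] (mod p)"
    and G: "homogeneous s G" "s + m * (p + 1) = r" "theta ^ m * G \<in> XV r i (i + 1)"
  shows "co G s 0 = 0"
proof -
  note st' = admissibleD[OF st]
  define c where "c = h + p - m"
  define q where "q = (\<lambda>n. if n \<le> h then (of_nat (c choose (h - n)) :: 'p mod_ring) else 0)"
  have k': "j \<le> k" "k \<le> i" "k + m = i + j" "k < p - 1" using m k st'(3) by simp_all
  have mp: "0 < m" "m < p - 1" "h < p" "m < p" using m h st'(3) by simp_all
  have c: "c + m = h + p" using mp by (simp add: c_def)
  have P: "bpoly q m t = of_nat (t + c choose h)" for t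
  proof -
    have "bpoly q m t = (\<Sum>n\<le>h. of_nat (c choose (h - n)) * of_nat (t choose n))"
      unfolding bpoly_def q_def using h by (intro sum.mono_neutral_cong_right) auto
    also have "\<dots> = of_nat (\<Sum>n\<le>h. (t choose n) * (c choose (h - n)))" by (simp add: mult.commute)
    finally show ?thesis by (simp only: vandermonde)
  qed
  have Pm: "bpoly q m m = 1"
  proof -
    have "[m + c = h] (mod p)" using c by (simp add: cong_def add.commute)
    from choose_cong[OF this mp(3)] show ?thesis unfolding P by simp
  qed
  have Pk: "bpoly q m (r - k) = 0"
  proof -
    have "[r - k + c + (k + m) = p + (k + m)] (mod p)"
    proof -
      have "r - k + c + (k + m) = r + h + p" "p + (k + m) = i + j + p" using c k' st'(8) by simp_all
      thus ?thesis using h(3) by (simp only: cong_def mod_add_self2)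
    qed
    hence "[r - k + c = p] (mod p)" by (simp only: cong_add_rcancel_nat)
    hence "(r - k + c) mod p = 0" by (simp add: cong_def)
    thus ?thesis unfolding P using choose_zero_iff[OF mp(3), of "r - k + c"] h(1) by simp
  qed
  have S: "(\<Sum>t\<le>r. if i < t \<and> t < r - i \<and> [t = m] (mod (p - 1)) then of_nat (r - l choose t) * bpoly q m t else 0) = 0"
    if l: "l \<le> i" for l
  proof -
    have lr: "l \<le> r" using l st'(7) by simp
    have "(\<Sum>t\<le>r. if [t = m] (mod (p - 1)) then of_nat (r - l choose t) * bpoly q m t else 0) =
        (\<Sum>n\<le>m. q n * of_nat (r - l choose n) * class_sum (r - l - n) (m - n))"
      by (rule full_sum_bpoly[OF order_refl lr])
    also have "\<dots> = (\<Sum>n\<le>h. of_nat (c choose (h - n)) * of_nat (r - l choose n) *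
        of_nat (r - l - n + (if l \<le> k then h else h - 1) choose (m - n)))"
    proof (rule sum.mono_neutral_cong_right)
      fix n assume "n \<in> {..h}"
      hence n: "n \<le> h" by simp
      show "q n * of_nat (r - l choose n) * class_sum (r - l - n) (m - n) = of_nat (c choose (h - n)) * of_nat (r - l choose n) *
          of_nat (r - l - n + (if l \<le> k then h else h - 1) choose (m - n))"
        unfolding class_sum_twisted[OF st m k mk h n l] using n by (simp add: q_def)
    qed (use h in \<open>auto simp: q_def\<close>)
    also have "\<dots> = of_nat (r - l choose m)"
      using l m st'(3,6) h mp c by (intro vandermonde_twisted) simp_all
    finally have full: "(\<Sum>t\<le>r. if [t = m] (mod (p - 1)) then of_nat (r - l choose t) * bpoly q m t else 0) = of_nat (r - l choose m)" .
    have "(\<Sum>t\<le>r. if i < t \<and> t < r - i \<and> [t = m] (mod (p - 1)) then of_nat (r - l choose t) * bpoly q m t else 0) =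
        (\<Sum>t\<le>r. if [t = m] (mod (p - 1)) then of_nat (r - l choose t) * bpoly q m t else 0) -
        (if m \<le> i then of_nat (r - l choose m) * bpoly q m m else 0) -
        (if k \<le> i then of_nat (r - l choose (r - k)) * bpoly q m (r - k) else 0)"
      using k' st'(4) by (intro band_sum mp(2) st'(3,6)) (simp_all add: add.commute)
    thus ?thesis unfolding full Pm Pk using m by simp
  qed
  have "(\<Sum>t\<le>s. co G (s - t) t * (if [m + t = m] (mod (p - 1)) then q m - (if t = 0 then bpoly q m m else 0) -
    (if t = s then (- 1) ^ m * bpoly q m (r - m) else 0) else 0)) = 0"
  proof (rule exclusion[OF st mp(1) m(2) _ _ _ S G])
    show "q n = 0" if "m < n" for n using that h by (simp add: q_def)
    show "bpoly q m t = 0" if t: "m < t" "t \<le> i" "[t = m] (mod (p - 1))" for t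
      using cong_small[OF t(3)] t st'(3) mp by simp
    show "bpoly q m t = 0" if t: "r - i \<le> t" "t < r - m" "[t = m] (mod (p - 1))" for t
    proof -
      have "t = r - k" using t by (intro class_boundary[OF st k'(3,4)]) simp_all
      thus ?thesis using Pk by simp
    qed
  qed
  also have "(\<Sum>t\<le>s. co G (s - t) t * (if [m + t = m] (mod (p - 1)) then q m - (if t = 0 then bpoly q m m else 0) -
      (if t = s then (- 1) ^ m * bpoly q m (r - m) else 0) else 0)) = (\<Sum>t\<le>s. if t = 0 then - co G s 0 else 0)"
  proof (intro sum.cong refl)
    fix t assume "t \<in> {..s}"
    have qm: "q m = 0" using h by (simp add: q_def)
    have last: "bpoly q m (r - m) = 0" if "[m + s = m] (mod (p - 1))"
    proof -
      have "[s + m = k] (mod (p - 1))" using admissible_class[OF st m(2) _ G(2)] m(2) k by simp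
      hence "[m = k] (mod (p - 1))" using that by (metis add.commute cong_sym cong_trans)
      hence "m = k" using mp k'(4) by (intro cong_small)
      thus ?thesis using Pk by simp
    qed
    show "co G (s - t) t * (if [m + t = m] (mod (p - 1)) then q m - (if t = 0 then bpoly q m m else 0) -
      (if t = s then (- 1) ^ m * bpoly q m (r - m) else 0) else 0) = (if t = 0 then - co G s 0 else 0)"
    proof (cases "t = s")
      case True
      thus ?thesis using qm Pm last by (cases "t = 0") auto
    next
      case False
      thus ?thesis using qm Pm by (cases "t = 0") auto
    qed
  qed
  finally show ?thesis by simp
qed

text \<open>The polynomial is \<open>P(t) = (t choose m)\<close>. For \<open>r + 1 \<equiv> k\<close> modulo \<open>p\<close> the boundary term at \<open>r - k\<close> is nonzero only in the
  equation for \<open>l = k\<close>, where the class sum is twice the boundary term at \<open>m\<close>.\<close>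

lemma moment_zero_high:
  assumes st: "admissible i j r" and m: "j \<le> m" "m \<le> i" and k: "k = i + j - m" and km: "k \<le> m" and rk: "[r + 1 = k] (mod p)"
    and G: "homogeneous s G" "s + m * (p + 1) = r" "theta ^ m * G \<in> XV r i (i + 1)"
  shows "total (G * mon (m - k) 0) = 0"
proof -
  note st' = admissibleD[OF st]
  define q where "q = (\<lambda>n. if n = m then 1 else (0 :: 'p mod_ring))"
  have k': "j \<le> k" "k \<le> i" "k + m = i + j" "k < p - 1" using m k st'(3) by simp_all
  have mp: "0 < m" "m < p - 1" "m < p" "k < p" using m k' st'(1,3) by simp_all
  have P: "bpoly q m t = of_nat (t choose m)" for t
  proof -
    have "bpoly q m t = (\<Sum>n\<le>m. if n = m then of_nat (t choose m) else 0)"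
      unfolding bpoly_def q_def by (intro sum.cong) auto
    thus ?thesis by simp
  qed
  have rl: "[r - l = k + p - l - 1] (mod p)" if "l \<le> k" for l
  proof -
    have "[r - l + (l + 1) = k + p - l - 1 + (l + 1)] (mod p)"
    proof -
      have "r - l + (l + 1) = r + 1" "k + p - l - 1 + (l + 1) = k + p" using that k'(2) st'(7) p3 by simp_all
      thus ?thesis using rk by (simp only: cong_def mod_add_self2)
    qed
    thus ?thesis by (simp only: cong_add_rcancel_nat)
  qed
  have S: "(\<Sum>t\<le>r. if i < t \<and> t < r - i \<and> [t = m] (mod (p - 1)) then of_nat (r - l choose t) * bpoly q m t else 0) = 0"
    if l: "l \<le> i" for l
  proof -
    have lr: "l \<le> r" using l st'(7) by simp
    have lm: "l + m < r" using l m st'(3,6) by simp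
    have "(\<Sum>t\<le>r. if [t = m] (mod (p - 1)) then of_nat (r - l choose t) * bpoly q m t else 0) =
        (\<Sum>n\<le>m. q n * of_nat (r - l choose n) * class_sum (r - l - n) (m - n))"
      by (rule full_sum_bpoly[OF order_refl lr])
    also have "\<dots> = (\<Sum>n\<le>m. if n = m then of_nat (r - l choose m) * class_sum (r - l - m) 0 else 0)"
      by (intro sum.cong refl) (auto simp: q_def)
    also have "\<dots> = of_nat (r - l choose m) * class_sum (r - l - m) 0" by simp
    also have "class_sum (r - l - m) 0 = (if l = k then 2 else 1)"
    proof -
      have "(p - 1) dvd (r - l - m) \<longleftrightarrow> l = k"
      proof
        assume "(p - 1) dvd (r - l - m)"
        hence "[r - l - m + (l + m) = 0 + (l + m)] (mod (p - 1))" by (intro cong_add cong_refl) (simp add: cong_0_iff)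
        hence "[r = l + m] (mod (p - 1))" using lm by simp
        hence "[l + m = k + m] (mod (p - 1))" using st'(4) k'(3) by (metis cong_sym cong_trans)
        hence "[l = k] (mod (p - 1))" by (simp only: cong_add_rcancel_nat)
        thus "l = k" using l st'(3) k'(4) by (intro cong_small) simp_all
      next
        assume "l = k"
        hence "[r - l - m = i + j - l - m] (mod (p - 1))" using k' st'(8) by (intro class_shift st'(4)) simp_all
        thus "(p - 1) dvd (r - l - m)" using \<open>l = k\<close> k'(3) by (simp add: cong_0_iff add.commute del: One_nat_def)
      qed
      thus ?thesis using class_sum_0[of "r - l - m"] lm by simp
    qed
    finally have full: "(\<Sum>t\<le>r. if [t = m] (mod (p - 1)) then of_nat (r - l choose t) * bpoly q m t else 0) =
        of_nat (r - l choose m) * (if l = k then 2 else 1)" .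
    have hi: "of_nat (r - l choose (r - k)) * of_nat (r - k choose m) = (if l = k then of_nat (r - k choose m) else (0 :: 'p mod_ring))"
    proof -
      consider "l = k" | "l < k" | "k < l" by linarith
      thus ?thesis
      proof cases
        case 2
        have "r - l - (r - k) = k - l" "r - k \<le> r - l" using 2 k'(2) st'(7) by simp_all
        hence "r - l choose (r - k) = r - l choose (k - l)" using binomial_symmetric[of "r - k" "r - l"] by simp
        moreover have "(r - l) mod p < k - l"
        proof -
          have "[r - l = k - l - 1] (mod p)"
          proof -
            have "k + p - l - 1 = k - l - 1 + p" using 2 by simp
            thus ?thesis using rl[of l] 2 by (simp only: cong_def mod_add_self2 less_imp_le)
          qed
          hence "(r - l) mod p = k - l - 1" using mp by (simp add: cong_def)
          thus ?thesis using 2 by simp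
        qed
        moreover have "k - l < p" using mp by simp
        ultimately show ?thesis using 2 choose_zero_iff[of "k - l" "r - l"] by simp
      next
        case 3
        have "r - l < r - k" using 3 l st'(7) by simp
        thus ?thesis using 3 by (simp add: binomial_eq_0)
      qed simp
    qed
    have "(\<Sum>t\<le>r. if i < t \<and> t < r - i \<and> [t = m] (mod (p - 1)) then of_nat (r - l choose t) * bpoly q m t else 0) =
        (\<Sum>t\<le>r. if [t = m] (mod (p - 1)) then of_nat (r - l choose t) * bpoly q m t else 0) -
        (if m \<le> i then of_nat (r - l choose m) * bpoly q m m else 0) -
        (if k \<le> i then of_nat (r - l choose (r - k)) * bpoly q m (r - k) else 0)"
      using k' st'(4) by (intro band_sum mp(2) st'(3,6)) (simp_all add: add.commute)
    also have "of_nat (r - l choose (r - k)) * bpoly q m (r - k) = (if l = k then of_nat (r - k choose m) else (0 :: 'p mod_ring))"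
      using hi unfolding P .
    finally show ?thesis unfolding full using m k' by (simp add: P)
  qed
  have last: "(- 1) ^ m * bpoly q m (r - m) = 1" if "m = k"
  proof -
    have "[r - m = p - 1] (mod p)" using rl[of m] that by simp
    from choose_cong[OF this mp(3)] have "bpoly q m (r - m) = (- 1) ^ m" unfolding P choose_p_minus_1[OF mp(3)] .
    thus ?thesis by (simp flip: power_add power_mult_distrib)
  qed
  have sk: "[s + m = k] (mod (p - 1))" using admissible_class[OF st m(2) _ G(2)] m(2) k by simp
  have "(\<Sum>t\<le>s. co G (s - t) t * (if [m + t = m] (mod (p - 1)) then q m - (if t = 0 then bpoly q m m else 0) -
    (if t = s then (- 1) ^ m * bpoly q m (r - m) else 0) else 0)) = 0"
  proof (rule exclusion[OF st mp(1) m(2) _ _ _ S G])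
    show "q n = 0" if "m < n" for n using that by (simp add: q_def)
    show "bpoly q m t = 0" if t: "m < t" "t \<le> i" "[t = m] (mod (p - 1))" for t
      using cong_small[OF t(3)] t st'(3) mp by simp
    show "bpoly q m t = 0" if t: "r - i \<le> t" "t < r - m" "[t = m] (mod (p - 1))" for t
    proof -
      have "t = r - k" using t by (intro class_boundary[OF st k'(3,4)]) simp_all
      hence False using t(2) km by simp
      thus ?thesis ..
    qed
  qed
  also have "(\<Sum>t\<le>s. co G (s - t) t * (if [m + t = m] (mod (p - 1)) then q m - (if t = 0 then bpoly q m m else 0) -
      (if t = s then (- 1) ^ m * bpoly q m (r - m) else 0) else 0)) =
      (\<Sum>t\<le>s. co G (s - t) t * total (mon (s - t + (m - k)) (t + 0)))"
  proof (intro sum.cong refl)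
    fix t assume "t \<in> {..s}"
    hence t: "t \<le> s" by simp
    have sp: "0 < s" using admissible_quotient(2)[OF st m(2)] G(2) p3 by simp
    have d: "[m + t = m] (mod (p - 1)) \<longleftrightarrow> (p - 1) dvd t"
      using cong_add_lcancel_nat[of m t 0 "p - 1"] by (simp add: cong_0_iff del: One_nat_def)
    have ks: "[s + (m - k) = 0] (mod (p - 1))"
    proof -
      have "[s + (m - k) + k = 0 + k] (mod (p - 1))" using sk km by simp
      thus ?thesis by (simp only: cong_add_rcancel_nat)
    qed
    have d': "(p - 1) dvd (s - t + (m - k))" if "(p - 1) dvd t"
    proof -
      have "s - t + (m - k) + t = s + (m - k)" using t by simp
      hence "(p - 1) dvd (s - t + (m - k) + t)" using ks by (simp add: cong_0_iff del: One_nat_def)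
      thus ?thesis using that by (metis dvd_add_left_iff)
    qed
    have smk: "m = k" if "(p - 1) dvd s"
    proof -
      have "[s + m = 0 + m] (mod (p - 1))" using that by (intro cong_add cong_refl) (simp add: cong_0_iff del: One_nat_def)
      hence "[m = k] (mod (p - 1))" using sk by (metis add_0 cong_sym cong_trans)
      thus ?thesis using mp k'(4) by (intro cong_small)
    qed
    show "co G (s - t) t * (if [m + t = m] (mod (p - 1)) then q m - (if t = 0 then bpoly q m m else 0) -
      (if t = s then (- 1) ^ m * bpoly q m (r - m) else 0) else 0) = co G (s - t) t * total (mon (s - t + (m - k)) (t + 0))"
    proof (cases "(p - 1) dvd t")
      case True
      have qm: "q m = 1" "bpoly q m m = 1" using P[of m] by (simp_all add: q_def)
      consider "t = 0" | "t = s" | "0 < t" "t < s" using t by linarith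
      thus ?thesis
      proof cases
        case 1
        thus ?thesis using True d qm sp by (simp add: total_mon)
      next
        case 2
        hence "m = k" using smk True by simp
        thus ?thesis using 2 True d qm last sp by (simp add: total_mon)
      next
        case 3
        thus ?thesis using True d d'[OF True] qm by (simp add: total_mon del: One_nat_def)
      qed
    next
      case False
      thus ?thesis using d by (simp add: total_mon del: One_nat_def)
    qed
  qed
  also have "\<dots> = total (G * mon (m - k) 0)"
    unfolding total_mult_mon[OF G(1)] ..
  finally show ?thesis .
qed

section \<open>Intersection with the filtration\<close>

text \<open>Let \<open>k = i + j - m\<close>. For \<open>m \<le> k\<close> the leading coefficient is zero by \<open>leading_coeff_zero\<close>. For \<open>m > k\<close> the degree \<open>p - 1 + m - k\<close> of the moments
  that vanish by \<open>moment_zero_low\<close> is at least \<open>p\<close>, which is enough to recover \<open>G(1, 0)\<close> from them.\<close>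

lemma intersection_step:
  assumes st: "admissible i j r" and m: "j \<le> m" "m \<le> i"
    and h: "1 \<le> h" "h < m \<or> h = m \<and> i + j < m + m" "[r + h = i + j] (mod p)"
  shows "XV r i (i + 1) \<inter> Vfil r m \<subseteq> (Vfil r (m + 1) :: 'p mod_ring poly poly set)"
proof
  note st' = admissibleD[OF st]
  define k where "k = i + j - m"
  define s where "s = r - m * (p + 1)"
  have s: "s + m * (p + 1) = r" "p \<le> s" using admissible_quotient[OF st m(2)] by (simp_all only: s_def)
  let ?N = "{G. homogeneous s G \<and> theta ^ m * G \<in> (XV r i (i + 1) :: 'p mod_ring poly poly set)}"
  note N = subm_theta_quotient[OF subm_XV[OF st'(7)] s(1), of "i + 1"]
  have k: "j \<le> k" "k \<le> i" "k + m = i + j" "k < p - 1" "0 < k" using m st'(1,3) by (simp_all add: k_def)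
  have "co G s 0 = 0" if G: "G \<in> ?N" for G
  proof (cases "m \<le> k")
    case True
    hence "h < m" using h(2) k(3) by auto
    thus ?thesis using leading_coeff_zero[OF st m k_def True h(1) _ h(3)] G s(1) by blast
  next
    case False
    have z: "of_nat (r - k choose m) = (0 :: 'p mod_ring)"
    proof -
      have "[r - k + (k + h) = m - h + (k + h)] (mod p)"
      proof -
        have "r - k + (k + h) = r + h" "m - h + (k + h) = i + j" using k h(2) st'(7) by auto
        thus ?thesis using h(3) by (simp only:)
      qed
      hence "[r - k = m - h] (mod p)" by (simp only: cong_add_rcancel_nat)
      moreover have "m - h < p" "m < p" using m st'(3) by simp_all
      ultimately have "(r - k) mod p = m - h" by (simp add: cong_def)
      thus ?thesis using choose_zero_iff[OF \<open>m < p\<close>, of "r - k"] h m st'(1) by simp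
    qed
    have mom: "total (H * mon (p - 1 - k) m) = 0" if "H \<in> ?N" for H
      using moment_zero_low[OF st m k_def z] that s(1) by blast
    define n where "n = p - 1 - k + m"
    have n: "p \<le> n" using False k(4) by (simp add: n_def)
    have v: "total (G * mon (n - t) t) = 0" if "t \<le> n" for t
      unfolding n_def by (rule moments_vanish[OF N mom _ _ G]) (use k m st'(3) that in \<open>simp_all add: n_def\<close>)
    have ns: "(p - 1) dvd (s + n)"
    proof -
      have "[s + m = k] (mod (p - 1))" using admissible_class[OF st m(2) _ s(1)] m(2) k_def by simp
      moreover have "s + n + k = s + m + (p - 1)" using k(4) by (simp add: n_def)
      moreover have "[s + m + (p - 1) = s + m] (mod (p - 1))" by (simp add: cong_def)
      ultimately have "[s + n + k = 0 + k] (mod (p - 1))" by (metis add_0 cong_trans)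
      hence "[s + n = 0] (mod (p - 1))" by (simp only: cong_add_rcancel_nat)
      thus ?thesis by (simp add: cong_0_iff)
    qed
    have hG: "homogeneous s G" using G by simp
    have dd: "(p - 1) dvd (s - t + n)" if "(p - 1) dvd t" "t \<le> s" for t
    proof -
      have "s - t + n + t = s + n" using that by simp
      thus ?thesis using ns that(1) by (metis dvd_add_left_iff)
    qed
    have dd': "(p - 1) dvd (s - t + (n - (p - 1)))" if "(p - 1) dvd t" "t \<le> s" for t
    proof -
      have "s - t + (n - (p - 1)) + (p - 1) = s - t + n" using n by simp
      thus ?thesis using dd[OF that] by (metis dvd_add_left_iff dvd_refl)
    qed
    \<comment> \<open>As a function on the plane, \<open>X\<^sup>n - X\<^bsup>n-(p-1)\<^esup> Y\<^bsup>p-1\<^esup>\<close> is supported on the line \<open>Y = 0\<close>.\<close>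
    have "0 = total (G * mon (n - (p - 1)) (p - 1)) - total (G * mon (n - 0) 0)"
      using v[of 0] v[of "p - 1"] n by simp
    also have "\<dots> = (\<Sum>t\<le>s. co G (s - t) t * (total (mon (s - t + (n - (p - 1))) (t + (p - 1))) - total (mon (s - t + (n - 0)) (t + 0))))"
      unfolding total_mult_mon[OF hG] sum_subtractf[symmetric] right_diff_distrib ..
    also have "\<dots> = (\<Sum>t\<le>s. if t = 0 then co G s 0 else 0)"
    proof (intro sum.cong refl)
      fix t assume "t \<in> {..s}"
      hence t: "t \<le> s" by simp
      show "co G (s - t) t * (total (mon (s - t + (n - (p - 1))) (t + (p - 1))) - total (mon (s - t + (n - 0)) (t + 0))) =
          (if t = 0 then co G s 0 else 0)"
      proof (cases "(p - 1) dvd t")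
        case True
        have "0 < s - t + (n - (p - 1))" "0 < s - t + n" "0 < t + (p - 1)" using n p3 by auto
        thus ?thesis using True dd[OF True t] dd'[OF True t] by (simp add: total_mon del: One_nat_def)
      next
        case False
        hence "\<not> (p - 1) dvd (t + (p - 1))" "t \<noteq> 0" by (simp, metis dvd_0_right)
        thus ?thesis using False by (simp add: total_mon del: One_nat_def)
      qed
    qed
    finally show ?thesis by simp
  qed
  hence NV: "?N \<subseteq> Vfil s 1" by (rule Vfil_if_leading_coeff_0[OF N s(2)])
  fix F :: "'p mod_ring poly poly" assume F: "F \<in> XV r i (i + 1) \<inter> Vfil r m"
  have "m * (p + 1) \<le> r" using s(1) by simp
  moreover have "homogeneous r F" "theta ^ m dvd F" using F by (simp_all add: Vfil_iff)
  ultimately obtain G where G: "homogeneous s G" "F = theta ^ m * G"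
    using theta_power_dvdE[of r F m] unfolding s_def by metis
  hence "G \<in> Vfil s 1" using NV F by auto
  hence "theta dvd G" by (simp add: Vfil_iff)
  hence "theta ^ m * theta dvd F" unfolding G(2) by (rule mult_dvd_mono[OF dvd_refl])
  thus "F \<in> Vfil r (m + 1)" using F by (simp add: Vfil_iff mult.commute)
qed

lemma intersection_eq:
  assumes st: "admissible i j r" and l: "j \<le> l" "l \<le> i + 1"
    and h: "1 \<le> h" "h < l \<or> h = l \<and> i + j < l + l" "[r + h = i + j] (mod p)"
  shows "XV r i (i + 1) \<inter> Vfil r l = (Vfil r (i + 1) :: 'p mod_ring poly poly set)"
proof
  have "XV r i (i + 1) \<inter> Vfil r l \<subseteq> (Vfil r m :: 'p mod_ring poly poly set)" if "l \<le> m" "m \<le> i + 1" for m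
    using that
  proof (induction m rule: dec_induct)
    case (step m)
    have "XV r i (i + 1) \<inter> Vfil r m \<subseteq> (Vfil r (m + 1) :: 'p mod_ring poly poly set)"
      by (rule intersection_step[OF st _ _ h(1) _ h(3)]) (use l h(2) step in auto)
    thus ?case using step by auto
  qed simp
  thus "XV r i (i + 1) \<inter> Vfil r l \<subseteq> (Vfil r (i + 1) :: 'p mod_ring poly poly set)" using l(2) by blast
  show "Vfil r (i + 1) \<subseteq> (XV r i (i + 1) \<inter> Vfil r l :: 'p mod_ring poly poly set)"
    using Vfil_XV[OF admissibleD(7)[OF st], of "i + 1"] Vfil_mono[OF l(2)] by blast
qed

end

section \<open>Subquotients of \<open>V\<^sub>r\<close>\<close>

lemma gmodule_det_twist: "gmodule Fp GL2 (det_twist (V n :: ('p::prime_card, 'p mod_ring poly poly) Gamma_module) k)"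
proof -
  interpret V: gmodule Fp GL2 "V n :: ('p, 'p mod_ring poly poly) Gamma_module" by (rule gmodule_V)
  let ?T = "det_twist (V n :: ('p, 'p mod_ring poly poly) Gamma_module) k"
  have T: "carrier ?T = carrier (V n)" "\<zero>\<^bsub>?T\<^esub> = \<zero>\<^bsub>V n\<^esub>" "add ?T = add (V n)" "module.smult ?T = module.smult (V n)"
    "act ?T = (\<lambda>g x. (det g ^ k) \<odot>\<^bsub>V n\<^esub> act (V n) g x)"
    by (simp_all add: det_twist_def)
  show ?thesis
  proof (intro gmodule.intro gmodule_axioms.intro GL2_group moduleI)
    show "cring (Fp :: 'p mod_ring ring)" by (rule cring_from_type_algebra)
    show "abelian_group ?T"
    proof (rule abelian_groupI)
      fix F assume "F \<in> carrier ?T"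
      thus "\<exists>G\<in>carrier ?T. G \<oplus>\<^bsub>?T\<^esub> F = \<zero>\<^bsub>?T\<^esub>"
        unfolding T using V.M.l_neg[of F] V.M.a_inv_closed[of F] by blast
    qed (auto simp: T homogeneous_add add_ac)
  next
    fix g h :: "'p mod_ring mat" and F assume *: "g \<in> carrier GL2" "h \<in> carrier GL2" "F \<in> carrier ?T"
    hence d: "det (g * h) = det g * det h" by (intro det_mult[of _ 2]) (simp_all add: carrier_GL2)
    have F: "F \<in> carrier (V n)" using * by (simp add: T)
    show "act ?T (g \<otimes>\<^bsub>GL2\<^esub> h) F = act ?T g (act ?T h F)"
      unfolding T V.act_mult[OF *(1,2) F] unfolding GL2_mult d
      by (simp add: subst_mult const_mult power_mult_distrib mult.assoc mult.left_commute)
  qed (auto simp: T GL2_one subst_varX_varY homogeneous_const homogeneous_add homogeneous_subst const_add const_mult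
      subst_add subst_mult distrib_left distrib_right mult.assoc mult.left_commute)
qed

context prime_field
begin

lemma subm_restrict:
  assumes "subm r B"
  shows "gmodule Fp GL2 ((V r)\<lparr>carrier := B\<rparr>)"
  using gmodule.gmodule_restrict[OF gmodule_V] assms by (simp add: subm_def)

lemma subm_in_restrict:
  assumes "subm r B" "subm r N" "N \<subseteq> B"
  shows "gsubmodule Fp GL2 ((V r)\<lparr>carrier := B\<rparr>) N"
  using gmodule.gsubmodule_in_restrict[OF gmodule_V] assms by (simp add: subm_def)

lemma restrict_minus:
  assumes B: "subm r B" and "F \<in> B" "G \<in> B"
  shows "F \<ominus>\<^bsub>(V r)\<lparr>carrier := B\<rparr>\<^esub> G = F - G"
proof -
  interpret B: gmodule Fp GL2 "(V r)\<lparr>carrier := B\<rparr>" by (rule subm_restrict[OF B])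
  have "(F \<ominus>\<^bsub>(V r)\<lparr>carrier := B\<rparr>\<^esub> G) \<oplus>\<^bsub>(V r)\<lparr>carrier := B\<rparr>\<^esub> G = F"
    using assms(2,3) by (intro B.minus_add_self) simp_all
  thus ?thesis by (simp add: eq_diff_eq)
qed

lemma subquot_iso:
  assumes A: "subm r A" and B: "subm r B" and U: "subm r U" and sub: "A \<subseteq> B" "U \<subseteq> B"
    and sum: "\<And>F. F \<in> B \<Longrightarrow> \<exists>u\<in>U. F - u \<in> A" and D: "U \<inter> A = D"
  shows "gmodule_iso Fp GL2 (subquot_gmodule (V r) B A) (subquot_gmodule (V r) U D)"
proof -
  have "\<exists>u\<in>U. F \<ominus>\<^bsub>(V r)\<lparr>carrier := B\<rparr>\<^esub> u \<in> A" if "F \<in> carrier ((V r)\<lparr>carrier := B\<rparr>)" for F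
  proof -
    have FB: "F \<in> B" using that by simp
    then obtain u where u: "u \<in> U" "F - u \<in> A" using sum by blast
    hence "F \<ominus>\<^bsub>(V r)\<lparr>carrier := B\<rparr>\<^esub> u \<in> A" using restrict_minus[OF B FB, of u] sub by auto
    thus ?thesis using u(1) by blast
  qed
  from gmodule.quot_iso_of_sum[OF subm_restrict[OF B] subm_in_restrict[OF B A sub(1)] subm_in_restrict[OF B U sub(2)] this D]
  show ?thesis by simp
qed

text \<open>The sequence for a map given on representatives, with the action expressed by matrix entries.\<close>

lemma subquot_exact:
  assumes A: "subm r A" and B: "subm r B" and U: "subm r U" and sub: "A \<subseteq> B" "U \<subseteq> B" and D: "U \<inter> A = D"
    and hom: "\<And>F. F \<in> B \<Longrightarrow> homogeneous n (\<phi> F)"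
    and add: "\<And>F G. F \<in> B \<Longrightarrow> G \<in> B \<Longrightarrow> \<phi> (F + G) = \<phi> F + \<phi> G"
    and scale: "\<And>c F. F \<in> B \<Longrightarrow> \<phi> (const c * F) = const c * \<phi> F"
    and act: "\<And>a b c d F. F \<in> B \<Longrightarrow> a * d - b * c \<noteq> 0 \<Longrightarrow>
      \<phi> (subst F (lin a c) (lin b d)) = const ((a * d - b * c) ^ k) * subst (\<phi> F) (lin a c) (lin b d)"
    and surj: "\<And>H. homogeneous n H \<Longrightarrow> \<exists>F\<in>B. \<phi> F = H"
    and ker: "\<And>F. F \<in> B \<Longrightarrow> \<phi> F = 0 \<longleftrightarrow> (\<exists>u\<in>U. F - u \<in> A)"
  shows "short_exact Fp GL2 (subquot_gmodule (V r) U D) (subquot_gmodule (V r) B A) (det_twist (V n) k)"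
proof -
  let ?B = "(V r)\<lparr>carrier := B\<rparr> :: ('p, 'p mod_ring poly poly) Gamma_module"
  let ?T = "det_twist (V n) k :: ('p, 'p mod_ring poly poly) Gamma_module"
  have T: "carrier ?T = carrier (V n)" "\<zero>\<^bsub>?T\<^esub> = 0" "add ?T = (+)" "module.smult ?T = (\<lambda>c F. const c * F)"
    "Defs.act ?T = (\<lambda>g x. const (det g ^ k) * Defs.act (V n) g x)"
    by (simp_all add: det_twist_def V_def)
  have "\<phi> \<in> gmodule_hom Fp GL2 ?B ?T"
    unfolding gmodule_hom_def
  proof (intro CollectI conjI ballI)
    fix g :: "'p mod_ring mat" and F assume g: "g \<in> carrier GL2" and F: "F \<in> carrier ?B"
    have "det g \<noteq> 0" and d1: "det g = g $$ (0,0) * g $$ (1,1) - g $$ (0,1) * g $$ (1,0)"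
      using g by (simp add: carrier_GL2) (use g in \<open>simp add: carrier_GL2 det_2\<close>)
    hence d: "det g = g $$ (0,0) * g $$ (1,1) - g $$ (0,1) * g $$ (1,0)"
      "g $$ (0,0) * g $$ (1,1) - g $$ (0,1) * g $$ (1,0) \<noteq> 0" by simp_all
    have FB: "F \<in> B" using F by simp
    show "\<phi> (Defs.act ?B g F) = Defs.act ?T g (\<phi> F)"
      unfolding T using act[OF FB d(2)] by (simp add: d(1))
  qed (use hom add scale in \<open>auto simp: T\<close>)
  moreover have "\<phi> ` carrier ?B = carrier ?T" using hom surj by (auto simp: T image_iff)
  moreover have "\<phi> F = \<zero>\<^bsub>?T\<^esub> \<longleftrightarrow> (\<exists>u\<in>U. F \<ominus>\<^bsub>?B\<^esub> u \<in> A)" if "F \<in> carrier ?B" for F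
  proof -
    have FB: "F \<in> B" using that by simp
    have "(\<exists>u\<in>U. F \<ominus>\<^bsub>?B\<^esub> u \<in> A) \<longleftrightarrow> (\<exists>u\<in>U. F - u \<in> A)"
      using restrict_minus[OF B FB] sub by (metis subsetD)
    thus ?thesis using ker[OF FB] by (simp only: T)
  qed
  ultimately have "short_exact Fp GL2 (quot_gmodule (?B\<lparr>carrier := U\<rparr>) D) (quot_gmodule ?B A) ?T"
    by (intro gmodule.short_exact_of_hom[OF subm_restrict[OF B] subm_in_restrict[OF B A sub(1)] subm_in_restrict[OF B U sub(2)]
        gmodule_det_twist _ _ _ D])
  thus ?thesis by simp
qed

text \<open>Every element of \<open>B\<close> is congruent modulo \<open>A\<close> to some \<open>\<theta>\<^sup>l G\<close>, and it is sent to the moments of \<open>G\<close>. The hypothesis \<open>kerA\<close> says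
  that this is well defined, and \<open>kerT\<close> says that the kernel is not larger than \<open>A + V\<^sup>(\<^sup>l\<^sup>+\<^sup>1\<^sup>)\<close>. The twist is \<open>l - n\<close>:
  \<open>\<theta>\<^sup>l\<close> contributes \<open>D\<^sup>l\<close>, and the moments contribute \<open>D\<^sup>-\<^sup>n\<close>.\<close>

lemma exact_via_moment_map:
  assumes A: "subm r A" and B: "subm r B" and sub: "A \<subseteq> B" "Vfil r l \<subseteq> B"
    and sum: "\<And>F. F \<in> B \<Longrightarrow> \<exists>H\<in>Vfil r l. F - H \<in> A"
    and s: "s + l * (p + 1) = r" "p \<le> s" and n: "n \<le> p - 1" "(p - 1) dvd (n + s)" and k: "[l = n + k] (mod (p - 1))"
    and kerA: "\<And>G. homogeneous s G \<Longrightarrow> theta ^ l * G \<in> A \<Longrightarrow> moment_map n G = 0"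
    and kerT: "\<And>G. homogeneous s G \<Longrightarrow> moment_map n G = 0 \<Longrightarrow> \<exists>H\<in>Vfil r (l + 1). theta ^ l * G - H \<in> A"
    and D: "A \<inter> Vfil r (l + 1) = D"
  shows "short_exact Fp GL2 (subquot_gmodule (V r) (Vfil r (l + 1)) D) (subquot_gmodule (V r) B A) (det_twist (V n) k)"
proof -
  define \<phi> where "\<phi> F = moment_map n (SOME G. homogeneous s G \<and> F - theta ^ l * G \<in> A)" for F
  have ex: "\<exists>G. homogeneous s G \<and> H = theta ^ l * G" if "H \<in> Vfil r l" for H :: "'p mod_ring poly poly"
  proof -
    have "l * (p + 1) \<le> r" "r - l * (p + 1) = s" using s(1) by simp_all
    thus ?thesis using theta_power_dvdE[of r H l] that unfolding Vfil_iff by metis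
  qed
  have \<phi>: "\<phi> F = moment_map n G" if G: "homogeneous s G" "F - theta ^ l * G \<in> A" for F G
  proof -
    define G' where "G' = (SOME G. homogeneous s G \<and> F - theta ^ l * G \<in> A)"
    have G': "homogeneous s G'" "F - theta ^ l * G' \<in> A"
      using someI[of "\<lambda>G. homogeneous s G \<and> F - theta ^ l * G \<in> A" G] G unfolding G'_def by blast+
    have "theta ^ l * (G' + const (- 1) * G) = (F - theta ^ l * G) - (F - theta ^ l * G')"
      by (simp add: const_minus algebra_simps)
    hence "theta ^ l * (G' + const (- 1) * G) \<in> A" using subm_diff[OF A G(2) G'(2)] by simp
    hence "moment_map n (G' + const (- 1) * G) = 0" using G(1) G'(1) by (intro kerA homogeneous_add homogeneous_const)
    thus ?thesis unfolding \<phi>_def G'_def[symmetric] moment_map_add moment_map_const by (simp add: const_minus)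
  qed
  have obt: "\<exists>G. homogeneous s G \<and> F - theta ^ l * G \<in> A" if "F \<in> B" for F
    using sum[OF that] ex by blast
  show ?thesis
  proof (rule subquot_exact[OF A B subm_Vfil sub(1), of _ _ _ \<phi>])
    show "Vfil r (l + 1) \<subseteq> B" using sub(2) Vfil_mono[of l "l + 1" r] by auto
    show "Vfil r (l + 1) \<inter> A = D" using D by blast
  next
    fix F assume "F \<in> B"
    thus "homogeneous n (\<phi> F)" using obt \<phi> homogeneous_moment_map by metis
  next
    fix F F' assume "F \<in> B" "F' \<in> B"
    then obtain G G' where G: "homogeneous s G" "F - theta ^ l * G \<in> A" "homogeneous s G'" "F' - theta ^ l * G' \<in> A"
      using obt by blast
    have "F + F' - theta ^ l * (G + G') = (F - theta ^ l * G) + (F' - theta ^ l * G')" by (simp add: distrib_left)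
    hence "F + F' - theta ^ l * (G + G') \<in> A" using submD(3)[OF A G(2,4)] by (simp only:)
    from \<phi>[OF homogeneous_add[OF G(1,3)] this] show "\<phi> (F + F') = \<phi> F + \<phi> F'"
      unfolding \<phi>[OF G(1,2)] \<phi>[OF G(3,4)] moment_map_add .
  next
    fix c F assume "F \<in> B"
    then obtain G where G: "homogeneous s G" "F - theta ^ l * G \<in> A" using obt by blast
    have "const c * F - theta ^ l * (const c * G) = const c * (F - theta ^ l * G)" by (simp add: right_diff_distrib mult.left_commute)
    hence "const c * F - theta ^ l * (const c * G) \<in> A" using submD(4)[OF A G(2)] by (simp only:)
    from \<phi>[OF homogeneous_const[OF G(1)] this] show "\<phi> (const c * F) = const c * \<phi> F"
      unfolding \<phi>[OF G] moment_map_const .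
  next
    fix a b c d F assume F: "F \<in> B" and det: "a * d - b * c \<noteq> (0 :: 'p mod_ring)"
    let ?\<delta> = "a * d - b * c" and ?g = "\<lambda>F. subst F (lin a c) (lin b d)"
    obtain G where G: "homogeneous s G" "F - theta ^ l * G \<in> A" using obt[OF F] by blast
    have "?g F - theta ^ l * (const (?\<delta> ^ l) * ?g G) = ?g (F - theta ^ l * G)"
      unfolding subst_diff subst_theta_power by (simp only: mult_ac)
    hence "?g F - theta ^ l * (const (?\<delta> ^ l) * ?g G) \<in> A" using submD(5)[OF A G(2) det] by (simp only:)
    from \<phi>[OF homogeneous_const[OF homogeneous_subst[OF G(1)]] this]
    have "\<phi> (?g F) = const (?\<delta> ^ l) * moment_map n (?g G)" unfolding moment_map_const .
    also have "?\<delta> ^ l = ?\<delta> ^ k * ?\<delta> ^ n" unfolding power_cong[OF det k] by (simp add: power_add)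
    finally show "\<phi> (?g F) = const (?\<delta> ^ k) * ?g (\<phi> F)"
      unfolding \<phi>[OF G] moment_map_subst[OF G(1) det] const_mult by (simp only: mult.assoc)
  next
    fix H :: "'p mod_ring poly poly" assume "homogeneous n H"
    then obtain G where G: "homogeneous s G" "moment_map n G = H" using range_moment_map[OF s(2) n] by blast
    have "theta ^ l * G \<in> B" using Vfil_mult[OF G(1) s(1)] sub(2) by blast
    moreover have "\<phi> (theta ^ l * G) = H" using \<phi>[OF G(1), of "theta ^ l * G"] G(2) submD(2)[OF A] by simp
    ultimately show "\<exists>F\<in>B. \<phi> F = H" by blast
  next
    fix F assume F: "F \<in> B"
    show "\<phi> F = 0 \<longleftrightarrow> (\<exists>u\<in>Vfil r (l + 1). F - u \<in> A)"
    proof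
      assume z: "\<phi> F = 0"
      obtain G where G: "homogeneous s G" "F - theta ^ l * G \<in> A" using obt[OF F] by blast
      have "moment_map n G = 0" using z \<phi>[OF G] by simp
      then obtain H where H: "H \<in> Vfil r (l + 1)" "theta ^ l * G - H \<in> A" using kerT[OF G(1)] by blast
      have "F - H = (F - theta ^ l * G) + (theta ^ l * G - H)" by simp
      hence "F - H \<in> A" using submD(3)[OF A G(2) H(2)] by (simp only:)
      thus "\<exists>u\<in>Vfil r (l + 1). F - u \<in> A" using H(1) by blast
    next
      assume "\<exists>u\<in>Vfil r (l + 1). F - u \<in> A"
      then obtain u where u: "u \<in> Vfil r (l + 1)" "F - u \<in> A" by blast
      have "u \<in> Vfil r l" using u(1) Vfil_mono[of l "l + 1" r] by auto
      then obtain G where G: "homogeneous s G" "u = theta ^ l * G" using ex by blast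
      have "theta ^ l * theta dvd theta ^ l * G" using u(1) unfolding Vfil_iff G(2) by (simp add: mult.commute)
      hence "theta dvd G" using theta_nonzero by (simp only: dvd_mult_cancel_left) simp
      then obtain K where "G = theta * K" by (rule dvdE)
      hence "moment_map n G = 0" by (simp only: moment_map_theta)
      thus "\<phi> F = 0" using \<phi>[OF G(1)] u(2) G(2) by simp
    qed
  qed
qed

section \<open>The kernel \<open>W\<close>\<close>

lemma admissible_move:
  assumes st: "admissible i j r" and l: "1 \<le> j'" "j' \<le> i'" "i' \<le> i" "i' + j' = i + j"
  shows "admissible i' j' r"
proof -
  note st' = admissibleD[OF st]
  have "i' * (p + 1) \<le> i * (p + 1)" using l(3) by (rule mult_le_mono1)
  hence "i' * (p + 1) + p \<le> r" using st'(5) by linarith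
  thus ?thesis unfolding admissible_def using l st' by simp
qed

lemma XV_mono:
  assumes "i' \<le> i" "i \<le> r" "i < p - 1" "m \<le> m'"
  shows "XV r i' m' \<subseteq> (XV r i m :: 'p mod_ring poly poly set)"
  using Xsub_mono[OF assms(1-3)] Xsub_XV[of r i m] Vfil_mono[OF assms(4), of r] Vfil_XV[OF assms(2), of m]
  by (intro XV_least[OF subm_XV[OF assms(2)]]) auto

text \<open>The step from \<open>l\<close> to \<open>l + 1\<close> is \<open>reach_below\<close> for the pair \<open>(i + j - l, l)\<close>. The binomial coefficient required there is nonzero
  because its upper argument is \<open>p - (u - l)\<close> modulo \<open>p\<close>.\<close>

lemma reach_chain:
  assumes st: "admissible i j r" and q: "j \<le> q" "q \<le> u" "u < p" "[r + u = i + j] (mod p)"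
    and l: "\<And>l. l < q \<Longrightarrow> l + l < i + j"
  shows "Vfil r j \<subseteq> (XV r i q :: 'p mod_ring poly poly set)"
  using q(1,2) l
proof (induction q rule: dec_induct)
  case base
  show ?case by (rule Vfil_XV) (use admissibleD(7)[OF st] in simp)
next
  case (step l)
  note st' = admissibleD[OF st]
  define i' where "i' = i + j - l"
  have ll: "l + l < i + j" "l < u" using step.prems by auto
  have i': "l < i'" "i' \<le> i" "i' + l = i + j" using ll step.hyps by (simp_all add: i'_def)
  have st2: "admissible i' l r" using i' step.hyps st'(1) by (intro admissible_move[OF st]) simp_all
  have "of_nat (r - i' choose l) \<noteq> (0 :: 'p mod_ring)"
  proof -
    have "[r - i' + (i' + u) = p - (u - l) + (i' + u)] (mod p)"
    proof -
      have "r - i' + (i' + u) = r + u" "p - (u - l) + (i' + u) = i + j + p"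
        using i' st'(7) ll q(3) by simp_all
      thus ?thesis using q(4) by (simp only: cong_def mod_add_self2)
    qed
    hence "[r - i' = p - (u - l)] (mod p)" by (simp only: cong_add_rcancel_nat)
    moreover have "p - (u - l) < p" using ll q(3) by simp
    ultimately have "(r - i') mod p = p - (u - l)" by (simp add: cong_def)
    moreover have "l < p" "l \<le> p - (u - l)" using ll q(3) by simp_all
    ultimately show ?thesis using choose_zero_iff[of l "r - i'"] by simp
  qed
  from reach_below[OF st2 i'(1) this] have "Vfil r l \<subseteq> (XV r i (l + 1) :: 'p mod_ring poly poly set)"
    using XV_mono[OF i'(2) st'(7,3), of "l + 1" "l + 1"] by auto
  moreover have "XV r i l \<subseteq> (XV r i (l + 1) :: 'p mod_ring poly poly set)"
    using calculation Xsub_XV[of r i "l + 1"] by (intro XV_least[OF subm_XV[OF st'(7)]])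
  moreover have "Vfil r j \<subseteq> (XV r i l :: 'p mod_ring poly poly set)" using step.prems by (intro step.IH) auto
  ultimately show ?case by auto
qed

lemma XV_sum:
  assumes st: "admissible i j r" and sub: "Vfil r j \<subseteq> (XV r i l :: 'p mod_ring poly poly set)" and F: "F \<in> XV r i j"
  shows "\<exists>H\<in>Vfil r l. F - H \<in> (XV r i (i + 1) :: 'p mod_ring poly poly set)"
proof -
  have "XV r i j \<subseteq> (XV r i l :: 'p mod_ring poly poly set)"
    using admissibleD(7)[OF st] by (intro XV_least subm_XV Xsub_XV sub)
  hence "F \<in> XV r i l" using F by blast
  then obtain K H where K: "F = K + H" "K \<in> Xsub r i" "H \<in> Vfil r l" by (auto simp: XV_def)
  hence "F - H = K" by simp
  hence "F - H \<in> XV r i (i + 1)" using Xsub_XV[of r i "i + 1"] K(2) by blast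
  thus ?thesis using K(3) by blast
qed

text \<open>If \<open>V\<^sup>(\<^sup>j\<^sup>)\<close> is already covered by \<open>A + V\<^sup>(\<^sup>l\<^sup>)\<close>, then \<open>W\<close> is the quotient of \<open>V\<^sup>(\<^sup>l\<^sup>)\<close> by its intersection with \<open>A\<close>.\<close>

lemma kernel_iso:
  assumes st: "admissible i j r" and l: "j \<le> l" "l \<le> i + 1"
    and sub: "Vfil r j \<subseteq> (XV r i l :: 'p mod_ring poly poly set)"
    and h: "1 \<le> h" "h < l \<or> h = l \<and> i + j < l + l" "[r + h = i + j] (mod p)"
  shows "gmodule_iso Fp GL2 (subquot_gmodule (V r) (XV r i j) (XV r i (i + 1) :: 'p mod_ring poly poly set))
    (subquot_gmodule (V r) (Vfil r l) (Vfil r (i + 1)))"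
proof (rule subquot_iso[OF subm_XV subm_XV subm_Vfil _ _ XV_sum[OF st sub]])
  note st' = admissibleD[OF st]
  show "i \<le> r" "i \<le> r" using st' by simp_all
  show "XV r i (i + 1) \<subseteq> (XV r i j :: 'p mod_ring poly poly set)"
    using st' by (intro XV_mono) simp_all
  show "Vfil r l \<subseteq> (XV r i j :: 'p mod_ring poly poly set)"
    using Vfil_mono[OF l(1), of r] Vfil_XV[OF st'(7), of j] by blast
  show "Vfil r l \<inter> XV r i (i + 1) = (Vfil r (i + 1) :: 'p mod_ring poly poly set)"
    using intersection_eq[OF st l h] by (simp only: Int_commute)
qed

text \<open>The common part of the two cases with an extra constituent. They differ in the moment that vanishes on \<open>A\<close> and in the
  generator of the kernel of the moment map.\<close>

lemma kernel_exact:
  assumes st: "admissible i j r" and l: "j \<le> l" "l \<le> i"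
    and sub: "Vfil r j \<subseteq> (XV r i l :: 'p mod_ring poly poly set)"
    and h: "1 \<le> h" "h < l + 1 \<or> h = l + 1 \<and> i + j < (l + 1) + (l + 1)" "[r + h = i + j] (mod p)"
    and s: "s + l * (p + 1) = r" and n: "n \<le> p - 1" "[n + (i + j) = l + l] (mod (p - 1))" "[l = n + k] (mod (p - 1))"
    and ab: "a + b = n" "a < p - 1" "b < p - 1"
    and kerA: "\<And>G. homogeneous s G \<Longrightarrow> theta ^ l * G \<in> XV r i (i + 1) \<Longrightarrow> total (G * mon a b) = 0"
    and kerT: "\<And>G N. subm s N \<Longrightarrow> Vfil s 1 \<subseteq> N \<Longrightarrow> N = {G. homogeneous s G \<and> theta ^ l * G \<in> XV r i (l + 1)} \<Longrightarrow>
      (p - 1) dvd (n + s) \<Longrightarrow> homogeneous s G \<Longrightarrow> moment_map n G = 0 \<Longrightarrow> G \<in> N"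
  shows "short_exact Fp GL2 (subquot_gmodule (V r) (Vfil r (l + 1)) (Vfil r (i + 1)))
    (subquot_gmodule (V r) (XV r i j) (XV r i (i + 1) :: 'p mod_ring poly poly set)) (det_twist (V n) k)"
proof -
  note st' = admissibleD[OF st]
  let ?A = "XV r i (i + 1) :: 'p mod_ring poly poly set"
  note N = subm_theta_quotient[OF subm_XV[OF st'(7)] s]
  have ps: "p \<le> s" using admissible_quotient(2)[OF st l(2)] s by simp
  have ns: "(p - 1) dvd (n + s)"
  proof -
    have "[s + l = i + j - l] (mod (p - 1))" using l(2) by (intro admissible_class[OF st l(2) _ s]) simp
    hence "[n + (s + l) + l = n + (i + j - l) + l] (mod (p - 1))" by (intro cong_add cong_refl)
    moreover have "n + (i + j - l) + l = n + (i + j)" using l(2) by simp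
    ultimately have "[n + (s + l) + l = l + l] (mod (p - 1))" using n(2) by (metis cong_trans)
    moreover have "n + (s + l) + l = n + s + (l + l)" by simp
    ultimately have "[n + s + (l + l) = 0 + (l + l)] (mod (p - 1))" by (simp only: add_0)
    hence "[n + s = 0] (mod (p - 1))" by (simp only: cong_add_rcancel_nat)
    thus ?thesis by (simp add: cong_0_iff)
  qed
  show ?thesis
  proof (rule exact_via_moment_map[OF subm_XV[OF st'(7)] subm_XV[OF st'(7)] _ _ XV_sum[OF st sub] s ps n(1) ns n(3)])
    show "?A \<subseteq> XV r i j" using st' by (intro XV_mono) simp_all
    show "Vfil r l \<subseteq> (XV r i j :: 'p mod_ring poly poly set)"
      using Vfil_mono[OF l(1), of r] Vfil_XV[OF st'(7), of j] by blast
    show "?A \<inter> Vfil r (l + 1) = (Vfil r (i + 1) :: 'p mod_ring poly poly set)"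
      by (rule intersection_eq[OF st _ _ h]) (use l in simp_all)
  next
    fix G assume G: "homogeneous s G" "theta ^ l * G \<in> ?A"
    let ?N = "{G. homogeneous s G \<and> theta ^ l * G \<in> ?A}"
    have z: "total (H * mon a b) = 0" if "H \<in> ?N" for H using kerA that by blast
    have "total (G * mon (a + b - t) t) = 0" if "t \<le> n" for t
      by (rule moments_vanish[OF N z ab(2,3)]) (use G that ab(1) in simp_all)
    moreover have "n < p" using n(1) p3 by simp
    ultimately show "moment_map n G = 0" unfolding moment_map_eq_0_iff[OF \<open>n < p\<close>] ab(1) by blast
  next
    fix G assume G: "homogeneous s G" "moment_map n G = 0"
    have V: "Vfil s 1 \<subseteq> {G. homogeneous s G \<and> theta ^ l * G \<in> (XV r i (l + 1) :: 'p mod_ring poly poly set)}"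
    proof
      fix H :: "'p mod_ring poly poly" assume H: "H \<in> Vfil s 1"
      hence "theta ^ l * H \<in> Vfil r (l + 1)"
        using Vfil_mult[of s H l r] s by (simp add: Vfil_iff mult_dvd_mono mult.commute)
      thus "H \<in> {G. homogeneous s G \<and> theta ^ l * G \<in> XV r i (l + 1)}"
        using H Vfil_XV[OF st'(7), of "l + 1"] by (auto simp: Vfil_iff)
    qed
    have "G \<in> {G. homogeneous s G \<and> theta ^ l * G \<in> XV r i (l + 1)}"
      by (rule kerT[OF N V refl ns G])
    then obtain K H where K: "theta ^ l * G = K + H" "K \<in> Xsub r i" "H \<in> Vfil r (l + 1)" by (auto simp: XV_def)
    hence "theta ^ l * G - H = K" by simp
    hence "theta ^ l * G - H \<in> ?A" using Xsub_XV[of r i "i + 1"] K(2) by blast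
    thus "\<exists>H\<in>Vfil r (l + 1). theta ^ l * G - H \<in> ?A" using K(3) by blast
  qed
qed

lemma kernel_trivial:
  assumes st: "admissible i j r" and nz: "of_nat (r - j + 1 choose (i + 1)) \<noteq> (0 :: 'p mod_ring)"
  defines "W \<equiv> subquot_gmodule (V r) (XV r i j) (XV r i (i + 1) :: 'p mod_ring poly poly set)"
  shows "carrier W = {\<zero>\<^bsub>W\<^esub>}"
proof -
  note st' = admissibleD[OF st]
  let ?A = "XV r i (i + 1) :: 'p mod_ring poly poly set"
  let ?M = "(V r)\<lparr>carrier := ?A\<rparr>"
  note A = subm_XV[OF st'(7)]
  have "?A \<subseteq> XV r i j" by (rule XV_mono) (use st'(2,3,7) in simp_all)
  hence eq: "XV r i j = ?A" by (rule subset_antisym[OF XV_least[OF A Xsub_XV reach_all[OF st nz]]])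
  have W: "W = quot_gmodule ?M ?A" unfolding W_def eq ..
  interpret M: gmodule Fp GL2 ?M by (rule subm_restrict[OF A])
  have C: "gsubmodule Fp GL2 ?M ?A" by (rule subm_in_restrict[OF A A order_refl])
  have cM: "carrier ?M = ?A" by simp
  have coset: "?A +>\<^bsub>?M\<^esub> F = ?A" if F: "F \<in> ?A" for F
  proof -
    have FM: "F \<in> carrier ?M" using F by simp
    have "F \<ominus>\<^bsub>?M\<^esub> \<zero>\<^bsub>?M\<^esub> \<in> ?A"
      by (rule M.gsubmoduleD(5)[OF C F M.gsubmoduleD(2)[OF C]])
    hence "?A +>\<^bsub>?M\<^esub> F = ?A +>\<^bsub>?M\<^esub> \<zero>\<^bsub>?M\<^esub>"
      by (rule M.coset_eq_iff[OF C FM M.M.zero_closed, THEN iffD2])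
    thus ?thesis unfolding M.quot_zero_coset[OF C] .
  qed
  have "(\<lambda>F. ?A +>\<^bsub>?M\<^esub> F) ` ?A = (\<lambda>F. ?A) ` ?A" by (rule image_cong[OF refl coset])
  also have "\<dots> = {?A}" using submD(2)[OF A] by blast
  finally show ?thesis unfolding W M.quot_carrier M.quot_zero cM .
qed

text \<open>Here \<open>r \<equiv> k\<close> modulo \<open>p\<close> makes \<open>(r - k choose q)\<close> zero, so that the moments of degree \<open>p - 1 - (k - q)\<close>
  vanish on the \<open>G\<close> with \<open>\<theta>\<^sup>q G \<in> A\<close>. The same congruence is the hypothesis of \<open>boundary_generator\<close> for the pair \<open>(k, q)\<close>.\<close>

lemma kernel_low:
  assumes st: "admissible i j r" and k: "[r = k] (mod p)" "k + q = i + j" "j \<le> q" "q \<le> k" "k \<le> i"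
  shows "short_exact Fp GL2 (subquot_gmodule (V r) (Vfil r (q + 1)) (Vfil r (i + 1)))
    (subquot_gmodule (V r) (XV r i j) (XV r i (i + 1) :: 'p mod_ring poly poly set)) (det_twist (V (p - 1 - (k - q))) k)"
proof -
  note st' = admissibleD[OF st]
  define s where "s = r - q * (p + 1)"
  have qi: "q \<le> i" using k by simp
  have s: "s + q * (p + 1) = r" "p \<le> s" using admissible_quotient[OF st qi] by (simp_all only: s_def)
  have kp: "k < p - 1" using k st' by simp
  have rq: "[r + q = i + j] (mod p)"
    using cong_add[OF k(1) cong_refl[of q]] k(2) by simp
  have sub: "Vfil r j \<subseteq> (XV r i q :: 'p mod_ring poly poly set)"
    by (rule reach_chain[OF st k(3) order_refl _ rq]) (use k kp in simp_all)
  have stk: "admissible k q r" using st' k by (intro admissible_move[OF st]) simp_all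
  have sub2: "XV r k (q + 1) \<subseteq> (XV r i (q + 1) :: 'p mod_ring poly poly set)"
    using k st' by (intro XV_mono) simp_all
  show ?thesis
  proof (rule kernel_exact[OF st k(3) qi sub _ _ rq s(1)])
    show "1 \<le> q" "q < q + 1 \<or> q = q + 1 \<and> i + j < (q + 1) + (q + 1)" using st' k by simp_all
    show "p - 1 - (k - q) \<le> p - 1" by simp
    have "p - 1 - (k - q) + (i + j) = q + q + (p - 1)" "p - 1 - (k - q) + k = q + (p - 1)" using k kp by simp_all
    thus "[p - 1 - (k - q) + (i + j) = q + q] (mod (p - 1))" "[q = p - 1 - (k - q) + k] (mod (p - 1))"
      by (simp_all only: cong_def mod_add_self2)
    show "p - 1 - k + q = p - 1 - (k - q)" "p - 1 - k < p - 1" "q < p - 1" using k kp st' by simp_all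
  next
    fix G assume G: "homogeneous s G" "theta ^ q * G \<in> (XV r i (i + 1) :: 'p mod_ring poly poly set)"
    have kk: "k = i + j - q" using k by simp
    have z: "of_nat (r - k choose q) = (0 :: 'p mod_ring)"
    proof -
      have "[r - k + k = 0 + k] (mod p)" using k(1,5) st'(7) by simp
      hence "[r - k = 0] (mod p)" by (simp only: cong_add_rcancel_nat)
      hence "(r - k) mod p = 0" by (simp add: cong_def)
      moreover have "q < p" "0 < q" using k kp st' by simp_all
      ultimately show ?thesis using choose_zero_iff[of q "r - k"] by simp
    qed
    show "total (G * mon (p - 1 - k) q) = 0" by (rule moment_zero_low[OF st k(3) qi kk z G(1) s(1) G(2)])
  next
    fix G and N :: "'p mod_ring poly poly set" assume N: "subm s N" "Vfil s 1 \<subseteq> N" "N = {G. homogeneous s G \<and> theta ^ q * G \<in> XV r i (q + 1)}"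
      and n: "(p - 1) dvd (p - 1 - (k - q) + s)" and G: "homogeneous s G" "moment_map (p - 1 - (k - q)) G = 0"
    show "G \<in> N"
    proof (cases "q < k")
      case True
      have "mon 0 s \<in> N" unfolding N(3) using boundary_generator(1)[OF stk k(1) s(1) True] sub2
        by (auto simp: homogeneous_mon)
      hence "mon s 0 \<in> N" using subm_swap[OF N(1)] by (metis subst_swap)
      moreover have "p - 1 - (k - q) < p - 1" using True kp by simp
      ultimately show ?thesis using ker_moment_map[OF N(1,2) _ s(2) _ n G] by blast
    next
      case False
      hence kq: "k = q" using k by simp
      have ps: "p - 1 \<le> s" using s(2) by simp
      have "mon s 0 + mon 0 s - mon (s - (p - 1)) (p - 1) \<in> N"
        unfolding N(3) using boundary_generator(2)[OF stk k(1) s(1) kq] sub2 ps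
        by (auto intro!: homogeneous_add homogeneous_diff homogeneous_mon)
      moreover have "(p - 1) dvd s" using n kq by (simp del: One_nat_def)
      moreover have "moment_map (p - 1) G = 0" using G(2) kq by simp
      ultimately show ?thesis using ker_moment_map_top[OF N(1,2) _ s(2) _ G(1)] by blast
    qed
  qed
qed

text \<open>The filtration is first reached up to \<open>V\<^sup>(\<^sup>q\<^sup>-\<^sup>1\<^sup>)\<close>: by single steps up to \<open>k + 2\<close>, and then at once by \<open>reach_all\<close> for the pair
  \<open>(q - 2, k + 2)\<close>. The kernel of the moment map is generated by \<open>\<theta>\<^bsup>q-1\<^esup> X\<^sup>s\<close>, which is \<open>top_generator\<close> for \<open>(q - 1, k + 1)\<close>.\<close>

lemma kernel_high:
  assumes st: "admissible i j r" and k: "[r = k] (mod p)" "k + q = i + j" "k + 1 < q" "q \<le> i + 1" "j \<le> k + 1"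
  shows "short_exact Fp GL2 (subquot_gmodule (V r) (Vfil r q) (Vfil r (i + 1)))
    (subquot_gmodule (V r) (XV r i j) (XV r i (i + 1) :: 'p mod_ring poly poly set)) (det_twist (V (q - k - 2)) (k + 1))"
proof -
  note st' = admissibleD[OF st]
  define m where "m = q - 1"
  have m: "q = m + 1" "j \<le> m" "m \<le> i" "k < m" "k + 1 + m = i + j" "m < p - 1" using k st' by (simp_all add: m_def)
  define s where "s = r - m * (p + 1)"
  have s: "s + m * (p + 1) = r" "p \<le> s" using admissible_quotient[OF st m(3)] by (simp_all only: s_def)
  have rq: "[r + q = i + j] (mod p)"
    using cong_add[OF k(1) cong_refl[of q]] k(2) by simp
  have rk: "(r - k - 1) mod p = p - 1"
  proof -
    have "[r - k - 1 + (k + 1) = p - 1 + (k + 1)] (mod p)"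
    proof -
      have "r - k - 1 + (k + 1) = r" "p - 1 + (k + 1) = k + p" using m st'(3,6) p3 by simp_all
      thus ?thesis using k(1) by (simp only: cong_def mod_add_self2)
    qed
    hence "[r - k - 1 = p - 1] (mod p)" by (simp only: cong_add_rcancel_nat)
    thus ?thesis using p3 by (simp add: cong_def)
  qed
  have sub: "Vfil r j \<subseteq> (XV r i m :: 'p mod_ring poly poly set)"
  proof (cases "m \<le> k + 2")
    case True
    show ?thesis by (rule reach_chain[OF st m(2) _ _ rq]) (use True m st'(3) in simp_all)
  next
    case False
    have chain: "Vfil r j \<subseteq> (XV r i (k + 2) :: 'p mod_ring poly poly set)"
      by (rule reach_chain[OF st _ _ _ rq]) (use False m k(5) st'(3) in simp_all)
    have st2: "admissible (m - 1) (k + 2) r" using False m k(5) by (intro admissible_move[OF st]) simp_all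
    have "of_nat (r - (k + 2) + 1 choose (m - 1 + 1)) \<noteq> (0 :: 'p mod_ring)"
    proof -
      have "r - (k + 2) + 1 = r - k - 1" "m - 1 + 1 = m" using m False st'(3,6) by simp_all
      moreover have "m < p" "m \<le> p - 1" using m by simp_all
      ultimately show ?thesis using choose_zero_iff[of m "r - k - 1"] rk by simp
    qed
    from reach_all[OF st2 this] have "Vfil r (k + 2) \<subseteq> (XV r (m - 1) m :: 'p mod_ring poly poly set)"
      using False by simp
    also have "\<dots> \<subseteq> XV r i m" using m st' by (intro XV_mono) simp_all
    finally have "XV r i (k + 2) \<subseteq> (XV r i m :: 'p mod_ring poly poly set)"
      by (intro XV_least[OF subm_XV[OF st'(7)] Xsub_XV])
    thus ?thesis using chain by (rule subset_trans[rotated])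
  qed
  have st2: "admissible m (k + 1) r" using m k(5) by (intro admissible_move[OF st]) simp_all
  have "short_exact Fp GL2 (subquot_gmodule (V r) (Vfil r (m + 1)) (Vfil r (i + 1)))
    (subquot_gmodule (V r) (XV r i j) (XV r i (i + 1) :: 'p mod_ring poly poly set)) (det_twist (V (m - (k + 1))) (k + 1))"
  proof (rule kernel_exact[OF st m(2,3) sub _ _ rq s(1)])
    show "1 \<le> q" "q < m + 1 \<or> q = m + 1 \<and> i + j < (m + 1) + (m + 1)" using m by simp_all
    have "m - (k + 1) + (i + j) = m + m" "m - (k + 1) + (k + 1) = m" using m by simp_all
    thus "[m - (k + 1) + (i + j) = m + m] (mod (p - 1))" "[m = m - (k + 1) + (k + 1)] (mod (p - 1))" by simp_all
    show "m - (k + 1) \<le> p - 1" "m - (k + 1) + 0 = m - (k + 1)" "m - (k + 1) < p - 1" "0 < p - 1" using m p3 by simp_all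
  next
    fix G assume G: "homogeneous s G" "theta ^ m * G \<in> (XV r i (i + 1) :: 'p mod_ring poly poly set)"
    have kk: "k + 1 = i + j - m" "k + 1 \<le> m" "[r + 1 = k + 1] (mod p)"
      using m cong_add[OF k(1) cong_refl[of 1]] by simp_all
    show "total (G * mon (m - (k + 1)) 0) = 0" by (rule moment_zero_high[OF st m(2,3) kk G(1) s(1) G(2)])
  next
    fix G and N :: "'p mod_ring poly poly set" assume N: "subm s N" "Vfil s 1 \<subseteq> N" "N = {G. homogeneous s G \<and> theta ^ m * G \<in> XV r i (m + 1)}"
      and n: "(p - 1) dvd (m - (k + 1) + s)" and G: "homogeneous s G" "moment_map (m - (k + 1)) G = 0"
    have "of_nat (r - (k + 1) choose m) \<noteq> (0 :: 'p mod_ring)"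
    proof -
      have "r - (k + 1) = r - k - 1" "m < p" "m \<le> p - 1" using m by simp_all
      thus ?thesis using choose_zero_iff[of m "r - k - 1"] rk by simp
    qed
    from top_generator[OF st2 this s(1)] have "theta ^ m * mon s 0 \<in> (XV r i (m + 1) :: 'p mod_ring poly poly set)"
      using XV_mono[OF m(3) st'(7,3), of "m + 1" "m + 1"] by blast
    hence "mon s 0 \<in> N" unfolding N(3) by (simp add: homogeneous_mon)
    moreover have "m - (k + 1) < p - 1" using m by simp
    ultimately show "G \<in> N" using ker_moment_map[OF N(1,2) _ s(2) _ n G] by blast
  qed
  moreover have "m - (k + 1) = q - k - 2" using m by simp
  ultimately show ?thesis unfolding m(1) by simp
qed

end

theorem theorem1p9:
  fixes p r a r\<^sub>0 i :: nat
  assumes "p = CARD('p::prime_card)"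
    and "p \<ge> 3"
    and "[r = a] (mod (p - 1))" and "1 \<le> a" and "a \<le> p - 1"
    and "[r = r\<^sub>0] (mod p)" and "r\<^sub>0 \<le> p - 1"
    and "1 \<le> br p (int a - int i)" and "br p (int a - int i) < i" and "i < p - 1"
    and "i * (p + 1) + p \<le> r"
  shows "\<exists>W :: ('p, 'p mod_ring poly poly set) Gamma_module.
    gmodule Fp GL2 W \<and>
    short_exact Fp GL2 W (Q r i) (Q r (br p (int a - int i) - 1)) \<and>
    (\<not> p dvd ((r - br p (int a - int i) + 1) choose (i + 1)) \<longrightarrow>
       carrier W = {\<zero>\<^bsub>W\<^esub>}) \<and>
    (p dvd ((r - br p (int a - int i) + 1) choose (i + 1)) \<and>
     \<not> p dvd ((r - i - 1) choose br p (int a - int i)) \<longrightarrow>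
       (br p (int a - int r\<^sub>0) < r\<^sub>0 + 1 \<longrightarrow>
          short_exact Fp GL2
            (subquot_gmodule (V r) (Vfil r (br p (int a - int r\<^sub>0) + 1)) (Vfil r (i + 1)))
            W
            (det_twist (V (br p (int a - 2 * int r\<^sub>0))) r\<^sub>0)) \<and>
       (br p (int a - int r\<^sub>0) = r\<^sub>0 + 1 \<longrightarrow>
          gmodule_iso Fp GL2 W
            (subquot_gmodule (V r) (Vfil r (br p (int a - int r\<^sub>0))) (Vfil r (i + 1)))) \<and>
       (br p (int a - int r\<^sub>0) > r\<^sub>0 + 1 \<longrightarrow>
          short_exact Fp GL2
            (subquot_gmodule (V r) (Vfil r (br p (int a - int r\<^sub>0))) (Vfil r (i + 1)))
            W
            (det_twist (V (p - 1 - br p (2 * int r\<^sub>0 + 2 - int a))) (r\<^sub>0 + 1)))) \<and>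
    (p dvd ((r - i - 1) choose br p (int a - int i)) \<and>
     \<not> [r = br p (int a - int i) + i] (mod p) \<longrightarrow>
       gmodule_iso Fp GL2 W
         (subquot_gmodule (V r) (Vfil r (br p (int a - int i))) (Vfil r (i + 1))))"
proof -
  interpret prime_field p "TYPE('p)" by unfold_locales (use assms in simp_all)
  define j where "j = br p (int a - int i)"
  have p2: "p \<ge> 2" and ip: "int p - 1 = int (p - 1)" using assms(2) by simp_all
  have br_eq: "br p x = y" if "1 \<le> y" "y \<le> p - 1" "[int y = x] (mod int (p - 1))" for x y
    using that unfolding br_unique[OF p2] ip atLeastAtMost_iff by blast
  have jc: "[int j = int a - int i] (mod int (p - 1))" "j \<le> p - 1"
    using br_unique[OF p2, of "int a - int i" j, unfolded ip atLeastAtMost_iff] j_def by blast+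
  have ija: "[int i + int j = int a] (mod int (p - 1))"
    using cong_add[OF cong_refl[of "int i"] jc(1)] by simp
  hence "[int (i + j) = int a] (mod int (p - 1))" by (simp only: of_nat_add)
  hence "[i + j = a] (mod (p - 1))" by (simp only: cong_int_iff)
  hence ijr: "[i + j = r] (mod (p - 1))" using assms(3) by (metis cong_sym cong_trans)
  have st: "admissible i j r" unfolding admissible_def using assms(8-11) ijr by (simp add: j_def)
  note st' = admissibleD[OF st]
  define W where "W = subquot_gmodule (V r) (XV r i j) (XV r i (i + 1) :: 'p mod_ring poly poly set)"
  have AB: "XV r i (i + 1) \<subseteq> (XV r i j :: 'p mod_ring poly poly set)"
    using st' by (intro XV_mono) simp_all
  have A: "gsubmodule Fp GL2 (V r) (XV r i (i + 1) :: 'p mod_ring poly poly set)"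
    and B: "gsubmodule Fp GL2 (V r) (XV r i j :: 'p mod_ring poly poly set)"
    using subm_XV[OF st'(7)] by (simp_all add: subm_def)
  have gW: "gmodule Fp GL2 W"
    unfolding W_def by (rule gmodule.gmodule_quot[OF subm_restrict subm_in_restrict]) (use AB subm_XV[OF st'(7)] in simp_all)
  have QB: "Q r (j - 1) = quot_gmodule (V r) (XV r i j :: 'p mod_ring poly poly set)"
    using XV_lower[OF st] st'(1) by (simp add: Q_def XV_eq)
  have main: "short_exact Fp GL2 W (Q r i) (Q r (j - 1))"
    unfolding W_def QB unfolding Q_def XV_eq by (rule gmodule.short_exact_subquot[OF gmodule_V A B AB])
  have part1: "carrier W = {\<zero>\<^bsub>W\<^esub>}" if "\<not> p dvd ((r - j + 1) choose (i + 1))"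
    using kernel_trivial[OF st] that unfolding W_def of_nat_eq_0 by blast
  have part2: "(br p (int a - int r\<^sub>0) < r\<^sub>0 + 1 \<longrightarrow>
          short_exact Fp GL2 (subquot_gmodule (V r) (Vfil r (br p (int a - int r\<^sub>0) + 1)) (Vfil r (i + 1)))
            W (det_twist (V (br p (int a - 2 * int r\<^sub>0))) r\<^sub>0)) \<and>
       (br p (int a - int r\<^sub>0) = r\<^sub>0 + 1 \<longrightarrow>
          gmodule_iso Fp GL2 W (subquot_gmodule (V r) (Vfil r (br p (int a - int r\<^sub>0))) (Vfil r (i + 1)))) \<and>
       (br p (int a - int r\<^sub>0) > r\<^sub>0 + 1 \<longrightarrow>
          short_exact Fp GL2 (subquot_gmodule (V r) (Vfil r (br p (int a - int r\<^sub>0))) (Vfil r (i + 1)))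
            W (det_twist (V (p - 1 - br p (2 * int r\<^sub>0 + 2 - int a))) (r\<^sub>0 + 1)))"
    if d: "p dvd ((r - j + 1) choose (i + 1))" "\<not> p dvd ((r - i - 1) choose j)"
  proof -
    have ipp: "i + 1 < p" "j < p" using st'(2,3) by simp_all
    have lo: "(r - j + 1) mod p \<le> i" using d(1) choose_zero_iff[OF ipp(1), of "r - j + 1"] by (simp only: of_nat_eq_0) simp
    have hi: "j \<le> (r - i - 1) mod p" using d(2) choose_zero_iff[OF ipp(2), of "r - i - 1"] by (simp only: of_nat_eq_0) simp
    define x where "x = (r - i - 1) mod p"
    have x: "j \<le> x" "x < p" using hi p2 by (simp_all add: x_def)
    have rx: "[r = x + i + 1] (mod p)"
    proof -
      have "[r - i - 1 + (i + 1) = x + (i + 1)] (mod p)" by (intro cong_add cong_refl) (simp add: x_def cong_def)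
      moreover have "r - i - 1 + (i + 1) = r" using st'(3,6) by simp
      ultimately show ?thesis by simp
    qed
    have wrap: "p + j \<le> x + i + 2"
    proof (rule ccontr)
      assume n: "\<not> p + j \<le> x + i + 2"
      have "[r - j + 1 + j = x + i + 2 - j + j] (mod p)"
      proof -
        have "r - j + 1 + j = r + 1" "x + i + 2 - j + j = x + i + 1 + 1" using x st'(2,7) by simp_all
        thus ?thesis using cong_add[OF rx cong_refl[of 1]] by (simp only:)
      qed
      hence "[r - j + 1 = x + i + 2 - j] (mod p)" by (simp only: cong_add_rcancel_nat)
      moreover have "x + i + 2 - j < p" using n x st'(2) by simp
      ultimately have "(r - j + 1) mod p = x + i + 2 - j" by (simp add: cong_def)
      thus False using lo x by simp
    qed
    have r0: "r\<^sub>0 + p = x + i + 1"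
    proof -
      have "x + i + 1 - p < p" "x + i + 1 = x + i + 1 - p + p" using wrap x st'(1,3) by simp_all
      hence "[r = x + i + 1 - p] (mod p)" using rx by (metis cong_def mod_add_self2)
      hence "[r\<^sub>0 = x + i + 1 - p] (mod p)" using assms(6) by (metis cong_sym cong_trans)
      moreover have "r\<^sub>0 < p" using assms(2,7) by simp
      ultimately have "r\<^sub>0 = x + i + 1 - p" using \<open>x + i + 1 - p < p\<close> by (simp add: cong_def)
      thus ?thesis using \<open>x + i + 1 = x + i + 1 - p + p\<close> by simp
    qed
    have r0b: "j \<le> r\<^sub>0 + 1" "r\<^sub>0 \<le> i" using r0 wrap x by simp_all
    \<comment> \<open>This is \<open>[a - r\<^sub>0]\<close>, as \<open>a \<equiv> i + j\<close> modulo \<open>p - 1\<close> and \<open>j - 1 \<le> r\<^sub>0 \<le> i\<close>.\<close>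
    define q where "q = i + j - r\<^sub>0"
    have q: "r\<^sub>0 + q = i + j" "j \<le> q" "q \<le> i + 1" using r0b by (simp_all add: q_def)
    have qr: "[r + q = i + j] (mod p)" using cong_add[OF assms(6) cong_refl[of q]] q(1) by simp
    have ar: "[int i + int j - z = int a - z] (mod int (p - 1))" for z
      using cong_diff[OF ija cong_refl[of z]] .
    have brq: "br p (int a - int r\<^sub>0) = q"
    proof (rule br_eq)
      show "1 \<le> q" "q \<le> p - 1" using q st'(1,3) by simp_all
      have "int q = int i + int j - int r\<^sub>0" using q(1) by simp
      thus "[int q = int a - int r\<^sub>0] (mod int (p - 1))" using ar[of "int r\<^sub>0"] by (simp only:)
    qed
    have bra: "br p (int a - 2 * int r\<^sub>0) = p - 1 - (r\<^sub>0 - q)" if "q \<le> r\<^sub>0"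
    proof (rule br_eq)
      show "1 \<le> p - 1 - (r\<^sub>0 - q)" "p - 1 - (r\<^sub>0 - q) \<le> p - 1" using r0b st'(1,3) q(2) by simp_all
      have "int (p - 1 - (r\<^sub>0 - q)) = int i + int j - 2 * int r\<^sub>0 + int (p - 1)"
        using q(1) that r0b st'(3) by (simp add: of_nat_diff)
      thus "[int (p - 1 - (r\<^sub>0 - q)) = int a - 2 * int r\<^sub>0] (mod int (p - 1))"
        using ar[of "2 * int r\<^sub>0"] by (simp only: cong_def mod_add_self2)
    qed
    have brc: "p - 1 - br p (2 * int r\<^sub>0 + 2 - int a) = q - r\<^sub>0 - 2" if "r\<^sub>0 + 1 < q"
    proof -
      have "br p (2 * int r\<^sub>0 + 2 - int a) = p - 1 - (q - r\<^sub>0 - 2)"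
      proof (rule br_eq)
        show "1 \<le> p - 1 - (q - r\<^sub>0 - 2)" "p - 1 - (q - r\<^sub>0 - 2) \<le> p - 1" using q st'(3) by simp_all
        have "int (p - 1 - (q - r\<^sub>0 - 2)) = 2 * int r\<^sub>0 + 2 - (int i + int j) + int (p - 1)"
          using q that st'(3) by (simp add: of_nat_diff)
        thus "[int (p - 1 - (q - r\<^sub>0 - 2)) = 2 * int r\<^sub>0 + 2 - int a] (mod int (p - 1))"
          using cong_diff[OF cong_refl[of "2 * int r\<^sub>0 + 2"] ija] by (simp only: cong_def mod_add_self2)
      qed
      thus ?thesis using q st'(3) by simp
    qed
    show ?thesis unfolding brq
    proof (intro conjI impI)
      assume "q < r\<^sub>0 + 1"
      hence le: "q \<le> r\<^sub>0" by simp
      show "short_exact Fp GL2 (subquot_gmodule (V r) (Vfil r (q + 1)) (Vfil r (i + 1))) W (det_twist (V (br p (int a - 2 * int r\<^sub>0))) r\<^sub>0)"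
        unfolding bra[OF le] W_def by (rule kernel_low[OF st assms(6) q(1,2) le r0b(2)])
    next
      assume eq: "q = r\<^sub>0 + 1"
      have "Vfil r j \<subseteq> (XV r i q :: 'p mod_ring poly poly set)"
        by (rule reach_chain[OF st q(2) order_refl _ qr]) (use q eq st'(3) in simp_all)
      thus "gmodule_iso Fp GL2 W (subquot_gmodule (V r) (Vfil r q) (Vfil r (i + 1)))"
        unfolding W_def by (rule kernel_iso[OF st q(2,3) _ _ _ qr]) (use q eq st'(1) in simp_all)
    next
      assume gt: "q > r\<^sub>0 + 1"
      show "short_exact Fp GL2 (subquot_gmodule (V r) (Vfil r q) (Vfil r (i + 1))) W
        (det_twist (V (p - 1 - br p (2 * int r\<^sub>0 + 2 - int a))) (r\<^sub>0 + 1))"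
        unfolding brc[OF gt] W_def by (rule kernel_high[OF st assms(6) q(1) gt q(3) r0b(1)])
    qed
  qed
  have part3: "gmodule_iso Fp GL2 W (subquot_gmodule (V r) (Vfil r j) (Vfil r (i + 1)))"
    if d: "p dvd ((r - i - 1) choose j)" "\<not> [r = j + i] (mod p)"
  proof -
    have jp: "j < p" using st'(2,3) by simp
    define z where "z = (r - i - 1) mod p"
    have z: "z < j" using d(1) choose_zero_iff[OF jp, of "r - i - 1"] by (simp only: of_nat_eq_0 z_def)
    have rz: "[r = z + i + 1] (mod p)"
    proof -
      have "[r - i - 1 + (i + 1) = z + (i + 1)] (mod p)" by (intro cong_add cong_refl) (simp add: z_def cong_def)
      moreover have "r - i - 1 + (i + 1) = r" using st'(3,6) by simp
      ultimately show ?thesis by simp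
    qed
    have "z + 1 \<noteq> j"
    proof
      assume "z + 1 = j"
      hence e: "z + i + 1 = j + i" by linarith
      show False using rz d(2) unfolding e by contradiction
    qed
    define h where "h = j - 1 - z"
    have h: "1 \<le> h" "h < j" "z + i + 1 + h = i + j" using z \<open>z + 1 \<noteq> j\<close> by (simp_all add: h_def)
    have "[r + h = i + j] (mod p)" using cong_add[OF rz cong_refl[of h]] by (simp only: h(3))
    moreover have "Vfil r j \<subseteq> (XV r i j :: 'p mod_ring poly poly set)" by (rule Vfil_XV[OF st'(7)])
    ultimately show ?thesis unfolding W_def
      by (intro kernel_iso[OF st order_refl _ _ h(1)]) (use h st'(2) in simp_all)
  qed
  show ?thesis
    unfolding j_def[symmetric]
  proof (rule exI[of _ W], intro conjI)
    show "gmodule Fp GL2 W" by (rule gW)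
    show "short_exact Fp GL2 W (Q r i) (Q r (j - 1))" by (rule main)
  qed (rule impI, rule part1, assumption, rule impI, elim conjE, rule part2, assumption, assumption,
      rule impI, elim conjE, rule part3, assumption, assumption)
qed

end
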